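(* Let $n\ge 1$, let $U\subset\mathbb{R}^n$ be an open, bounded, connected set with Lipschitz boundary, and let $u\in W^{1,p}(U,\mathbb{R}^n)$. (1) Let $1<p<\infty$. There exists $v\in W^{1,p}(U,\mathbb{R}^n)$ with $\operatorname{div}v=0$ such that $$\int_U|Du-Dv|^p\,dx\le C\int_U\operatorname{dist}^p(Du,sl(n))\,dx,$$ where $C$ depends only on $n$ and $p$. (2) Let $p=1$. There exists $v\in W^{1,1}(U,\mathbb{R}^n)$ with $\operatorname{div}v=0$ in $U$ such that $$\int_U|u-v|\,dx\le C\int_U\operatorname{dist}(Du,sl(n))\,dx,$$ where $C$ depends only on $n$ and $\operatorname{diam}U$.
   Context: $sl(n)$ is the set of real $n\times n$ matrices $A$ with $\operatorname{tr}A=0$. $|\cdot|$ on matrices is the Frobenius norm and $\operatorname{dist}$ is the corresponding distance. *)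

theory Defs
  imports "HOL-Analysis.Analysis"
begin

primrec Ck :: "nat \<Rightarrow> ('a::euclidean_space \<Rightarrow> real) \<Rightarrow> bool" where
  "Ck 0 f \<longleftrightarrow> continuous_on UNIV f"
| "Ck (Suc k) f \<longleftrightarrow> (\<forall>x. f differentiable (at x)) \<and>
     (\<forall>v. Ck k (\<lambda>x. frechet_derivative f (at x) v))"

definition test_function :: "'a::euclidean_space set \<Rightarrow> ('a \<Rightarrow> real) \<Rightarrow> bool" where
  "test_function U \<phi> \<longleftrightarrow> (\<forall>k. Ck k \<phi>) \<and>
     compact (closure {x. \<phi> x \<noteq> 0}) \<and> closure {x. \<phi> x \<noteq> 0} \<subseteq> U"

definition partial_deriv :: "'n::finite \<Rightarrow> (real^'n \<Rightarrow> real) \<Rightarrow> real^'n \<Rightarrow> real" where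
  "partial_deriv j \<phi> x = frechet_derivative \<phi> (at x) (axis j 1)"

definition locally_integrable_on ::
    "('a::euclidean_space \<Rightarrow> 'b::euclidean_space) \<Rightarrow> 'a set \<Rightarrow> bool" where
  "locally_integrable_on f U \<longleftrightarrow> (\<forall>K. compact K \<and> K \<subseteq> U \<longrightarrow> set_integrable lebesgue K f)"

definition Lp :: "real \<Rightarrow> 'a::euclidean_space set \<Rightarrow> ('a \<Rightarrow> 'b::euclidean_space) set" where
  "Lp p U = {f. f \<in> borel_measurable (lebesgue_on U) \<and>
     integrable (lebesgue_on U) (\<lambda>x. norm (f x) powr p)}"

(* Convention: Du x $ i $ j is the j-th partial derivative of the i-th component.
   Functions are representatives; Du is determined by u only almost everywhere in U. *)
definition has_weak_gradient ::
    "(real^'n \<Rightarrow> real^'m) \<Rightarrow> (real^'n \<Rightarrow> real^'n^'m) \<Rightarrow> (real^'n) set \<Rightarrow> bool" where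
  "has_weak_gradient u Du U \<longleftrightarrow>
     locally_integrable_on u U \<and> locally_integrable_on Du U \<and>
     (\<forall>\<phi> i j. test_function U \<phi> \<longrightarrow>
        (\<integral>x\<in>U. u x $ i * partial_deriv j \<phi> x \<partial>lebesgue) =
        - (\<integral>x\<in>U. Du x $ i $ j * \<phi> x \<partial>lebesgue))"

definition W1p :: "real \<Rightarrow> (real^'n) set \<Rightarrow> (real^'n \<Rightarrow> real^'m) set" where
  "W1p p U = {u \<in> Lp p U. \<exists>Du \<in> Lp p U. has_weak_gradient u Du U}"

(* For a vector field with weak gradient Dv, div v is the sum of the D_i v_i. *)
definition div_free :: "(real^'n) set \<Rightarrow> (real^'n \<Rightarrow> real^'n^'n) \<Rightarrow> bool" where
  "div_free U Dv \<longleftrightarrow> (AE x in lebesgue_on U. (\<Sum>i\<in>UNIV. Dv x $ i $ i) = 0)"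

(* Near each boundary point, U is the strict epigraph of a Lipschitz function in some rotated
   orthonormal frame.  The unit vector e is the last axis of that frame, and the hyperplane
   orthogonal to e plays the role of the space of the other n - 1 coordinates. *)
definition lipschitz_boundary :: "'a::euclidean_space set \<Rightarrow> bool" where
  "lipschitz_boundary U \<longleftrightarrow>
     (\<forall>x0 \<in> frontier U. \<exists>r>0. \<exists>e \<gamma> L. norm e = 1 \<and>
        L-lipschitz_on {y. y \<bullet> e = 0} \<gamma> \<and>
        U \<inter> ball x0 r = {x \<in> ball x0 r. x \<bullet> e > (\<gamma> (x - (x \<bullet> e) *\<^sub>R e) :: real)})"

(* The norm of the type real^'n^'n, hence also infdist, is the Frobenius one. *)
definition sl :: "(real^'n^'n) set" where
  "sl = {A. trace A = 0}"

end

theory Submission imports Defs "HOL-Real_Asymp.Real_Asymp" begin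

text \<open>
  For \<open>p > 1\<close> it suffices to solve \<open>div w = div u\<close> with the gradient of \<open>w\<close> bounded in the
  \<open>p\<close>-norm by the divergence, and to put \<open>v = u - w\<close>: the trace of \<open>Du\<close> is at most \<open>n\<close> times its
  distance from the trace-free matrices.  Extended by zero, \<open>div u\<close> is a limit of trigonometric polynomials
  on a large torus, for which \<open>w\<close> is the gradient of the inverse Laplacian.  The Calderon-Zygmund bound for
  \<open>\<partial>\<^sub>i \<partial>\<^sub>j \<Delta>\<inverse>\<close> comes from a Bellman function of Nazarov-Treil type: along the heat flow, \<open>\<integral> G(u, v)\<close>
  decreases at least as fast as the pairing of \<open>\<partial>\<^sub>i \<partial>\<^sub>j \<Delta>\<inverse> u\<close> with \<open>v\<close> changes.

  For \<open>p = 1\<close> only \<open>u\<close> itself has to be close to \<open>v\<close>, and integrating the divergence along a single coordinate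
  axis would be enough if the antiderivative were weakly differentiable in the other directions.  It becomes so
  after a mollification that keeps \<open>u\<close> and \<open>div u\<close> almost unchanged in the 1-norm.  The mollified field must be
  defined on all of \<open>U\<close>, hence the kernels are shifted into the cones that the Lipschitz boundary provides, and
  are glued by a partition of unity.
\<close>

text \<open>The constant in (1) must not see the domain. The period of the torus is therefore a free
  parameter: the heat flow bounds the Riesz transforms by a constant independent of the period,
  which enters only the bound on \<open>w\<close> itself. The Bellman inequality is bilinear; the
  norm bound follows by pairing with a multiple of the signed power \<open>p - 1\<close> of the
  transform, replaced by a trigonometric polynomial so that the flow stays explicit. For p = 1 the
  Riesz transforms are unbounded, so nothing is claimed about gradients. The obstacle is that the
  mollified field need only have a weak gradient on \<open>U\<close>, whereas its divergence is
  integrated along lines that leave \<open>U\<close> and must be weakly differentiable on the whole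
  space. Both hold because the divergence is assembled from smooth cutoffs and convolutions with
  smooth kernels, a formula that makes sense everywhere. The mollification error is a fixed fraction
  of the 1-norm of the divergence and is absorbed into the bound; if that norm is 0, then
  \<open>v = u\<close> serves.\<close>

section \<open>Bellman functions\<close>

text \<open>\<open>P\<close> and \<open>Q\<close> are the partial derivatives of \<open>G\<close>, in the form of a chain rule along curves.\<close>

definition diff2 :: "(real \<Rightarrow> real \<Rightarrow> real) \<Rightarrow> (real \<Rightarrow> real \<Rightarrow> real) \<Rightarrow> (real \<Rightarrow> real \<Rightarrow> real) \<Rightarrow> bool" where
  "diff2 G P Q \<longleftrightarrow>
     (\<forall>X Y X' Y' s. (X has_real_derivative X') (at s) \<longrightarrow> (Y has_real_derivative Y') (at s) \<longrightarrow>
        ((\<lambda>r. G (X r) (Y r)) has_real_derivative (P (X s) (Y s) * X' + Q (X s) (Y s) * Y')) (at s)) \<and>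
     continuous_on UNIV (\<lambda>z. P (fst z) (snd z)) \<and> continuous_on UNIV (\<lambda>z. Q (fst z) (snd z))"

text \<open>By the inequality of arithmetic and geometric means the last clause bounds the Hessian form
  from below by \<open>2 \<bar>\<alpha>\<bar> \<bar>\<beta>\<bar>\<close>; since \<open>\<tau>\<close> does not depend on \<open>\<alpha>\<close> and \<open>\<beta>\<close>, summing over all coordinate
  directions gives twice the product of the norms of the two gradients.\<close>

definition bellman_function ::
    "(real \<Rightarrow> real \<Rightarrow> real) \<Rightarrow> (real \<Rightarrow> real \<Rightarrow> real) \<Rightarrow> (real \<Rightarrow> real \<Rightarrow> real) \<Rightarrow>
     (real \<Rightarrow> real \<Rightarrow> real) \<Rightarrow> (real \<Rightarrow> real \<Rightarrow> real) \<Rightarrow> (real \<Rightarrow> real \<Rightarrow> real) \<Rightarrow> bool" where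
  "bellman_function G Gx Gy Gxx Gxy Gyy \<longleftrightarrow>
     diff2 G Gx Gy \<and> diff2 Gx Gxx Gxy \<and> diff2 Gy Gxy Gyy \<and>
     continuous_on UNIV (\<lambda>z. G (fst z) (snd z)) \<and> (\<forall>x y. 0 \<le> G x y) \<and>
     (\<forall>x y. \<exists>\<tau>>0. \<forall>\<alpha> \<beta>. \<tau> * \<alpha>\<^sup>2 + \<beta>\<^sup>2 / \<tau> \<le>
        Gxx x y * \<alpha>\<^sup>2 + 2 * Gxy x y * \<alpha> * \<beta> + Gyy x y * \<beta>\<^sup>2)"

text \<open>Exchanging the variables exchanges the two weights, so \<open>\<tau>\<close> becomes its
  inverse. The construction below is made for exponents at least 2; this carries it over to
  exponents between 1 and 2.\<close>

lemma bellman_function_swap: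
  assumes "bellman_function G Gx Gy Gxx Gxy Gyy"
  shows "bellman_function (\<lambda>x y. G y x) (\<lambda>x y. Gy y x) (\<lambda>x y. Gx y x)
           (\<lambda>x y. Gyy y x) (\<lambda>x y. Gxy y x) (\<lambda>x y. Gxx y x)"
proof -
  have csw: "continuous_on UNIV (\<lambda>z::real\<times>real. K (snd z) (fst z))"
    if "continuous_on UNIV (\<lambda>z. K (fst z) (snd z))" for K :: "real \<Rightarrow> real \<Rightarrow> real"
    using continuous_on_compose2[OF that, of UNIV "\<lambda>z. (snd z, fst z)"]
    by (simp add: continuous_on_Pair continuous_on_fst continuous_on_snd)
  have sw: "diff2 (\<lambda>x y. H y x) (\<lambda>x y. Q y x) (\<lambda>x y. P y x)" if "diff2 H P Q" for H P Q
  proof -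
    have "((\<lambda>r. H (Y r) (X r)) has_real_derivative (Q (Y s) (X s) * X' + P (Y s) (X s) * Y')) (at s)"
      if "(X has_real_derivative X') (at s)" "(Y has_real_derivative Y') (at s)" for X Y X' Y' s
      using \<open>diff2 H P Q\<close> that unfolding diff2_def by (metis add.commute)
    then show ?thesis using \<open>diff2 H P Q\<close> csw unfolding diff2_def by blast
  qed
  have "\<exists>\<tau>>0. \<forall>\<alpha> \<beta>. \<tau> * \<alpha>\<^sup>2 + \<beta>\<^sup>2 / \<tau> \<le>
        Gyy y x * \<alpha>\<^sup>2 + 2 * Gxy y x * \<alpha> * \<beta> + Gxx y x * \<beta>\<^sup>2" for x y
  proof -
    obtain \<tau> where \<tau>: "\<tau> > 0" "\<And>\<alpha> \<beta>. \<tau> * \<alpha>\<^sup>2 + \<beta>\<^sup>2 / \<tau> \<le>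
        Gxx y x * \<alpha>\<^sup>2 + 2 * Gxy y x * \<alpha> * \<beta> + Gyy y x * \<beta>\<^sup>2"
      using assms unfolding bellman_function_def by meson
    show ?thesis
    proof (intro exI[of _ "1/\<tau>"] conjI allI)
      show "1 / \<tau> * \<alpha>\<^sup>2 + \<beta>\<^sup>2 / (1 / \<tau>) \<le> Gyy y x * \<alpha>\<^sup>2 + 2 * Gxy y x * \<alpha> * \<beta> + Gxx y x * \<beta>\<^sup>2" for \<alpha> \<beta>
        using \<tau>(2)[of \<beta> \<alpha>] by (simp add: algebra_simps)
    qed (use \<tau> in simp)
  qed
  then show ?thesis
    using assms sw csw unfolding bellman_function_def by simp
qed

text \<open>The shift by \<open>\<epsilon>\<close> keeps the base positive, so that the power is
  twice differentiable at the origin also for exponents below 2.\<close>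

lemma smoothed_power_derivs:
  fixes p \<epsilon> :: real
  assumes "\<epsilon> > 0"
  shows "((\<lambda>x. (x\<^sup>2 + \<epsilon>\<^sup>2) powr (p/2)) has_real_derivative p * x * (x\<^sup>2 + \<epsilon>\<^sup>2) powr (p/2 - 1)) (at x)"
    and "((\<lambda>x. p * x * (x\<^sup>2 + \<epsilon>\<^sup>2) powr (p/2 - 1)) has_real_derivative
           p * (x\<^sup>2 + \<epsilon>\<^sup>2) powr (p/2 - 1) + p * (p - 2) * x\<^sup>2 * (x\<^sup>2 + \<epsilon>\<^sup>2) powr (p/2 - 2)) (at x)"
proof -
  have pos: "x\<^sup>2 + \<epsilon>\<^sup>2 > 0" using assms by (simp add: add_nonneg_pos)
  have d: "((\<lambda>x. x\<^sup>2 + \<epsilon>\<^sup>2) has_real_derivative 2 * x) (at x)"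
    by (auto intro!: derivative_eq_intros)
  show "((\<lambda>x. (x\<^sup>2 + \<epsilon>\<^sup>2) powr (p/2)) has_real_derivative p * x * (x\<^sup>2 + \<epsilon>\<^sup>2) powr (p/2 - 1)) (at x)"
    using DERIV_fun_powr[OF d pos, of "p/2"] by (simp add: algebra_simps)
  have e: "((\<lambda>x. (x\<^sup>2 + \<epsilon>\<^sup>2) powr (p/2 - 1)) has_real_derivative
      (p/2 - 1) * (x\<^sup>2 + \<epsilon>\<^sup>2) powr (p/2 - 1 - 1) * (2 * x)) (at x)"
    using DERIV_fun_powr[OF d pos, of "p/2 - 1"] by simp
  have "p/2 - 1 - 1 = p/2 - 2" by simp
  then show "((\<lambda>x. p * x * (x\<^sup>2 + \<epsilon>\<^sup>2) powr (p/2 - 1)) has_real_derivative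
           p * (x\<^sup>2 + \<epsilon>\<^sup>2) powr (p/2 - 1) + p * (p - 2) * x\<^sup>2 * (x\<^sup>2 + \<epsilon>\<^sup>2) powr (p/2 - 2)) (at x)"
    using pos by (auto intro!: derivative_eq_intros e simp: power2_eq_square algebra_simps)
qed

text \<open>This is the Hessian of \<open>G\<close> in \<open>bellman_exists\<close> with letters
  for its powers: \<open>A\<close> and \<open>B\<close> are the smoothed squares of \<open>x\<close>
  and \<open>y\<close>, \<open>N\<close> is the sum of the smoothed powers, \<open>T\<close> is
  \<open>N powr s\<close>, and \<open>PP\<close> and \<open>QQ\<close> are the smoothed squares
  raised to \<open>p/2 - 1\<close> and \<open>q/2 - 1\<close>. The pure powers, multiplied by a
  large \<open>M\<close>, pay for what the product \<open>A * T\<close> spoils.\<close>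

lemma bellman_hessian_arith:
  fixes p q M A B N s x y \<alpha> \<beta> PP QQ T a1 b1 a2 b2 :: real
  assumes p: "2 \<le> p" and q: "1 < q" and s: "0 \<le> s" "s \<le> 1"
    and M: "2 * p \<le> M" "6 * q\<^sup>2 + 1 \<le> M * (q * (q - 1))"
    and x: "x\<^sup>2 \<le> A" and y: "y\<^sup>2 \<le> B"
    and pos: "A > 0" "B > 0" "N > 0" "PP \<ge> 0" "QQ \<ge> 0" "T > 0"
    and A: "A * PP \<le> N" and B: "B * QQ \<le> N" and T: "A * T \<le> N"
    and a1: "a1 = p * x * PP" and b1: "b1 = q * y * QQ"
    and a2: "p * PP \<le> a2" and b2: "q * (q - 1) * QQ \<le> b2"
  shows "T * \<alpha>\<^sup>2 + QQ * \<beta>\<^sup>2 \<le>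
     (M * a2 + 2 * T + 4 * x * s * (T / N) * a1 + A * s * (s - 1) * (T / N\<^sup>2) * a1\<^sup>2 + A * s * (T / N) * a2) * \<alpha>\<^sup>2
     + 2 * (2 * x * s * (T / N) * b1 + A * s * (s - 1) * (T / N\<^sup>2) * a1 * b1) * \<alpha> * \<beta>
     + (M * b2 + A * s * (s - 1) * (T / N\<^sup>2) * b1\<^sup>2 + A * s * (T / N) * b2) * \<beta>\<^sup>2"
proof -
  define R where "R = A * T / N"
  have R: "0 \<le> R" "R \<le> 1" using pos T by (auto simp: R_def)
  have sq1: "a1\<^sup>2 \<le> p\<^sup>2 * PP * N"
  proof -
    have "a1\<^sup>2 = p\<^sup>2 * PP * (x\<^sup>2 * PP)" by (simp add: a1 power2_eq_square)
    also have "\<dots> \<le> p\<^sup>2 * PP * N"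
      using x A pos by (intro mult_left_mono) (auto intro: order_trans[OF mult_right_mono])
    finally show ?thesis .
  qed
  have sq2: "b1\<^sup>2 \<le> q\<^sup>2 * QQ * N"
  proof -
    have "b1\<^sup>2 = q\<^sup>2 * QQ * (y\<^sup>2 * QQ)" by (simp add: b1 power2_eq_square)
    also have "\<dots> \<le> q\<^sup>2 * QQ * N"
      using y B pos by (intro mult_left_mono) (auto intro: order_trans[OF mult_right_mono])
    finally show ?thesis .
  qed
  have c1: "0 \<le> 4 * x * s * (T / N) * a1"
  proof -
    have "4 * x * s * (T / N) * a1 = 4 * s * (T/N) * p * x\<^sup>2 * PP" by (simp add: a1 power2_eq_square)
    also have "\<dots> \<ge> 0" using pos s p by simp
    finally show ?thesis .
  qed
  have c2: "0 \<le> A * s * (T / N) * a2" "0 \<le> A * s * (T / N) * b2"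
  proof -
    have "0 \<le> a2" "0 \<le> b2" using a2 b2 pos p q by (auto intro: order_trans[rotated])
    then show "0 \<le> A * s * (T / N) * a2" "0 \<le> A * s * (T / N) * b2" using pos s by simp_all
  qed
  \<comment> \<open>the only term with a bad sign\<close>
  have neg: "A * s * (s - 1) * (T / N\<^sup>2) * (a1 * \<alpha> + b1 * \<beta>)\<^sup>2
      \<ge> - (2 * p\<^sup>2 * PP * \<alpha>\<^sup>2 + 2 * q\<^sup>2 * QQ * \<beta>\<^sup>2)"
  proof -
    have "(a1 * \<alpha> + b1 * \<beta>)\<^sup>2 \<le> 2 * (a1\<^sup>2 * \<alpha>\<^sup>2) + 2 * (b1\<^sup>2 * \<beta>\<^sup>2)"
      using zero_le_power2[of "a1 * \<alpha> - b1 * \<beta>"] by (simp add: power2_eq_square algebra_simps)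
    also have "\<dots> \<le> 2 * (p\<^sup>2 * PP * N * \<alpha>\<^sup>2) + 2 * (q\<^sup>2 * QQ * N * \<beta>\<^sup>2)"
      using sq1 sq2 by (intro add_mono mult_left_mono mult_right_mono) auto
    finally have 1: "(a1 * \<alpha> + b1 * \<beta>)\<^sup>2 \<le> N * (2 * p\<^sup>2 * PP * \<alpha>\<^sup>2 + 2 * q\<^sup>2 * QQ * \<beta>\<^sup>2)"
      by (simp add: algebra_simps)
    have "(s * (1 - s) * R / N) * (a1 * \<alpha> + b1 * \<beta>)\<^sup>2
        \<le> (s * (1 - s) * R / N) * (N * (2 * p\<^sup>2 * PP * \<alpha>\<^sup>2 + 2 * q\<^sup>2 * QQ * \<beta>\<^sup>2))"
      using 1 s R pos by (intro mult_left_mono) auto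
    also have "\<dots> = (s * (1 - s) * R) * (2 * p\<^sup>2 * PP * \<alpha>\<^sup>2 + 2 * q\<^sup>2 * QQ * \<beta>\<^sup>2)" using pos by simp
    also have "\<dots> \<le> 1 * (2 * p\<^sup>2 * PP * \<alpha>\<^sup>2 + 2 * q\<^sup>2 * QQ * \<beta>\<^sup>2)"
      using s R pos by (intro mult_right_mono mult_le_one) auto
    finally have "(s * (1 - s) * R / N) * (a1 * \<alpha> + b1 * \<beta>)\<^sup>2 \<le> 2 * p\<^sup>2 * PP * \<alpha>\<^sup>2 + 2 * q\<^sup>2 * QQ * \<beta>\<^sup>2" by simp
    moreover have "A * s * (s - 1) * (T / N\<^sup>2) = - (s * (1 - s) * R / N)"
      using pos by (simp add: R_def field_simps power2_eq_square)
    ultimately show ?thesis by simp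
  qed
  \<comment> \<open>Completing a square spends one of the two copies of
    \<open>T * \<alpha>\<^sup>2\<close> on the mixed term; the other copy survives as the lower
    bound.\<close>
  have cross: "4 * x * s * (T / N) * b1 * \<alpha> * \<beta> \<ge> - (T * \<alpha>\<^sup>2 + 4 * q\<^sup>2 * QQ * \<beta>\<^sup>2)"
  proof -
    define e where "e = 2 * x * s * b1 * \<beta> / N"
    have "0 \<le> T * (\<alpha> + e)\<^sup>2" using pos by simp
    then have "- (T * \<alpha>\<^sup>2) - T * e\<^sup>2 \<le> 2 * T * \<alpha> * e" by (simp add: power2_eq_square algebra_simps)
    moreover have "T * e\<^sup>2 \<le> 4 * q\<^sup>2 * QQ * \<beta>\<^sup>2"
    proof -
      have "T * e\<^sup>2 = 4 * s\<^sup>2 * (T * x\<^sup>2 / N) * (b1\<^sup>2 / N) * \<beta>\<^sup>2"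
        by (simp add: e_def power2_eq_square)
      also have "\<dots> \<le> 4 * 1 * 1 * (q\<^sup>2 * QQ) * \<beta>\<^sup>2"
      proof (intro mult_right_mono mult_mono)
        have "T * x\<^sup>2 \<le> T * A" using x pos by simp
        also have "\<dots> \<le> N" using T by (simp add: mult.commute)
        finally show "T * x\<^sup>2 / N \<le> 1" using pos by simp
        show "b1\<^sup>2 / N \<le> q\<^sup>2 * QQ" using sq2 pos by (simp add: divide_le_eq)
        show "s\<^sup>2 \<le> 1" using s by (simp add: power_le_one)
      qed (use pos s in auto)
      finally show ?thesis by simp
    qed
    moreover have "4 * x * s * (T / N) * b1 * \<alpha> * \<beta> = 2 * T * \<alpha> * e" by (simp add: e_def)
    ultimately show ?thesis by linarith
  qed
  have m1: "2 * p\<^sup>2 * PP * \<alpha>\<^sup>2 \<le> M * a2 * \<alpha>\<^sup>2"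
  proof -
    have "(2 * p) * (p * PP) \<le> M * a2" using M a2 p pos by (intro mult_mono) auto
    then show ?thesis by (intro mult_right_mono) (auto simp: power2_eq_square algebra_simps)
  qed
  \<comment> \<open>The origin of \<open>6 * q\<^sup>2 + 1\<close>: \<open>neg\<close> uses 2 of the
    6 copies, \<open>cross\<close> uses 4, and the remaining 1 is the term
    \<open>QQ * \<beta>\<^sup>2\<close> of the claim.\<close>
  have m2: "(6 * q\<^sup>2 * QQ + QQ) * \<beta>\<^sup>2 \<le> M * b2 * \<beta>\<^sup>2"
  proof -
    have "(6 * q\<^sup>2 + 1) * QQ \<le> M * (q * (q - 1)) * QQ" using M pos by (intro mult_right_mono) auto
    also have "\<dots> = M * (q * (q - 1) * QQ)" by simp
    also have "\<dots> \<le> M * b2" using b2 M p by (intro mult_left_mono) auto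
    finally show ?thesis by (intro mult_right_mono) (auto simp: algebra_simps)
  qed
  have c3: "0 \<le> (4 * x * s * (T / N) * a1) * \<alpha>\<^sup>2" "0 \<le> (A * s * (T / N) * a2) * \<alpha>\<^sup>2"
     "0 \<le> (A * s * (T / N) * b2) * \<beta>\<^sup>2"
    by (rule mult_nonneg_nonneg[OF c1 zero_le_power2] mult_nonneg_nonneg[OF c2(1) zero_le_power2]
        mult_nonneg_nonneg[OF c2(2) zero_le_power2])+
  have eq: "(M * a2 + 2 * T + 4 * x * s * (T / N) * a1 + A * s * (s - 1) * (T / N\<^sup>2) * a1\<^sup>2 + A * s * (T / N) * a2) * \<alpha>\<^sup>2
     + 2 * (2 * x * s * (T / N) * b1 + A * s * (s - 1) * (T / N\<^sup>2) * a1 * b1) * \<alpha> * \<beta>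
     + (M * b2 + A * s * (s - 1) * (T / N\<^sup>2) * b1\<^sup>2 + A * s * (T / N) * b2) * \<beta>\<^sup>2
    = M * a2 * \<alpha>\<^sup>2 + 2 * T * \<alpha>\<^sup>2 + (4 * x * s * (T / N) * a1) * \<alpha>\<^sup>2 + (A * s * (T / N) * a2) * \<alpha>\<^sup>2
      + 4 * x * s * (T / N) * b1 * \<alpha> * \<beta> + M * b2 * \<beta>\<^sup>2 + (A * s * (T / N) * b2) * \<beta>\<^sup>2
      + A * s * (s - 1) * (T / N\<^sup>2) * (a1 * \<alpha> + b1 * \<beta>)\<^sup>2"
    by (simp add: power2_eq_square algebra_simps)
  have m2': "6 * q\<^sup>2 * QQ * \<beta>\<^sup>2 + QQ * \<beta>\<^sup>2 \<le> M * b2 * \<beta>\<^sup>2" using m2 by (simp add: algebra_simps)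
  show ?thesis unfolding eq using neg cross m1 m2' c3 by linarith
qed

text \<open>The Nazarov-Treil function is glued from two formulas:
  \<open>x\<^sup>2 * \<bar>y\<bar> powr (2 - q)\<close> is added to the pure powers where
  \<open>\<bar>y\<bar> powr q\<close> dominates, and only pure powers occur where
  \<open>\<bar>x\<bar> powr p\<close> does. Multiplying \<open>x\<^sup>2\<close> by the power
  \<open>1 - 2/p\<close> of the sum of both interpolates between the two regimes without gluing, so
  that the second derivatives are continuous. \<open>C\<close> comes before
  \<open>\<epsilon>\<close> because \<open>\<epsilon>\<close> will tend to 0.\<close>

lemma bellman_exists:
  fixes p q :: real
  assumes p: "2 \<le> p" and pq: "1/p + 1/q = 1"
  shows "\<exists>C>0. \<forall>\<epsilon>>0. \<exists>G Gx Gy Gxx Gxy Gyy. bellman_function G Gx Gy Gxx Gxy Gyy \<and>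
     (\<forall>x y. G x y \<le> C * ((x\<^sup>2 + \<epsilon>\<^sup>2) powr (p/2) + (y\<^sup>2 + \<epsilon>\<^sup>2) powr (q/2)))"
proof -
  have q0: "q \<noteq> 0" using pq p by auto
  have pq': "p + q = p * q" using pq p q0 by (simp add: field_simps)
  then have "q * (p - 1) = p" by (simp add: algebra_simps)
  then have qe: "q = p / (p - 1)" using p by (simp add: field_simps)
  have q: "1 < q" "q \<le> 2" using p by (auto simp: qe field_simps)
  define s where "s = 1 - 2/p"
  have s: "0 \<le> s" "s \<le> 1" using p by (auto simp: s_def)
  have sq: "s * q = 2 - q"
  proof -
    have "s * q = q - 2 * q / p" by (simp add: s_def algebra_simps)
    also have "q / p = q - 1" using pq' p by (simp add: field_simps)
    then have "2 * q / p = 2 * (q - 1)" by simp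
    finally show ?thesis by simp
  qed
  define M where "M = 2 * p + (6 * q\<^sup>2 + 1) / (q * (q - 1))"
  have M: "2 * p \<le> M" "6 * q\<^sup>2 + 1 \<le> M * (q * (q - 1))" "0 < M"
  proof -
    have qq: "0 < q * (q - 1)" using q by simp
    have pos: "0 < (6 * q\<^sup>2 + 1) / (q * (q - 1))" using qq by (intro divide_pos_pos) (auto simp: add_nonneg_pos)
    show "2 * p \<le> M" "0 < M" using pos p by (auto simp: M_def)
    have "6 * q\<^sup>2 + 1 = (6 * q\<^sup>2 + 1) / (q * (q - 1)) * (q * (q - 1))" using q by simp
    also have "\<dots> \<le> M * (q * (q - 1))" using qq p by (intro mult_right_mono) (auto simp: M_def)
    finally show "6 * q\<^sup>2 + 1 \<le> M * (q * (q - 1))" .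
  qed
  show ?thesis
  proof (intro exI[of _ "M + 1"] conjI allI impI)
    fix \<epsilon> :: real assume \<epsilon>: "\<epsilon> > 0"
    define a where "a r x = (x\<^sup>2 + \<epsilon>\<^sup>2) powr (r/2)" for r x :: real
    define a1 where "a1 r x = r * x * (x\<^sup>2 + \<epsilon>\<^sup>2) powr (r/2 - 1)" for r x :: real
    define a2 where "a2 r x = r * (x\<^sup>2 + \<epsilon>\<^sup>2) powr (r/2 - 1) + r * (r - 2) * x\<^sup>2 * (x\<^sup>2 + \<epsilon>\<^sup>2) powr (r/2 - 2)" for r x :: real
    define c where "c x = x\<^sup>2 + \<epsilon>\<^sup>2" for x :: real
    define N where "N x y = a p x + a q y" for x y
    have cpos: "c x > 0" for x using \<epsilon> by (simp add: c_def add_nonneg_pos)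
    have cpos': "x\<^sup>2 + \<epsilon>\<^sup>2 > 0" for x using cpos by (simp add: c_def)
    have apos: "a r x > 0" for r x using \<epsilon> by (simp add: a_def)
    have Npos: "N x y > 0" for x y using apos[of p x] apos[of q y] by (simp add: N_def)
    have da: "(a r has_real_derivative a1 r x) (at x)" for r x
      using smoothed_power_derivs(1)[OF \<epsilon>, of r x] by (simp add: a_def[abs_def] a1_def)
    have da1: "(a1 r has_real_derivative a2 r x) (at x)" for r x
      using smoothed_power_derivs(2)[OF \<epsilon>, of r x] by (simp add: a2_def a1_def[abs_def])
    have dc: "(c has_real_derivative 2 * x) (at x)" for x
      by (auto simp: c_def[abs_def] intro!: derivative_eq_intros)
    have da': "((\<lambda>x. a r (g x)) has_real_derivative a1 r (g x) * D) (at x)"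
      and da1': "((\<lambda>x. a1 r (g x)) has_real_derivative a2 r (g x) * D) (at x)"
      and dc': "((\<lambda>x. c (g x)) has_real_derivative 2 * g x * D) (at x)"
      if "(g has_real_derivative D) (at x)" for g D r x
      using that by (rule DERIV_chain2[OF da] DERIV_chain2[OF da1] DERIV_chain2[OF dc])+
    have dN: "((\<lambda>r. N (X r) (Y r) powr t) has_real_derivative
         t * N (X r) (Y r) powr (t - 1) * (a1 p (X r) * X' + a1 q (Y r) * Y')) (at r)"
      if "(X has_real_derivative X') (at r)" "(Y has_real_derivative Y') (at r)" for X Y X' Y' r t
    proof -
      have "((\<lambda>r. N (X r) (Y r)) has_real_derivative (a1 p (X r) * X' + a1 q (Y r) * Y')) (at r)"
        unfolding N_def using that by (intro DERIV_add da')
      from DERIV_fun_powr[OF this Npos, of t] show ?thesis by (simp add: algebra_simps)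
    qed
    have conta: "continuous_on S (\<lambda>z. a r (f z))" "continuous_on S (\<lambda>z. a1 r (f z))"
       "continuous_on S (\<lambda>z. a2 r (f z))" "continuous_on S (\<lambda>z. c (f z))"
      if "continuous_on S f" for S :: "(real \<times> real) set" and f r
      unfolding a_def a1_def a2_def c_def using that \<epsilon>
      by (auto intro!: continuous_intros simp: less_imp_neq[symmetric])
    have contN: "continuous_on S (\<lambda>z. N (fst z) (snd z) powr t)" for S :: "(real \<times> real) set" and t
    proof -
      have "continuous_on S (\<lambda>z. N (fst z) (snd z))"
        unfolding N_def by (intro continuous_on_add conta continuous_on_fst continuous_on_snd continuous_on_id)
      then show ?thesis using Npos by (intro continuous_on_powr continuous_on_const) (auto simp: less_imp_neq[symmetric])
    qed
    note conts = conta[OF continuous_on_fst[OF continuous_on_id]] conta[OF continuous_on_snd[OF continuous_on_id]] contN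
       continuous_on_fst[OF continuous_on_id] continuous_on_snd[OF continuous_on_id]
    (* The Hessian of the second summand supplies the weight N^s for \<alpha>^2, that of a q the weight |y|^(q-2) for
       \<beta>^2; their product is at least 1 because N >= |y|^q (up to the smoothing by \<epsilon>) and s q = 2 - q. *)
    define G where "G x y = M * (a p x + a q y) + c x * N x y powr s" for x y
    define Gx where "Gx x y = M * a1 p x + 2 * x * N x y powr s + c x * s * N x y powr (s - 1) * a1 p x" for x y
    define Gy where "Gy x y = M * a1 q y + c x * s * N x y powr (s - 1) * a1 q y" for x y
    define Gxx where "Gxx x y = M * a2 p x + 2 * N x y powr s + 4 * x * s * N x y powr (s - 1) * a1 p x
       + c x * s * (s - 1) * N x y powr (s - 2) * (a1 p x)\<^sup>2 + c x * s * N x y powr (s - 1) * a2 p x" for x y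
    define Gxy where "Gxy x y = 2 * x * s * N x y powr (s - 1) * a1 q y
       + c x * s * (s - 1) * N x y powr (s - 2) * a1 p x * a1 q y" for x y
    define Gyy where "Gyy x y = M * a2 q y + c x * s * (s - 1) * N x y powr (s - 2) * (a1 q y)\<^sup>2
       + c x * s * N x y powr (s - 1) * a2 q y" for x y
    have s2: "s - 1 - 1 = s - 2" by simp
    have cG: "continuous_on UNIV (\<lambda>z. Gx (fst z) (snd z))" "continuous_on UNIV (\<lambda>z. Gy (fst z) (snd z))"
      "continuous_on UNIV (\<lambda>z. Gxx (fst z) (snd z))" "continuous_on UNIV (\<lambda>z. Gxy (fst z) (snd z))"
      "continuous_on UNIV (\<lambda>z. Gyy (fst z) (snd z))" "continuous_on UNIV (\<lambda>z. G (fst z) (snd z))"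
      unfolding G_def Gx_def Gy_def Gxx_def Gxy_def Gyy_def
      by (intro continuous_on_add continuous_on_mult continuous_on_const continuous_on_power conts)+
    have D: "diff2 G Gx Gy" "diff2 Gx Gxx Gxy" "diff2 Gy Gxy Gyy"
    proof -
      note rules = DERIV_add DERIV_mult DERIV_const da' da1' dc' dN
      show "diff2 G Gx Gy" unfolding diff2_def
      proof (intro conjI allI impI cG)
        fix X Y X' Y' r assume X: "(X has_real_derivative X') (at r)" and Y: "(Y has_real_derivative Y') (at r)"
        show "((\<lambda>r. G (X r) (Y r)) has_real_derivative Gx (X r) (Y r) * X' + Gy (X r) (Y r) * Y') (at r)"
          unfolding G_def
          by (rule DERIV_cong, (rule rules X Y)+) (simp add: Gx_def Gy_def algebra_simps)
      qed
      show "diff2 Gx Gxx Gxy" unfolding diff2_def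
      proof (intro conjI allI impI cG)
        fix X Y X' Y' r assume X: "(X has_real_derivative X') (at r)" and Y: "(Y has_real_derivative Y') (at r)"
        show "((\<lambda>r. Gx (X r) (Y r)) has_real_derivative Gxx (X r) (Y r) * X' + Gxy (X r) (Y r) * Y') (at r)"
          unfolding Gx_def
          by (rule DERIV_cong, (rule rules X Y)+) (simp add: Gxx_def Gxy_def s2 power2_eq_square algebra_simps)
      qed
      show "diff2 Gy Gxy Gyy" unfolding diff2_def
      proof (intro conjI allI impI cG)
        fix X Y X' Y' r assume X: "(X has_real_derivative X') (at r)" and Y: "(Y has_real_derivative Y') (at r)"
        show "((\<lambda>r. Gy (X r) (Y r)) has_real_derivative Gxy (X r) (Y r) * X' + Gyy (X r) (Y r) * Y') (at r)"
          unfolding Gy_def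
          by (rule DERIV_cong, (rule rules X Y)+) (simp add: Gxy_def Gyy_def s2 power2_eq_square algebra_simps)
      qed
    qed
    \<comment> \<open>Since \<open>1 - s = 2/p\<close>, the smoothed square is the power
      \<open>1 - s\<close> of the smoothed p-th power. The resulting bound serves twice: in the
      Hessian estimate and in the upper bound for \<open>G\<close>.\<close>
    have T: "c x * N x y powr s \<le> N x y" for x y
    proof -
      have "c x = a p x powr (1 - s)" using cpos[of x] p by (simp add: a_def c_def powr_powr s_def)
      also have "\<dots> \<le> N x y powr (1 - s)" using apos[of p x] apos[of q y] s
        by (intro powr_mono2) (auto simp: N_def)
      finally have "c x * N x y powr s \<le> N x y powr (1 - s) * N x y powr s" by (intro mult_right_mono) auto
      also have "\<dots> = N x y" using Npos[of x y] by (simp add: powr_add[symmetric])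
      finally show ?thesis .
    qed
    have G0: "0 \<le> G x y" for x y
      using M apos[of p x] apos[of q y] cpos[of x] by (auto simp: G_def intro!: add_nonneg_nonneg mult_nonneg_nonneg)
    have ub: "G x y \<le> (M + 1) * ((x\<^sup>2 + \<epsilon>\<^sup>2) powr (p/2) + (y\<^sup>2 + \<epsilon>\<^sup>2) powr (q/2))" for x y
      using T[of x y] unfolding G_def N_def a_def by (simp add: algebra_simps)
    have H: "\<exists>\<tau>>0. \<forall>\<alpha> \<beta>. \<tau> * \<alpha>\<^sup>2 + \<beta>\<^sup>2 / \<tau> \<le> Gxx x y * \<alpha>\<^sup>2 + 2 * Gxy x y * \<alpha> * \<beta> + Gyy x y * \<beta>\<^sup>2" for x y
    proof (intro exI[of _ "N x y powr s"] conjI allI)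
      fix \<alpha> \<beta> :: real
      have cr: "c z * c z powr (r/2 - 1) = a r z" for r z
        using cpos[of z] unfolding a_def c_def[symmetric]
        by (metis add.commute diff_add_cancel less_eq_real_def powr_add powr_one)
      have cr2: "c z powr (r/2 - 1) = c z * c z powr (r/2 - 2)" for r z
        using cpos[of z] powr_add[of "c z" 1 "r/2 - 2"] by (simp add: algebra_simps)
      have zc: "z\<^sup>2 \<le> c z" for z by (simp add: c_def)
      have a2p: "p * c x powr (p/2 - 1) \<le> a2 p x"
        unfolding a2_def c_def[symmetric] using p by simp
      \<comment> \<open>For \<open>q\<close> below 2 the second summand of \<open>a2 q y\<close> is
        negative; replacing \<open>y\<^sup>2\<close> by the larger \<open>c y\<close> in it leaves
        the factor \<open>q - 1\<close>.\<close>
      have a2q: "q * (q - 1) * c y powr (q/2 - 1) \<le> a2 q y"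
      proof -
        have "q * (2 - q) * (y\<^sup>2 * c y powr (q/2 - 2)) \<le> q * (2 - q) * (c y * c y powr (q/2 - 2))"
          using q zc by (intro mult_left_mono mult_right_mono) auto
        then have "q * (2 - q) * (y\<^sup>2 * c y powr (q/2 - 2)) \<le> q * (2 - q) * c y powr (q/2 - 1)"
          by (simp add: cr2)
        then show ?thesis unfolding a2_def c_def[symmetric] by (simp add: algebra_simps)
      qed
      have Ns: "N x y powr (s - 1) = N x y powr s / N x y" "N x y powr (s - 2) = N x y powr s / (N x y)\<^sup>2"
        using Npos[of x y] by (simp_all add: powr_diff powr_numeral)
      have aN: "a p x \<le> N x y" "a q y \<le> N x y" using apos[of p x] apos[of q y] by (auto simp: N_def)
      have main: "N x y powr s * \<alpha>\<^sup>2 + c y powr (q/2 - 1) * \<beta>\<^sup>2 \<le> Gxx x y * \<alpha>\<^sup>2 + 2 * Gxy x y * \<alpha> * \<beta> + Gyy x y * \<beta>\<^sup>2"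
        unfolding Gxx_def Gxy_def Gyy_def Ns
        by (rule bellman_hessian_arith[where PP = "c x powr (p/2 - 1)" and y=y and p=p and q=q and B="c y" and A="c x"])
          (use p q s M zc cpos Npos[of x y] T apos a2p a2q aN in
            \<open>auto simp: cr a1_def c_def[symmetric] less_imp_le\<close>)
      have "\<beta>\<^sup>2 / N x y powr s \<le> c y powr (q/2 - 1) * \<beta>\<^sup>2"
      proof -
        have "c y powr (1 - q/2) = a q y powr s"
        proof -
          have e: "1 - q/2 = q/2 * s" using sq by (simp add: field_simps)
          have "a q y = c y powr (q/2)" by (simp add: a_def c_def)
          then show ?thesis unfolding e by (simp only: powr_powr)
        qed
        also have "\<dots> \<le> N x y powr s" using apos[of p x] apos[of q y] s
          by (intro powr_mono2) (auto simp: N_def)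
        finally have "inverse (N x y powr s) \<le> inverse (c y powr (1 - q/2))"
          using cpos[of y] by (intro le_imp_inverse_le) auto
        also have "\<dots> = c y powr (q/2 - 1)" using powr_minus[of "c y" "1 - q/2"] by simp
        finally have "inverse (N x y powr s) * \<beta>\<^sup>2 \<le> c y powr (q/2 - 1) * \<beta>\<^sup>2" by (intro mult_right_mono) auto
        then show ?thesis by (simp only: divide_inverse mult.commute)
      qed
      then show "N x y powr s * \<alpha>\<^sup>2 + \<beta>\<^sup>2 / N x y powr s \<le> Gxx x y * \<alpha>\<^sup>2 + 2 * Gxy x y * \<alpha> * \<beta> + Gyy x y * \<beta>\<^sup>2"
        using main by linarith
    qed (use Npos[of x y] in simp)
    show "\<exists>G Gx Gy Gxx Gxy Gyy. bellman_function G Gx Gy Gxx Gxy Gyy \<and>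
     (\<forall>x y. G x y \<le> (M + 1) * ((x\<^sup>2 + \<epsilon>\<^sup>2) powr (p/2) + (y\<^sup>2 + \<epsilon>\<^sup>2) powr (q/2)))"
      unfolding bellman_function_def
      by (intro exI[of _ G] exI[of _ Gx] exI[of _ Gy] exI[of _ Gxx] exI[of _ Gxy] exI[of _ Gyy] conjI allI D cG G0 H ub)
  qed (use M in auto)
qed

section \<open>Integration over a periodic cell\<close>

text \<open>No integrability is assumed: translation preserves measurability, and without it both
  integrals take the default value 0.\<close>

lemma lborel_integral_translate:
  fixes g :: "'a::euclidean_space \<Rightarrow> 'b::euclidean_space"
  shows "(LINT x|lborel. g (x + t)) = (LINT x|lborel. g x)"
proof -
  have "(LINT x|lborel. g x) = (LINT x|distr lborel borel ((+) t). g x)" by (simp add: lborel_distr_plus)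
  also have "\<dots> = (LINT x|lborel. g (t + x))"
  proof (cases "g \<in> borel_measurable borel")
    case True
    then show ?thesis by (intro integral_distr) auto
  next
    case False
    have "(\<lambda>x. g (t + x)) \<notin> borel_measurable borel"
    proof
      assume "(\<lambda>x. g (t + x)) \<in> borel_measurable borel"
      from measurable_compose[OF _ this, of "\<lambda>x. x - t" borel] False show False by simp
    qed
    then have "\<not> integrable lborel (\<lambda>x. g (t + x))" using borel_measurable_integrable by fastforce
    moreover have "\<not> integrable (distr lborel borel ((+) t)) g"
      using False borel_measurable_integrable by fastforce
    ultimately show ?thesis by (simp add: not_integrable_integral_eq)
  qed
  finally show ?thesis by (simp add: add.commute)
qed

lemma lborel_integrable_translate:
  fixes g :: "'a::euclidean_space \<Rightarrow> 'b::euclidean_space"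
  shows "integrable lborel (\<lambda>x. g (x + t)) \<longleftrightarrow> integrable lborel g"
proof -
  have *: "integrable lborel (\<lambda>x. g (x + t))" if "integrable lborel g" for t and g :: "'a \<Rightarrow> 'b"
  proof -
    have "integrable (distr lborel borel ((+) t)) g" using that by (simp add: lborel_distr_plus)
    moreover have "g \<in> borel_measurable borel" using that by auto
    ultimately show ?thesis by (subst (asm) integrable_distr_eq) (auto simp: add.commute)
  qed
  show ?thesis using *[of g t] *[of "\<lambda>x. g (x + t)" "- t"] by auto
qed

lemma set_integrable_continuous_bounded:
  fixes f :: "'a::euclidean_space \<Rightarrow> 'b::euclidean_space"
  assumes "A \<in> sets borel" "bounded A" "continuous_on UNIV f"
  shows "set_integrable lborel A f"
proof (rule set_integrable_subset)
  show "set_integrable lborel (closure A) f"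
    unfolding set_integrable_def
    using assms by (intro borel_integrable_compact) (auto simp: compact_closure intro: continuous_on_subset)
qed (use assms closure_subset in auto)

text \<open>This takes the place of differentiation under the integral sign: the fundamental theorem
  is applied at each \<open>x\<close>, and then the order of integration is exchanged.\<close>

lemma fubini_ftc:
  fixes A :: "'a::euclidean_space set" and \<Psi> \<Theta> :: "real \<Rightarrow> 'a \<Rightarrow> real"
  assumes A: "A \<in> sets borel" "bounded A" and T: "0 \<le> T"
    and d: "\<And>s x. ((\<lambda>s. \<Psi> s x) has_real_derivative \<Theta> s x) (at s)"
    and c: "continuous_on UNIV (\<lambda>z. \<Theta> (fst z) (snd z))"
  shows "(LINT x:A|lborel. (\<Psi> T x - \<Psi> 0 x)) = (LINT s:{0..T}|lborel. (LINT x:A|lborel. \<Theta> s x))"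
proof -
  have cs: "continuous_on S (\<lambda>s. \<Theta> s x)" for x S
    using continuous_on_compose2[OF c, of S "\<lambda>s. (s, x)"]
    by (simp add: continuous_on_Pair)
  have ftc: "(LINT s|lborel. indicator {0..T} s *\<^sub>R \<Theta> s x) = \<Psi> T x - \<Psi> 0 x" for x
  proof (rule integral_FTC_atLeastAtMost[OF T])
    show "((\<lambda>s. \<Psi> s x) has_vector_derivative \<Theta> s x) (at s within {0..T})" for s
      using d[of x s] has_real_derivative_iff_has_vector_derivative has_vector_derivative_at_within by blast
  qed (rule cs)
  define f where "f s x = indicator {0..T} s *\<^sub>R indicator A x *\<^sub>R \<Theta> s x" for s and x :: 'a
  have "set_integrable lborel ({0..T} \<times> A) (\<lambda>z. \<Theta> (fst z) (snd z))"
  proof (rule set_integrable_continuous_bounded[OF _ _ c])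
    show "{0..T} \<times> A \<in> sets borel"
      using A by (simp add: borel_prod[symmetric])
    show "bounded ({0..T} \<times> A)" using A by (intro bounded_Times) auto
  qed
  then have int: "integrable (lborel \<Otimes>\<^sub>M lborel) (case_prod f)"
    unfolding set_integrable_def lborel_prod f_def
    by (rule Bochner_Integration.integrable_cong[OF refl, THEN iffD1, rotated])
       (auto simp: indicator_def split: if_splits)
  have "(LINT x|lborel. LINT s|lborel. f s x) = (LINT s|lborel. LINT x|lborel. f s x)"
    by (rule lborel_pair.Fubini_integral[OF int])
  moreover have "(LINT x|lborel. LINT s|lborel. f s x) = (LINT x:A|lborel. (\<Psi> T x - \<Psi> 0 x))"
  proof -
    have "(LINT s|lborel. f s x) = indicator A x *\<^sub>R (\<Psi> T x - \<Psi> 0 x)" for x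
    proof -
      have "(LINT s|lborel. f s x) = (LINT s|lborel. indicator A x * (indicator {0..T} s *\<^sub>R \<Theta> s x))"
        unfolding f_def by (intro Bochner_Integration.integral_cong) auto
      then show ?thesis using ftc[of x] by simp
    qed
    then show ?thesis by (simp add: set_lebesgue_integral_def)
  qed
  moreover have "(LINT s|lborel. LINT x|lborel. f s x) = (LINT s:{0..T}|lborel. (LINT x:A|lborel. \<Theta> s x))"
    unfolding f_def set_lebesgue_integral_def by simp
  ultimately show ?thesis by simp
qed

text \<open>Averaging over all shifts by \<open>s\<close> in \<open>{0..T}\<close> gives
  \<open>T\<close> times the integral of \<open>F'\<close> and, by \<open>fubini_ftc\<close>, an
  increment of \<open>F\<close> that vanishes. Shift invariance is an abstract hypothesis so as to
  cover periodic functions on a cell as well as functions of bounded support.\<close>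

lemma set_integral_directional_derivative_eq_0:
  fixes A :: "'a::euclidean_space set" and F F' :: "'a \<Rightarrow> real"
  assumes A: "A \<in> sets borel" "bounded A" and T: "0 < T"
    and d: "\<And>s x. ((\<lambda>s. F (x + s *\<^sub>R e)) has_real_derivative F' (x + s *\<^sub>R e)) (at s)"
    and c: "continuous_on UNIV F" "continuous_on UNIV F'"
    and inv: "(LINT x:A|lborel. F (x + T *\<^sub>R e)) = (LINT x:A|lborel. F x)"
    and inv': "\<And>s. 0 \<le> s \<Longrightarrow> s \<le> T \<Longrightarrow> (LINT x:A|lborel. F' (x + s *\<^sub>R e)) = (LINT x:A|lborel. F' x)"
  shows "(LINT x:A|lborel. F' x) = 0"
proof -
  have "(LINT x:A|lborel. (F (x + T *\<^sub>R e) - F (x + 0 *\<^sub>R e)))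
      = (LINT s:{0..T}|lborel. (LINT x:A|lborel. F' (x + s *\<^sub>R e)))"
  proof (rule fubini_ftc[OF A _ d])
    show "continuous_on UNIV (\<lambda>z. F' (snd z + fst z *\<^sub>R e))"
      by (rule continuous_on_compose2[OF c(2)]) (auto intro!: continuous_intros)
  qed (use T in auto)
  also have "\<dots> = (LINT s:{0..T}|lborel. (LINT x:A|lborel. F' x))"
    using inv' by (intro set_lebesgue_integral_cong) auto
  also have "\<dots> = T * (LINT x:A|lborel. F' x)"
    using T by (simp add: set_lebesgue_integral_def)
  finally have "T * (LINT x:A|lborel. F' x) = (LINT x:A|lborel. (F (x + T *\<^sub>R e) - F (x + 0 *\<^sub>R e)))" ..
  also have "\<dots> = (LINT x:A|lborel. F (x + T *\<^sub>R e)) - (LINT x:A|lborel. F x)"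
    using A c
    by (subst set_integral_diff(2)) (auto intro!: set_integrable_continuous_bounded continuous_on_compose2[OF c(1)] continuous_intros)
  finally show ?thesis using inv T by simp
qed

text \<open>A fundamental domain of the torus with period \<open>2 * l\<close>; half-open, so that
  its translates by periods are disjoint.\<close>

definition cell :: "real \<Rightarrow> (real^'n) set" where
  "cell l = {x. \<forall>i. - l \<le> x $ i \<and> x $ i < l}"

definition periodic :: "real \<Rightarrow> (real^'n \<Rightarrow> 'b) \<Rightarrow> bool" where
  "periodic l F \<longleftrightarrow> (\<forall>x i. F (x + (2 * l) *\<^sub>R axis i 1) = F x)"

lemma cell_borel [measurable]: "cell l \<in> sets borel"
  unfolding cell_def by measurable

lemma bounded_cell: "bounded (cell l :: (real^'n) set)"
  by (rule bounded_subset[of "cbox (\<chi> i. - l) (\<chi> i. l)"])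
    (use less_imp_le in \<open>auto simp: cell_def mem_box_cart subset_iff\<close>)

lemmas cell_integrable = set_integrable_continuous_bounded[OF cell_borel bounded_cell]

text \<open>The shifted cell is made of the part \<open>R\<close> of the cell that the shift still
  covers and of the remaining part \<open>S\<close>, moved by one period.\<close>

lemma periodic_shift_axis:
  fixes F :: "real^'n \<Rightarrow> real"
  assumes per: "periodic l F" and c: "continuous_on UNIV F" and h: "0 \<le> h" "h \<le> 2 * l"
  shows "(LINT x:cell l|lborel. F (x + h *\<^sub>R axis i 1)) = (LINT x:cell l|lborel. F x)"
proof -
  define e :: "real^'n" where "e = axis i 1"
  define S :: "(real^'n) set" where "S = cell l \<inter> {x. x $ i < h - l}"
  define R :: "(real^'n) set" where "R = cell l \<inter> {x. x $ i \<ge> h - l}"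
  have bS: "S \<in> sets borel" "bounded S" and bR: "R \<in> sets borel" "bounded R"
    unfolding S_def R_def using bounded_cell by (auto intro: bounded_Int)
  have intS: "integrable lborel (\<lambda>x. indicator S x *\<^sub>R F x)"
    and intR: "integrable lborel (\<lambda>x. indicator R x *\<^sub>R F x)"
    using set_integrable_continuous_bounded[OF bS c] set_integrable_continuous_bounded[OF bR c]
    by (auto simp: set_integrable_def)
  have ind: "indicator (cell l) (y - h *\<^sub>R e) = (indicator R y + indicator S (y - (2 * l) *\<^sub>R e) :: real)" for y
  proof -
    have ei: "(y - t *\<^sub>R e) $ k = (if k = i then y $ i - t else y $ k)" for t k
      by (simp add: e_def axis_def)
    have "y - h *\<^sub>R e \<in> cell l \<longleftrightarrow> (\<forall>k. k \<noteq> i \<longrightarrow> - l \<le> y $ k \<and> y $ k < l) \<and> h - l \<le> y $ i \<and> y $ i < h + l"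
      unfolding cell_def mem_Collect_eq ei by auto
    moreover have "y \<in> R \<longleftrightarrow> (\<forall>k. k \<noteq> i \<longrightarrow> - l \<le> y $ k \<and> y $ k < l) \<and> h - l \<le> y $ i \<and> y $ i < l"
      unfolding R_def cell_def using h by (auto simp: less_le_trans) (smt (verit))
    moreover have "y - (2 * l) *\<^sub>R e \<in> S \<longleftrightarrow> (\<forall>k. k \<noteq> i \<longrightarrow> - l \<le> y $ k \<and> y $ k < l) \<and> l \<le> y $ i \<and> y $ i < h + l"
      unfolding S_def cell_def Int_iff mem_Collect_eq ei using h by auto
    ultimately show ?thesis using h by (auto simp: indicator_def)
  qed
  have intS': "integrable lborel (\<lambda>y. indicator S (y - (2 * l) *\<^sub>R e) *\<^sub>R F y)"
  proof -
    have "integrable lborel (\<lambda>y. (\<lambda>x. indicator S x *\<^sub>R F x) (y + (- (2 * l) *\<^sub>R e)))"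
      using intS by (subst lborel_integrable_translate)
    moreover have "F (y - (2 * l) *\<^sub>R e) = F y" for y
      using per[unfolded periodic_def, rule_format, of "y - (2 * l) *\<^sub>R e" i] by (simp add: e_def)
    ultimately show ?thesis by simp
  qed
  have "(LINT x:cell l|lborel. F (x + h *\<^sub>R e))
      = (LINT x|lborel. (\<lambda>y. indicator (cell l) (y - h *\<^sub>R e) *\<^sub>R F y) (x + h *\<^sub>R e))"
    by (simp add: set_lebesgue_integral_def)
  also have "\<dots> = (LINT y|lborel. indicator (cell l) (y - h *\<^sub>R e) *\<^sub>R F y)"
    by (rule lborel_integral_translate)
  also have "\<dots> = (LINT y|lborel. indicator R y *\<^sub>R F y + indicator S (y - (2 * l) *\<^sub>R e) *\<^sub>R F y)"
    by (simp add: ind algebra_simps)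
  also have "\<dots> = (LINT y|lborel. indicator R y *\<^sub>R F y) + (LINT y|lborel. indicator S (y - (2 * l) *\<^sub>R e) *\<^sub>R F y)"
    by (rule Bochner_Integration.integral_add[OF intR intS'])
  also have "(LINT y|lborel. indicator S (y - (2 * l) *\<^sub>R e) *\<^sub>R F y)
     = (LINT y|lborel. (\<lambda>y. indicator S (y - (2 * l) *\<^sub>R e) *\<^sub>R F y) (y + (2 * l) *\<^sub>R e))"
    by (rule lborel_integral_translate[symmetric])
  also have "\<dots> = (LINT y|lborel. indicator S y *\<^sub>R F y)"
    using per by (simp add: periodic_def e_def)
  also have "(LINT y|lborel. indicator R y *\<^sub>R F y) + \<dots> = (LINT y|lborel. indicator R y *\<^sub>R F y + indicator S y *\<^sub>R F y)"
    by (rule Bochner_Integration.integral_add[OF intR intS, symmetric])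
  also have "\<dots> = (LINT x:cell l|lborel. F x)"
    unfolding set_lebesgue_integral_def
    by (intro Bochner_Integration.integral_cong) (auto simp: R_def S_def indicator_def)
  finally show ?thesis by (simp add: e_def)
qed

lemma set_integral_cell_deriv_eq_0:
  fixes F F' :: "real^'n \<Rightarrow> real"
  assumes l: "0 < l" and per: "periodic l F" "periodic l F'"
    and d: "\<And>s x. ((\<lambda>s. F (x + s *\<^sub>R axis i 1)) has_real_derivative F' (x + s *\<^sub>R axis i 1)) (at s)"
    and c: "continuous_on UNIV F" "continuous_on UNIV F'"
  shows "(LINT x:cell l|lborel. F' x) = 0"
  by (rule set_integral_directional_derivative_eq_0[OF cell_borel bounded_cell _ d c, of "2 * l"])
    (use l per periodic_shift_axis[OF per(2) c(2)] in \<open>simp_all add: periodic_def\<close>)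

lemma periodic_shift:
  fixes F :: "real^'n \<Rightarrow> real"
  assumes per: "periodic l F" and c: "continuous_on UNIV F" and y: "\<And>i. \<bar>y $ i\<bar> \<le> l"
  shows "(LINT x:cell l|lborel. F (x + y)) = (LINT x:cell l|lborel. F x)"
proof -
  have per': "periodic l (\<lambda>x. F (x + z))" for z
    using per unfolding periodic_def by (metis add.assoc add.commute)
  have c': "continuous_on UNIV (\<lambda>x. F (x + z))" for z
    by (rule continuous_on_compose2[OF c]) (auto intro!: continuous_intros)
  have ax: "(LINT x:cell l|lborel. F (x + z + h *\<^sub>R axis i 1)) = (LINT x:cell l|lborel. F (x + z))"
    if h: "\<bar>h\<bar> \<le> l" for h i z
  proof (cases "h \<ge> 0")
    case True
    then show ?thesis using periodic_shift_axis[OF per'[of z] c', of h i] h by (simp add: add_ac)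
  next
    case False
    then show ?thesis
      using periodic_shift_axis[OF per'[of "z + h *\<^sub>R axis i 1"] c', of "-h" i] h by (simp add: add_ac)
  qed
  have "(LINT x:cell l|lborel. F (x + (\<Sum>i\<in>I. (y $ i) *\<^sub>R axis i 1))) = (LINT x:cell l|lborel. F x)" if "finite I" for I
    using that
  proof (induction I)
    case (insert i I)
    then show ?case using ax[of "y $ i" "\<Sum>i\<in>I. (y $ i) *\<^sub>R axis i 1" i] y[of i] by (simp add: add_ac)
  qed simp
  from this[of UNIV] show ?thesis
    using basis_expansion[of y] by (simp add: scalar_mult_eq_scaleR)
qed

section \<open>Trigonometric polynomials and the heat flow\<close>

text \<open>An entry \<open>(\<xi>, a, b)\<close> stands for \<open>a cos (\<xi> \<bullet> x) + b sin (\<xi> \<bullet> x)\<close>; frequencies may be repeated.\<close>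

type_synonym 'n trig = "((real^'n) \<times> real \<times> real) list"

definition tp :: "'n::finite trig \<Rightarrow> real^'n \<Rightarrow> real" where
  "tp xs x = (\<Sum>(\<xi>, a, b)\<leftarrow>xs. a * cos (\<xi> \<bullet> x) + b * sin (\<xi> \<bullet> x))"

text \<open>The Fourier multiplier with symbol \<open>m\<close>.\<close>

definition scale_freq :: "(real^'n \<Rightarrow> real) \<Rightarrow> 'n trig \<Rightarrow> 'n trig" where
  "scale_freq m xs = map (\<lambda>(\<xi>, a, b). (\<xi>, m \<xi> * a, m \<xi> * b)) xs"

definition tderiv :: "'n \<Rightarrow> 'n::finite trig \<Rightarrow> 'n trig" where
  "tderiv i xs = map (\<lambda>(\<xi>, a, b). (\<xi>, \<xi> $ i * b, - (\<xi> $ i) * a)) xs"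

abbreviation heat :: "real \<Rightarrow> 'n::finite trig \<Rightarrow> 'n trig" where
  "heat t \<equiv> scale_freq (\<lambda>\<xi>. exp (- t * (\<xi> \<bullet> \<xi>)))"

text \<open>The zero frequency is annihilated because \<open>- 1 / 0 = 0\<close>.\<close>

abbreviation inv_laplace :: "'n::finite trig \<Rightarrow> 'n trig" where
  "inv_laplace \<equiv> scale_freq (\<lambda>\<xi>. - 1 / (\<xi> \<bullet> \<xi>))"

text \<open>The frequencies lie in the dual lattice of the period \<open>2 * l\<close>, which makes
  \<open>tp\<close> periodic.\<close>

definition lattice_trig :: "real \<Rightarrow> 'n::finite trig \<Rightarrow> bool" where
  "lattice_trig l xs \<longleftrightarrow> (\<forall>(\<xi>, a, b)\<in>set xs. \<forall>i. \<exists>k::int. \<xi> $ i = of_int k * pi / l)"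

lemma tp_simps [simp]:
  "tp [] x = 0"
  "tp ((\<xi>, a, b) # xs) x = a * cos (\<xi> \<bullet> x) + b * sin (\<xi> \<bullet> x) + tp xs x"
  "tp (xs @ ys) x = tp xs x + tp ys x"
  by (simp_all add: tp_def)

lemma tderiv_simps [simp]:
  "tderiv i [] = []"
  "tderiv i ((\<xi>, a, b) # xs) = (\<xi>, \<xi> $ i * b, - (\<xi> $ i) * a) # tderiv i xs"
  "tderiv i (xs @ ys) = tderiv i xs @ tderiv i ys"
  by (simp_all add: tderiv_def)

lemma scale_freq_simps [simp]:
  "scale_freq m [] = []"
  "scale_freq m ((\<xi>, a, b) # xs) = (\<xi>, m \<xi> * a, m \<xi> * b) # scale_freq m xs"
  "scale_freq m (xs @ ys) = scale_freq m xs @ scale_freq m ys"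
  by (simp_all add: scale_freq_def)

lemma trig_induct [case_names Nil Cons]:
  assumes "P []" "\<And>\<xi> a b xs. P xs \<Longrightarrow> P ((\<xi>, a, b) # xs)"
  shows "P xs"
  by (induction xs) (use assms in auto)

lemma tderiv_scale_freq: "tderiv i (scale_freq m xs) = scale_freq m (tderiv i xs)"
  by (induction xs rule: trig_induct) auto

lemma scale_freq_commute: "scale_freq m (scale_freq m' xs) = scale_freq m' (scale_freq m xs)"
  by (induction xs rule: trig_induct) auto

lemma lattice_trig_Nil_Cons [simp]:
  "lattice_trig l []"
  "lattice_trig l ((\<xi>, a, b) # xs) \<longleftrightarrow> (\<forall>i. \<exists>k::int. \<xi> $ i = of_int k * pi / l) \<and> lattice_trig l xs"
  by (auto simp: lattice_trig_def)

lemma lattice_trig_simps [simp]: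
  "lattice_trig l (scale_freq m xs) = lattice_trig l xs"
  "lattice_trig l (tderiv i xs) = lattice_trig l xs"
  "lattice_trig l (xs @ ys) \<longleftrightarrow> lattice_trig l xs \<and> lattice_trig l ys"
  by (induction xs rule: trig_induct) auto

lemma tp_scale_const: "tp (scale_freq (\<lambda>_. c) xs) x = c * tp xs x"
  by (induction xs rule: trig_induct) (auto simp: algebra_simps)

lemma tp_has_derivative:
  "((\<lambda>s. tp xs (x + s *\<^sub>R axis i 1)) has_real_derivative tp (tderiv i xs) (x + s *\<^sub>R axis i 1)) (at s)"
proof (induction xs rule: trig_induct)
  case (Cons \<xi> a b xs)
  have "((\<lambda>s. \<xi> \<bullet> (x + s *\<^sub>R axis i 1)) has_real_derivative \<xi> $ i) (at s)"
    by (simp add: inner_add_right inner_axis) (auto intro!: derivative_eq_intros)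
  then show ?case
    by (auto intro!: derivative_eq_intros Cons simp: algebra_simps inner_add_right inner_axis)
qed simp

lemma tp_heat_has_derivative:
  "((\<lambda>t. tp (heat t xs) x) has_real_derivative (\<Sum>i\<in>UNIV. tp (tderiv i (tderiv i (heat t xs))) x)) (at t)"
proof (induction xs rule: trig_induct)
  case (Cons \<xi> a b xs)
  have "(\<Sum>i\<in>UNIV. tp (tderiv i (tderiv i (heat t ((\<xi>, a, b) # xs)))) x)
     = - (\<xi> \<bullet> \<xi>) * exp (- t * (\<xi> \<bullet> \<xi>)) * (a * cos (\<xi> \<bullet> x) + b * sin (\<xi> \<bullet> x))
        + (\<Sum>i\<in>UNIV. tp (tderiv i (tderiv i (heat t xs))) x)"
  proof -
    define K where "K = exp (- t * (\<xi> \<bullet> \<xi>)) * (a * cos (\<xi> \<bullet> x) + b * sin (\<xi> \<bullet> x))"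
    have "tp (tderiv i (tderiv i (heat t ((\<xi>, a, b) # xs)))) x
        = - (\<xi> $ i * \<xi> $ i) * K + tp (tderiv i (tderiv i (heat t xs))) x" for i
      by (simp add: K_def algebra_simps)
    moreover have "(\<Sum>i\<in>UNIV. - (\<xi> $ i * \<xi> $ i) * K) = - (\<xi> \<bullet> \<xi>) * K"
      by (simp add: inner_vec_def sum_distrib_right sum_negf)
    ultimately have "(\<Sum>i\<in>UNIV. tp (tderiv i (tderiv i (heat t ((\<xi>, a, b) # xs)))) x)
        = - (\<xi> \<bullet> \<xi>) * K + (\<Sum>i\<in>UNIV. tp (tderiv i (tderiv i (heat t xs))) x)"
      by (simp only: sum.distrib)
    then show ?thesis by (simp only: K_def mult.assoc)
  qed
  moreover have "((\<lambda>t. tp (heat t ((\<xi>, a, b) # xs)) x) has_real_derivative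
     - (\<xi> \<bullet> \<xi>) * exp (- t * (\<xi> \<bullet> \<xi>)) * (a * cos (\<xi> \<bullet> x) + b * sin (\<xi> \<bullet> x))
        + (\<Sum>i\<in>UNIV. tp (tderiv i (tderiv i (heat t xs))) x)) (at t)"
    by (auto intro!: derivative_eq_intros Cons[simplified] simp: algebra_simps)
  ultimately show ?case by simp
qed simp

lemma tp_laplace_inv_laplace:
  "(\<Sum>i\<in>UNIV. tp (tderiv i (tderiv i (inv_laplace xs))) x) = tp (filter (\<lambda>(\<xi>, a, b). \<xi> \<noteq> 0) xs) x"
proof (induction xs rule: trig_induct)
  case (Cons \<xi> a b xs)
  have "(\<Sum>i\<in>UNIV. \<xi> $ i * (\<xi> $ i)) = \<xi> \<bullet> \<xi>" by (simp add: inner_vec_def)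
  moreover have "(\<Sum>i\<in>UNIV. tp (tderiv i (tderiv i (inv_laplace ((\<xi>, a, b) # xs)))) x)
     = (\<Sum>i\<in>UNIV. \<xi> $ i * (\<xi> $ i)) * ((a * cos (\<xi> \<bullet> x) + b * sin (\<xi> \<bullet> x)) / (\<xi> \<bullet> \<xi>))
        + (\<Sum>i\<in>UNIV. tp (tderiv i (tderiv i (inv_laplace xs))) x)"
  proof -
    define K where "K = (a * cos (\<xi> \<bullet> x) + b * sin (\<xi> \<bullet> x)) / (\<xi> \<bullet> \<xi>)"
    have "tp (tderiv i (tderiv i (inv_laplace ((\<xi>, a, b) # xs)))) x
        = (\<xi> $ i * \<xi> $ i) * K + tp (tderiv i (tderiv i (inv_laplace xs))) x" for i
      by (simp add: K_def add_divide_distrib algebra_simps)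
    then have "(\<Sum>i\<in>UNIV. tp (tderiv i (tderiv i (inv_laplace ((\<xi>, a, b) # xs)))) x)
        = (\<Sum>i\<in>UNIV. \<xi> $ i * \<xi> $ i) * K + (\<Sum>i\<in>UNIV. tp (tderiv i (tderiv i (inv_laplace xs))) x)"
      by (simp only: sum.distrib sum_distrib_right)
    then show ?thesis by (simp only: K_def)
  qed
  ultimately show ?case using Cons by auto
qed simp

text \<open>The zero frequency that \<open>inv_laplace\<close> loses is also annihilated by the
  derivatives on the right, so no term is missing.\<close>

lemma tp_laplace_riesz:
  "(\<Sum>k\<in>UNIV. tp (tderiv k (tderiv k (tderiv i (tderiv j (inv_laplace xs))))) x) = tp (tderiv i (tderiv j xs)) x"
proof -
  have "(\<Sum>k\<in>UNIV. tp (tderiv k (tderiv k (tderiv i (tderiv j (inv_laplace xs))))) x)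
      = (\<Sum>k\<in>UNIV. tp (tderiv k (tderiv k (inv_laplace (tderiv i (tderiv j xs))))) x)"
    by (simp add: tderiv_scale_freq)
  also have "\<dots> = tp (tderiv i (tderiv j xs)) x"
    unfolding tp_laplace_inv_laplace by (induction xs rule: trig_induct) auto
  finally show ?thesis .
qed

lemma continuous_on_tp [continuous_intros]:
  fixes S :: "'a::t2_space set"
  shows "continuous_on S f \<Longrightarrow> continuous_on S (\<lambda>z. tp xs (f z))"
  by (induction xs rule: trig_induct) (auto intro!: continuous_intros)

lemma continuous_on_tp_heat [continuous_intros]:
  fixes S :: "'a::t2_space set"
  shows "continuous_on S f \<Longrightarrow> continuous_on S g \<Longrightarrow> continuous_on S (\<lambda>z. tp (heat (g z) xs) (f z))"
  by (induction xs rule: trig_induct) (auto intro!: continuous_intros)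

lemma tp_shift:
  assumes "lattice_trig l xs" "l > 0"
  shows "tp xs (x + (2 * l) *\<^sub>R axis i 1) = tp xs x"
  using assms(1)
proof (induction xs rule: trig_induct)
  case (Cons \<xi> a b xs)
  from Cons.prems obtain k :: int where k: "\<xi> $ i = of_int k * pi / l" by (meson lattice_trig_Nil_Cons(2))
  have "\<xi> \<bullet> (x + (2 * l) *\<^sub>R axis i 1) = \<xi> \<bullet> x + 2 * pi * of_int k"
    using k \<open>l > 0\<close> by (simp add: inner_add_right inner_axis)
  moreover have "lattice_trig l xs" using Cons.prems by (auto simp: lattice_trig_def)
  ultimately show ?case using Cons.IH by (simp add: cos_add sin_add cos_int_2pin sin_int_2pin)
qed simp

lemma tp_periodic: "lattice_trig l xs \<Longrightarrow> l > 0 \<Longrightarrow> periodic l (tp xs)"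
  by (simp add: periodic_def tp_shift)

lemma diff2_deriv:
  assumes "diff2 G P Q" "(X has_real_derivative X') (at s)" "(Y has_real_derivative Y') (at s)"
  shows "((\<lambda>r. G (X r) (Y r)) has_real_derivative (P (X s) (Y s) * X' + Q (X s) (Y s) * Y')) (at s)"
  using assms unfolding diff2_def by blast

lemma diff2_continuous:
  assumes "diff2 G P Q" "continuous_on S f" "continuous_on S g"
  shows "continuous_on S (\<lambda>z. P (f z) (g z))" "continuous_on S (\<lambda>z. Q (f z) (g z))"
proof -
  have "continuous_on UNIV (\<lambda>z. P (fst z) (snd z))" "continuous_on UNIV (\<lambda>z. Q (fst z) (snd z))"
    using assms(1) unfolding diff2_def by auto
  from continuous_on_compose2[OF this(1), of S "\<lambda>z. (f z, g z)"] continuous_on_compose2[OF this(2), of S "\<lambda>z. (f z, g z)"]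
  show "continuous_on S (\<lambda>z. P (f z) (g z))" "continuous_on S (\<lambda>z. Q (f z) (g z))"
    using assms(2,3) by (auto simp: continuous_on_Pair)
qed

text \<open>This is the time derivative of the functional \<open>\<integral> G(u, v) - \<theta> R u v\<close> along the heat flow, where
  \<open>R\<close> is the Riesz transform \<open>\<partial>\<^sub>i \<partial>\<^sub>j \<Delta>\<inverse>\<close>.  Integration by parts turns it into
  \<open>2 \<theta> \<integral> \<partial>\<^sub>j u \<partial>\<^sub>i v\<close> minus the Hessian form of \<open>G\<close> at the gradients of \<open>u\<close> and \<open>v\<close>.\<close>

lemma energy_dissipation:
  fixes xs ys :: "'n::finite trig"
  assumes G: "bellman_function G Gx Gy Gxx Gxy Gyy" and l: "l > 0"
    and xs: "lattice_trig l xs" and ys: "lattice_trig l ys" and \<theta>: "\<bar>\<theta>\<bar> \<le> 1"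
    and zs: "zs = tderiv i (tderiv j (inv_laplace xs))"
  shows "(LINT x:cell l|lborel.
       Gx (tp xs x) (tp ys x) * (\<Sum>k\<in>UNIV. tp (tderiv k (tderiv k xs)) x)
     + Gy (tp xs x) (tp ys x) * (\<Sum>k\<in>UNIV. tp (tderiv k (tderiv k ys)) x)
     - \<theta> * ((\<Sum>k\<in>UNIV. tp (tderiv k (tderiv k zs)) x) * tp ys x
            + tp zs x * (\<Sum>k\<in>UNIV. tp (tderiv k (tderiv k ys)) x))) \<le> 0"
proof -
  have G': "diff2 G Gx Gy" "diff2 Gx Gxx Gxy" "diff2 Gy Gxy Gyy"
    using G by (auto simp: bellman_function_def)
  define u where "u = tp xs"
  define v where "v = tp ys"
  define z where "z = tp zs"
  define u1 where "u1 k = tp (tderiv k xs)" for k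
  define v1 where "v1 k = tp (tderiv k ys)" for k
  define z1 where "z1 k = tp (tderiv k zs)" for k
  define u2 where "u2 k = tp (tderiv k (tderiv k xs))" for k
  define v2 where "v2 k = tp (tderiv k (tderiv k ys))" for k
  define z2 where "z2 k = tp (tderiv k (tderiv k zs))" for k
  \<comment> \<open>\<open>A k\<close> and \<open>B\<close> are periodic fluxes with derivatives
    \<open>A' k\<close> along axis k and \<open>B'\<close> along axis i, which integrate to 0 over
    the cell. The Laplacian of \<open>z\<close> being the mixed second derivative of
    \<open>u\<close>, subtracting them removes all second derivatives from the integrand. What
    remains is \<open>R\<close>, which is quadratic in the gradients.\<close>
  define A where "A k x = Gx (u x) (v x) * u1 k x + Gy (u x) (v x) * v1 k x - \<theta> * (z x * v1 k x - z1 k x * v x)" for k x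
  define H where "H k x = Gxx (u x) (v x) * (u1 k x)\<^sup>2 + 2 * Gxy (u x) (v x) * u1 k x * v1 k x + Gyy (u x) (v x) * (v1 k x)\<^sup>2" for k x
  define A' where "A' k x = H k x + Gx (u x) (v x) * u2 k x + Gy (u x) (v x) * v2 k x - \<theta> * (z x * v2 k x - z2 k x * v x)" for k x
  define B where "B x = u1 j x * v x" for x
  define B' where "B' x = tp (tderiv i (tderiv j xs)) x * v x + u1 j x * v1 i x" for x
  define R where "R x = 2 * \<theta> * u1 j x * v1 i x - (\<Sum>k\<in>UNIV. H k x)" for x
  note defs = u_def v_def z_def u1_def v1_def z1_def u2_def v2_def z2_def
  have wz: "lattice_trig l zs" using xs by (simp add: zs)
  have cont: "continuous_on UNIV (A k)" "continuous_on UNIV (A' k)" "continuous_on UNIV (H k)" for k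
    unfolding A_def A'_def H_def defs
    by (intro continuous_intros diff2_continuous[OF G'(1)] diff2_continuous[OF G'(2)] diff2_continuous[OF G'(3)])+
  have contB: "continuous_on UNIV B" "continuous_on UNIV B'" "continuous_on UNIV R"
    unfolding B_def B'_def R_def defs using cont by (auto intro!: continuous_intros)
  have perA: "periodic l (A k)" "periodic l (A' k)" "periodic l B" "periodic l B'" for k
    unfolding periodic_def A_def A'_def H_def B_def B'_def defs
    using l xs ys wz by (auto simp: tp_shift)
  have dA: "((\<lambda>s. A k (x + s *\<^sub>R axis k 1)) has_real_derivative A' k (x + s *\<^sub>R axis k 1)) (at s)" for k s x
    unfolding A_def defs
    by (rule DERIV_cong, (rule DERIV_add DERIV_diff DERIV_cmult DERIV_mult diff2_deriv[OF G'(2)] diff2_deriv[OF G'(3)] tp_has_derivative)+)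
       (simp add: A'_def H_def defs algebra_simps power2_eq_square)
  have dB: "((\<lambda>s. B (x + s *\<^sub>R axis i 1)) has_real_derivative B' (x + s *\<^sub>R axis i 1)) (at s)" for s x
    unfolding B_def defs
    by (rule DERIV_cong, (rule DERIV_mult tp_has_derivative)+) (simp add: B'_def defs algebra_simps)
  have R: "R x \<le> 0" for x
  proof -
    obtain \<tau> where \<tau>: "\<tau> > 0" "\<And>\<alpha> \<beta>. \<tau> * \<alpha>\<^sup>2 + \<beta>\<^sup>2 / \<tau> \<le>
        Gxx (u x) (v x) * \<alpha>\<^sup>2 + 2 * Gxy (u x) (v x) * \<alpha> * \<beta> + Gyy (u x) (v x) * \<beta>\<^sup>2"
      using G unfolding bellman_function_def by meson
    have "2 * \<theta> * u1 j x * v1 i x \<le> 2 * \<bar>u1 j x\<bar> * \<bar>v1 i x\<bar>"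
    proof -
      have "\<theta> * (u1 j x * v1 i x) \<le> \<bar>\<theta>\<bar> * \<bar>u1 j x * v1 i x\<bar>" by (metis abs_ge_self abs_mult)
      also have "\<dots> \<le> 1 * \<bar>u1 j x * v1 i x\<bar>" using \<theta> by (intro mult_right_mono) auto
      finally show ?thesis by (simp add: abs_mult)
    qed
    also have "2 * \<bar>u1 j x\<bar> * \<bar>v1 i x\<bar> \<le> \<tau> * (u1 j x)\<^sup>2 + (v1 i x)\<^sup>2 / \<tau>"
    proof -
      have "0 \<le> (\<tau> * \<bar>u1 j x\<bar> - \<bar>v1 i x\<bar>)\<^sup>2 / \<tau>" using \<tau> by simp
      also have "\<dots> = \<tau> * (u1 j x)\<^sup>2 + (v1 i x)\<^sup>2 / \<tau> - 2 * \<bar>u1 j x\<bar> * \<bar>v1 i x\<bar>"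
        using \<tau>(1) by (simp add: power2_diff field_simps power_mult_distrib) (simp add: power2_eq_square)
      finally show ?thesis by simp
    qed
    also have "\<tau> * (u1 j x)\<^sup>2 + (v1 i x)\<^sup>2 / \<tau> \<le> (\<Sum>k\<in>UNIV. \<tau> * (u1 k x)\<^sup>2) + (\<Sum>k\<in>UNIV. (v1 k x)\<^sup>2 / \<tau>)"
      using \<tau>(1) by (intro add_mono member_le_sum) auto
    also have "\<dots> = (\<Sum>k\<in>UNIV. \<tau> * (u1 k x)\<^sup>2 + (v1 k x)\<^sup>2 / \<tau>)" by (simp add: sum.distrib)
    also have "\<dots> \<le> (\<Sum>k\<in>UNIV. H k x)"
      unfolding H_def using \<tau>(2) by (intro sum_mono) auto
    finally show ?thesis by (simp add: R_def)
  qed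
  have eq: "Gx (u x) (v x) * (\<Sum>k\<in>UNIV. u2 k x) + Gy (u x) (v x) * (\<Sum>k\<in>UNIV. v2 k x)
     - \<theta> * ((\<Sum>k\<in>UNIV. z2 k x) * v x + z x * (\<Sum>k\<in>UNIV. v2 k x))
     = (\<Sum>k\<in>UNIV. A' k x) - 2 * \<theta> * B' x + R x" for x
  proof -
    have "(\<Sum>k\<in>UNIV. z2 k x) = tp (tderiv i (tderiv j xs)) x"
      unfolding z2_def zs by (rule tp_laplace_riesz)
    then have "B' x = (\<Sum>k\<in>UNIV. z2 k x) * v x + u1 j x * v1 i x" by (simp add: B'_def)
    moreover have "(\<Sum>k\<in>UNIV. A' k x) = (\<Sum>k\<in>UNIV. H k x) + Gx (u x) (v x) * (\<Sum>k\<in>UNIV. u2 k x)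
        + Gy (u x) (v x) * (\<Sum>k\<in>UNIV. v2 k x) - \<theta> * (z x * (\<Sum>k\<in>UNIV. v2 k x) - (\<Sum>k\<in>UNIV. z2 k x) * v x)"
      unfolding A'_def by (simp only: sum.distrib sum_subtractf sum_distrib_left sum_distrib_right right_diff_distrib)
    ultimately show ?thesis unfolding R_def by (simp add: algebra_simps)
  qed
  have "(LINT x:cell l|lborel. (\<Sum>k\<in>UNIV. A' k x) - 2 * \<theta> * B' x + R x)
      = (\<Sum>k\<in>UNIV. (LINT x:cell l|lborel. A' k x)) - 2 * \<theta> * (LINT x:cell l|lborel. B' x) + (LINT x:cell l|lborel. R x)"
  proof -
    define fA where "fA k x = indicator (cell l) x * A' k x" for k x
    define fB where "fB x = indicator (cell l) x * B' x" for x
    define fR where "fR x = indicator (cell l) x * R x" for x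
    have int: "integrable lborel (fA k)" "integrable lborel fB" "integrable lborel fR" for k
      using cell_integrable[OF cont(2)] cell_integrable[OF contB(2)] cell_integrable[OF contB(3)]
      by (simp_all add: set_integrable_def fA_def[abs_def] fB_def[abs_def] fR_def[abs_def])
    have "(LINT x:cell l|lborel. (\<Sum>k\<in>UNIV. A' k x) - 2 * \<theta> * B' x + R x)
        = (LINT x|lborel. (\<Sum>k\<in>UNIV. fA k x) - 2 * \<theta> * fB x + fR x)"
      unfolding set_lebesgue_integral_def
      by (intro Bochner_Integration.integral_cong) (auto simp: fA_def fB_def fR_def algebra_simps indicator_def)
    also have "\<dots> = (\<Sum>k\<in>UNIV. integral\<^sup>L lborel (fA k)) - 2 * \<theta> * integral\<^sup>L lborel fB + integral\<^sup>L lborel fR"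
      using int by simp
    finally show ?thesis by (simp add: set_lebesgue_integral_def fA_def[abs_def] fB_def[abs_def] fR_def[abs_def])
  qed
  also have "\<dots> = (LINT x:cell l|lborel. R x)"
    using set_integral_cell_deriv_eq_0[OF l perA(1,2) dA cont(1,2)] set_integral_cell_deriv_eq_0[OF l perA(3,4) dB contB(1,2)]
    by simp
  also have "\<dots> \<le> 0"
  proof -
    have "0 \<le> (LINT x|lborel. - (indicator (cell l) x *\<^sub>R R x))"
      using R by (intro integral_nonneg_AE) (auto simp: indicator_def)
    then show ?thesis by (simp add: set_lebesgue_integral_def)
  qed
  finally show ?thesis unfolding eq[symmetric] defs .
qed

section \<open>Second-order Riesz transforms of trigonometric polynomials\<close>

definition amplitude :: "'n::finite trig \<Rightarrow> real" where
  "amplitude xs = (\<Sum>(\<xi>, a, b)\<leftarrow>xs. \<bar>a\<bar> + \<bar>b\<bar>)"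

lemma amplitude_simps [simp]:
  "amplitude [] = 0" "amplitude ((\<xi>, a, b) # xs) = \<bar>a\<bar> + \<bar>b\<bar> + amplitude xs"
  by (simp_all add: amplitude_def)

lemma amplitude_nonneg: "0 \<le> amplitude xs"
  by (induction xs rule: trig_induct) auto

lemma abs_tp_le: "\<bar>tp xs x\<bar> \<le> amplitude xs"
proof (induction xs rule: trig_induct)
  case (Cons \<xi> a b xs)
  have "\<bar>a * cos (\<xi> \<bullet> x)\<bar> \<le> \<bar>a\<bar> * 1" "\<bar>b * sin (\<xi> \<bullet> x)\<bar> \<le> \<bar>b\<bar> * 1"
    unfolding abs_mult by (intro mult_left_mono; simp)+
  with Cons show ?case by simp
qed simp

lemma amplitude_heat_le: "0 \<le> t \<Longrightarrow> amplitude (heat t xs) \<le> amplitude xs"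
proof (induction xs rule: trig_induct)
  case (Cons \<xi> a b xs)
  have "exp (- t * (\<xi> \<bullet> \<xi>)) * \<bar>c\<bar> \<le> 1 * \<bar>c\<bar>" for c
    using Cons.prems by (intro mult_right_mono) auto
  from this[of a] this[of b] Cons show ?case by (simp add: abs_mult)
qed simp

text \<open>Non-zero frequencies decay exponentially, and the zero frequency has coefficient 0 after
  two derivatives.\<close>

lemma amplitude_heat_riesz_tendsto_0:
  "((\<lambda>t. amplitude (heat t (tderiv i (tderiv j (inv_laplace xs))))) \<longlongrightarrow> 0) at_top"
proof (induction xs rule: trig_induct)
  case (Cons \<xi> a b xs)
  have "((\<lambda>t. \<bar>exp (- t * (\<xi> \<bullet> \<xi>)) * (\<xi> $ i * (\<xi> $ j * (c / (\<xi> \<bullet> \<xi>))))\<bar>) \<longlongrightarrow> 0) at_top" for c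
  proof (cases "\<xi> = 0")
    case False
    then have "\<xi> \<bullet> \<xi> > 0" by simp
    then have "((\<lambda>t. exp (- t * (\<xi> \<bullet> \<xi>))) \<longlongrightarrow> 0) at_top" by real_asymp
    from tendsto_rabs_zero[OF tendsto_mult_left_zero[OF this]] show ?thesis .
  qed simp
  from tendsto_add[OF tendsto_add[OF this[of a] this[of b]] Cons]
  show ?case by (simp add: abs_minus_commute)
qed simp

text \<open>By \<open>energy_dissipation\<close> the difference of the Bellman integral and the
  pairing is nonincreasing along the heat flow. For large times the pairing tends to 0 while the
  Bellman integral stays nonnegative, so the difference is nonnegative at time 0 as well.\<close>

lemma riesz_pairing_le_bellman:
  fixes xs ys :: "'n::finite trig"
  assumes G: "bellman_function G Gx Gy Gxx Gxy Gyy" and l: "l > 0"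
    and xs: "lattice_trig l xs" and ys: "lattice_trig l ys" and \<theta>: "\<bar>\<theta>\<bar> \<le> 1"
    and zs: "zs = tderiv i (tderiv j (inv_laplace xs))"
  shows "\<theta> * (LINT x:cell l|lborel. tp zs x * tp ys x) \<le> (LINT x:cell l|lborel. G (tp xs x) (tp ys x))"
proof -
  have G': "diff2 G Gx Gy" and G0: "\<And>x y. 0 \<le> G x y"
    and Gc: "continuous_on UNIV (\<lambda>z. G (fst z) (snd z))"
    using G by (auto simp: bellman_function_def)
  define z where "z t = (LINT x:cell l|lborel. tp (heat t zs) x * tp (heat t ys) x)" for t
  define E where "E t = (LINT x:cell l|lborel. G (tp (heat t xs) x) (tp (heat t ys) x))" for t
  define \<Psi> where "\<Psi> t x = G (tp (heat t xs) x) (tp (heat t ys) x) - \<theta> * (tp (heat t zs) x * tp (heat t ys) x)" for t x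
  define \<Theta> where "\<Theta> t x = Gx (tp (heat t xs) x) (tp (heat t ys) x) * (\<Sum>k\<in>UNIV. tp (tderiv k (tderiv k (heat t xs))) x)
     + Gy (tp (heat t xs) x) (tp (heat t ys) x) * (\<Sum>k\<in>UNIV. tp (tderiv k (tderiv k (heat t ys))) x)
     - \<theta> * ((\<Sum>k\<in>UNIV. tp (tderiv k (tderiv k (heat t zs))) x) * tp (heat t ys) x
            + tp (heat t zs) x * (\<Sum>k\<in>UNIV. tp (tderiv k (tderiv k (heat t ys))) x))" for t x
  have contG: "continuous_on UNIV (\<lambda>x. G (tp xs x) (tp ys x))" for xs ys :: "'n trig"
    using continuous_on_compose2[OF Gc, of UNIV "\<lambda>x. (tp xs x, tp ys x)"]
    by (simp add: continuous_on_Pair continuous_on_tp)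
  have contz: "continuous_on UNIV (\<lambda>x. tp xs x * tp ys x)" for xs ys :: "'n trig"
    by (intro continuous_intros)
  have cont\<Psi>: "continuous_on UNIV (\<Psi> t)" for t
    unfolding \<Psi>_def by (intro continuous_intros contG)
  have d: "((\<lambda>s. \<Psi> s x) has_real_derivative \<Theta> t x) (at t)" for t x
    unfolding \<Psi>_def
    by (rule DERIV_cong, (rule DERIV_diff DERIV_cmult DERIV_mult diff2_deriv[OF G'] tp_heat_has_derivative)+)
       (simp add: \<Theta>_def algebra_simps)
  have c: "continuous_on UNIV (\<lambda>w. \<Theta> (fst w) (snd w))"
    unfolding \<Theta>_def tderiv_scale_freq
    by (intro continuous_intros diff2_continuous[OF G'])
  \<comment> \<open>Multipliers commute, so \<open>zs\<close> remains the Riesz transform of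
    \<open>xs\<close> at every time, as \<open>energy_dissipation\<close> requires.\<close>
  have zs': "heat t zs = tderiv i (tderiv j (inv_laplace (heat t xs)))" for t
    unfolding zs tderiv_scale_freq[symmetric] scale_freq_commute[of "\<lambda>\<xi>. exp (- t * (\<xi> \<bullet> \<xi>))"] ..
  have dec: "E T - \<theta> * z T \<le> E 0 - \<theta> * z 0" if "T \<ge> 0" for T
  proof -
    have "(LINT x:cell l|lborel. (\<Psi> T x - \<Psi> 0 x)) = (LINT s:{0..T}|lborel. (LINT x:cell l|lborel. \<Theta> s x))"
      by (rule fubini_ftc[OF cell_borel bounded_cell that d c])
    also have "\<dots> \<le> 0"
    proof -
      have "(LINT x:cell l|lborel. \<Theta> s x) \<le> 0" for s
        unfolding \<Theta>_def by (rule energy_dissipation[OF G l _ _ \<theta> zs']) (simp_all add: xs ys)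
      then have "0 \<le> (LINT s|lborel. - (indicator {0..T} s *\<^sub>R (LINT x:cell l|lborel. \<Theta> s x)))"
        by (intro integral_nonneg_AE) (auto simp: indicator_def)
      then show ?thesis unfolding set_lebesgue_integral_def[where A="{0..T}"] by simp
    qed
    finally have "(LINT x:cell l|lborel. \<Psi> T x) \<le> (LINT x:cell l|lborel. \<Psi> 0 x)"
      using cell_integrable[OF cont\<Psi>] by (subst (asm) set_integral_diff(2)) auto
    moreover have "(LINT x:cell l|lborel. \<Psi> t x) = E t - \<theta> * z t" for t
    proof -
      have "(LINT x:cell l|lborel. \<Psi> t x) = E t - (LINT x:cell l|lborel. \<theta> * (tp (heat t zs) x * tp (heat t ys) x))"
        unfolding \<Psi>_def E_def
        by (rule set_integral_diff(2)) (intro cell_integrable contG continuous_intros)+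
      then show ?thesis by (simp add: z_def)
    qed
    ultimately show ?thesis by simp
  qed
  have E0: "0 \<le> E T" for T
    unfolding E_def set_lebesgue_integral_def using G0 by (intro integral_nonneg_AE) (auto simp: indicator_def)
  define m where "m = measure lborel (cell l :: (real^'n) set)"
  have zb: "\<bar>z T\<bar> \<le> m * (amplitude (heat T zs) * amplitude ys)" if "T \<ge> 0" for T
  proof -
    have fin: "emeasure lborel (cell l :: (real^'n) set) < \<infinity>"
      by (rule emeasure_bounded_finite[OF bounded_cell])
    have "\<bar>z T\<bar> \<le> (LINT x:cell l|lborel. \<bar>tp (heat T zs) x * tp (heat T ys) x\<bar>)"
      unfolding z_def using set_integral_norm_bound[OF cell_integrable[OF contz]] by simp
    also have "\<dots> \<le> (LINT x:(cell l :: (real^'n) set)|lborel. amplitude (heat T zs) * amplitude ys)"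
    proof (rule set_integral_mono)
      show "\<bar>tp (heat T zs) x * tp (heat T ys) x\<bar> \<le> amplitude (heat T zs) * amplitude ys" for x
        unfolding abs_mult
        using abs_tp_le[of "heat T zs" x] abs_tp_le[of "heat T ys" x] amplitude_heat_le[OF that, of ys]
        by (intro mult_mono) (auto simp: amplitude_nonneg)
    qed (auto intro!: cell_integrable continuous_intros)
    also have "\<dots> = m * (amplitude (heat T zs) * amplitude ys)"
      using fin by (simp add: m_def set_lebesgue_integral_def)
    finally show ?thesis .
  qed
  have "((\<lambda>T. E 0 - \<theta> * z 0 + m * (amplitude (heat T zs) * amplitude ys)) \<longlongrightarrow> E 0 - \<theta> * z 0 + m * (0 * amplitude ys)) at_top"
    unfolding zs by (intro tendsto_intros amplitude_heat_riesz_tendsto_0)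
  moreover have "eventually (\<lambda>T. 0 \<le> E 0 - \<theta> * z 0 + m * (amplitude (heat T zs) * amplitude ys)) at_top"
    using eventually_ge_at_top[of 0]
  proof eventually_elim
    case (elim T)
    have "\<theta> * z T \<le> \<bar>\<theta>\<bar> * \<bar>z T\<bar>" by (metis abs_ge_self abs_mult)
    also have "\<dots> \<le> 1 * \<bar>z T\<bar>" using \<theta> by (intro mult_right_mono) auto
    finally show ?case using dec[OF elim] E0[of T] zb[OF elim] by linarith
  qed
  ultimately have "0 \<le> E 0 - \<theta> * z 0"
    using tendsto_lowerbound by fastforce
  moreover have "heat 0 ws = ws" for ws :: "'n trig" by (induction ws rule: trig_induct) auto
  ultimately show ?thesis by (simp add: E_def z_def)
qed

lemma powr_add_le:
  fixes a b p :: real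
  assumes "0 \<le> a" "0 \<le> b" "0 \<le> p"
  shows "(a + b) powr p \<le> 2 powr p * (a powr p + b powr p)"
proof -
  have "(a + b) powr p \<le> (2 * max a b) powr p" using assms by (intro powr_mono2) auto
  also have "\<dots> = 2 powr p * max a b powr p" using assms by (simp add: powr_mult)
  also have "\<dots> \<le> 2 powr p * (a powr p + b powr p)" by (intro mult_left_mono) (auto simp: max_def)
  finally show ?thesis .
qed

lemma smoothed_power_le:
  fixes x \<epsilon> p :: real
  assumes "\<epsilon> > 0" "0 \<le> p"
  shows "(x\<^sup>2 + \<epsilon>\<^sup>2) powr (p/2) \<le> 2 powr p * (\<bar>x\<bar> powr p + \<epsilon> powr p)"
proof -
  have "x\<^sup>2 + \<epsilon>\<^sup>2 \<le> (\<bar>x\<bar> + \<epsilon>)\<^sup>2" using assms by (simp add: power2_sum)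
  then have "(x\<^sup>2 + \<epsilon>\<^sup>2) powr (p/2) \<le> ((\<bar>x\<bar> + \<epsilon>)\<^sup>2) powr (p/2)" using assms by (intro powr_mono2) auto
  also have "\<dots> = (\<bar>x\<bar> + \<epsilon>) powr p"
    using assms powr_powr[of "\<bar>x\<bar> + \<epsilon>" 2 "p/2"] by (simp add: powr_numeral add_nonneg_pos)
  also have "\<dots> \<le> 2 powr p * (\<bar>x\<bar> powr p + \<epsilon> powr p)" using assms by (intro powr_add_le) auto
  finally show ?thesis .
qed

lemma bellman_exists_conjugate:
  fixes p q :: real
  assumes p: "1 < p" and pq: "1/p + 1/q = 1"
  shows "\<exists>C>0. \<forall>\<epsilon>>0. \<exists>G Gx Gy Gxx Gxy Gyy. bellman_function G Gx Gy Gxx Gxy Gyy \<and>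
     (\<forall>x y. G x y \<le> C * ((x\<^sup>2 + \<epsilon>\<^sup>2) powr (p/2) + (y\<^sup>2 + \<epsilon>\<^sup>2) powr (q/2)))"
proof (cases "2 \<le> p")
  case True
  then show ?thesis using bellman_exists[OF _ pq] by blast
next
  case False
  have "1/p > 1/2" using False p by (simp add: field_simps)
  then have "1/q < 1/2" using pq by simp
  moreover have "1/q > 0"
  proof -
    have "1/p < 1" using p by simp
    then show ?thesis using pq by linarith
  qed
  ultimately have q: "2 \<le> q" by (simp add: field_simps zero_less_divide_iff)
  have "1/q + 1/p = 1" using pq by simp
  from bellman_exists[OF q this] obtain C where C: "C > 0"
    "\<And>\<epsilon>. \<epsilon> > 0 \<Longrightarrow> \<exists>G Gx Gy Gxx Gxy Gyy. bellman_function G Gx Gy Gxx Gxy Gyy \<and>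
     (\<forall>x y. G x y \<le> C * ((x\<^sup>2 + \<epsilon>\<^sup>2) powr (q/2) + (y\<^sup>2 + \<epsilon>\<^sup>2) powr (p/2)))" by blast
  show ?thesis
  proof (intro exI[of _ C] conjI allI impI)
    fix \<epsilon> :: real assume "\<epsilon> > 0"
    from C(2)[OF this] obtain G Gx Gy Gxx Gxy Gyy where G: "bellman_function G Gx Gy Gxx Gxy Gyy"
      and le: "\<And>x y. G x y \<le> C * ((x\<^sup>2 + \<epsilon>\<^sup>2) powr (q/2) + (y\<^sup>2 + \<epsilon>\<^sup>2) powr (p/2))" by blast
    show "\<exists>G Gx Gy Gxx Gxy Gyy. bellman_function G Gx Gy Gxx Gxy Gyy \<and>
     (\<forall>x y. G x y \<le> C * ((x\<^sup>2 + \<epsilon>\<^sup>2) powr (p/2) + (y\<^sup>2 + \<epsilon>\<^sup>2) powr (q/2)))"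
      apply (intro exI conjI)
       apply (rule bellman_function_swap[OF G])
      using le add.commute by metis
  qed (rule C(1))
qed

lemma cell_integral_const:
  fixes c :: real
  shows "(LINT x:(cell l :: (real^'n) set)|lborel. c) = c * measure lborel (cell l :: (real^'n) set)"
proof -
  have "emeasure lborel (cell l :: (real^'n) set) < \<infinity>"
    by (rule emeasure_bounded_finite[OF bounded_cell])
  then show ?thesis by (simp add: set_lebesgue_integral_def)
qed

text \<open>Both sides scale differently in \<open>xs\<close> and \<open>ys\<close>. The estimate is
  left in this additive form, because \<open>riesz_Lp\<close> chooses the scale of \<open>ys\<close>
  itself.\<close>

lemma riesz_pairing_Lp:
  fixes p q :: real
  assumes p: "1 < p" and pq: "1/p + 1/q = 1"
  shows "\<exists>C>0. \<forall>l>0. \<forall>(xs :: 'n::finite trig) ys i j. lattice_trig l xs \<longrightarrow> lattice_trig l ys \<longrightarrow>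
     (LINT x:cell l|lborel. tp (tderiv i (tderiv j (inv_laplace xs))) x * tp ys x)
       \<le> C * ((LINT x:cell l|lborel. \<bar>tp xs x\<bar> powr p) + (LINT x:cell l|lborel. \<bar>tp ys x\<bar> powr q))"
proof -
  have q: "q > 0"
  proof -
    have "1/p < 1" using p by simp
    then have "1/q > 0" using pq by linarith
    then show ?thesis by (simp add: zero_less_divide_iff)
  qed
  obtain C0 where C0: "C0 > 0"
    "\<And>\<epsilon>. \<epsilon> > 0 \<Longrightarrow> \<exists>G Gx Gy Gxx Gxy Gyy. bellman_function G Gx Gy Gxx Gxy Gyy \<and>
     (\<forall>x y. G x y \<le> C0 * ((x\<^sup>2 + \<epsilon>\<^sup>2) powr (p/2) + (y\<^sup>2 + \<epsilon>\<^sup>2) powr (q/2)))"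
    using bellman_exists_conjugate[OF p pq] by blast
  define K where "K = 2 powr p + 2 powr q"
  have K: "K > 0" by (simp add: K_def add_pos_pos)
  show ?thesis
  proof (intro exI[of _ "C0 * K"] conjI allI impI)
    fix l :: real and xs ys :: "'n trig" and i j
    assume l: "l > 0" and xs: "lattice_trig l xs" and ys: "lattice_trig l ys"
    define I where "I = (LINT x:cell l|lborel. tp (tderiv i (tderiv j (inv_laplace xs))) x * tp ys x)"
    define F where "F = (LINT x:cell l|lborel. \<bar>tp xs x\<bar> powr p)"
    define H where "H = (LINT x:cell l|lborel. \<bar>tp ys x\<bar> powr q)"
    define m where "m = measure lborel (cell l :: (real^'n) set)"
    have cp: "continuous_on UNIV (\<lambda>x. \<bar>tp ws x\<bar> powr r)" if "r > 0" for ws :: "'n trig" and r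
      using that by (intro continuous_on_powr' continuous_intros) auto
    have le: "I \<le> C0 * K * (F + H + (\<epsilon> powr p + \<epsilon> powr q) * m)" if \<epsilon>: "\<epsilon> > 0" for \<epsilon>
    proof -
      from C0(2)[OF \<epsilon>] obtain G Gx Gy Gxx Gxy Gyy where G: "bellman_function G Gx Gy Gxx Gxy Gyy"
        and Gle: "\<And>x y. G x y \<le> C0 * ((x\<^sup>2 + \<epsilon>\<^sup>2) powr (p/2) + (y\<^sup>2 + \<epsilon>\<^sup>2) powr (q/2))" by blast
      have Gc: "continuous_on UNIV (\<lambda>z. G (fst z) (snd z))"
        using G by (auto simp: bellman_function_def)
      have contG: "continuous_on UNIV (\<lambda>x. G (tp xs x) (tp ys x))"
        using continuous_on_compose2[OF Gc, of UNIV "\<lambda>x. (tp xs x, tp ys x)"]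
        by (simp add: continuous_on_Pair continuous_on_tp)
      have pt: "G a b \<le> C0 * K * (\<bar>a\<bar> powr p + \<bar>b\<bar> powr q + (\<epsilon> powr p + \<epsilon> powr q))" for a b
      proof -
        have "(a\<^sup>2 + \<epsilon>\<^sup>2) powr (p/2) \<le> K * (\<bar>a\<bar> powr p + \<epsilon> powr p)"
          by (rule order_trans[OF smoothed_power_le[OF \<epsilon>]]) (use p in \<open>auto simp: K_def intro!: mult_right_mono\<close>)
        moreover have "(b\<^sup>2 + \<epsilon>\<^sup>2) powr (q/2) \<le> K * (\<bar>b\<bar> powr q + \<epsilon> powr q)"
          by (rule order_trans[OF smoothed_power_le[OF \<epsilon>]]) (use q in \<open>auto simp: K_def intro!: mult_right_mono\<close>)
        ultimately have "(a\<^sup>2 + \<epsilon>\<^sup>2) powr (p/2) + (b\<^sup>2 + \<epsilon>\<^sup>2) powr (q/2)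
            \<le> K * (\<bar>a\<bar> powr p + \<bar>b\<bar> powr q + (\<epsilon> powr p + \<epsilon> powr q))" by (simp add: algebra_simps)
        then show ?thesis using Gle[of a b] C0(1) by (smt (verit) mult.assoc mult_left_mono)
      qed
      have "I \<le> (LINT x:cell l|lborel. G (tp xs x) (tp ys x))"
        unfolding I_def using riesz_pairing_le_bellman[OF G l xs ys, of 1, OF _ refl] by simp
      also have "\<dots> \<le> (LINT x:cell l|lborel. C0 * K * (\<bar>tp xs x\<bar> powr p + \<bar>tp ys x\<bar> powr q + (\<epsilon> powr p + \<epsilon> powr q)))"
        using p q pt by (intro set_integral_mono cell_integrable contG continuous_intros cp) auto
      also have "\<dots> = C0 * K * (LINT x:cell l|lborel. \<bar>tp xs x\<bar> powr p + \<bar>tp ys x\<bar> powr q + (\<epsilon> powr p + \<epsilon> powr q))"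
        by simp
      also have "(LINT x:cell l|lborel. \<bar>tp xs x\<bar> powr p + \<bar>tp ys x\<bar> powr q + (\<epsilon> powr p + \<epsilon> powr q))
          = (LINT x:cell l|lborel. \<bar>tp xs x\<bar> powr p + \<bar>tp ys x\<bar> powr q) + (LINT x:(cell l :: (real^'n) set)|lborel. \<epsilon> powr p + \<epsilon> powr q)"
        using p q by (intro set_integral_add(2) cell_integrable continuous_intros cp) auto
      also have "(LINT x:cell l|lborel. \<bar>tp xs x\<bar> powr p + \<bar>tp ys x\<bar> powr q) = F + H"
        unfolding F_def H_def using p q by (intro set_integral_add(2) cell_integrable cp) auto
      finally show ?thesis by (simp only: cell_integral_const m_def)
    qed
    \<comment> \<open>The smoothing costs a term proportional to the measure of the cell. It
      disappears in the limit, and with it the dependence on \<open>l\<close>.\<close>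
    have "((\<lambda>\<epsilon>. C0 * K * (F + H + (\<epsilon> powr p + \<epsilon> powr q) * m)) \<longlongrightarrow> C0 * K * (F + H + (0 + 0) * m)) (at_right 0)"
      using p q by (intro tendsto_intros) real_asymp+
    moreover have "eventually (\<lambda>\<epsilon>. I \<le> C0 * K * (F + H + (\<epsilon> powr p + \<epsilon> powr q) * m)) (at_right 0)"
      using eventually_at_right_less[of 0] by eventually_elim (rule le)
    ultimately have "I \<le> C0 * K * (F + H + (0 + 0) * m)"
      by (intro tendsto_lowerbound) auto
    then show "(LINT x:cell l|lborel. tp (tderiv i (tderiv j (inv_laplace xs))) x * tp ys x)
       \<le> C0 * K * ((LINT x:cell l|lborel. \<bar>tp xs x\<bar> powr p) + (LINT x:cell l|lborel. \<bar>tp ys x\<bar> powr q))"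
      by (simp add: I_def F_def H_def)
  qed (use C0 K in auto)
qed

section \<open>The algebra of trigonometric polynomials\<close>

definition trig_fun :: "real \<Rightarrow> (real^'n::finite \<Rightarrow> real) \<Rightarrow> bool" where
  "trig_fun l F \<longleftrightarrow> (\<exists>xs. lattice_trig l xs \<and> (\<forall>x. F x = tp xs x))"

lemma trig_fun_const: "trig_fun l (\<lambda>x. c)"
  unfolding trig_fun_def by (rule exI[of _ "[(0, c, 0)]"]) (auto intro: exI[of _ 0])

lemma trig_fun_add: "trig_fun l F \<Longrightarrow> trig_fun l H \<Longrightarrow> trig_fun l (\<lambda>x. F x + H x)"
  unfolding trig_fun_def by (metis lattice_trig_simps(3) tp_simps(3))

lemma trig_fun_cmult: "trig_fun l F \<Longrightarrow> trig_fun l (\<lambda>x. c * F x)"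
  unfolding trig_fun_def by (metis lattice_trig_simps(1) tp_scale_const)

lemma trig_fun_sum: "(\<And>i. i \<in> I \<Longrightarrow> trig_fun l (F i)) \<Longrightarrow> trig_fun l (\<lambda>x. \<Sum>i\<in>I. F i x)"
  by (induction I rule: infinite_finite_induct) (auto intro: trig_fun_const trig_fun_add)

lemma trig_fun_single:
  "(\<And>i. \<exists>k::int. \<xi> $ i = of_int k * pi / l) \<Longrightarrow> trig_fun l (\<lambda>x. a * cos (\<xi> \<bullet> x) + b * sin (\<xi> \<bullet> x))"
  unfolding trig_fun_def by (rule exI[of _ "[(\<xi>, a, b)]"]) auto

text \<open>Product-to-sum formulas; the lattice of frequencies is closed under sums and
  differences.\<close>

lemma trig_fun_mult:
  fixes F H :: "real^'n::finite \<Rightarrow> real"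
  assumes "trig_fun l F" "trig_fun l H"
  shows "trig_fun l (\<lambda>x. F x * H x)"
proof -
  have single: "trig_fun l (\<lambda>x. (a * cos (\<xi> \<bullet> x) + b * sin (\<xi> \<bullet> x)) * (c * cos (\<eta> \<bullet> x) + d * sin (\<eta> \<bullet> x)))"
    if \<xi>: "\<And>i. \<exists>k::int. \<xi> $ i = of_int k * pi / l" and \<eta>: "\<And>i. \<exists>k::int. \<eta> $ i = of_int k * pi / l"
    for \<xi> \<eta> :: "real^'n" and a b c d
  proof -
    have 1: "\<exists>k::int. (\<xi> + \<eta>) $ i = of_int k * pi / l" "\<exists>k::int. (\<xi> - \<eta>) $ i = of_int k * pi / l" for i
    proof -
      obtain k m :: int where "\<xi> $ i = of_int k * pi / l" "\<eta> $ i = of_int m * pi / l" using \<xi> \<eta> by meson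
      then show "\<exists>k::int. (\<xi> + \<eta>) $ i = of_int k * pi / l" "\<exists>k::int. (\<xi> - \<eta>) $ i = of_int k * pi / l"
        by (intro exI[of _ "k + m"] exI[of _ "k - m"]; simp add: algebra_simps add_divide_distrib diff_divide_distrib)+
    qed
    have "(a * cos (\<xi> \<bullet> x) + b * sin (\<xi> \<bullet> x)) * (c * cos (\<eta> \<bullet> x) + d * sin (\<eta> \<bullet> x))
       = ((a*c - b*d) / 2 * cos ((\<xi> + \<eta>) \<bullet> x) + (a*d + b*c) / 2 * sin ((\<xi> + \<eta>) \<bullet> x))
       + ((a*c + b*d) / 2 * cos ((\<xi> - \<eta>) \<bullet> x) + (b*c - a*d) / 2 * sin ((\<xi> - \<eta>) \<bullet> x))" for x
      by (simp add: inner_add_left inner_diff_left cos_add sin_add cos_diff sin_diff field_simps)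
    then show ?thesis
      using trig_fun_add[OF trig_fun_single[of "\<xi> + \<eta>", OF 1(1)] trig_fun_single[of "\<xi> - \<eta>", OF 1(2)]] by presburger
  qed
  obtain xs ys where xs: "lattice_trig l xs" "\<And>x. F x = tp xs x" and ys: "lattice_trig l ys" "\<And>x. H x = tp ys x"
    using assms unfolding trig_fun_def by blast
  have "trig_fun l (\<lambda>x. (a * cos (\<xi> \<bullet> x) + b * sin (\<xi> \<bullet> x)) * tp ys x)"
    if \<xi>: "\<And>i. \<exists>k::int. \<xi> $ i = of_int k * pi / l" for \<xi> :: "real^'n" and a b
    using ys(1)
  proof (induction ys rule: trig_induct)
    case (Cons \<eta> c d ys)
    then show ?case using trig_fun_add[OF single[OF \<xi>, of \<eta> a b c d] Cons.IH] by (simp add: algebra_simps)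
  qed (simp add: trig_fun_const)
  then have "trig_fun l (\<lambda>x. tp xs x * tp ys x)"
    using xs(1)
  proof (induction xs rule: trig_induct)
    case (Cons \<xi> a b xs)
    then show ?case using trig_fun_add[OF Cons.prems(1)[of \<xi> a b] Cons.IH] by (simp add: algebra_simps)
  qed (simp add: trig_fun_const)
  then show ?thesis using xs ys by simp
qed

text \<open>\<open>h\<close> may be vector-valued: the lemma serves the scalar transform in
  \<open>riesz_Lp\<close> as well as the embedding of the torus in
  \<open>trig_uniform_approx\<close>.\<close>

lemma trig_fun_polynomial:
  fixes h :: "real^'n::finite \<Rightarrow> 'b::euclidean_space"
  assumes "real_polynomial_function P" "\<And>b. b \<in> Basis \<Longrightarrow> trig_fun l (\<lambda>x. h x \<bullet> b)"
  shows "trig_fun l (\<lambda>x. P (h x))"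
  using assms(1)
proof (induction P)
  case (linear f)
  then interpret bounded_linear f .
  have "f (h x) = (\<Sum>b\<in>Basis. f b * (h x \<bullet> b))" for x
  proof -
    have "f (h x) = f (\<Sum>b\<in>Basis. (h x \<bullet> b) *\<^sub>R b)" by (simp add: euclidean_representation)
    then show ?thesis by (simp add: sum scaleR mult.commute)
  qed
  then show ?case using assms(2) by (simp add: trig_fun_sum trig_fun_cmult)
qed (auto intro: trig_fun_const trig_fun_add trig_fun_mult)

text \<open>Duality: paired with \<open>\<mu> * \<phi> z\<close>, where \<open>\<phi>\<close> is the
  signed power \<open>p - 1\<close>, the transform \<open>z\<close> gives \<open>\<mu>\<close> times
  its p-th power integral. The q-th power of the partner is \<open>\<mu> powr q\<close> times the
  same integral, since \<open>(p - 1) * q = p\<close>. As \<open>q > 1\<close>, a small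
  \<open>\<mu>\<close> lets the left-hand side absorb it.\<close>

lemma riesz_Lp:
  fixes p :: real
  assumes p: "1 < p"
  shows "\<exists>C>0. \<forall>l>0. \<forall>(xs :: 'n::finite trig) i j. lattice_trig l xs \<longrightarrow>
     (LINT x:cell l|lborel. \<bar>tp (tderiv i (tderiv j (inv_laplace xs))) x\<bar> powr p)
       \<le> C * (LINT x:cell l|lborel. \<bar>tp xs x\<bar> powr p)"
proof -
  define q where "q = p / (p - 1)"
  have pq: "1/p + 1/q = 1" using p by (simp add: q_def field_simps)
  have q: "1 < q" using p by (simp add: q_def field_simps)
  have qp: "(p - 1) * q = p" using p by (simp add: q_def)
  obtain C where C: "C > 0" and le: "\<And>l xs ys i j. l > 0 \<Longrightarrow> lattice_trig l xs \<Longrightarrow> lattice_trig l ys \<Longrightarrow>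
     (LINT x:cell l|lborel. tp (tderiv i (tderiv j (inv_laplace (xs :: 'n trig)))) x * tp ys x)
       \<le> C * ((LINT x:cell l|lborel. \<bar>tp xs x\<bar> powr p) + (LINT x:cell l|lborel. \<bar>tp ys x\<bar> powr q))"
    using riesz_pairing_Lp[OF p pq, where 'n='n] by blast
  \<comment> \<open>This solves \<open>C * \<mu> powr q * 2 powr q = \<mu> / 2\<close>, so that
    exactly half of the left-hand side is absorbed; the factor \<open>2 powr q\<close> stems from
    \<open>powr_add_le\<close>.\<close>
  define \<mu> where "\<mu> = (1 / (2 * C * 2 powr q)) powr (1 / (q - 1))"
  have \<mu>: "\<mu> > 0" using C by (simp add: \<mu>_def)
  have \<mu>q: "C * \<mu> powr q * 2 powr q = \<mu> / 2"
  proof -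
    have "\<mu> powr (q - 1) = 1 / (2 * C * 2 powr q)" using q C by (simp add: \<mu>_def powr_powr)
    moreover have "\<mu> powr q = \<mu> powr (q - 1) * \<mu>" using \<mu> by (simp add: powr_diff)
    ultimately show ?thesis using C by simp
  qed
  show ?thesis
  proof (intro exI[of _ "2 * C / \<mu>"] conjI allI impI)
    fix l :: real and xs :: "'n trig" and i j
    assume l: "l > 0" and xs: "lattice_trig l xs"
    define zs where "zs = tderiv i (tderiv j (inv_laplace xs))"
    have zs: "lattice_trig l zs" using xs by (simp add: zs_def)
    define F where "F = (LINT x:cell l|lborel. \<bar>tp xs x\<bar> powr p)"
    define H where "H = (LINT x:cell l|lborel. \<bar>tp zs x\<bar> powr p)"
    define m where "m = measure lborel (cell l :: (real^'n) set)"
    define B where "B = amplitude zs"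
    have B: "\<bar>tp zs x\<bar> \<le> B" "0 \<le> B" for x by (auto simp: B_def abs_tp_le amplitude_nonneg)
    define \<phi> where "\<phi> s = sgn s * \<bar>s\<bar> powr (p - 1)" for s :: real
    have \<phi>1: "s * \<phi> s = \<bar>s\<bar> powr p" for s
    proof (cases "s = 0")
      case False
      have "s * \<phi> s = \<bar>s\<bar> * \<bar>s\<bar> powr (p - 1)" by (simp add: \<phi>_def abs_sgn mult.assoc)
      also have "\<dots> = \<bar>s\<bar> powr p" using False powr_add[of "\<bar>s\<bar>" 1 "p - 1"] by simp
      finally show ?thesis .
    qed (simp add: \<phi>_def)
    have \<phi>2: "\<bar>\<phi> s\<bar> = \<bar>s\<bar> powr (p - 1)" for s by (auto simp: \<phi>_def abs_mult sgn_real_def)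
    have \<phi>c: "continuous_on UNIV \<phi>"
    proof -
      have "continuous_on ({0..} \<union> {..0}) (\<lambda>s. if s \<in> {0..} then s powr (p - 1) else - ((- s) powr (p - 1)))"
        using p by (intro continuous_on_cases continuous_intros continuous_on_powr') auto
      moreover have "({0..} \<union> {..0}) = (UNIV :: real set)" by auto
      moreover have "(\<lambda>s. if s \<in> {0..} then s powr (p - 1) else - ((- s) powr (p - 1))) = \<phi>"
        by (auto simp: \<phi>_def fun_eq_iff sgn_real_def)
      ultimately show ?thesis by (simp only:)
    qed
    have cp: "continuous_on UNIV (\<lambda>x. \<bar>tp ws x\<bar> powr r)" if "r > 0" for ws :: "'n trig" and r
      using that by (intro continuous_on_powr' continuous_intros) auto
    have key: "\<mu> * H \<le> C * F + \<mu> / 2 * H + (\<mu> * B * \<eta> + C * \<mu> powr q * 2 powr q * \<eta> powr q) * m" if \<eta>: "\<eta> > 0" for \<eta>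
    proof -
      \<comment> \<open>The function \<open>\<phi>\<close> of a trigonometric polynomial is in
        general not one, but a polynomial of it is. Uniform closeness on the range
        \<open>{-B..B}\<close> suffices, because the cell has finite measure.\<close>
      obtain P where P: "real_polynomial_function P" "\<And>s. s \<in> {-B..B} \<Longrightarrow> \<bar>\<phi> s - P s\<bar> < \<eta>"
        using Stone_Weierstrass_real_polynomial_function[of "{-B..B}" \<phi> \<eta>] \<eta> \<phi>c continuous_on_subset by blast
      have "trig_fun l (\<lambda>x. \<mu> * P (tp zs x))"
        by (intro trig_fun_cmult trig_fun_polynomial[OF P(1)]) (use zs in \<open>auto simp: trig_fun_def\<close>)
      then obtain ys where ys: "lattice_trig l ys" "\<And>x. tp ys x = \<mu> * P (tp zs x)"
        unfolding trig_fun_def by metis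
      have near: "\<bar>\<phi> (tp zs x) - P (tp zs x)\<bar> < \<eta>" for x using P(2) B(1)[of x] by (auto simp: abs_le_iff)
      have lower: "\<mu> * \<bar>tp zs x\<bar> powr p - \<mu> * B * \<eta> \<le> tp zs x * tp ys x" for x
      proof -
        have "tp zs x * (\<phi> (tp zs x) - P (tp zs x)) \<le> \<bar>tp zs x\<bar> * \<bar>\<phi> (tp zs x) - P (tp zs x)\<bar>"
          by (metis abs_ge_self abs_mult)
        also have "\<dots> \<le> B * \<eta>" using B near[of x] by (intro mult_mono) auto
        finally have "\<bar>tp zs x\<bar> powr p - B * \<eta> \<le> tp zs x * P (tp zs x)"
          by (simp add: right_diff_distrib \<phi>1)
        then have "\<mu> * (\<bar>tp zs x\<bar> powr p - B * \<eta>) \<le> \<mu> * (tp zs x * P (tp zs x))"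
          using \<mu> by (intro mult_left_mono) auto
        then show ?thesis by (simp add: ys(2) algebra_simps)
      qed
      have upper: "\<bar>tp ys x\<bar> powr q \<le> \<mu> powr q * 2 powr q * \<bar>tp zs x\<bar> powr p + \<mu> powr q * 2 powr q * \<eta> powr q" for x
      proof -
        have "\<bar>P (tp zs x)\<bar> \<le> \<bar>tp zs x\<bar> powr (p - 1) + \<eta>" using near[of x] \<phi>2[of "tp zs x"] by linarith
        then have "\<bar>P (tp zs x)\<bar> powr q \<le> (\<bar>tp zs x\<bar> powr (p - 1) + \<eta>) powr q" using q by (intro powr_mono2) auto
        also have "\<dots> \<le> 2 powr q * ((\<bar>tp zs x\<bar> powr (p - 1)) powr q + \<eta> powr q)"
          using \<eta> q by (intro powr_add_le) auto
        also have "(\<bar>tp zs x\<bar> powr (p - 1)) powr q = \<bar>tp zs x\<bar> powr p" by (simp add: powr_powr qp)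
        finally have "\<mu> powr q * \<bar>P (tp zs x)\<bar> powr q \<le> \<mu> powr q * (2 powr q * (\<bar>tp zs x\<bar> powr p + \<eta> powr q))"
          by (intro mult_left_mono) auto
        then show ?thesis using \<mu> by (simp add: ys(2) abs_mult powr_mult algebra_simps)
      qed
      have "\<mu> * H - \<mu> * B * \<eta> * m = (LINT x:cell l|lborel. \<mu> * \<bar>tp zs x\<bar> powr p - \<mu> * B * \<eta>)"
        using p by (subst set_integral_diff(2)) (auto intro!: cell_integrable continuous_intros cp simp: cell_integral_const m_def H_def)
      also have "\<dots> \<le> (LINT x:cell l|lborel. tp zs x * tp ys x)"
        using p lower by (intro set_integral_mono cell_integrable continuous_intros cp) auto
      also have "\<dots> \<le> C * (F + (LINT x:cell l|lborel. \<bar>tp ys x\<bar> powr q))"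
        unfolding zs_def F_def by (rule le[OF l xs ys(1)])
      also have "(LINT x:cell l|lborel. \<bar>tp ys x\<bar> powr q)
          \<le> (LINT x:cell l|lborel. \<mu> powr q * 2 powr q * \<bar>tp zs x\<bar> powr p + \<mu> powr q * 2 powr q * \<eta> powr q)"
        using p q upper by (intro set_integral_mono cell_integrable continuous_intros cp) auto
      also have "\<dots> = \<mu> powr q * 2 powr q * H + \<mu> powr q * 2 powr q * \<eta> powr q * m"
        using p by (subst set_integral_add(2)) (auto intro!: cell_integrable continuous_intros cp simp: cell_integral_const m_def H_def)
      finally have "\<mu> * H - \<mu> * B * \<eta> * m \<le> C * (F + (\<mu> powr q * 2 powr q * H + \<mu> powr q * 2 powr q * \<eta> powr q * m))"
        using C by simp
      also have "\<dots> = C * F + (C * \<mu> powr q * 2 powr q) * H + (C * \<mu> powr q * 2 powr q) * \<eta> powr q * m"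
        by (simp add: algebra_simps)
      finally show ?thesis unfolding \<mu>q by (simp add: algebra_simps)
    qed
    have "((\<lambda>\<eta>. C * F + \<mu> / 2 * H + (\<mu> * B * \<eta> + C * \<mu> powr q * 2 powr q * \<eta> powr q) * m)
        \<longlongrightarrow> C * F + \<mu> / 2 * H + (\<mu> * B * 0 + C * \<mu> powr q * 2 powr q * 0) * m) (at_right 0)"
    proof (intro tendsto_intros)
      show "((\<lambda>\<eta>. \<eta> powr q) \<longlongrightarrow> 0) (at_right 0)" using q by real_asymp
    qed
    moreover have "eventually (\<lambda>\<eta>. \<mu> * H \<le> C * F + \<mu> / 2 * H + (\<mu> * B * \<eta> + C * \<mu> powr q * 2 powr q * \<eta> powr q) * m) (at_right 0)"
      using eventually_at_right_less[of 0] by eventually_elim (rule key)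
    ultimately have "\<mu> * H \<le> C * F + \<mu> / 2 * H + (\<mu> * B * 0 + C * \<mu> powr q * 2 powr q * 0) * m"
      by (intro tendsto_lowerbound) auto
    then have "H \<le> 2 * C / \<mu> * F" using \<mu> by (simp add: field_simps)
    then show "(LINT x:cell l|lborel. \<bar>tp (tderiv i (tderiv j (inv_laplace xs))) x\<bar> powr p)
       \<le> 2 * C / \<mu> * (LINT x:cell l|lborel. \<bar>tp xs x\<bar> powr p)"
      by (simp add: H_def F_def zs_def)
  qed (use C \<mu> in auto)
qed

section \<open>The divergence equation for trigonometric polynomials\<close>

text \<open>The mean value over a cell, by \<open>zero_mode_integral\<close>. Only constants pass
  the filter, so the point 0 of evaluation is immaterial.\<close>

definition zero_mode :: "'n::finite trig \<Rightarrow> real" where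
  "zero_mode xs = tp (filter (\<lambda>(\<xi>, a, b). \<xi> = 0) xs) 0"

lemma tp_zero_mode: "tp xs x = tp (filter (\<lambda>(\<xi>, a, b). \<xi> \<noteq> 0) xs) x + zero_mode xs"
  unfolding zero_mode_def by (induction xs rule: trig_induct) auto

lemma cell_measure_pos:
  assumes "l > 0"
  shows "0 < measure lborel (cell l :: (real^'n) set)"
proof -
  have sub: "box (\<chi> i. - l) (\<chi> i. l) \<subseteq> (cell l :: (real^'n) set)"
    by (auto simp: cell_def mem_box_cart less_imp_le)
  have "0 < measure lborel (box (\<chi> i. - l) (\<chi> i. l) :: (real^'n) set)"
    using assms by (auto simp: measure_lborel_box_eq Basis_vec_def inner_axis intro!: prod_pos)
  also have "\<dots> \<le> measure lborel (cell l :: (real^'n) set)"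
    using emeasure_bounded_finite[OF bounded_cell, of l]
    by (intro measure_mono_fmeasurable sub) (auto simp: fmeasurable_def)
  finally show ?thesis .
qed

lemma set_integral_sum:
  fixes f :: "'i \<Rightarrow> 'a \<Rightarrow> real"
  assumes "\<And>i. i \<in> I \<Longrightarrow> set_integrable M A (f i)"
  shows "(LINT x:A|M. (\<Sum>i\<in>I. f i x)) = (\<Sum>i\<in>I. LINT x:A|M. f i x)"
  using assms unfolding set_lebesgue_integral_def set_integrable_def scaleR_sum_right
  by (rule Bochner_Integration.integral_sum)

text \<open>The part without zero frequency is the Laplacian of a periodic function and has integral
  0.\<close>

lemma zero_mode_integral:
  assumes "l > 0" "lattice_trig l (xs :: 'n::finite trig)"
  shows "(LINT x:cell l|lborel. tp xs x) = zero_mode xs * measure lborel (cell l :: (real^'n) set)"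
proof -
  have lat: "lattice_trig l (filter (\<lambda>(\<xi>, a, b). \<xi> \<noteq> 0) xs)"
    using assms(2) by (auto simp: lattice_trig_def)
  have "(LINT x:cell l|lborel. tp (tderiv k (tderiv k (inv_laplace xs))) x) = 0" for k
    by (rule set_integral_cell_deriv_eq_0[OF assms(1), of "tp (tderiv k (inv_laplace xs))", OF _ _ tp_has_derivative])
       (use assms in \<open>auto intro!: tp_periodic continuous_intros\<close>)
  moreover have "(LINT x:cell l|lborel. (\<Sum>k\<in>UNIV. tp (tderiv k (tderiv k (inv_laplace xs))) x))
     = (\<Sum>k\<in>UNIV. (LINT x:cell l|lborel. tp (tderiv k (tderiv k (inv_laplace xs))) x))"
    by (intro set_integral_sum cell_integrable continuous_intros)
  ultimately have 0: "(LINT x:cell l|lborel. tp (filter (\<lambda>(\<xi>, a, b). \<xi> \<noteq> 0) xs) x) = 0"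
    by (simp only: tp_laplace_inv_laplace sum.neutral_const)
  have "(LINT x:cell l|lborel. tp xs x)
      = (LINT x:cell l|lborel. tp (filter (\<lambda>(\<xi>, a, b). \<xi> \<noteq> 0) xs) x + zero_mode xs)"
    by (rule arg_cong[where f="set_lebesgue_integral lborel (cell l)"]) (auto simp: fun_eq_iff intro: tp_zero_mode)
  also have "\<dots> = zero_mode xs * measure lborel (cell l :: (real^'n) set)"
    by (subst set_integral_add(2)) (auto intro!: cell_integrable continuous_intros simp: 0 cell_integral_const)
  finally show ?thesis .
qed

lemma sum_powr_le:
  fixes a :: "'i \<Rightarrow> real"
  assumes "finite I" "\<And>i. i \<in> I \<Longrightarrow> 0 \<le> a i" "0 \<le> p"
  shows "(\<Sum>i\<in>I. a i) powr p \<le> real (card I) powr p * (\<Sum>i\<in>I. a i powr p)"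
proof (cases "I = {}")
  case False
  define M where "M = Max (a ` I)"
  have M: "M \<in> a ` I" "\<And>i. i \<in> I \<Longrightarrow> a i \<le> M" using assms(1) False by (auto simp: M_def)
  then have "(\<Sum>i\<in>I. a i) \<le> real (card I) * M" using sum_bounded_above[of I a M] by simp
  then have "(\<Sum>i\<in>I. a i) powr p \<le> (real (card I) * M) powr p"
    using assms by (intro powr_mono2 sum_nonneg) auto
  also have "\<dots> = real (card I) powr p * M powr p"
    by (rule powr_mult)
  also have "M powr p \<le> (\<Sum>i\<in>I. a i powr p)"
    using M(1) assms(1) by (auto intro!: member_le_sum)
  then have "real (card I) powr p * M powr p \<le> real (card I) powr p * (\<Sum>i\<in>I. a i powr p)"
    by (intro mult_left_mono) auto
  finally show ?thesis .
qed simp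

text \<open>Jensen's inequality up to the factor \<open>2 powr p\<close>. With \<open>\<eta>\<close>
  half the mean of \<open>f\<close>, the pointwise bound
  \<open>f \<le> \<eta> + \<eta> powr (1 - p) * f powr p\<close> integrates to an inequality whose
  first term is half of the left-hand side.\<close>

lemma set_integral_powr_le:
  fixes f :: "'a \<Rightarrow> real"
  assumes p: "1 \<le> p" and A: "0 < measure M A" and f: "\<And>x. 0 \<le> f x"
    and Am: "A \<in> sets M" and int: "set_integrable M A f" "set_integrable M A (\<lambda>x. f x powr p)"
  shows "(LINT x:A|M. f x) powr p \<le> 2 powr p * measure M A powr (p - 1) * (LINT x:A|M. f x powr p)"
proof -
  define m where "m = measure M A"
  define I where "I = (LINT x:A|M. f x)"
  define J where "J = (LINT x:A|M. f x powr p)"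
  have fin: "emeasure M A < \<infinity>"
    using A by (metis ennreal_0 infinity_ennreal_def less_irrefl measure_def enn2real_top top.not_eq_extremum)
  have int1: "set_integrable M A (\<lambda>x. c)" for c :: real
    using Am fin by (simp add: set_integrable_def)
  have mA: "(LINT x:A|M. c) = c * m" for c :: real
    using fin Am by (simp add: set_lebesgue_integral_def m_def)
  have J0: "0 \<le> J" unfolding J_def set_lebesgue_integral_def by (intro integral_nonneg_AE) (auto simp: indicator_def)
  have I0: "0 \<le> I" unfolding I_def set_lebesgue_integral_def using f by (intro integral_nonneg_AE) (auto simp: indicator_def)
  show ?thesis
  proof (cases "I = 0")
    case True
    then show ?thesis using J0 p by (simp add: I_def[symmetric] J_def[symmetric])
  next
    case False
    then have I: "I > 0" using I0 by simp
    have m: "m > 0" using A by (simp add: m_def)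
    define \<eta> where "\<eta> = I / (2 * m)"
    have \<eta>: "\<eta> > 0" using I m by (simp add: \<eta>_def)
    have pt: "f x \<le> \<eta> + \<eta> powr (1 - p) * f x powr p" for x
    proof (cases "f x \<le> \<eta>")
      case False
      then have fx: "f x > 0" using \<eta> by simp
      have "f x = f x powr (1 - p) * f x powr p" using fx by (simp add: powr_add[symmetric])
      also have "\<dots> \<le> \<eta> powr (1 - p) * f x powr p"
        using False \<eta> p by (intro mult_right_mono powr_mono2') auto
      finally show ?thesis using \<eta> by simp
    qed (simp add: add_increasing2)
    have "I \<le> (LINT x:A|M. \<eta> + \<eta> powr (1 - p) * f x powr p)"
      unfolding I_def using int pt int1
      by (intro set_integral_mono set_integral_add) auto
    also have "\<dots> = \<eta> * m + \<eta> powr (1 - p) * J"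
      using int int1
      by (subst set_integral_add(2)) (auto simp: mA J_def)
    also have "\<eta> * m = I / 2" using m by (simp add: \<eta>_def)
    finally have "I / 2 \<le> \<eta> powr (1 - p) * J" by simp
    then have "\<eta> powr (p - 1) * (I / 2) \<le> \<eta> powr (p - 1) * (\<eta> powr (1 - p) * J)" by (intro mult_left_mono) auto
    also have "\<dots> = J" using \<eta> by (simp add: mult.assoc[symmetric] powr_add[symmetric])
    also have "I / 2 = \<eta> * m" using m by (simp add: \<eta>_def)
    also have "\<eta> powr (p - 1) * (\<eta> * m) = \<eta> powr p * m" using \<eta> by (simp add: powr_diff)
    finally have *: "\<eta> powr p * m \<le> J" .
    have "I powr p = (2 * m * \<eta>) powr p" using m by (simp add: \<eta>_def)
    also have "\<dots> = 2 powr p * m powr (p - 1) * (\<eta> powr p * m)"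
      using m \<eta> by (simp add: powr_mult powr_diff)
    also have "\<dots> \<le> 2 powr p * m powr (p - 1) * J" using * by (intro mult_left_mono) auto
    finally show ?thesis by (simp add: I_def J_def m_def)
  qed
qed

lemma fubini_continuous_bounded:
  fixes F :: "'a::euclidean_space \<Rightarrow> 'b::euclidean_space \<Rightarrow> real"
  assumes A: "A \<in> sets borel" "bounded A" and B: "B \<in> sets borel" "bounded B"
    and c: "continuous_on UNIV (\<lambda>z. F (fst z) (snd z))"
  shows "(LINT x:A|lborel. LINT y:B|lborel. F x y) = (LINT y:B|lborel. LINT x:A|lborel. F x y)"
    and "set_integrable lborel A (\<lambda>x. LINT y:B|lborel. F x y)"
    and "set_integrable lborel B (\<lambda>y. LINT x:A|lborel. F x y)"
proof -
  have "set_integrable lborel (A \<times> B) (\<lambda>z. F (fst z) (snd z))"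
  proof (rule set_integrable_continuous_bounded[OF _ _ c])
    show "A \<times> B \<in> sets borel" using A B by (simp add: borel_prod[symmetric])
    show "bounded (A \<times> B)" using A B by (intro bounded_Times) auto
  qed
  then have int: "integrable (lborel \<Otimes>\<^sub>M lborel) (\<lambda>(x, y). indicator A x *\<^sub>R indicator B y *\<^sub>R F x y)"
    unfolding set_integrable_def lborel_prod
    by (rule Bochner_Integration.integrable_cong[OF refl, THEN iffD1, rotated])
       (auto simp: indicator_def split: if_splits)
  from lborel_pair.Fubini_integral[OF int]
  have "(LINT y|lborel. LINT x|lborel. indicator A x *\<^sub>R indicator B y *\<^sub>R F x y)
      = (LINT x|lborel. LINT y|lborel. indicator A x *\<^sub>R indicator B y *\<^sub>R F x y)" .
  moreover have *: "(LINT x|lborel. indicator A x *\<^sub>R indicator B y *\<^sub>R F x y) = indicator B y *\<^sub>R (LINT x:A|lborel. F x y)" for y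
  proof -
    have "(LINT x|lborel. indicator A x *\<^sub>R indicator B y *\<^sub>R F x y)
        = (LINT x|lborel. indicator B y *\<^sub>R (indicator A x *\<^sub>R F x y))"
      by (intro Bochner_Integration.integral_cong) auto
    then show ?thesis by (simp add: set_lebesgue_integral_def)
  qed
  ultimately show "(LINT x:A|lborel. LINT y:B|lborel. F x y) = (LINT y:B|lborel. LINT x:A|lborel. F x y)"
    by (simp add: set_lebesgue_integral_def)
  show "set_integrable lborel A (\<lambda>x. LINT y:B|lborel. F x y)"
    using lborel_pair.integrable_fst'[OF int] by (simp add: set_integrable_def set_lebesgue_integral_def)
  show "set_integrable lborel B (\<lambda>y. LINT x:A|lborel. F x y)"
    using lborel_pair.integrable_snd[OF int] by (simp only: split * set_integrable_def)
qed

lemma tp_has_derivative_line: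
  "((\<lambda>s. tp xs (x + s *\<^sub>R y)) has_real_derivative (\<Sum>k\<in>UNIV. y $ k * tp (tderiv k xs) (x + s *\<^sub>R y))) (at s)"
proof (induction xs rule: trig_induct)
  case (Cons \<xi> a b xs)
  define A where "A = \<xi> \<bullet> (x + s *\<^sub>R y)"
  have "((\<lambda>s. \<xi> \<bullet> (x + s *\<^sub>R y)) has_real_derivative \<xi> \<bullet> y) (at s)"
    by (simp add: inner_add_right) (auto intro!: derivative_eq_intros)
  then have "((\<lambda>s. a * cos (\<xi> \<bullet> (x + s *\<^sub>R y)) + b * sin (\<xi> \<bullet> (x + s *\<^sub>R y))) has_real_derivative
      (b * cos A - a * sin A) * (\<xi> \<bullet> y)) (at s)"
    unfolding A_def by (auto intro!: derivative_eq_intros simp: algebra_simps)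
  from DERIV_add[OF this Cons]
  have "((\<lambda>s. tp ((\<xi>, a, b) # xs) (x + s *\<^sub>R y)) has_real_derivative (b * cos A - a * sin A) * (\<xi> \<bullet> y)
      + (\<Sum>k\<in>UNIV. y $ k * tp (tderiv k xs) (x + s *\<^sub>R y))) (at s)" by simp
  moreover have "(\<Sum>k\<in>UNIV. y $ k * tp (tderiv k ((\<xi>, a, b) # xs)) (x + s *\<^sub>R y))
      = (b * cos A - a * sin A) * (\<xi> \<bullet> y) + (\<Sum>k\<in>UNIV. y $ k * tp (tderiv k xs) (x + s *\<^sub>R y))"
  proof -
    have "y $ k * tp (tderiv k ((\<xi>, a, b) # xs)) (x + s *\<^sub>R y)
       = (b * cos A - a * sin A) * (\<xi> $ k * y $ k) + y $ k * tp (tderiv k xs) (x + s *\<^sub>R y)" for k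
      by (simp add: A_def algebra_simps)
    then show ?thesis by (simp only: sum.distrib sum_distrib_left inner_vec_def inner_real_def)
  qed
  ultimately show ?case by simp
qed simp

text \<open>As the mean is 0, the value at \<open>x\<close> is minus the average of
  \<open>h (x + y) - h x\<close> over \<open>y\<close>. Each difference is an integral of the
  gradient over a segment, and by periodicity shifting the gradient along that segment does not
  change its norm over the cell.\<close>

lemma poincare_cell:
  fixes xs :: "'n::finite trig"
  assumes l: "0 < l" and p: "1 \<le> p" and xs: "lattice_trig l xs" and z: "zero_mode xs = 0"
  shows "(LINT x:cell l|lborel. \<bar>tp xs x\<bar> powr p)
     \<le> (4 * l * CARD('n)) powr p * (\<Sum>k\<in>UNIV. LINT x:cell l|lborel. \<bar>tp (tderiv k xs) x\<bar> powr p)"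
proof -
  define g where "g x = (\<Sum>k\<in>UNIV. \<bar>tp (tderiv k xs) x\<bar> powr p)" for x
  define h where "h = tp xs"
  define m where "m = measure lborel (cell l :: (real^'n) set)"
  have m: "m > 0" unfolding m_def by (rule cell_measure_pos[OF l])
  \<comment> \<open>The factor 2 comes from \<open>set_integral_powr_le\<close> on the segment,
    \<open>l\<close> from the size of \<open>y\<close>, and the dimension from
    \<open>sum_powr_le\<close>. The average over \<open>y\<close> contributes another 2, whence 4 in
    the statement.\<close>
  define K where "K = (2 * l * CARD('n)) powr p"
  have cp: "continuous_on S (\<lambda>x. \<bar>f x\<bar> powr p)" if "continuous_on S f" for S :: "'z::t2_space set" and f :: "'z \<Rightarrow> real"
    using p that by (intro continuous_on_powr' continuous_intros) auto
  have cg: "continuous_on S (\<lambda>z. g (f z))" if "continuous_on S f" for S :: "'z::t2_space set" and f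
    unfolding g_def using that by (intro continuous_intros cp)
  have ch: "continuous_on S (\<lambda>z. h (f z))" if "continuous_on S f" for S :: "'z::t2_space set" and f
    unfolding h_def using that by (intro continuous_intros)
  have pg: "periodic l g" using l xs by (auto simp: periodic_def g_def tp_shift)
  have Ig: "(LINT x:cell l|lborel. g x) = (\<Sum>k\<in>UNIV. LINT x:cell l|lborel. \<bar>tp (tderiv k xs) x\<bar> powr p)"
    unfolding g_def by (intro set_integral_sum cell_integrable cp continuous_intros)
  have yl: "\<bar>y $ k\<bar> \<le> l" if "y \<in> cell l" for y :: "real^'n" and k
    using that by (auto simp: cell_def abs_le_iff less_imp_le intro: order_trans) (smt (verit))+
  have step1: "\<bar>h (x + y) - h x\<bar> powr p \<le> K * (LINT s:{0..1}|lborel. g (x + s *\<^sub>R y))" if y: "y \<in> cell l" for x y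
  proof -
    define D where "D s = (\<Sum>k\<in>UNIV. y $ k * tp (tderiv k xs) (x + s *\<^sub>R y))" for s
    have cD: "continuous_on S D" for S unfolding D_def by (intro continuous_intros)
    have "(LINT s|lborel. indicator {0..1} s *\<^sub>R D s) = h (x + 1 *\<^sub>R y) - h (x + 0 *\<^sub>R y)"
      unfolding h_def D_def
      by (rule integral_FTC_atLeastAtMost)
         (auto intro!: has_field_derivative_at_within tp_has_derivative_line continuous_intros
           simp: has_real_derivative_iff_has_vector_derivative[symmetric])
    then have "\<bar>h (x + y) - h x\<bar> = \<bar>LINT s:{0..1}|lborel. D s\<bar>" by (simp add: set_lebesgue_integral_def)
    also have "\<dots> \<le> (LINT s:{0..1}|lborel. \<bar>D s\<bar>)"
      using set_integral_norm_bound[of lborel "{0..1}" D] set_integrable_continuous_bounded[of "{0..1}" D] cD by simp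
    finally have "\<bar>h (x + y) - h x\<bar> powr p \<le> (LINT s:{0..1}|lborel. \<bar>D s\<bar>) powr p"
      using p by (intro powr_mono2) auto
    also have "\<dots> \<le> 2 powr p * measure lborel {0..1::real} powr (p - 1) * (LINT s:{0..1}|lborel. \<bar>D s\<bar> powr p)"
      by (rule set_integral_powr_le)
         (use p in \<open>auto intro!: set_integrable_continuous_bounded cp cD continuous_intros\<close>)
    also have "\<dots> = 2 powr p * (LINT s:{0..1}|lborel. \<bar>D s\<bar> powr p)" by simp
    also have "(LINT s:{0..1}|lborel. \<bar>D s\<bar> powr p) \<le> (LINT s:{0..1}|lborel. (l * CARD('n)) powr p * g (x + s *\<^sub>R y))"
    proof (rule set_integral_mono)
      show "\<bar>D s\<bar> powr p \<le> (l * CARD('n)) powr p * g (x + s *\<^sub>R y)" for s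
      proof -
        have "\<bar>D s\<bar> \<le> (\<Sum>k\<in>UNIV. l * \<bar>tp (tderiv k xs) (x + s *\<^sub>R y)\<bar>)"
          unfolding D_def using yl[OF y]
          by (intro order_trans[OF sum_abs] sum_mono) (auto simp: abs_mult intro!: mult_right_mono)
        also have "\<dots> = l * (\<Sum>k\<in>UNIV. \<bar>tp (tderiv k xs) (x + s *\<^sub>R y)\<bar>)" by (simp add: sum_distrib_left)
        finally have "\<bar>D s\<bar> powr p \<le> (l * (\<Sum>k\<in>UNIV. \<bar>tp (tderiv k xs) (x + s *\<^sub>R y)\<bar>)) powr p"
          using p by (intro powr_mono2) auto
        also have "\<dots> = l powr p * (\<Sum>k\<in>UNIV. \<bar>tp (tderiv k xs) (x + s *\<^sub>R y)\<bar>) powr p" by (rule powr_mult)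
        also have "\<dots> \<le> l powr p * (real CARD('n) powr p * g (x + s *\<^sub>R y))"
          unfolding g_def using p by (intro mult_left_mono sum_powr_le) auto
        finally show ?thesis by (simp add: powr_mult mult.assoc)
      qed
    qed (use p in \<open>auto intro!: set_integrable_continuous_bounded cp cD cg continuous_intros\<close>)
    also have "\<dots> = (l * CARD('n)) powr p * (LINT s:{0..1}|lborel. g (x + s *\<^sub>R y))" by simp
    finally show ?thesis by (simp add: K_def powr_mult mult.assoc)
  qed
  have step2: "(LINT x:cell l|lborel. \<bar>h (x + y) - h x\<bar> powr p) \<le> K * (LINT x:cell l|lborel. g x)" if y: "y \<in> cell l" for y
  proof -
    have "(LINT x:cell l|lborel. \<bar>h (x + y) - h x\<bar> powr p)
        \<le> (LINT x:cell l|lborel. K * (LINT s:{0..1}|lborel. g (x + s *\<^sub>R y)))"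
    proof (rule set_integral_mono)
      show "set_integrable lborel (cell l) (\<lambda>x. K * (LINT s:{0..1}|lborel. g (x + s *\<^sub>R y)))"
        by (intro set_integrable_mult_right fubini_continuous_bounded(2))
           (auto intro!: cg continuous_intros simp: bounded_cell)
    qed (use step1[OF y] in \<open>auto intro!: cell_integrable cp ch continuous_intros\<close>)
    also have "\<dots> = K * (LINT x:cell l|lborel. LINT s:{0..1}|lborel. g (x + s *\<^sub>R y))" by simp
    also have "(LINT x:cell l|lborel. LINT s:{0..1}|lborel. g (x + s *\<^sub>R y))
        = (LINT s:{0..1}|lborel. LINT x:cell l|lborel. g (x + s *\<^sub>R y))"
      by (rule fubini_continuous_bounded(1)) (auto intro!: cg continuous_intros simp: bounded_cell)
    also have "\<dots> = (LINT s:{0..1::real}|lborel. LINT x:cell l|lborel. g x)"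
    proof (rule set_lebesgue_integral_cong, simp, intro allI impI)
      fix s :: real assume s: "s \<in> {0..1}"
      show "(LINT x:cell l|lborel. g (x + s *\<^sub>R y)) = (LINT x:cell l|lborel. g x)"
      proof (rule periodic_shift[OF pg cg[OF continuous_on_id]])
        have "\<bar>s\<bar> * \<bar>y $ i\<bar> \<le> 1 * l" for i using s yl[OF y, of i] by (intro mult_mono) auto
        then show "\<bar>(s *\<^sub>R y) $ i\<bar> \<le> l" for i by (simp add: abs_mult)
      qed
    qed
    also have "\<dots> = (LINT x:cell l|lborel. g x)" by (simp add: set_lebesgue_integral_def)
    finally show ?thesis .
  qed
  have step3: "m powr p * \<bar>h x\<bar> powr p \<le> 2 powr p * m powr (p - 1) * (LINT y:cell l|lborel. \<bar>h (x + y) - h x\<bar> powr p)"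
    if x: "x \<in> cell l" for x
  proof -
    have "(LINT y:cell l|lborel. h (y + x)) = (LINT y:cell l|lborel. h y)"
      unfolding h_def by (rule periodic_shift[OF tp_periodic[OF xs l]]) (use yl[OF x] in \<open>auto intro!: continuous_intros\<close>)
    also have "\<dots> = 0" unfolding h_def zero_mode_integral[OF l xs] z by simp
    finally have "(LINT y:cell l|lborel. h (x + y) - h x) = - (h x * m)"
      by (subst set_integral_diff(2)) (auto intro!: cell_integrable ch continuous_intros simp: cell_integral_const m_def add.commute)
    then have "m * \<bar>h x\<bar> = \<bar>LINT y:cell l|lborel. h (x + y) - h x\<bar>" using m by (simp add: abs_mult mult.commute)
    also have "\<dots> \<le> (LINT y:cell l|lborel. \<bar>h (x + y) - h x\<bar>)"
    proof -
      have "set_integrable lborel (cell l) (\<lambda>y. h (x + y) - h x)"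
        by (intro cell_integrable ch continuous_intros)
      from set_integral_norm_bound[OF this] show ?thesis by simp
    qed
    finally have "(m * \<bar>h x\<bar>) powr p \<le> (LINT y:cell l|lborel. \<bar>h (x + y) - h x\<bar>) powr p"
      using p m by (intro powr_mono2) auto
    also have "\<dots> \<le> 2 powr p * m powr (p - 1) * (LINT y:cell l|lborel. \<bar>h (x + y) - h x\<bar> powr p)"
      unfolding m_def
      by (rule set_integral_powr_le) (use p m in \<open>auto intro!: cell_integrable cp ch continuous_intros simp: m_def\<close>)
    finally show ?thesis by (simp add: powr_mult)
  qed
  have "m powr p * (LINT x:cell l|lborel. \<bar>h x\<bar> powr p) = (LINT x:cell l|lborel. m powr p * \<bar>h x\<bar> powr p)" by simp
  also have "\<dots> \<le> (LINT x:cell l|lborel. 2 powr p * m powr (p - 1) * (LINT y:cell l|lborel. \<bar>h (x + y) - h x\<bar> powr p))"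
    using step3 p
    by (intro set_integral_mono set_integrable_mult_right fubini_continuous_bounded(2))
       (auto intro!: cell_integrable ch cp continuous_intros simp: bounded_cell)
  also have "\<dots> = 2 powr p * m powr (p - 1) * (LINT x:cell l|lborel. LINT y:cell l|lborel. \<bar>h (x + y) - h x\<bar> powr p)" by simp
  also have "(LINT x:cell l|lborel. LINT y:cell l|lborel. \<bar>h (x + y) - h x\<bar> powr p)
      = (LINT y:cell l|lborel. LINT x:cell l|lborel. \<bar>h (x + y) - h x\<bar> powr p)"
    by (rule fubini_continuous_bounded(1)) (auto intro!: ch cp continuous_intros simp: bounded_cell)
  also have "\<dots> \<le> (LINT y:(cell l :: (real^'n) set)|lborel. K * (LINT x:cell l|lborel. g x))"
    using step2
    by (intro set_integral_mono fubini_continuous_bounded(3))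
       (auto intro!: cell_integrable ch cp continuous_intros simp: bounded_cell)
  also have "\<dots> = m * K * (LINT x:cell l|lborel. g x)" by (simp add: cell_integral_const m_def)
  finally have "m powr p * (LINT x:cell l|lborel. \<bar>h x\<bar> powr p)
      \<le> 2 powr p * m powr (p - 1) * (m * K * (LINT x:cell l|lborel. g x))" by (simp add: mult_left_mono)
  also have "\<dots> = m powr p * (2 powr p * K * (LINT x:cell l|lborel. g x))" using m by (simp add: powr_diff)
  finally have "(LINT x:cell l|lborel. \<bar>h x\<bar> powr p) \<le> 2 powr p * K * (LINT x:cell l|lborel. g x)"
    using m by simp
  also have "2 powr p * K = (4 * l * CARD('n)) powr p" by (simp add: K_def powr_mult[symmetric] mult.assoc)
  finally show ?thesis by (simp add: h_def Ig)
qed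

text \<open>The gradient of the inverse Laplacian, plus a linear field that accounts for the mean value.\<close>

definition sol_w :: "'n::finite trig \<Rightarrow> real^'n \<Rightarrow> real^'n" where
  "sol_w xs x = (\<chi> i. tp (tderiv i (inv_laplace xs)) x + zero_mode xs / CARD('n) * x $ i)"

definition sol_Dw :: "'n::finite trig \<Rightarrow> real^'n \<Rightarrow> real^'n^'n" where
  "sol_Dw xs x = (\<chi> i j. tp (tderiv j (tderiv i (inv_laplace xs))) x + (if i = j then zero_mode xs / CARD('n) else 0))"

lemma sol_w_has_derivative:
  "((\<lambda>s. sol_w xs (x + s *\<^sub>R axis j 1) $ i) has_real_derivative sol_Dw xs (x + s *\<^sub>R axis j 1) $ i $ j) (at s)"
proof -
  have "((\<lambda>s. zero_mode xs / CARD('a) * (x + s *\<^sub>R axis j 1) $ i) has_real_derivative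
      (if i = j then zero_mode xs / CARD('a) else 0)) (at s)"
    by (cases "i = j") (auto simp: axis_def intro!: derivative_eq_intros)
  from DERIV_add[OF tp_has_derivative[of "tderiv i (inv_laplace xs)" x j s] this]
  show ?thesis by (simp only: sol_w_def sol_Dw_def vec_lambda_beta)
qed

lemma sol_Dw_trace: "(\<Sum>i\<in>UNIV. sol_Dw xs x $ i $ i) = tp xs x"
  using tp_laplace_inv_laplace[of xs x] by (simp add: sol_Dw_def sum.distrib tp_zero_mode[of xs x])

lemma continuous_on_sol: "continuous_on S (sol_w xs)" "continuous_on S (sol_Dw xs)"
  unfolding sol_w_def sol_Dw_def by (intro continuous_intros)+

lemma zero_mode_diff: "zero_mode (xs @ scale_freq (\<lambda>_. - 1) ys) = zero_mode xs - zero_mode ys"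
proof -
  have "zero_mode (scale_freq (\<lambda>_. - 1) ys) = - zero_mode ys"
    unfolding zero_mode_def by (induction ys rule: trig_induct) auto
  moreover have "zero_mode (as @ bs) = zero_mode as + zero_mode bs" for as bs :: "'a trig"
    unfolding zero_mode_def by simp
  ultimately show ?thesis by simp
qed

text \<open>A difference of lists is encoded by appending the negated list. The bounds of
  \<open>sol_bounds\<close> then apply to differences and produce Cauchy sequences.\<close>

lemma sol_diff:
  "tp (xs @ scale_freq (\<lambda>_. - 1) ys) x = tp xs x - tp ys x"
  "sol_w (xs @ scale_freq (\<lambda>_. - 1) ys) x = sol_w xs x - sol_w ys x"
  "sol_Dw (xs @ scale_freq (\<lambda>_. - 1) ys) x = sol_Dw xs x - sol_Dw ys x"
proof -
  have 1: "tp (tderiv i (inv_laplace (scale_freq (\<lambda>_. - 1) ys))) x = - tp (tderiv i (inv_laplace ys)) x"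
    "tp (tderiv j (tderiv i (inv_laplace (scale_freq (\<lambda>_. - 1) ys)))) x = - tp (tderiv j (tderiv i (inv_laplace ys))) x" for i j
    by (induction ys rule: trig_induct) (auto simp: algebra_simps)
  show "tp (xs @ scale_freq (\<lambda>_. - 1) ys) x = tp xs x - tp ys x" by (simp add: tp_scale_const)
  show "sol_w (xs @ scale_freq (\<lambda>_. - 1) ys) x = sol_w xs x - sol_w ys x"
    unfolding sol_w_def zero_mode_diff vec_eq_iff by (simp add: 1[simplified] diff_divide_distrib algebra_simps)
  show "sol_Dw (xs @ scale_freq (\<lambda>_. - 1) ys) x = sol_Dw xs x - sol_Dw ys x"
    unfolding sol_Dw_def zero_mode_diff vec_eq_iff by (simp add: 1[simplified] diff_divide_distrib)
qed

lemma zero_mode_powr_le: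
  assumes l: "l > 0" and p: "1 \<le> p" and xs: "lattice_trig l (xs :: 'n::finite trig)"
  shows "measure lborel (cell l :: (real^'n) set) * \<bar>zero_mode xs\<bar> powr p \<le> 2 powr p * (LINT x:cell l|lborel. \<bar>tp xs x\<bar> powr p)"
proof -
  define m where "m = measure lborel (cell l :: (real^'n) set)"
  have m: "m > 0" unfolding m_def by (rule cell_measure_pos[OF l])
  have cp: "continuous_on UNIV (\<lambda>x. \<bar>tp xs x\<bar> powr p)"
    using p by (intro continuous_on_powr' continuous_intros) auto
  have si: "set_integrable lborel (cell l) (tp xs)" by (intro cell_integrable continuous_intros)
  have "m * \<bar>zero_mode xs\<bar> = \<bar>LINT x:cell l|lborel. tp xs x\<bar>"
    using m by (simp add: zero_mode_integral[OF l xs] abs_mult m_def)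
  also have "\<dots> \<le> (LINT x:cell l|lborel. \<bar>tp xs x\<bar>)" using set_integral_norm_bound[OF si] by simp
  finally have "(m * \<bar>zero_mode xs\<bar>) powr p \<le> (LINT x:cell l|lborel. \<bar>tp xs x\<bar>) powr p"
    using p m by (intro powr_mono2) auto
  also have "\<dots> \<le> 2 powr p * m powr (p - 1) * (LINT x:cell l|lborel. \<bar>tp xs x\<bar> powr p)"
    unfolding m_def
    by (rule set_integral_powr_le) (use p m in \<open>auto intro!: cell_integrable cp continuous_intros simp: m_def\<close>)
  finally have "m powr (p - 1) * (m * \<bar>zero_mode xs\<bar> powr p) \<le> m powr (p - 1) * (2 powr p * (LINT x:cell l|lborel. \<bar>tp xs x\<bar> powr p))"
    using m by (simp add: powr_mult powr_diff mult_ac)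
  then show ?thesis using m by (simp add: m_def)
qed

text \<open>The common part of the bounds for the field and for its gradient: a norm dominated by
  finitely many functions that are already controlled, plus a multiple of the mean value.\<close>

lemma sol_bound_aux:
  fixes a :: "'i::finite \<Rightarrow> real^'n::finite \<Rightarrow> real"
  assumes p: "1 \<le> p" and l: "l > 0" and xs: "lattice_trig l (xs :: 'n trig)" and c: "0 \<le> c" "0 \<le> K"
    and a: "\<And>i. continuous_on UNIV (a i)" "\<And>i. (LINT x:cell l|lborel. \<bar>a i x\<bar> powr p) \<le> K * (LINT x:cell l|lborel. \<bar>tp xs x\<bar> powr p)"
    and b: "continuous_on UNIV b" "\<And>x. x \<in> cell l \<Longrightarrow> norm (b x) \<le> (\<Sum>i\<in>UNIV. \<bar>a i x\<bar>) + c * \<bar>zero_mode xs\<bar>"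
  shows "(LINT x:cell l|lborel. norm (b x :: 'b::euclidean_space) powr p)
     \<le> 2 powr p * (CARD('i) powr p * CARD('i) * K + c powr p * 2 powr p) * (LINT x:cell l|lborel. \<bar>tp xs x\<bar> powr p)"
proof -
  define F where "F = (LINT x:cell l|lborel. \<bar>tp xs x\<bar> powr p)"
  define m where "m = measure lborel (cell l :: (real^'n) set)"
  have cp: "continuous_on UNIV (\<lambda>x. \<bar>f x\<bar> powr p)" if "continuous_on UNIV f" for f :: "real^'n \<Rightarrow> real"
    using p that by (intro continuous_on_powr' continuous_intros) auto
  have cn: "continuous_on UNIV (\<lambda>x. norm (b x) powr p)"
    using p b(1) by (intro continuous_on_powr' continuous_intros) auto
  have "(LINT x:cell l|lborel. norm (b x) powr p)
      \<le> (LINT x:cell l|lborel. 2 powr p * (CARD('i) powr p * (\<Sum>i\<in>UNIV. \<bar>a i x\<bar> powr p) + c powr p * \<bar>zero_mode xs\<bar> powr p))"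
  proof (rule set_integral_mono)
    fix x :: "real^'n" assume x: "x \<in> cell l"
    have "norm (b x) powr p \<le> ((\<Sum>i\<in>UNIV. \<bar>a i x\<bar>) + c * \<bar>zero_mode xs\<bar>) powr p"
      using p b(2)[OF x] by (intro powr_mono2) auto
    also have "\<dots> \<le> 2 powr p * ((\<Sum>i\<in>UNIV. \<bar>a i x\<bar>) powr p + (c * \<bar>zero_mode xs\<bar>) powr p)"
      using p c by (intro powr_add_le) (auto intro: sum_nonneg)
    also have "\<dots> \<le> 2 powr p * (CARD('i) powr p * (\<Sum>i\<in>UNIV. \<bar>a i x\<bar> powr p) + c powr p * \<bar>zero_mode xs\<bar> powr p)"
      using p by (intro mult_left_mono add_mono sum_powr_le) (auto simp: powr_mult)
    finally show "norm (b x) powr p \<le> 2 powr p * (CARD('i) powr p * (\<Sum>i\<in>UNIV. \<bar>a i x\<bar> powr p) + c powr p * \<bar>zero_mode xs\<bar> powr p)" .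
  qed (intro cell_integrable cn continuous_intros cp a)+
  also have "\<dots> = 2 powr p * (CARD('i) powr p * (\<Sum>i\<in>UNIV. LINT x:cell l|lborel. \<bar>a i x\<bar> powr p) + c powr p * (m * \<bar>zero_mode xs\<bar> powr p))"
  proof -
    have "(LINT x:cell l|lborel. (\<Sum>i\<in>UNIV. \<bar>a i x\<bar> powr p)) = (\<Sum>i\<in>UNIV. LINT x:cell l|lborel. \<bar>a i x\<bar> powr p)"
      by (intro set_integral_sum cell_integrable cp a)
    moreover have "(LINT x:cell l|lborel. CARD('i) powr p * (\<Sum>i\<in>UNIV. \<bar>a i x\<bar> powr p) + c powr p * \<bar>zero_mode xs\<bar> powr p)
       = (LINT x:cell l|lborel. CARD('i) powr p * (\<Sum>i\<in>UNIV. \<bar>a i x\<bar> powr p)) + (LINT x:(cell l :: (real^'n) set)|lborel. c powr p * \<bar>zero_mode xs\<bar> powr p)"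
      by (intro set_integral_add(2) cell_integrable continuous_intros cp a)
    ultimately show ?thesis by (simp add: cell_integral_const m_def)
  qed
  also have "\<dots> \<le> 2 powr p * (CARD('i) powr p * (\<Sum>i\<in>(UNIV::'i set). K * F) + c powr p * (2 powr p * F))"
    unfolding F_def m_def using zero_mode_powr_le[OF l p xs] a(2)
    by (intro mult_left_mono add_mono sum_mono) auto
  also have "\<dots> = 2 powr p * (CARD('i) powr p * CARD('i) * K + c powr p * 2 powr p) * F" by (simp add: algebra_simps)
  finally show ?thesis by (simp add: F_def)
qed

text \<open>\<open>C\<close> comes before \<open>l\<close>, because neither the Riesz bound nor the
  contribution of the mean to the gradient depends on the period. \<open>K\<close> depends on
  \<open>l\<close> through \<open>poincare_cell\<close> and the linear field; it serves only to make
  the fields converge.\<close>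

lemma sol_bounds:
  fixes p :: real
  assumes p: "1 < p"
  shows "\<exists>C>0. \<forall>l>0. \<exists>K>0. \<forall>xs :: 'n::finite trig. lattice_trig l xs \<longrightarrow>
     (LINT x:cell l|lborel. norm (sol_Dw xs x) powr p) \<le> C * (LINT x:cell l|lborel. \<bar>tp xs x\<bar> powr p) \<and>
     (LINT x:cell l|lborel. norm (sol_w xs x) powr p) \<le> K * (LINT x:cell l|lborel. \<bar>tp xs x\<bar> powr p)"
proof -
  obtain C where C: "C > 0" "\<And>l xs i j. l > 0 \<Longrightarrow> lattice_trig l (xs :: 'n trig) \<Longrightarrow>
     (LINT x:cell l|lborel. \<bar>tp (tderiv i (tderiv j (inv_laplace xs))) x\<bar> powr p) \<le> C * (LINT x:cell l|lborel. \<bar>tp xs x\<bar> powr p)"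
    using riesz_Lp[OF p, where 'n='n] by blast
  have p': "1 \<le> p" using p by simp
  define N where "N = real CARD('n)"
  have N: "N > 0" by (simp add: N_def)
  define C1 where "C1 = 2 powr p * (CARD('n \<times> 'n) powr p * CARD('n \<times> 'n) * C + 1 powr p * 2 powr p)"
  show ?thesis
  proof (rule exI[of _ C1], intro conjI allI impI)
    show "C1 > 0" using C by (simp add: C1_def add_nonneg_pos)
    fix l :: real assume l: "l > 0"
    define C2 where "C2 = (4 * l * CARD('n)) powr p * (CARD('n) * C)"
    have C2: "0 \<le> C2" using C by (simp add: C2_def)
    define K where "K = 2 powr p * (CARD('n) powr p * CARD('n) * C2 + l powr p * 2 powr p)"
    show "\<exists>K>0. \<forall>xs :: 'n trig. lattice_trig l xs \<longrightarrow>
     (LINT x:cell l|lborel. norm (sol_Dw xs x) powr p) \<le> C1 * (LINT x:cell l|lborel. \<bar>tp xs x\<bar> powr p) \<and>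
     (LINT x:cell l|lborel. norm (sol_w xs x) powr p) \<le> K * (LINT x:cell l|lborel. \<bar>tp xs x\<bar> powr p)"
    proof (intro exI[of _ K] conjI allI impI)
      show "K > 0" using C2 l by (simp add: K_def add_nonneg_pos)
      fix xs :: "'n trig" assume xs: "lattice_trig l xs"
      show "(LINT x:cell l|lborel. norm (sol_Dw xs x) powr p) \<le> C1 * (LINT x:cell l|lborel. \<bar>tp xs x\<bar> powr p)"
        unfolding C1_def
      proof (rule sol_bound_aux[OF p' l xs, where a = "\<lambda>(i, j) x. tp (tderiv j (tderiv i (inv_laplace xs))) x"])
        fix x :: "real^'n"
        have "norm (sol_Dw xs x) \<le> (\<Sum>i\<in>UNIV. norm (sol_Dw xs x $ i))" unfolding norm_vec_def[of "sol_Dw xs x"] by (rule L2_set_le_sum) simp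
        also have "\<dots> \<le> (\<Sum>i\<in>UNIV. \<Sum>j\<in>UNIV. \<bar>sol_Dw xs x $ i $ j\<bar>)" by (intro sum_mono norm_le_l1_cart)
        also have "\<dots> \<le> (\<Sum>i\<in>UNIV. \<Sum>j\<in>UNIV. \<bar>tp (tderiv j (tderiv i (inv_laplace xs))) x\<bar> + (if i = j then \<bar>zero_mode xs\<bar> / N else 0))"
          by (intro sum_mono) (auto simp: sol_Dw_def N_def intro: order_trans[OF abs_triangle_ineq])
        also have "\<dots> = (\<Sum>i\<in>UNIV. \<Sum>j\<in>UNIV. \<bar>tp (tderiv j (tderiv i (inv_laplace xs))) x\<bar>) + \<bar>zero_mode xs\<bar>"
          by (simp add: sum.distrib N_def)
        also have "(\<Sum>i\<in>UNIV. \<Sum>j\<in>UNIV. \<bar>tp (tderiv j (tderiv i (inv_laplace xs))) x\<bar>)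
            = (\<Sum>i\<in>UNIV. \<bar>(case i of (i, j) \<Rightarrow> \<lambda>x. tp (tderiv j (tderiv i (inv_laplace xs))) x) x\<bar>)"
          by (simp add: sum.cartesian_product split_beta)
        finally show "norm (sol_Dw xs x) \<le> (\<Sum>i\<in>UNIV. \<bar>(case i of (i, j) \<Rightarrow> \<lambda>x. tp (tderiv j (tderiv i (inv_laplace xs))) x) x\<bar>) + 1 * \<bar>zero_mode xs\<bar>" by simp
      qed (use C l xs in \<open>auto intro!: continuous_intros continuous_on_sol\<close>)
      have "(LINT x:cell l|lborel. norm (sol_w xs x) powr p)
          \<le> 2 powr p * (CARD('n) powr p * CARD('n) * C2 + l powr p * 2 powr p) * (LINT x:cell l|lborel. \<bar>tp xs x\<bar> powr p)"
      proof (rule sol_bound_aux[OF p' l xs, where a = "\<lambda>i x. tp (tderiv i (inv_laplace xs)) x"])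
        show "(LINT x:cell l|lborel. \<bar>tp (tderiv i (inv_laplace xs)) x\<bar> powr p) \<le> C2 * (LINT x:cell l|lborel. \<bar>tp xs x\<bar> powr p)" for i
        proof -
          have z: "zero_mode (tderiv i (inv_laplace xs)) = 0"
            unfolding zero_mode_def by (induction xs rule: trig_induct) auto
          have "(LINT x:cell l|lborel. \<bar>tp (tderiv i (inv_laplace xs)) x\<bar> powr p)
              \<le> (4 * l * CARD('n)) powr p * (\<Sum>k\<in>UNIV. LINT x:cell l|lborel. \<bar>tp (tderiv k (tderiv i (inv_laplace xs))) x\<bar> powr p)"
            by (rule poincare_cell[OF l p' _ z]) (simp add: xs)
          also have "\<dots> \<le> (4 * l * CARD('n)) powr p * (\<Sum>k\<in>(UNIV::'n set). C * (LINT x:cell l|lborel. \<bar>tp xs x\<bar> powr p))"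
            using C(2)[OF l xs] by (intro mult_left_mono sum_mono) auto
          finally show ?thesis by (simp add: C2_def mult_ac)
        qed
        fix x :: "real^'n" assume x: "x \<in> cell l"
        have "norm (sol_w xs x) \<le> (\<Sum>i\<in>UNIV. \<bar>sol_w xs x $ i\<bar>)" by (rule norm_le_l1_cart)
        also have "\<dots> \<le> (\<Sum>i\<in>UNIV. \<bar>tp (tderiv i (inv_laplace xs)) x\<bar> + l * \<bar>zero_mode xs\<bar> / N)"
        proof (rule sum_mono)
          fix i
          have "\<bar>x $ i\<bar> \<le> l" using x by (auto simp: cell_def abs_le_iff less_imp_le) (smt (verit))
          then have "\<bar>zero_mode xs\<bar> / N * \<bar>x $ i\<bar> \<le> \<bar>zero_mode xs\<bar> / N * l" using N by (intro mult_left_mono) auto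
          then show "\<bar>sol_w xs x $ i\<bar> \<le> \<bar>tp (tderiv i (inv_laplace xs)) x\<bar> + l * \<bar>zero_mode xs\<bar> / N"
            unfolding sol_w_def using N
            by (auto simp: N_def abs_mult mult.commute intro!: order_trans[OF abs_triangle_ineq])
        qed
        also have "\<dots> = (\<Sum>i\<in>UNIV. \<bar>tp (tderiv i (inv_laplace xs)) x\<bar>) + l * \<bar>zero_mode xs\<bar>"
          by (simp add: sum.distrib N_def)
        finally show "norm (sol_w xs x) \<le> (\<Sum>i\<in>UNIV. \<bar>tp (tderiv i (inv_laplace xs)) x\<bar>) + l * \<bar>zero_mode xs\<bar>" .
      qed (use C2 l xs in \<open>auto intro!: continuous_intros continuous_on_sol\<close>)
      then show "(LINT x:cell l|lborel. norm (sol_w xs x) powr p) \<le> K * (LINT x:cell l|lborel. \<bar>tp xs x\<bar> powr p)"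
        unfolding K_def .
    qed
  qed
qed

section \<open>Approximation in Lebesgue spaces\<close>

definition clamp_norm :: "real \<Rightarrow> 'b::euclidean_space \<Rightarrow> 'b" where
  "clamp_norm M y = (M / max M (norm y)) *\<^sub>R y"

lemma norm_clamp_norm_le: "0 < M \<Longrightarrow> norm (clamp_norm M y) \<le> M"
  by (auto simp: clamp_norm_def max_def field_simps)

lemma clamp_norm_eq: "0 < M \<Longrightarrow> norm y \<le> M \<Longrightarrow> clamp_norm M y = y"
  by (auto simp: clamp_norm_def max_def)

lemma norm_diff_clamp_norm_le: "0 < M \<Longrightarrow> norm (clamp_norm M y - y) \<le> norm y"
proof (cases "norm y \<le> M")
  case False
  assume M: "0 < M"
  define t where "t = M / norm y"
  have t: "0 \<le> t" "t \<le> 1" using M False by (auto simp: t_def divide_le_eq)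
  have "clamp_norm M y - y = (t - 1) *\<^sub>R y" using False by (simp add: clamp_norm_def t_def max_def scaleR_diff_left)
  then have "norm (clamp_norm M y - y) = (1 - t) * norm y" using t by simp
  also have "\<dots> \<le> 1 * norm y" using t by (intro mult_right_mono) auto
  finally show ?thesis by simp
qed (simp add: clamp_norm_eq)

lemma continuous_on_clamp_norm: "0 < M \<Longrightarrow> continuous_on S f \<Longrightarrow> continuous_on S (\<lambda>x. clamp_norm M (f x))"
  unfolding clamp_norm_def by (intro continuous_intros) (auto simp: max_def)

lemma borel_measurable_clamp_norm [measurable]:
  "f \<in> borel_measurable N \<Longrightarrow> (\<lambda>x. clamp_norm M (f x)) \<in> borel_measurable N"
  unfolding clamp_norm_def max_def by (intro measurable_If borel_measurable_scaleR borel_measurable_divide) auto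

lemma norm_diff_powr_le:
  fixes a b c :: "'b::real_normed_vector"
  assumes "0 \<le> p"
  shows "norm (a - c) powr p \<le> 2 powr p * (norm (a - b) powr p + norm (b - c) powr p)"
proof -
  have "norm (a - c) powr p \<le> (norm (a - b) + norm (b - c)) powr p"
    using assms norm_triangle_ineq[of "a - b" "b - c"] by (intro powr_mono2) auto
  also have "\<dots> \<le> 2 powr p * (norm (a - b) powr p + norm (b - c) powr p)"
    using assms by (intro powr_add_le) auto
  finally show ?thesis .
qed

lemma integrable_norm_diff_powr:
  fixes f g :: "'a \<Rightarrow> 'b::euclidean_space"
  assumes p: "0 \<le> p" and m: "f \<in> borel_measurable M" "g \<in> borel_measurable M"
    and i: "integrable M (\<lambda>x. norm (f x) powr p)" "integrable M (\<lambda>x. norm (g x) powr p)"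
  shows "integrable M (\<lambda>x. norm (f x - g x) powr p)"
proof (rule Bochner_Integration.integrable_bound)
  show "integrable M (\<lambda>x. 2 powr p * (norm (f x) powr p + norm (g x) powr p))" using i by simp
  show "AE x in M. norm (norm (f x - g x) powr p) \<le> norm (2 powr p * (norm (f x) powr p + norm (g x) powr p))"
    using norm_diff_powr_le[OF p, of "f _" "g _" 0] by (auto intro!: AE_I2)
qed (use m in measurable)

text \<open>The function is first truncated to a bounded one. Almost everywhere approximation by
  continuous functions then becomes approximation in the p-norm by dominated convergence, once the
  approximants are truncated at the same level and cut off outside \<open>V\<close>.\<close>

lemma dense_continuous_Lp:
  fixes f :: "'a::euclidean_space \<Rightarrow> 'b::euclidean_space"
  assumes p: "0 < p" and f: "f \<in> borel_measurable borel" "integrable lborel (\<lambda>x. norm (f x) powr p)"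
    and K: "closed K" "\<And>x. x \<notin> K \<Longrightarrow> f x = 0" and V: "open V" "bounded V" "K \<subseteq> V" and \<epsilon>: "0 < \<epsilon>"
  shows "\<exists>h. continuous_on UNIV h \<and> (\<forall>x. x \<notin> V \<longrightarrow> h x = 0) \<and>
     integrable lborel (\<lambda>x. norm (h x - f x) powr p) \<and> (LINT x|lborel. norm (h x - f x) powr p) < \<epsilon>"
proof -
  note [measurable] = f(1)
  have l1: "(\<lambda>n. LINT x|lborel. norm (clamp_norm (real (Suc n)) (f x) - f x) powr p) \<longlonglongrightarrow> integral\<^sup>L lborel (\<lambda>x::'a. 0 :: real)"
  proof (rule integral_dominated_convergence[where w = "\<lambda>x. norm (f x) powr p"])
    show "AE x in lborel. (\<lambda>n. norm (clamp_norm (real (Suc n)) (f x) - f x) powr p) \<longlonglongrightarrow> 0"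
    proof (intro AE_I2 tendsto_eventually)
      fix x
      obtain N where N: "norm (f x) \<le> real N" using real_arch_simple by blast
      show "eventually (\<lambda>n. norm (clamp_norm (real (Suc n)) (f x) - f x) powr p = 0) sequentially"
        using eventually_ge_at_top[of N] by eventually_elim (use N in \<open>simp add: clamp_norm_eq\<close>)
    qed
    show "AE x in lborel. norm (norm (clamp_norm (real (Suc n)) (f x) - f x) powr p) \<le> norm (f x) powr p" for n
      using p by (auto intro!: AE_I2 powr_mono2 norm_diff_clamp_norm_le)
  qed (use f in \<open>auto\<close>)
  \<comment> \<open>The truncation and the approximation each contribute \<open>\<delta>\<close>,
    and \<open>norm_diff_powr_le\<close> multiplies their sum by \<open>2 powr p\<close>.\<close>
  define \<delta> where "\<delta> = \<epsilon> / (2 * 2 powr p)"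
  have \<delta>: "0 < \<delta>" using \<epsilon> by (simp add: \<delta>_def)
  obtain n where n: "(LINT x|lborel. norm (clamp_norm (real (Suc n)) (f x) - f x) powr p) < \<delta>"
    using order_tendstoD(2)[OF l1, of \<delta>] \<delta> by (auto simp: eventually_sequentially)
  define M where "M = real (Suc n)"
  have M: "0 < M" by (simp add: M_def)
  have "f \<in> borel_measurable lebesgue" by (simp add: measurable_completion)
  from lebesgue_measurable_imp_measurable_on[OF this, of UNIV] obtain N g where
    N: "negligible N" and g: "\<And>k. continuous_on UNIV (g k)" "\<And>x. x \<notin> N \<Longrightarrow> (\<lambda>k. g k x) \<longlonglongrightarrow> f x"
    unfolding measurable_on_def by auto
  \<comment> \<open>The cutoff equals 1 on \<open>K\<close>, where \<open>f\<close> lives, and so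
    does not disturb the pointwise limit.\<close>
  obtain \<zeta> :: "'a \<Rightarrow> real" where \<zeta>: "continuous_on UNIV \<zeta>" "\<And>x. \<zeta> x \<in> closed_segment 1 0"
    "\<And>x. x \<in> K \<Longrightarrow> \<zeta> x = 1" "\<And>x. x \<in> - V \<Longrightarrow> \<zeta> x = 0"
    using Urysohn[of K "- V" "1::real" 0] K(1) V by (metis Compl_disjoint2 closed_Compl disjoint_eq_subset_Compl double_complement)
  have \<zeta>01: "0 \<le> \<zeta> x" "\<zeta> x \<le> 1" for x using \<zeta>(2)[of x] by (auto simp: closed_segment_eq_real_ivl)
  define h where "h k x = \<zeta> x *\<^sub>R clamp_norm M (g k x)" for k x
  have hc: "continuous_on UNIV (h k)" for k
    unfolding h_def using M by (intro continuous_intros \<zeta> continuous_on_clamp_norm g)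
  have hm [measurable]: "h k \<in> borel_measurable borel" for k
    using hc by (rule borel_measurable_continuous_onI)
  have h0: "h k x = 0" if "x \<notin> V" for k x using \<zeta>(4) that by (simp add: h_def)
  have hb: "norm (h k x) \<le> M" for k x
    unfolding h_def using mult_mono[OF \<zeta>01(2) norm_clamp_norm_le[OF M]] M \<zeta>01[of x] by simp
  have f0: "f x = 0" if "x \<notin> V" for x using K V that by auto
  have w: "integrable lborel (\<lambda>x. indicator V x *\<^sub>R ((2 * M) powr p) :: real)"
    using V emeasure_bounded_finite[OF V(2)] by (simp add: borel_open)
  have lim: "(\<lambda>k. LINT x|lebesgue. norm (h k x - clamp_norm M (f x)) powr p) \<longlonglongrightarrow> integral\<^sup>L lebesgue (\<lambda>x::'a. 0 :: real)"
  proof (rule integral_dominated_convergence[where w = "\<lambda>x. indicator V x *\<^sub>R ((2 * M) powr p)"])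
    show "AE x in lebesgue. (\<lambda>k. norm (h k x - clamp_norm M (f x)) powr p) \<longlonglongrightarrow> 0"
    proof (rule AE_I')
      show "N \<in> null_sets lebesgue" using N negligible_iff_null_sets by blast
      have "(\<lambda>k. norm (h k x - clamp_norm M (f x)) powr p) \<longlonglongrightarrow> 0" if "x \<notin> N" for x
      proof -
        have "isCont (clamp_norm M) (f x)"
          using continuous_on_clamp_norm[OF M continuous_on_id, of "UNIV :: 'b set"] by (simp add: continuous_on_eq_continuous_at)
        then have "(\<lambda>k. clamp_norm M (g k x)) \<longlonglongrightarrow> clamp_norm M (f x)"
          using g(2)[OF that] by (rule isCont_tendsto_compose)
        then have "(\<lambda>k. h k x) \<longlonglongrightarrow> \<zeta> x *\<^sub>R clamp_norm M (f x)" unfolding h_def by (intro tendsto_intros)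
        moreover have "\<zeta> x *\<^sub>R clamp_norm M (f x) = clamp_norm M (f x)"
          using \<zeta>(3)[of x] K(2)[of x] by (cases "x \<in> K") (auto simp: clamp_norm_def)
        ultimately have "(\<lambda>k. norm (h k x - clamp_norm M (f x))) \<longlonglongrightarrow> 0"
          by (simp add: tendsto_norm_zero_iff LIM_zero)
        from tendsto_powr'[OF this tendsto_const[of p]] show ?thesis using p by simp
      qed
      then show "{x \<in> space lebesgue. \<not> (\<lambda>k. norm (h k x - clamp_norm M (f x)) powr p) \<longlonglongrightarrow> 0} \<subseteq> N" by auto
    qed
    show "AE x in lebesgue. norm (norm (h k x - clamp_norm M (f x)) powr p) \<le> indicator V x *\<^sub>R ((2 * M) powr p)" for k
    proof (rule AE_I2)
      fix x
      show "norm (norm (h k x - clamp_norm M (f x)) powr p) \<le> indicator V x *\<^sub>R ((2 * M) powr p)"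
      proof (cases "x \<in> V")
        case True
        have "norm (h k x - clamp_norm M (f x)) \<le> 2 * M"
          using norm_triangle_ineq4[of "h k x" "clamp_norm M (f x)"] hb[of k x] norm_clamp_norm_le[OF M, of "f x"] by simp
        then show ?thesis using True p by (auto intro!: powr_mono2)
      qed (simp add: h0 f0 clamp_norm_def)
    qed
  qed (use w M in \<open>auto simp: integrable_completion measurable_completion\<close>)
  have hi: "integrable lborel (\<lambda>x. norm (h k x) powr p)" for k
  proof (rule Bochner_Integration.integrable_bound[OF w])
    show "AE x in lborel. norm (norm (h k x) powr p) \<le> norm (indicator V x *\<^sub>R ((2 * M) powr p) :: real)"
    proof (rule AE_I2)
      fix x show "norm (norm (h k x) powr p) \<le> norm (indicator V x *\<^sub>R ((2 * M) powr p) :: real)"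
        using hb[of k x] h0[of x k] M p by (cases "x \<in> V") (auto intro!: powr_mono2)
    qed
  qed auto
  have ci: "integrable lborel (\<lambda>x. norm (clamp_norm M (f x)) powr p)"
  proof (rule Bochner_Integration.integrable_bound[OF w])
    show "AE x in lborel. norm (norm (clamp_norm M (f x)) powr p) \<le> norm (indicator V x *\<^sub>R ((2 * M) powr p) :: real)"
    proof (rule AE_I2)
      fix x show "norm (norm (clamp_norm M (f x)) powr p) \<le> norm (indicator V x *\<^sub>R ((2 * M) powr p) :: real)"
        using norm_clamp_norm_le[OF M, of "f x"] f0[of x] M p by (cases "x \<in> V") (auto intro!: powr_mono2 simp: clamp_norm_def[of _ 0])
    qed
  qed (use M in auto)
  obtain k where k: "(LINT x|lebesgue. norm (h k x - clamp_norm M (f x)) powr p) < \<delta>"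
    using order_tendstoD(2)[OF lim, of \<delta>] \<delta> by (auto simp: eventually_sequentially)
  then have k: "(LINT x|lborel. norm (h k x - clamp_norm M (f x)) powr p) < \<delta>"
    using M by (subst (asm) integral_completion) auto
  have p': "0 \<le> p" using p by simp
  have i1: "integrable lborel (\<lambda>x. norm (h k x - clamp_norm M (f x)) powr p)"
    and i2: "integrable lborel (\<lambda>x. norm (clamp_norm M (f x) - f x) powr p)"
    and i3: "integrable lborel (\<lambda>x. norm (h k x - f x) powr p)"
    using hi ci f M by (intro integrable_norm_diff_powr[OF p']; simp)+
  have "(LINT x|lborel. norm (h k x - f x) powr p)
      \<le> (LINT x|lborel. 2 powr p * (norm (h k x - clamp_norm M (f x)) powr p + norm (clamp_norm M (f x) - f x) powr p))"
    using i1 i2 i3 norm_diff_powr_le[OF p'] by (intro integral_mono) auto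
  also have "\<dots> = 2 powr p * ((LINT x|lborel. norm (h k x - clamp_norm M (f x)) powr p) + (LINT x|lborel. norm (clamp_norm M (f x) - f x) powr p))"
    using i1 i2 by simp
  also have "\<dots> < 2 powr p * (\<delta> + \<delta>)"
    using k n by (intro mult_strict_left_mono add_strict_mono) (auto simp: M_def)
  also have "\<dots> = \<epsilon>" by (simp add: \<delta>_def)
  finally show ?thesis using hc h0 i3 by blast
qed


section \<open>Density of trigonometric polynomials\<close>

definition torus_emb :: "real \<Rightarrow> real^'n \<Rightarrow> complex^'n" where
  "torus_emb l x = (\<chi> i. cis (pi / l * x $ i))"

text \<open>Real and imaginary parts of the circle coordinates are the basic cosines and sines, so
  polynomials in them are trigonometric polynomials.\<close>

lemma trig_fun_torus_emb:
  assumes "b \<in> Basis"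
  shows "trig_fun l (\<lambda>x. torus_emb l x \<bullet> b)"
proof -
  obtain i u where b: "b = axis i u" "u \<in> Basis" using assms by (auto simp: Basis_vec_def)
  have lat: "\<exists>k::int. axis i (pi / l) $ j = of_int k * pi / l" for j
    by (cases "i = j") (auto simp: axis_def intro: exI[of _ 1] exI[of _ 0])
  have "torus_emb l x \<bullet> b = (if u = 1 then 1 else 0) * cos (axis i (pi / l) \<bullet> x) + (if u = 1 then 0 else 1) * sin (axis i (pi / l) \<bullet> x)" for x
    using b(2) by (auto simp: b(1) torus_emb_def inner_axis inner_axis' Basis_complex_def)
  then show ?thesis using trig_fun_single[OF lat] by simp
qed

text \<open>On the closed cube only points on opposite faces are identified, and there the functions
  to be approximated vanish.\<close>

lemma torus_emb_eqD:
  assumes l: "l > 0" and x: "\<And>i. \<bar>x $ i\<bar> \<le> l" "\<And>i. \<bar>y $ i\<bar> \<le> l" and e: "torus_emb l x = torus_emb l y" and ne: "x \<noteq> y"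
  shows "\<exists>i. \<bar>x $ i\<bar> = l \<and> \<bar>y $ i\<bar> = l"
proof -
  obtain i where i: "x $ i \<noteq> y $ i" using ne by (auto simp: vec_eq_iff)
  have "cis (pi / l * x $ i) = cis (pi / l * y $ i)" using e by (simp add: torus_emb_def vec_eq_iff)
  then have "sin (pi / l * x $ i) = sin (pi / l * y $ i) \<and> cos (pi / l * x $ i) = cos (pi / l * y $ i)"
    by (simp add: complex_eq_iff)
  then obtain n :: int where "pi / l * x $ i = pi / l * y $ i + 2 * pi * n" using sin_cos_eq_iff by blast
  then have "pi * (x $ i - y $ i) = pi * (2 * l * n)" using l by (simp add: field_simps)
  then have eq: "x $ i - y $ i = 2 * l * n" by simp
  have n0: "n \<noteq> 0" using eq i by auto
  have b: "\<bar>x $ i - y $ i\<bar> \<le> 2 * l" using x(1)[of i] x(2)[of i] by linarith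
  have "2 * l * \<bar>real_of_int n\<bar> \<le> 2 * l * 1" using b l by (simp add: eq abs_mult)
  then have "\<bar>real_of_int n\<bar> \<le> 1" using l by simp
  then have "n = 1 \<or> n = - 1" using n0 by linarith
  then have "x $ i - y $ i = 2 * l \<or> x $ i - y $ i = - 2 * l" using eq by auto
  then show ?thesis using x(1)[of i] x(2)[of i] l by (intro exI[of _ i]) linarith
qed

text \<open>The function descends to the image of the closed cube in the torus, where the
  Stone-Weierstrass theorem provides a polynomial in the circle coordinates.\<close>

lemma trig_uniform_approx:
  fixes h :: "real^'n::finite \<Rightarrow> real"
  assumes l: "l > 0" and h: "continuous_on UNIV h" and h0: "\<And>x i. l \<le> \<bar>x $ i\<bar> \<Longrightarrow> h x = 0" and \<delta>: "0 < \<delta>"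
  shows "\<exists>xs. lattice_trig l xs \<and> (\<forall>x\<in>cell l. \<bar>tp xs x - h x\<bar> < \<delta>)"
proof -
  define S :: "(real^'n) set" where "S = cbox (\<chi> i. - l) (\<chi> i. l)"
  have S: "x \<in> S \<longleftrightarrow> (\<forall>i. \<bar>x $ i\<bar> \<le> l)" for x by (auto simp: S_def mem_box_cart abs_le_iff) (metis minus_le_iff)+
  have cS: "compact S" by (simp add: S_def)
  have ce: "continuous_on S (torus_emb l)"
    unfolding torus_emb_def cis_conv_exp by (intro continuous_intros)
  \<comment> \<open>A continuous map from a compact space onto its image in a Hausdorff space is a
    quotient map; this makes the descended function continuous.\<close>
  have q: "quotient_map (top_of_set S) (top_of_set (torus_emb l ` S)) (torus_emb l)"
    by (rule T1_Spaces.continuous_imp_quotient_map)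
       (use ce cS in \<open>auto simp: compact_space_subtopology Hausdorff_space_subtopology\<close>)
  have hS: "continuous_map (top_of_set S) euclideanreal h"
    using h continuous_on_subset by auto
  have wd: "h x = h y" if xy: "x \<in> topspace (top_of_set S)" "y \<in> topspace (top_of_set S)" "torus_emb l x = torus_emb l y" for x y
  proof (cases "x = y")
    case False
    then obtain i where "\<bar>x $ i\<bar> = l" "\<bar>y $ i\<bar> = l" using torus_emb_eqD[OF l _ _ xy(3)] xy(1,2) S by auto
    then show ?thesis using h0[of x i] h0[of y i] by simp
  qed simp
  have "\<exists>g. continuous_map (top_of_set (torus_emb l ` S)) euclideanreal g \<and> (\<forall>x\<in>S. g (torus_emb l x) = h x)"
  proof (rule quotient_map_lift_exists[OF q hS])
    show "h x = h y" if "x \<in> topspace (top_of_set S)" "y \<in> topspace (top_of_set S)" "torus_emb l x = torus_emb l y" for x y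
      using that by (rule wd)
  next
    fix g assume "continuous_map (top_of_set (torus_emb l ` S)) euclideanreal g"
      and "\<And>x. x \<in> topspace (top_of_set S) \<Longrightarrow> g (torus_emb l x) = h x"
    then show "\<exists>g. continuous_map (top_of_set (torus_emb l ` S)) euclideanreal g \<and> (\<forall>x\<in>S. g (torus_emb l x) = h x)"
      by (intro exI[of _ g]) simp
  qed
  then obtain g where g: "continuous_map (top_of_set (torus_emb l ` S)) euclideanreal g" "\<And>x. x \<in> S \<Longrightarrow> g (torus_emb l x) = h x"
    by blast
  have gc: "continuous_on (torus_emb l ` S) g" using g(1) by simp
  obtain P where P: "real_polynomial_function P" "\<And>y. y \<in> torus_emb l ` S \<Longrightarrow> \<bar>g y - P y\<bar> < \<delta>"
    using Stone_Weierstrass_real_polynomial_function[OF compact_continuous_image[OF ce cS] gc \<delta>] by blast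
  have "trig_fun l (\<lambda>x. P (torus_emb l x))" by (rule trig_fun_polynomial[OF P(1) trig_fun_torus_emb])
  then obtain xs where xs: "lattice_trig l xs" "\<And>x. P (torus_emb l x) = tp xs x" unfolding trig_fun_def by blast
  have "\<bar>tp xs x - h x\<bar> < \<delta>" if "x \<in> cell l" for x
  proof -
    have "x \<in> S" using that by (auto simp: cell_def S abs_le_iff less_imp_le) (smt (verit))
    then show ?thesis using P(2)[of "torus_emb l x"] g(2)[of x] xs(2)[of x] by auto
  qed
  then show ?thesis using xs(1) by blast
qed

lemma dense_trig_Lp:
  fixes f :: "real^'n::finite \<Rightarrow> real"
  assumes p: "1 \<le> p" and l: "l > 0" and f: "f \<in> borel_measurable borel" "integrable lborel (\<lambda>x. \<bar>f x\<bar> powr p)"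
    and K: "closed K" "\<And>x. x \<notin> K \<Longrightarrow> f x = 0" "\<And>x i. x \<in> K \<Longrightarrow> \<bar>x $ i\<bar> < l" and \<epsilon>: "0 < \<epsilon>"
  shows "\<exists>xs. lattice_trig l xs \<and> set_integrable lborel (cell l) (\<lambda>x. \<bar>tp xs x - f x\<bar> powr p) \<and>
     (LINT x:cell l|lborel. \<bar>tp xs x - f x\<bar> powr p) < \<epsilon>"
proof -
  define V :: "(real^'n) set" where "V = box (\<chi> i. - l) (\<chi> i. l)"
  have V: "x \<in> V \<longleftrightarrow> (\<forall>i. \<bar>x $ i\<bar> < l)" for x by (auto simp: V_def mem_box_cart abs_less_iff) (metis minus_less_iff)+
  have V': "open V" "bounded V" "K \<subseteq> V" using K(3) V by (auto simp: V_def)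
  define m where "m = measure lborel (cell l :: (real^'n) set)"
  have m: "m > 0" unfolding m_def by (rule cell_measure_pos[OF l])
  define \<epsilon>1 where "\<epsilon>1 = \<epsilon> / (2 * 2 powr p)"
  have \<epsilon>1: "\<epsilon>1 > 0" using \<epsilon> by (simp add: \<epsilon>1_def)
  \<comment> \<open>A uniform error \<open>\<delta>\<close> has p-th power integral at most
    \<open>\<delta> powr p * m = \<epsilon>1\<close> over the cell.\<close>
  define \<delta> where "\<delta> = (\<epsilon>1 / m) powr (1/p)"
  have \<delta>: "\<delta> > 0" "\<delta> powr p = \<epsilon>1 / m" using \<epsilon>1 m p by (auto simp: \<delta>_def powr_powr)
  have p0: "0 < p" using p by simp
  have fi: "integrable lborel (\<lambda>x. norm (f x) powr p)" using f(2) by simp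
  obtain h where h: "continuous_on UNIV h" "\<And>x. x \<notin> V \<Longrightarrow> h x = 0" "integrable lborel (\<lambda>x. norm (h x - f x) powr p)"
     "(LINT x|lborel. norm (h x - f x) powr p) < \<epsilon>1"
    using dense_continuous_Lp[OF p0 f(1) fi K(1,2) V' \<epsilon>1] by auto
  have h0: "h x = 0" if "l \<le> \<bar>x $ i\<bar>" for x i using h(2)[of x] that V[of x] not_le by blast
  obtain xs where xs: "lattice_trig l xs" "\<And>x. x \<in> cell l \<Longrightarrow> \<bar>tp xs x - h x\<bar> < \<delta>"
    using trig_uniform_approx[OF l h(1) _ \<delta>(1)] h0 by metis
  note [measurable] = f(1) borel_measurable_continuous_onI[OF h(1)] borel_measurable_continuous_onI[OF continuous_on_tp[OF continuous_on_id], of xs]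
  have i1: "set_integrable lborel (cell l) (\<lambda>x. \<bar>tp xs x - h x\<bar> powr p)"
    using p0 by (intro cell_integrable continuous_on_powr' continuous_intros h) auto
  have i2: "set_integrable lborel (cell l) (\<lambda>x. \<bar>h x - f x\<bar> powr p)"
    using integrable_mult_indicator[OF _ h(3), of "cell l"] by (simp add: set_integrable_def)
  have pt: "\<bar>tp xs x - f x\<bar> powr p \<le> 2 powr p * (\<bar>tp xs x - h x\<bar> powr p + \<bar>h x - f x\<bar> powr p)" for x
    using norm_diff_powr_le[of p "tp xs x" "f x" "h x"] p by simp
  have i12: "set_integrable lborel (cell l) (\<lambda>x. 2 powr p * (\<bar>tp xs x - h x\<bar> powr p + \<bar>h x - f x\<bar> powr p))"
    by (intro set_integrable_mult_right set_integral_add(1) i1 i2)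
  have i3: "set_integrable lborel (cell l) (\<lambda>x. \<bar>tp xs x - f x\<bar> powr p)"
    unfolding set_integrable_def
  proof (rule Bochner_Integration.integrable_bound[OF i12[unfolded set_integrable_def]])
    show "AE x in lborel. norm (indicator (cell l) x *\<^sub>R \<bar>tp xs x - f x\<bar> powr p)
      \<le> norm (indicator (cell l) x *\<^sub>R (2 powr p * (\<bar>tp xs x - h x\<bar> powr p + \<bar>h x - f x\<bar> powr p)))"
      using pt by (auto intro!: AE_I2 simp: indicator_def)
  qed measurable
  have "(LINT x:cell l|lborel. \<bar>tp xs x - f x\<bar> powr p)
     \<le> (LINT x:cell l|lborel. 2 powr p * (\<bar>tp xs x - h x\<bar> powr p + \<bar>h x - f x\<bar> powr p))"
    using i3 i12 pt by (intro set_integral_mono) auto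
  also have "\<dots> = 2 powr p * ((LINT x:cell l|lborel. \<bar>tp xs x - h x\<bar> powr p) + (LINT x:cell l|lborel. \<bar>h x - f x\<bar> powr p))"
    using i1 i2 by (simp add: set_integral_add)
  also have "\<dots> < 2 powr p * (\<epsilon>1 + \<epsilon>1)"
  proof (intro mult_strict_left_mono add_le_less_mono)
    have "(LINT x:cell l|lborel. \<bar>tp xs x - h x\<bar> powr p) \<le> (LINT x:(cell l :: (real^'n) set)|lborel. \<delta> powr p)"
    proof (rule set_integral_mono[OF i1])
      show "\<bar>tp xs x - h x\<bar> powr p \<le> \<delta> powr p" if "x \<in> cell l" for x
        using xs(2)[OF that] p by (intro powr_mono2) auto
    qed (intro cell_integrable continuous_intros)
    also have "\<dots> = \<epsilon>1" using m by (simp add: cell_integral_const \<delta>(2) m_def)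
    finally show "(LINT x:cell l|lborel. \<bar>tp xs x - h x\<bar> powr p) \<le> \<epsilon>1" .
    have "(LINT x:cell l|lborel. \<bar>h x - f x\<bar> powr p) \<le> (LINT x|lborel. \<bar>h x - f x\<bar> powr p)"
      unfolding set_lebesgue_integral_def
      using h(3) i2 by (intro integral_mono) (auto simp: set_integrable_def indicator_def)
    then show "(LINT x:cell l|lborel. \<bar>h x - f x\<bar> powr p) < \<epsilon>1" using h(4) by simp
  qed simp
  also have "\<dots> = \<epsilon>" by (simp add: \<epsilon>1_def)
  finally show ?thesis using xs(1) i3 by blast
qed

text \<open>The prescribed decay leaves room for the weight \<open>(2 ^ k) powr p\<close>: even the
  weighted integrals are summable, so almost everywhere the increments are at most a constant times
  \<open>(1/2) ^ k\<close>.\<close>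

lemma Lp_Cauchy_AE_convergent:
  fixes F :: "nat \<Rightarrow> 'a \<Rightarrow> 'b::euclidean_space"
  assumes p: "0 < p" and m: "\<And>k. F k \<in> borel_measurable M" and c: "0 \<le> c"
    and i: "\<And>k. integrable M (\<lambda>x. norm (F (Suc k) x - F k x) powr p)"
    and b: "\<And>k. (LINT x|M. norm (F (Suc k) x - F k x) powr p) \<le> c * (1/2) ^ k / (2 ^ k) powr p"
  shows "AE x in M. convergent (\<lambda>k. F k x)"
proof -
  note [measurable] = m
  define g where "g k x = ennreal ((2 ^ k) powr p * norm (F (Suc k) x - F k x) powr p)" for k x
  have gm [measurable]: "g k \<in> borel_measurable M" for k unfolding g_def by measurable
  have "(\<integral>\<^sup>+x. (\<Sum>k. g k x) \<partial>M) = (\<Sum>k. (\<integral>\<^sup>+x. g k x \<partial>M))" by (rule nn_integral_suminf) measurable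
  also have "\<dots> \<le> (\<Sum>k. ennreal (c * (1/2) ^ k))"
  proof (rule suminf_le)
    fix k
    have "(\<integral>\<^sup>+x. g k x \<partial>M) = ennreal (LINT x|M. (2 ^ k) powr p * norm (F (Suc k) x - F k x) powr p)"
      unfolding g_def using i by (intro nn_integral_eq_integral) auto
    also have "\<dots> \<le> ennreal (c * (1/2) ^ k)"
    proof (rule ennreal_leI)
      have "(2 ^ k) powr p * (LINT x|M. norm (F (Suc k) x - F k x) powr p) \<le> (2 ^ k) powr p * (c * (1/2) ^ k / (2 ^ k) powr p)"
        by (rule mult_left_mono[OF b]) simp
      then show "(LINT x|M. (2 ^ k) powr p * norm (F (Suc k) x - F k x) powr p) \<le> c * (1/2) ^ k" by simp
    qed
    finally show "(\<integral>\<^sup>+x. g k x \<partial>M) \<le> ennreal (c * (1/2) ^ k)" .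
  qed auto
  also have "\<dots> < \<infinity>"
  proof -
    have "summable (\<lambda>k. c * (1/2::real) ^ k)" by (intro summable_mult summable_geometric) simp
    then show ?thesis using c by (subst suminf_ennreal2) auto
  qed
  finally have "AE x in M. (\<Sum>k. g k x) \<noteq> \<infinity>" by (intro nn_integral_PInf_AE) auto
  then show ?thesis
  proof eventually_elim
    case (elim x)
    define S where "S = enn2real (\<Sum>k. g k x)"
    have S: "(2 ^ k) powr p * norm (F (Suc k) x - F k x) powr p \<le> S" for k
    proof -
      have "g k x \<le> (\<Sum>k. g k x)" using sum_le_suminf[of "\<lambda>k. g k x" "{k}"] by simp
      also have "\<dots> = ennreal S" using elim by (simp add: S_def top.not_eq_extremum)
      finally show ?thesis unfolding g_def by (subst (asm) ennreal_le_iff) (auto simp: S_def)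
    qed
    have "norm (F (Suc k) x - F k x) \<le> S powr (1/p) * (1/2) ^ k" for k
    proof -
      have "(2 ^ k * norm (F (Suc k) x - F k x)) powr p \<le> S" using S[of k] by (simp add: powr_mult)
      then have "((2 ^ k * norm (F (Suc k) x - F k x)) powr p) powr (1/p) \<le> S powr (1/p)"
        using p by (intro powr_mono2) auto
      then have "2 ^ k * norm (F (Suc k) x - F k x) \<le> S powr (1/p)" using p by (simp add: powr_powr)
      then show ?thesis by (simp add: field_simps power_divide)
    qed
    moreover have "summable (\<lambda>k. S powr (1/p) * (1/2::real) ^ k)" by (intro summable_mult summable_geometric) simp
    ultimately have "summable (\<lambda>k. F (Suc k) x - F k x)"
      by (rule summable_comparison_test'[rotated, where N = 0])
    then have "convergent (\<lambda>n. \<Sum>k<n. F (Suc k) x - F k x)" by (simp add: summable_iff_convergent)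
    moreover have "(\<Sum>k<n. F (Suc k) x - F k x) = F n x - F 0 x" for n by (rule sum_lessThan_telescope)
    ultimately have "convergent (\<lambda>n. F n x - F 0 x)" by (simp only:)
    then have "convergent (\<lambda>n. (F n x - F 0 x) + F 0 x)" by (intro convergent_add convergent_const)
    then show "convergent (\<lambda>k. F k x)" by simp
  qed
qed

text \<open>Fatou's lemma with bounds that converge themselves, so that the limit inherits the
  limiting constant.\<close>

lemma Lp_fatou:
  fixes F :: "nat \<Rightarrow> 'a \<Rightarrow> 'b::euclidean_space"
  assumes p: "0 < p" and m: "\<And>k. F k \<in> borel_measurable M" "G \<in> borel_measurable M"
    and lim: "AE x in M. (\<lambda>k. F k x) \<longlonglongrightarrow> G x"
    and i: "\<And>k. integrable M (\<lambda>x. norm (F k x) powr p)" and b: "\<And>k. (LINT x|M. norm (F k x) powr p) \<le> c k" and c: "c \<longlonglongrightarrow> C"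
  shows "integrable M (\<lambda>x. norm (G x) powr p) \<and> (LINT x|M. norm (G x) powr p) \<le> C"
proof -
  note [measurable] = m
  have c0: "0 \<le> c k" for k using b[of k] by (rule order_trans[rotated]) auto
  have C0: "0 \<le> C" using c c0 LIMSEQ_le_const by blast
  have "(\<integral>\<^sup>+x. ennreal (norm (G x) powr p) \<partial>M) = (\<integral>\<^sup>+x. liminf (\<lambda>k. ennreal (norm (F k x) powr p)) \<partial>M)"
  proof (rule nn_integral_cong_AE)
    show "AE x in M. ennreal (norm (G x) powr p) = liminf (\<lambda>k. ennreal (norm (F k x) powr p))"
      using lim
    proof eventually_elim
      case (elim x)
      have "(\<lambda>k. norm (F k x) powr p) \<longlonglongrightarrow> norm (G x) powr p"
        using p elim by (intro tendsto_powr' tendsto_intros) auto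
      then have "(\<lambda>k. ennreal (norm (F k x) powr p)) \<longlonglongrightarrow> ennreal (norm (G x) powr p)" by (rule tendsto_ennrealI)
      then show ?case by (rule lim_imp_Liminf[OF sequentially_bot, symmetric])
    qed
  qed
  also have "\<dots> \<le> liminf (\<lambda>k. \<integral>\<^sup>+x. ennreal (norm (F k x) powr p) \<partial>M)" by (rule nn_integral_liminf) measurable
  also have "\<dots> \<le> liminf (\<lambda>k. ennreal (c k))"
  proof (intro Liminf_mono always_eventually allI)
    fix k
    have "(\<integral>\<^sup>+x. ennreal (norm (F k x) powr p) \<partial>M) = ennreal (LINT x|M. norm (F k x) powr p)"
      using i by (intro nn_integral_eq_integral) auto
    also have "\<dots> \<le> ennreal (c k)" by (rule ennreal_leI[OF b])
    finally show "(\<integral>\<^sup>+x. ennreal (norm (F k x) powr p) \<partial>M) \<le> ennreal (c k)" .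
  qed
  also have "\<dots> = ennreal C" by (rule lim_imp_Liminf[OF sequentially_bot tendsto_ennrealI[OF c]])
  finally have le: "(\<integral>\<^sup>+x. ennreal (norm (G x) powr p) \<partial>M) \<le> ennreal C" .
  have int: "integrable M (\<lambda>x. norm (G x) powr p)"
    using le by (intro integrableI_nonneg) (auto simp: less_top[symmetric] top_unique)
  have "ennreal (LINT x|M. norm (G x) powr p) \<le> ennreal C"
    using le int by (subst (asm) nn_integral_eq_integral) auto
  then show ?thesis using int C0 by (simp add: ennreal_le_iff)
qed

section \<open>Smooth functions\<close>

text \<open>Any family of derivatives may be exhibited instead of \<open>frechet_derivative\<close>,
  which makes the closure properties below provable by induction on \<open>k\<close>.\<close>

lemma Ck_Suc_iff:
  "Ck (Suc k) f \<longleftrightarrow> (\<exists>f'. (\<forall>x. (f has_derivative f' x) (at x)) \<and> (\<forall>v. Ck k (\<lambda>x. f' x v)))"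
proof
  assume "Ck (Suc k) f"
  then show "\<exists>f'. (\<forall>x. (f has_derivative f' x) (at x)) \<and> (\<forall>v. Ck k (\<lambda>x. f' x v))"
    by (intro exI[of _ "\<lambda>x. frechet_derivative f (at x)"]) (auto simp: frechet_derivative_works[symmetric])
next
  assume "\<exists>f'. (\<forall>x. (f has_derivative f' x) (at x)) \<and> (\<forall>v. Ck k (\<lambda>x. f' x v))"
  then obtain f' where f': "\<And>x. (f has_derivative f' x) (at x)" "\<And>v. Ck k (\<lambda>x. f' x v)" by blast
  have "frechet_derivative f (at x) = f' x" for x using frechet_derivative_at[OF f'(1)] by simp
  then show "Ck (Suc k) f" using f' by (auto simp: differentiable_def)
qed

lemma Ck_imp_continuous: "Ck k f \<Longrightarrow> continuous_on UNIV f"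
proof (cases k)
  case (Suc m)
  assume "Ck k f"
  then have "\<forall>x. f differentiable at x" unfolding Suc by simp
  then show ?thesis by (meson continuous_at_imp_continuous_on differentiable_imp_continuous_within)
qed simp

lemma Ck_Suc_imp_Ck: "Ck (Suc k) f \<Longrightarrow> Ck k f"
proof (induction k arbitrary: f)
  case 0
  show ?case using Ck_imp_continuous[OF 0] by simp
next
  case (Suc k)
  then show ?case unfolding Ck_Suc_iff[of "Suc k" f] Ck_Suc_iff[of k f] by blast
qed

lemma Ck_const: "Ck k (\<lambda>x::'a::euclidean_space. c)"
proof (induction k arbitrary: c)
  case (Suc k)
  show ?case unfolding Ck_Suc_iff by (rule exI[of _ "\<lambda>x v. 0"]) (use Suc in auto)
qed simp

lemma Ck_linear: "bounded_linear f \<Longrightarrow> Ck k f"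
proof (cases k)
  case (Suc m)
  assume f: "bounded_linear f"
  show ?thesis unfolding Suc Ck_Suc_iff
    by (rule exI[of _ "\<lambda>x. f"]) (use f in \<open>auto intro: bounded_linear_imp_has_derivative Ck_const\<close>)
qed (simp add: linear_continuous_on)

lemma Ck_add: "Ck k f \<Longrightarrow> Ck k g \<Longrightarrow> Ck k (\<lambda>x. f x + g x)"
proof (induction k arbitrary: f g)
  case (Suc k)
  from Suc.prems obtain f' g' where f: "\<And>x. (f has_derivative f' x) (at x)" "\<And>v. Ck k (\<lambda>x. f' x v)"
    and g: "\<And>x. (g has_derivative g' x) (at x)" "\<And>v. Ck k (\<lambda>x. g' x v)" unfolding Ck_Suc_iff by blast
  show ?case unfolding Ck_Suc_iff
    by (rule exI[of _ "\<lambda>x v. f' x v + g' x v"]) (use f g Suc.IH in \<open>auto intro: has_derivative_add\<close>)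
qed (auto intro: continuous_intros)

lemma Ck_mult: "Ck k f \<Longrightarrow> Ck k g \<Longrightarrow> Ck k (\<lambda>x. f x * g x)"
proof (induction k arbitrary: f g)
  case (Suc k)
  note Ck = Ck_Suc_imp_Ck[OF Suc.prems(1)] Ck_Suc_imp_Ck[OF Suc.prems(2)]
  from Suc.prems obtain f' g' where f: "\<And>x. (f has_derivative f' x) (at x)" "\<And>v. Ck k (\<lambda>x. f' x v)"
    and g: "\<And>x. (g has_derivative g' x) (at x)" "\<And>v. Ck k (\<lambda>x. g' x v)" unfolding Ck_Suc_iff by blast
  show ?case unfolding Ck_Suc_iff
    by (rule exI[of _ "\<lambda>x v. f x * g' x v + f' x v * g x"])
       (use f g Ck in \<open>auto intro!: has_derivative_mult Ck_add Suc.IH\<close>)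
qed (auto intro: continuous_intros)

lemma Ck_sum: "(\<And>i. i \<in> I \<Longrightarrow> Ck k (f i)) \<Longrightarrow> Ck k (\<lambda>x. \<Sum>i\<in>I. f i x)"
  by (induction I rule: infinite_finite_induct) (auto intro: Ck_const Ck_add)

lemma Ck_prod: "(\<And>i. i \<in> I \<Longrightarrow> Ck k (f i)) \<Longrightarrow> Ck k (\<lambda>x. \<Prod>i\<in>I. f i x)"
  by (induction I rule: infinite_finite_induct) (auto intro: Ck_const Ck_mult)

lemma Ck_minus: "Ck k f \<Longrightarrow> Ck k (\<lambda>x. - f x)"
  using Ck_mult[OF Ck_const[of k "- 1"], of f] by simp

lemma Ck_diff: "Ck k f \<Longrightarrow> Ck k g \<Longrightarrow> Ck k (\<lambda>x. f x - g x)"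
  using Ck_add[of k f "\<lambda>x. - g x"] Ck_minus[of k g] by simp

lemma Ck_inverse: "(\<And>x. f x \<noteq> 0) \<Longrightarrow> Ck k f \<Longrightarrow> Ck k (\<lambda>x. inverse (f x))"
proof (induction k arbitrary: f)
  case (Suc k)
  note Ck = Ck_Suc_imp_Ck[OF Suc.prems(2)]
  from Suc.prems obtain f' where f: "\<And>x. (f has_derivative f' x) (at x)" "\<And>v. Ck k (\<lambda>x. f' x v)"
    unfolding Ck_Suc_iff by blast
  show ?case unfolding Ck_Suc_iff
    by (rule exI[of _ "\<lambda>x v. - (inverse (f x) * f' x v * inverse (f x))"])
       (use f Ck Suc.prems(1) in \<open>auto intro!: has_derivative_inverse Ck_minus Ck_mult Suc.IH\<close>)
qed (auto intro: continuous_intros)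

lemma Ck_affine: "Ck k f \<Longrightarrow> Ck k (\<lambda>x. f (c *\<^sub>R x + a))"
proof (induction k arbitrary: f)
  case 0
  then show ?case by (auto intro!: continuous_on_compose2[of UNIV f] continuous_intros)
next
  case (Suc k)
  from Suc.prems obtain f' where f: "\<And>x. (f has_derivative f' x) (at x)" "\<And>v. Ck k (\<lambda>x. f' x v)"
    unfolding Ck_Suc_iff by blast
  have "((\<lambda>x. f (c *\<^sub>R x + a)) has_derivative (\<lambda>v. f' (c *\<^sub>R x + a) (c *\<^sub>R v))) (at x)" for x
    by (rule has_derivative_compose[OF _ f(1)]) (auto intro!: derivative_eq_intros)
  then show ?case unfolding Ck_Suc_iff
    by (intro exI[of _ "\<lambda>x v. f' (c *\<^sub>R x + a) (c *\<^sub>R v)"]) (auto intro: Suc.IH f(2))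
qed

lemma Ck_compose_real: "Ck k g \<Longrightarrow> Ck k f \<Longrightarrow> Ck k (\<lambda>x. g (f x :: real))"
proof (induction k arbitrary: f g)
  case 0
  then show ?case by (auto intro!: continuous_on_compose2[of UNIV g])
next
  case (Suc k)
  note Ck = Ck_Suc_imp_Ck[OF Suc.prems(1)] Ck_Suc_imp_Ck[OF Suc.prems(2)]
  from Suc.prems obtain f' g' where f: "\<And>x. (f has_derivative f' x) (at x)" "\<And>v. Ck k (\<lambda>x. f' x v)"
    and g: "\<And>x. (g has_derivative g' x) (at x)" "\<And>v. Ck k (\<lambda>x. g' x v)" unfolding Ck_Suc_iff by blast
  have lin: "g' y t = g' y 1 * t" for y t
    using linear_cmul[OF has_derivative_linear[OF g(1)], of y t 1] by simp
  have "((\<lambda>x. g (f x)) has_derivative (\<lambda>v. g' (f x) 1 * f' x v)) (at x)" for x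
  proof -
    have "((\<lambda>x. g (f x)) has_derivative (\<lambda>v. g' (f x) (f' x v))) (at x)"
      by (rule has_derivative_compose[OF f(1) g(1)])
    moreover have "(\<lambda>v. g' (f x) (f' x v)) = (\<lambda>v. g' (f x) 1 * f' x v)" by (rule ext) (rule lin)
    ultimately show ?thesis by (simp only:)
  qed
  then show ?case unfolding Ck_Suc_iff
    using Ck_mult[OF Suc.IH[OF g(2) Ck(2)] f(2)]
    by (intro exI[of _ "\<lambda>x v. g' (f x) 1 * f' x v"]) simp
qed

text \<open>The factor \<open>t\<^bsup>- n\<^esup>\<close> makes this family closed under differentiation up to linear combinations.\<close>

definition flat_exp :: "nat \<Rightarrow> real \<Rightarrow> real" where
  "flat_exp n t = (if t \<le> 0 then 0 else (1 / t) ^ n * exp (- 1 / t))"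

text \<open>For \<open>f t = 1 / t\<close> this is the derivative of \<open>flat_exp\<close> on the
  positive half-line; only the equation \<open>f' = - f\<^sup>2\<close> enters, which keeps the
  computation free of divisions.\<close>

lemma power_times_exp_minus_derivative:
  assumes "(f has_real_derivative - ((f t)\<^sup>2)) (at t)"
  shows "((\<lambda>t. f t ^ n * exp (- f t)) has_real_derivative
    (f t ^ (n + 2) * exp (- f t) - real n * (f t ^ (n + 1) * exp (- f t)))) (at t)"
proof -
  have e: "((\<lambda>t. exp (- f t)) has_real_derivative exp (- f t) * (f t)\<^sup>2) (at t)"
    by (auto intro!: derivative_eq_intros assms)
  show ?thesis
    by (rule DERIV_cong[OF DERIV_mult[OF DERIV_power[OF assms] e]])
       (cases n; simp add: power2_eq_square algebra_simps)
qed

lemma flat_exp_has_derivative: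
  "(flat_exp n has_real_derivative (flat_exp (n + 2) t - real n * flat_exp (n + 1) t)) (at t)"
proof -
  consider "t < 0" | "t = 0" | "t > 0" by linarith
  then show ?thesis
  proof cases
    case 1
    have "((\<lambda>t. 0) has_real_derivative 0) (at t)" by simp
    moreover have "eventually (\<lambda>s. flat_exp n s = 0) (nhds t)"
      using eventually_nhds_in_open[of "{..<0}" t] 1 by (auto simp: flat_exp_def elim!: eventually_mono)
    ultimately have "(flat_exp n has_real_derivative 0) (at t)"
      using DERIV_cong_ev[of t t "flat_exp n" "\<lambda>_. 0" 0 0] by simp
    then show ?thesis using 1 by (simp add: flat_exp_def)
  next
    case 3
    have d: "((\<lambda>t. (1 / t) ^ n * exp (- 1 / t)) has_real_derivative
        ((1 / t) ^ (n + 2) * exp (- 1 / t) - real n * ((1 / t) ^ (n + 1) * exp (- 1 / t)))) (at t)"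
    proof -
      have "((\<lambda>t. 1 / t) has_real_derivative - ((1 / t)\<^sup>2)) (at t)"
        using 3 by (auto intro!: derivative_eq_intros simp: power2_eq_square)
      from power_times_exp_minus_derivative[OF this, of n] show ?thesis by simp
    qed
    have "eventually (\<lambda>s. flat_exp n s = (1 / s) ^ n * exp (- 1 / s)) (nhds t)"
      using eventually_nhds_in_open[of "{0<..}" t] 3 by (auto simp: flat_exp_def elim!: eventually_mono)
    note ev = this
    have "(flat_exp n has_real_derivative
        ((1 / t) ^ (n + 2) * exp (- 1 / t) - real n * ((1 / t) ^ (n + 1) * exp (- 1 / t)))) (at t)"
      by (subst DERIV_cong_ev[OF refl ev refl]) (rule d)
    then show ?thesis using 3 by (simp add: flat_exp_def)
  next
    case 2
    \<comment> \<open>With \<open>y = 1 / h\<close> the right-hand difference quotient is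
      \<open>y ^ (n + 1) / exp y\<close>, which tends to 0.\<close>
    have "((\<lambda>h. flat_exp n h / h) \<longlongrightarrow> 0) (at_right 0)"
    proof -
      have "((\<lambda>x. x ^ (n + 1) / exp x) \<longlongrightarrow> (0::real)) at_top" by (rule tendsto_power_div_exp_0)
      from filterlim_compose[OF this filterlim_inverse_at_top_right]
      have "((\<lambda>h. inverse h ^ (n + 1) / exp (inverse h)) \<longlongrightarrow> (0::real)) (at_right 0)" .
      then show ?thesis
      proof (rule Lim_transform_eventually)
        show "eventually (\<lambda>h. inverse h ^ (n + 1) / exp (inverse h) = flat_exp n h / h) (at_right 0)"
          using eventually_at_right_less[of 0]
          by eventually_elim (auto simp: flat_exp_def exp_minus field_simps)
      qed
    qed
    moreover have "((\<lambda>h. flat_exp n h / h) \<longlongrightarrow> 0) (at_left 0)"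
    proof (rule tendsto_eventually)
      show "eventually (\<lambda>h. flat_exp n h / h = 0) (at_left 0)"
        using eventually_at_left_field[of _ "0::real"] by (auto simp: flat_exp_def intro!: exI[of _ "-1"])
    qed
    ultimately have "((\<lambda>h. flat_exp n h / h) \<longlongrightarrow> 0) (at 0)" by (simp add: filterlim_split_at)
    then have "(flat_exp n has_real_derivative 0) (at 0)"
      unfolding DERIV_def by (simp add: flat_exp_def[of n 0])
    then show ?thesis using 2 by (simp add: flat_exp_def)
  qed
qed

lemma Ck_flat_exp: "Ck k (flat_exp n)"
proof (induction k arbitrary: n)
  case 0
  then show ?case using flat_exp_has_derivative[of n] DERIV_isCont by (auto simp: continuous_on_eq_continuous_at)
next
  case (Suc k)
  show ?case unfolding Ck_Suc_iff
  proof (intro exI conjI allI)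
    show "(flat_exp n has_derivative (\<lambda>v. (flat_exp (n + 2) x - real n * flat_exp (n + 1) x) * v)) (at x)" for x
      using flat_exp_has_derivative[of n x] unfolding has_field_derivative_def .
    show "Ck k (\<lambda>x. (flat_exp (n + 2) x - real n * flat_exp (n + 1) x) * v)" for v
      by (intro Ck_mult Ck_diff Ck_const Suc)
  qed
qed

definition smooth_step :: "real \<Rightarrow> real" where
  "smooth_step t = flat_exp 0 t * inverse (flat_exp 0 t + flat_exp 0 (1 - t))"

lemma smooth_step_denom_pos: "flat_exp 0 t + flat_exp 0 (1 - t) > 0"
  by (auto simp: flat_exp_def add_pos_pos)

lemma Ck_smooth_step: "Ck k smooth_step"
proof -
  have "Ck k (\<lambda>t. flat_exp 0 (1 - t))" using Ck_affine[OF Ck_flat_exp, of k 0 "- 1" 1] by simp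
  then show ?thesis unfolding smooth_step_def[abs_def]
    by (intro Ck_mult Ck_inverse Ck_add Ck_flat_exp) (use smooth_step_denom_pos in \<open>auto simp: less_imp_neq[symmetric]\<close>)
qed

lemma smooth_step_range: "0 \<le> smooth_step t" "smooth_step t \<le> 1"
proof -
  have a: "0 \<le> flat_exp 0 s" for s by (simp add: flat_exp_def)
  show "0 \<le> smooth_step t" unfolding smooth_step_def using a smooth_step_denom_pos[of t] by simp
  show "smooth_step t \<le> 1" unfolding smooth_step_def using a[of "1 - t"] smooth_step_denom_pos[of t]
    by (simp add: divide_inverse[symmetric])
qed

lemma smooth_step_eq_1: "1 \<le> t \<Longrightarrow> smooth_step t = 1"
  by (auto simp: smooth_step_def flat_exp_def)

lemma smooth_step_eq_0: "t \<le> 0 \<Longrightarrow> smooth_step t = 0"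
  by (auto simp: smooth_step_def flat_exp_def)

abbreviation smooth :: "('a::euclidean_space \<Rightarrow> real) \<Rightarrow> bool" where
  "smooth f \<equiv> \<forall>k. Ck k f"

text \<open>The factor 4/3 lets the argument reach 1 at distance \<open>r / 2\<close> from the
  centre, and it is 0 at distance \<open>r\<close>. The squared norm keeps the function smooth at
  the centre.\<close>

definition bump :: "'a::euclidean_space \<Rightarrow> real \<Rightarrow> 'a \<Rightarrow> real" where
  "bump x0 r x = smooth_step (4/3 * (1 - (norm (x - x0) / r)\<^sup>2))"

lemma smooth_bump: "smooth (bump x0 r)"
proof
  fix k
  have "bump x0 r = (\<lambda>x. smooth_step (4/3 * (1 - inverse (r * r) * (\<Sum>b\<in>Basis. ((x \<bullet> b) - x0 \<bullet> b) * ((x \<bullet> b) - x0 \<bullet> b)))))"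
  proof
    fix x
    have "(norm (x - x0))\<^sup>2 = (\<Sum>b\<in>Basis. ((x \<bullet> b) - x0 \<bullet> b) * ((x \<bullet> b) - x0 \<bullet> b))"
      unfolding power2_norm_eq_inner by (subst euclidean_inner) (simp add: inner_diff_left)
    moreover have "(norm (x - x0) / r)\<^sup>2 = inverse (r * r) * (norm (x - x0))\<^sup>2"
      by (simp add: power2_eq_square divide_inverse)
    ultimately show "bump x0 r x = smooth_step (4/3 * (1 - inverse (r * r) * (\<Sum>b\<in>Basis. ((x \<bullet> b) - x0 \<bullet> b) * ((x \<bullet> b) - x0 \<bullet> b))))"
      by (simp only: bump_def)
  qed
  moreover have "Ck k (\<lambda>x. smooth_step (4/3 * (1 - inverse (r * r) * (\<Sum>b\<in>Basis. ((x \<bullet> b) - x0 \<bullet> b) * ((x \<bullet> b) - x0 \<bullet> b)))))"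
    by (rule Ck_compose_real[OF Ck_smooth_step]) (intro Ck_mult Ck_diff Ck_const Ck_sum Ck_linear bounded_linear_inner_left)
  ultimately show "Ck k (bump x0 r)" by simp
qed

lemma bump_range: "0 \<le> bump x0 r x" "bump x0 r x \<le> 1"
  unfolding bump_def by (rule smooth_step_range)+

lemma bump_eq_1: "0 < r \<Longrightarrow> norm (x - x0) \<le> r / 2 \<Longrightarrow> bump x0 r x = 1"
proof -
  assume r: "0 < r" and "norm (x - x0) \<le> r / 2"
  then have "norm (x - x0) / r \<le> 1/2" by (simp add: field_simps)
  then have "(norm (x - x0) / r)\<^sup>2 \<le> (1/2)\<^sup>2" using r by (intro power_mono) auto
  moreover have "(1/2::real)\<^sup>2 = 1/4" by (simp add: power2_eq_square)
  moreover define q where "q = (norm (x - x0) / r)\<^sup>2"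
  ultimately have "q \<le> 1/4" by simp
  then show ?thesis unfolding bump_def q_def[symmetric] by (intro smooth_step_eq_1) (simp add: field_simps)
qed

lemma bump_eq_0: "0 < r \<Longrightarrow> r \<le> norm (x - x0) \<Longrightarrow> bump x0 r x = 0"
proof -
  assume r: "0 < r" and "r \<le> norm (x - x0)"
  then have "1 \<le> norm (x - x0) / r" by (simp add: field_simps)
  then have "1\<^sup>2 \<le> (norm (x - x0) / r)\<^sup>2" by (intro power_mono) auto
  then show ?thesis unfolding bump_def by (intro smooth_step_eq_0) simp
qed

section \<open>Test functions and their partial derivatives\<close>

lemma test_functionI:
  assumes "smooth \<phi>" "compact S" "S \<subseteq> U" "\<And>x. \<phi> x \<noteq> 0 \<Longrightarrow> x \<in> S"
  shows "test_function U \<phi>"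
proof -
  have "closure {x. \<phi> x \<noteq> 0} \<subseteq> S" using assms by (intro closure_minimal compact_imp_closed) auto
  moreover from this have "compact (closure {x. \<phi> x \<noteq> 0})"
    using assms(2) by (meson closed_closure compact_Int_closed inf.absorb2 compact_closure bounded_subset compact_imp_bounded closure_subset)
  ultimately show ?thesis unfolding test_function_def using assms by blast
qed

lemma test_function_support:
  assumes "test_function U \<phi>"
  obtains S where "compact S" "S \<subseteq> U" "\<And>x. x \<notin> S \<Longrightarrow> \<phi> x = 0" "\<And>x j. x \<notin> S \<Longrightarrow> partial_deriv j \<phi> x = 0"
proof
  define S where "S = closure {x. \<phi> x \<noteq> 0}"
  show "compact S" "S \<subseteq> U" using assms by (auto simp: test_function_def S_def)
  show 0: "\<phi> x = 0" if "x \<notin> S" for x using that closure_subset[of "{x. \<phi> x \<noteq> 0}"] by (auto simp: S_def)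
  show "partial_deriv j \<phi> x = 0" if "x \<notin> S" for x j
  proof -
    have "open (- S)" unfolding S_def by (intro open_Compl closed_closure)
    then have "(\<phi> has_derivative (\<lambda>_. 0)) (at x)"
      using has_derivative_transform_within_open[of "\<lambda>_. 0" "\<lambda>_. 0" x UNIV "- S" \<phi>] that 0 by auto
    from frechet_derivative_at[OF this] show ?thesis by (metis partial_deriv_def)
  qed
qed

lemma smooth_has_derivative: "smooth f \<Longrightarrow> (f has_derivative frechet_derivative f (at x)) (at x)"
  by (metis Ck.simps(2) frechet_derivative_works)

lemma smooth_partial_deriv: "smooth f \<Longrightarrow> smooth (partial_deriv j f)"
  unfolding partial_deriv_def[abs_def] using Ck.simps(2) by blast

lemma smooth_continuous: "smooth f \<Longrightarrow> continuous_on UNIV f"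
  by (metis Ck.simps(1))

lemma smooth_partial_has_derivative:
  assumes "smooth f"
  shows "((\<lambda>s. f (x + s *\<^sub>R axis j 1)) has_real_derivative partial_deriv j f (x + s *\<^sub>R axis j 1)) (at s)"
proof -
  have "((\<lambda>s. x + s *\<^sub>R axis j 1) has_derivative (\<lambda>t. t *\<^sub>R axis j 1)) (at s)"
    by (auto intro!: derivative_eq_intros)
  from has_derivative_compose[OF this smooth_has_derivative[OF assms]]
  have "((\<lambda>s. f (x + s *\<^sub>R axis j 1)) has_derivative (\<lambda>t. frechet_derivative f (at (x + s *\<^sub>R axis j 1)) (t *\<^sub>R axis j 1))) (at s)" .
  moreover have "(\<lambda>t. frechet_derivative f (at y) (t *\<^sub>R axis j 1)) = (*) (partial_deriv j f y)" for y
    using linear_cmul[OF has_derivative_linear[OF smooth_has_derivative[OF assms]], of y _ "axis j 1"]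
    by (auto simp: partial_deriv_def fun_eq_iff mult.commute)
  ultimately show ?thesis by (simp add: has_field_derivative_def)
qed

lemma partial_deriv_eqI:
  assumes "(f has_derivative f') (at x)"
  shows "partial_deriv j f x = f' (axis j 1)"
  using frechet_derivative_at[OF assms] by (simp add: partial_deriv_def)

lemma partial_deriv_mult:
  assumes "smooth f" "smooth g"
  shows "partial_deriv j (\<lambda>x. f x * g x) x = f x * partial_deriv j g x + partial_deriv j f x * g x"
  using partial_deriv_eqI[OF has_derivative_mult[OF smooth_has_derivative[OF assms(1)] smooth_has_derivative[OF assms(2)]], of j x]
  by (simp add: partial_deriv_def)

lemma partial_deriv_affine:
  assumes "smooth f"
  shows "partial_deriv j (\<lambda>x. f (c *\<^sub>R x + a)) x = c * partial_deriv j f (c *\<^sub>R x + a)"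
proof -
  have "((\<lambda>x. f (c *\<^sub>R x + a)) has_derivative (\<lambda>v. frechet_derivative f (at (c *\<^sub>R x + a)) (c *\<^sub>R v))) (at x)"
    by (rule has_derivative_compose[OF _ smooth_has_derivative[OF assms]]) (auto intro!: derivative_eq_intros)
  from partial_deriv_eqI[OF this, of j] show ?thesis
    using linear_cmul[OF has_derivative_linear[OF smooth_has_derivative[OF assms]]] by (simp add: partial_deriv_def)
qed

lemma partial_deriv_sum:
  assumes "\<And>i. i \<in> I \<Longrightarrow> smooth (f i)"
  shows "partial_deriv j (\<lambda>x. \<Sum>i\<in>I. f i x) x = (\<Sum>i\<in>I. partial_deriv j (f i) x)"
proof -
  have "((\<lambda>x. \<Sum>i\<in>I. f i x) has_derivative (\<lambda>v. \<Sum>i\<in>I. frechet_derivative (f i) (at x) v)) (at x)"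
    by (intro has_derivative_sum smooth_has_derivative assms)
  from partial_deriv_eqI[OF this, of j] show ?thesis by (simp add: partial_deriv_def)
qed

lemma test_function_smooth: "test_function U \<phi> \<Longrightarrow> smooth \<phi>"
  by (simp add: test_function_def)

lemma test_function_mult:
  fixes \<phi> :: "real^'n::finite \<Rightarrow> real"
  assumes "smooth \<psi>" "test_function U \<phi>"
  shows "test_function U (\<lambda>x. \<psi> x * \<phi> x)"
proof -
  obtain S where S: "compact S" "S \<subseteq> U" "\<And>x. x \<notin> S \<Longrightarrow> \<phi> x = 0"
    using test_function_support[OF assms(2)] by metis
  show ?thesis
    by (rule test_functionI[of _ S]) (use S assms in \<open>auto intro!: Ck_mult simp: test_function_def\<close>)
qed

lemma test_function_mono: "test_function U \<phi> \<Longrightarrow> U \<subseteq> V \<Longrightarrow> test_function V \<phi>"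
  by (auto simp: test_function_def)

lemma test_function_bounded:
  assumes "test_function U \<phi>"
  obtains B where "0 < B" "\<And>x. \<bar>\<phi> x\<bar> \<le> B" "\<And>x j. \<bar>partial_deriv j \<phi> x\<bar> \<le> B"
proof -
  obtain S where S: "compact S" "\<And>x. x \<notin> S \<Longrightarrow> \<phi> x = 0" "\<And>x j. x \<notin> S \<Longrightarrow> partial_deriv j \<phi> x = 0"
    using test_function_support[OF assms] by metis
  have b: "\<exists>B. \<forall>x. \<bar>f x\<bar> \<le> B" if "continuous_on UNIV f" "\<And>x. x \<notin> S \<Longrightarrow> f x = 0" for f :: "real^'a \<Rightarrow> real"
  proof -
    have "bounded (f ` S)"
      using that(1) S(1) by (intro compact_imp_bounded compact_continuous_image continuous_on_subset[OF that(1)]) auto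
    then obtain B where B: "\<And>x. x \<in> S \<Longrightarrow> \<bar>f x\<bar> \<le> B" unfolding bounded_iff by auto
    have "\<bar>f x\<bar> \<le> max B 0" for x using B[of x] that(2)[of x] by (cases "x \<in> S") auto
    then show ?thesis by blast
  qed
  have sm: "smooth \<phi>" using assms by (rule test_function_smooth)
  obtain B0 where B0: "\<And>x. \<bar>\<phi> x\<bar> \<le> B0" using b[OF smooth_continuous[OF sm] S(2)] by blast
  have "\<forall>j. \<exists>B. \<forall>x. \<bar>partial_deriv j \<phi> x\<bar> \<le> B"
    using b[OF smooth_continuous[OF smooth_partial_deriv[OF sm]] S(3)] by blast
  then obtain B1 where B1: "\<And>j x. \<bar>partial_deriv j \<phi> x\<bar> \<le> B1 j" by metis
  have B10: "0 \<le> B1 j" for j using B1[of j 0] by linarith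
  show thesis
  proof (rule that[of "\<bar>B0\<bar> + (\<Sum>j\<in>UNIV. B1 j) + 1"])
    have s: "0 \<le> (\<Sum>j\<in>UNIV. B1 j)" using B10 by (simp add: sum_nonneg)
    then show "0 < \<bar>B0\<bar> + (\<Sum>j\<in>UNIV. B1 j) + 1" by linarith
    show "\<bar>\<phi> x\<bar> \<le> \<bar>B0\<bar> + (\<Sum>j\<in>UNIV. B1 j) + 1" for x using B0[of x] s by linarith
    show "\<bar>partial_deriv j \<phi> x\<bar> \<le> \<bar>B0\<bar> + (\<Sum>j\<in>UNIV. B1 j) + 1" for x j
    proof -
      have "B1 j \<le> (\<Sum>j\<in>UNIV. B1 j)" using B10 by (intro member_le_sum) auto
      then show ?thesis using B1[of j x] by linarith
    qed
  qed
qed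

text \<open>The centre \<open>a\<close> is arbitrary, because near the boundary the kernels are
  moved off the origin.\<close>

lemma mollifier_exists:
  fixes a :: "'a::euclidean_space"
  assumes "0 < r"
  shows "\<exists>K. smooth K \<and> (\<forall>x. 0 \<le> K x) \<and> (\<forall>x. K x \<noteq> 0 \<longrightarrow> x \<in> ball a r) \<and> integrable lborel K \<and> (LINT x|lborel. K x) = 1"
proof -
  define I where "I = (LINT x|lborel. bump a r x)"
  have c: "continuous_on UNIV (bump a r)" by (rule smooth_continuous[OF smooth_bump])
  have supp: "bump a r x \<noteq> 0 \<Longrightarrow> x \<in> ball a r" for x
    using bump_eq_0[OF assms, of x a] by (auto simp: dist_norm norm_minus_commute not_le[symmetric])
  have "integrable lborel (\<lambda>x. indicator (cball a r) x *\<^sub>R bump a r x)"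
    by (rule borel_integrable_compact) (auto intro: continuous_on_subset[OF c])
  moreover have "(\<lambda>x. indicator (cball a r) x *\<^sub>R bump a r x) = bump a r"
    using supp by (force simp: fun_eq_iff indicator_def)
  ultimately have int: "integrable lborel (bump a r)" by simp
  have "0 < measure lborel (ball a (r/2))" using assms by (simp add: content_ball_pos)
  also have "\<dots> = (LINT x|lborel. indicator (ball a (r/2)) x)" by simp
  also have "\<dots> \<le> I" unfolding I_def
  proof (rule integral_mono[OF _ int])
    show "integrable lborel (indicator (ball a (r/2)) :: 'a \<Rightarrow> real)"
      using emeasure_bounded_finite[OF bounded_ball, of a "r/2"] by simp
    show "indicator (ball a (r/2)) x \<le> bump a r x" for x
      using bump_eq_1[OF assms, of x a] bump_range(1)[of a r x] by (auto simp: indicator_def dist_norm norm_minus_commute)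
  qed
  finally have I: "0 < I" .
  show ?thesis
  proof (intro exI[of _ "\<lambda>x. inverse I * bump a r x"] conjI allI impI)
    show "Ck k (\<lambda>x. inverse I * bump a r x)" for k using smooth_bump by (intro Ck_mult Ck_const) auto
    show "0 \<le> inverse I * bump a r x" for x using I bump_range(1)[of a r x] by simp
    show "x \<in> ball a r" if "inverse I * bump a r x \<noteq> 0" for x using that supp by auto
    show "integrable lborel (\<lambda>x. inverse I * bump a r x)" using int by simp
    show "(LINT x|lborel. inverse I * bump a r x) = 1" using I by (simp add: I_def)
  qed
qed

section \<open>Convolution\<close>

lemma integral_directional_derivative_compact_eq_0:
  fixes P P' :: "'a::euclidean_space \<Rightarrow> real"
  assumes d: "\<And>s x. ((\<lambda>s. P (x + s *\<^sub>R e)) has_real_derivative P' (x + s *\<^sub>R e)) (at s)"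
    and c: "continuous_on UNIV P" "continuous_on UNIV P'"
    and S: "bounded S" "\<And>x. x \<notin> S \<Longrightarrow> P x = 0" "\<And>x. x \<notin> S \<Longrightarrow> P' x = 0"
  shows "(LINT x|lborel. P' x) = 0"
proof -
  obtain R where R: "0 < R" "\<And>x. x \<in> S \<Longrightarrow> norm x \<le> R" using S(1) bounded_pos by metis
  \<comment> \<open>The enlarged radius contains the support after every shift by
    \<open>s *\<^sub>R e\<close> with \<open>s\<close> in \<open>{0..1}\<close>.\<close>
  define A where "A = cball (0::'a) (R + norm e)"
  have A: "A \<in> sets borel" "bounded A" by (auto simp: A_def)
  have full: "(LINT x:A|lborel. Q (x + s *\<^sub>R e)) = (LINT x|lborel. Q x)"
    if "\<And>x. x \<notin> S \<Longrightarrow> Q x = 0" "0 \<le> s" "s \<le> 1" for Q :: "'a \<Rightarrow> real" and s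
  proof -
    have "Q (x + s *\<^sub>R e) = 0" if "x \<notin> A" for x
    proof -
      have "norm (s *\<^sub>R e) \<le> 1 * norm e" unfolding norm_scaleR using \<open>0 \<le> s\<close> \<open>s \<le> 1\<close> by (intro mult_right_mono) auto
      then have "norm (x + s *\<^sub>R e) > R" using that norm_triangle_ineq4[of "x + s *\<^sub>R e" "s *\<^sub>R e"] by (simp add: A_def dist_norm)
      then show ?thesis using R(2) \<open>\<And>x. x \<notin> S \<Longrightarrow> Q x = 0\<close> not_le by blast
    qed
    then have "(LINT x:A|lborel. Q (x + s *\<^sub>R e)) = (LINT x|lborel. Q (x + s *\<^sub>R e))"
      unfolding set_lebesgue_integral_def by (intro Bochner_Integration.integral_cong) (auto simp: indicator_def)
    also have "\<dots> = (LINT x|lborel. Q x)" by (rule lborel_integral_translate)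
    finally show ?thesis .
  qed
  have "(LINT x:A|lborel. P' x) = 0"
  proof (rule set_integral_directional_derivative_eq_0[OF A zero_less_one d c])
    show "(LINT x:A|lborel. P (x + 1 *\<^sub>R e)) = (LINT x:A|lborel. P x)" using full[of P 1] full[of P 0] S(2) by simp
    show "(LINT x:A|lborel. P' (x + s *\<^sub>R e)) = (LINT x:A|lborel. P' x)" if "0 \<le> s" "s \<le> 1" for s
      using full[of P' s] full[of P' 0] S(3) that by simp
  qed
  then show ?thesis using full[of P' 0] S(3) by simp
qed

lemma integrable_continuous_bounded_support:
  fixes f :: "'a::euclidean_space \<Rightarrow> 'b::euclidean_space"
  assumes "continuous_on UNIV f" "compact S" "\<And>x. x \<notin> S \<Longrightarrow> f x = 0"
  shows "integrable lborel f"
proof -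
  have "integrable lborel (\<lambda>x. indicator S x *\<^sub>R f x)"
    using assms by (intro borel_integrable_compact) (auto intro: continuous_on_subset)
  moreover have "(\<lambda>x. indicator S x *\<^sub>R f x) = f" using assms(3) by (auto simp: fun_eq_iff indicator_def)
  ultimately show ?thesis by simp
qed

lemma integration_by_parts_test:
  fixes F F' :: "real^'n::finite \<Rightarrow> real"
  assumes d: "\<And>s x. ((\<lambda>s. F (x + s *\<^sub>R axis j 1)) has_real_derivative F' (x + s *\<^sub>R axis j 1)) (at s)"
    and c: "continuous_on UNIV F" "continuous_on UNIV F'" and \<phi>: "test_function U \<phi>"
  shows "(LINT x|lborel. F x * partial_deriv j \<phi> x) = - (LINT x|lborel. F' x * \<phi> x)"
proof -
  obtain S where S: "compact S" "\<And>x. x \<notin> S \<Longrightarrow> \<phi> x = 0" "\<And>x j. x \<notin> S \<Longrightarrow> partial_deriv j \<phi> x = 0"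
    using test_function_support[OF \<phi>] by metis
  have sm: "smooth \<phi>" using \<phi> by (rule test_function_smooth)
  have c\<phi>: "continuous_on UNIV \<phi>" "continuous_on UNIV (partial_deriv j \<phi>)"
    by (rule smooth_continuous[OF sm], rule smooth_continuous[OF smooth_partial_deriv[OF sm]])
  have "(LINT x|lborel. F' x * \<phi> x + F x * partial_deriv j \<phi> x) = 0"
  proof (rule integral_directional_derivative_compact_eq_0[where e = "axis j 1" and P = "\<lambda>x. F x * \<phi> x" and S = S])
    show "((\<lambda>s. F (x + s *\<^sub>R axis j 1) * \<phi> (x + s *\<^sub>R axis j 1)) has_real_derivative
       F' (x + s *\<^sub>R axis j 1) * \<phi> (x + s *\<^sub>R axis j 1) + F (x + s *\<^sub>R axis j 1) * partial_deriv j \<phi> (x + s *\<^sub>R axis j 1)) (at s)" for s x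
      using DERIV_mult[OF d smooth_partial_has_derivative[OF sm]] by (simp add: mult.commute)
  qed (use S c c\<phi> in \<open>auto intro!: continuous_intros compact_imp_bounded\<close>)
  moreover have "integrable lborel (\<lambda>x. F' x * \<phi> x)" "integrable lborel (\<lambda>x. F x * partial_deriv j \<phi> x)"
    using S c c\<phi> by (auto intro!: integrable_continuous_bounded_support[of _ S] continuous_intros)
  ultimately show ?thesis by simp
qed

text \<open>For continuous functions of bounded support this is uniform continuity; density carries
  it over, since translation preserves the 1-norm of the approximation error.\<close>

lemma L1_translation_continuous:
  fixes G :: "'a::euclidean_space \<Rightarrow> real"
  assumes G: "integrable lborel G" and S: "bounded S" "\<And>x. x \<notin> S \<Longrightarrow> G x = 0" and \<epsilon>: "0 < \<epsilon>"
  shows "\<exists>\<delta>>0. \<forall>z. norm z < \<delta> \<longrightarrow> (LINT x|lborel. \<bar>G (x + z) - G x\<bar>) < \<epsilon>"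
proof -
  obtain R where R: "0 < R" "\<And>x. x \<in> S \<Longrightarrow> norm x \<le> R" using S(1) bounded_pos by metis
  have Gm: "G \<in> borel_measurable borel" using G by auto
  have "integrable lborel (\<lambda>x. norm (G x) powr 1)" using G by simp
  then have "\<exists>h. continuous_on UNIV h \<and> (\<forall>x. x \<notin> ball 0 (R + 1) \<longrightarrow> h x = 0) \<and>
     integrable lborel (\<lambda>x. norm (h x - G x) powr 1) \<and> (LINT x|lborel. norm (h x - G x) powr 1) < \<epsilon> / 4"
  proof (rule dense_continuous_Lp[OF zero_less_one Gm])
    show "G x = 0" if "x \<notin> cball 0 R" for x using that R(2)[of x] S(2)[of x] by auto
  qed (use \<epsilon> in auto)
  then obtain h where h: "continuous_on UNIV h" "\<And>x. x \<notin> ball 0 (R + 1) \<Longrightarrow> h x = 0"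
    "integrable lborel (\<lambda>x. \<bar>h x - G x\<bar>)" "(LINT x|lborel. \<bar>h x - G x\<bar>) < \<epsilon>/4"
    by (metis (no_types, lifting) real_norm_def powr_one Bochner_Integration.integral_cong Bochner_Integration.integrable_cong norm_ge_zero)
  \<comment> \<open>\<open>h\<close> is supported in radius \<open>R + 1\<close> and shifts have
    length below 1. Differences thus live in radius \<open>R + 2\<close>, and the points compared
    lie in radius \<open>R + 3\<close>.\<close>
  define m where "m = measure lborel (cball (0::'a) (R + 2))"
  have m: "0 < m" using R by (simp add: m_def content_cball_pos)
  have "uniformly_continuous_on (cball 0 (R + 3)) h"
    by (intro compact_uniformly_continuous continuous_on_subset[OF h(1)]) auto
  then obtain d where d: "0 < d" "\<And>x y. x \<in> cball 0 (R + 3) \<Longrightarrow> y \<in> cball 0 (R + 3) \<Longrightarrow> dist y x < d \<Longrightarrow> dist (h y) (h x) < \<epsilon> / (4 * m)"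
    unfolding uniformly_continuous_on_def using \<epsilon> m by (metis divide_pos_pos mult_pos_pos zero_less_numeral)
  show ?thesis
  proof (intro exI[of _ "min d 1"] conjI allI impI)
    fix z :: 'a assume z: "norm z < min d 1"
    have hz: "continuous_on UNIV (\<lambda>x. h (x + z))" by (rule continuous_on_compose2[OF h(1)]) (auto intro!: continuous_intros)
    have zero: "h (x + z) - h x = 0" if "x \<notin> cball 0 (R + 2)" for x
      using that z h(2)[of x] h(2)[of "x + z"] norm_triangle_ineq4[of "x + z" z] by auto
    have i1: "integrable lborel (\<lambda>x. h (x + z) - h x)"
      using zero h(1) hz by (intro integrable_continuous_bounded_support[of _ "cball 0 (R + 2)"] continuous_intros) auto
    have i2: "integrable lborel (\<lambda>x. \<bar>h (x + z) - G (x + z)\<bar>)"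
      using h(3) lborel_integrable_translate[of "\<lambda>x. \<bar>h x - G x\<bar>" z] by simp
    have i3: "integrable lborel (\<lambda>x. G (x + z))" using G by (simp add: lborel_integrable_translate)
    have "(LINT x|lborel. \<bar>G (x + z) - G x\<bar>) \<le> (LINT x|lborel. \<bar>h (x + z) - G (x + z)\<bar> + \<bar>h x - G x\<bar> + \<bar>h (x + z) - h x\<bar>)"
      using i1 i2 i3 h(3) G by (intro integral_mono) auto
    also have "\<dots> = (LINT x|lborel. \<bar>h (x + z) - G (x + z)\<bar>) + (LINT x|lborel. \<bar>h x - G x\<bar>) + (LINT x|lborel. \<bar>h (x + z) - h x\<bar>)"
      using i1 i2 h(3) by simp
    also have "(LINT x|lborel. \<bar>h (x + z) - G (x + z)\<bar>) = (LINT x|lborel. \<bar>h x - G x\<bar>)"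
      using lborel_integral_translate[of "\<lambda>x. \<bar>h x - G x\<bar>" z] by simp
    also have "(LINT x|lborel. \<bar>h (x + z) - h x\<bar>) \<le> (LINT x|lborel. \<epsilon> / (4 * m) * indicator (cball (0::'a) (R + 2)) x)"
    proof (rule integral_mono)
      show "integrable lborel (\<lambda>x. \<epsilon> / (4 * m) * indicator (cball (0::'a) (R + 2)) x)"
        using emeasure_bounded_finite[OF bounded_cball, of "0::'a" "R + 2"] by simp
      show "\<bar>h (x + z) - h x\<bar> \<le> \<epsilon> / (4 * m) * indicator (cball 0 (R + 2)) x" for x
      proof (cases "x \<in> cball 0 (R + 2)")
        case True
        have "x \<in> cball 0 (R + 3)" "x + z \<in> cball 0 (R + 3)" "dist (x + z) x < d"
        proof -
          have "norm x \<le> R + 2" using True by simp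
          moreover from this have "norm (x + z) \<le> R + 3" using z norm_triangle_ineq[of x z] by simp
          ultimately show "x \<in> cball 0 (R + 3)" "x + z \<in> cball 0 (R + 3)" unfolding mem_cball_0 by auto
          show "dist (x + z) x < d" using z by (simp add: dist_norm)
        qed
        from d(2)[OF this] True show ?thesis by (simp add: dist_norm)
      qed (use zero in auto)
    qed (use i1 in auto)
    also have "\<dots> = \<epsilon> / 4" using m by (simp add: m_def)
    finally show "(LINT x|lborel. \<bar>G (x + z) - G x\<bar>) < \<epsilon>" using h(4) \<epsilon> by simp
  qed (use d in auto)
qed

text \<open>The kernel is evaluated at the displacement \<open>z\<close> from \<open>x\<close> to
  \<open>x + z\<close>, the reflected form of the usual convolution. A kernel supported in a cone of
  directions thus looks exactly in these directions.\<close>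

definition conv :: "('a::euclidean_space \<Rightarrow> real) \<Rightarrow> ('a \<Rightarrow> real) \<Rightarrow> 'a \<Rightarrow> real" where
  "conv K G x = (LINT z|lborel. K z * G (x + z))"

lemma conv_product_integrable:
  fixes K G :: "'a::euclidean_space \<Rightarrow> real"
  assumes K: "integrable lborel K" and G: "integrable lborel G"
    and h: "h \<in> borel_measurable borel" "\<And>x. \<bar>h x\<bar> \<le> B"
  shows "integrable (lborel \<Otimes>\<^sub>M lborel) (\<lambda>(x, z). h x * (K z * G (x + z)))"
proof -
  have [measurable]: "K \<in> borel_measurable borel" "G \<in> borel_measurable borel" "h \<in> borel_measurable borel" using K G h by auto
  have *: "integrable (lborel \<Otimes>\<^sub>M lborel) (\<lambda>(z, x). K z * G (x + z))"
  proof (rule lborel_pair.Fubini_integrable)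
    have "(LINT x|lborel. norm (K z * G (x + z))) = \<bar>K z\<bar> * (LINT x|lborel. \<bar>G x\<bar>)" for z
      using lborel_integral_translate[of "\<lambda>x. \<bar>G x\<bar>" z] by (simp add: abs_mult)
    then show "integrable lborel (\<lambda>z. LINT x|lborel. norm (case (z, x) of (z, x) \<Rightarrow> K z * G (x + z)))"
      using K by simp
    show "AE z in lborel. integrable lborel (\<lambda>x. case (z, x) of (z, x) \<Rightarrow> K z * G (x + z))"
      using G by (intro AE_I2) (simp add: lborel_integrable_translate)
  qed measurable
  then have **: "integrable (lborel \<Otimes>\<^sub>M lborel) (\<lambda>(x, z). K z * G (x + z))"
    using lborel_pair.integrable_product_swap[OF *] by simp
  show ?thesis
  proof (rule Bochner_Integration.integrable_bound)
    show "integrable (lborel \<Otimes>\<^sub>M lborel) (\<lambda>(x, z). B * (K z * G (x + z)))"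
      using integrable_mult_right[OF **, of B] by (simp add: split_beta')
    show "AE xz in lborel \<Otimes>\<^sub>M lborel. norm (case xz of (x, z) \<Rightarrow> h x * (K z * G (x + z))) \<le> norm (case xz of (x, z) \<Rightarrow> B * (K z * G (x + z)))"
    proof (intro AE_I2, clarsimp simp: abs_mult)
      fix a b
      have "\<bar>h a\<bar> \<le> \<bar>B\<bar>" using h(2)[of a] by linarith
      then show "\<bar>h a\<bar> * (\<bar>K b\<bar> * \<bar>G (a + b)\<bar>) \<le> \<bar>B\<bar> * (\<bar>K b\<bar> * \<bar>G (a + b)\<bar>)" by (intro mult_right_mono) auto
    qed
  qed measurable
qed

lemma conv_integrable:
  assumes "integrable lborel K" "integrable lborel G"
  shows "integrable lborel (conv K G)"
  using lborel_pair.integrable_fst'[OF conv_product_integrable[OF assms, of "\<lambda>_. 1" 1]]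
  by (simp add: conv_def[abs_def])

text \<open>The smoothing is moved to the bounded factor, where it appears as an average of
  translates; for a test function these are again tests as long as they stay in the domain.\<close>

lemma conv_duality:
  assumes "integrable lborel K" "integrable lborel G" "h \<in> borel_measurable borel" "\<And>x. \<bar>h x\<bar> \<le> B"
  shows "(LINT x|lborel. conv K G x * h x) = (LINT z|lborel. K z * (LINT y|lborel. G y * h (y - z)))"
proof -
  have "(LINT x|lborel. conv K G x * h x) = (LINT x|lborel. LINT z|lborel. h x * (K z * G (x + z)))"
    by (simp add: conv_def mult.commute)
  also have "\<dots> = (LINT z|lborel. LINT x|lborel. h x * (K z * G (x + z)))"
    using lborel_pair.Fubini_integral[OF conv_product_integrable[OF assms]] by simp
  also have "\<dots> = (LINT z|lborel. K z * (LINT y|lborel. G y * h (y - z)))"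
  proof (rule Bochner_Integration.integral_cong[OF refl])
    fix z
    have "(LINT x|lborel. h x * (K z * G (x + z))) = K z * (LINT x|lborel. (\<lambda>y. G y * h (y - z)) (x + z))"
      by (simp add: mult.left_commute mult.commute)
    also have "(LINT x|lborel. (\<lambda>y. G y * h (y - z)) (x + z)) = (LINT y|lborel. G y * h (y - z))"
      by (rule lborel_integral_translate)
    finally show "(LINT x|lborel. h x * (K z * G (x + z))) = K z * (LINT y|lborel. G y * h (y - z))" .
  qed
  finally show ?thesis .
qed

text \<open>As the kernel is a probability density, the error is an average of the differences
  \<open>G (x + z) - G x\<close> over its support.\<close>

lemma conv_L1_bound:
  fixes K G :: "'a::euclidean_space \<Rightarrow> real"
  assumes K: "integrable lborel K" "\<And>z. 0 \<le> K z" "(LINT z|lborel. K z) = 1" and G: "integrable lborel G"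
    and b: "\<And>z. K z \<noteq> 0 \<Longrightarrow> (LINT x|lborel. \<bar>G (x + z) - G x\<bar>) \<le> \<epsilon>"
  shows "(LINT x|lborel. \<bar>conv K G x - G x\<bar>) \<le> \<epsilon>"
proof -
  have [measurable]: "K \<in> borel_measurable borel" "G \<in> borel_measurable borel" using K G by auto
  have tr: "integrable lborel (\<lambda>x. G (x + z))" for z using G by (simp add: lborel_integrable_translate)
  have i1: "integrable (lborel \<Otimes>\<^sub>M lborel) (\<lambda>(x, z). K z * G (x + z))"
    using conv_product_integrable[OF K(1) G, of "\<lambda>_. 1" 1] by simp
  have i2: "integrable (lborel \<Otimes>\<^sub>M lborel) (\<lambda>(x, z). K z * G x)"
  proof -
    have "integrable (lborel \<Otimes>\<^sub>M lborel) (\<lambda>(x, z). G x * K z)"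
    proof (rule lborel_pair.Fubini_integrable)
      show "integrable lborel (\<lambda>x. LINT z|lborel. norm (case (x, z) of (x, z) \<Rightarrow> G x * K z))"
        using G by (simp add: abs_mult)
    qed (use K in \<open>auto intro!: AE_I2\<close>)
    then show ?thesis by (simp add: mult.commute)
  qed
  have i3: "integrable (lborel \<Otimes>\<^sub>M lborel) (\<lambda>(x, z). K z * \<bar>G (x + z) - G x\<bar>)"
  proof -
    have "integrable (lborel \<Otimes>\<^sub>M lborel) (\<lambda>xz. \<bar>(case xz of (x, z) \<Rightarrow> K z * G (x + z)) - (case xz of (x, z) \<Rightarrow> K z * G x)\<bar>)"
      using i1 i2 by (intro integrable_abs Bochner_Integration.integrable_diff)
    moreover have "(\<lambda>xz. \<bar>(case xz of (x, z) \<Rightarrow> K z * G (x + z)) - (case xz of (x, z) \<Rightarrow> K z * G x)\<bar>) = (\<lambda>(x, z). K z * \<bar>G (x + z) - G x\<bar>)"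
      using K(2) by (auto simp: fun_eq_iff abs_mult right_diff_distrib[symmetric])
    ultimately show ?thesis by simp
  qed
  have "AE x in lborel. integrable lborel (\<lambda>z. K z * G (x + z))"
    using lborel_pair.AE_integrable_fst'[OF i1] by simp
  then have "AE x in lborel. \<bar>conv K G x - G x\<bar> \<le> (LINT z|lborel. K z * \<bar>G (x + z) - G x\<bar>)"
  proof eventually_elim
    case (elim x)
    have "conv K G x - G x = (LINT z|lborel. K z * G (x + z)) - (LINT z|lborel. K z * G x)" by (simp add: conv_def K(3))
    also have "\<dots> = (LINT z|lborel. K z * (G (x + z) - G x))"
      using elim K(1) by (simp add: right_diff_distrib)
    finally show ?case using integral_abs_bound[of lborel "\<lambda>z. K z * (G (x + z) - G x)"] K(2) by (simp add: abs_mult)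
  qed
  then have "(LINT x|lborel. \<bar>conv K G x - G x\<bar>) \<le> (LINT x|lborel. LINT z|lborel. K z * \<bar>G (x + z) - G x\<bar>)"
    using lborel_pair.integrable_fst'[OF i3] conv_integrable[OF K(1) G] G by (intro integral_mono_AE) auto
  also have "\<dots> = (LINT z|lborel. LINT x|lborel. K z * \<bar>G (x + z) - G x\<bar>)"
    using lborel_pair.Fubini_integral[OF i3] by simp
  also have "\<dots> \<le> (LINT z|lborel. K z * \<epsilon>)"
  proof (rule integral_mono)
    show "integrable lborel (\<lambda>z. LINT x|lborel. K z * \<bar>G (x + z) - G x\<bar>)"
      using lborel_pair.integrable_snd[OF i3] .
    show "(LINT x|lborel. K z * \<bar>G (x + z) - G x\<bar>) \<le> K z * \<epsilon>" for z
      using b[of z] K(2)[of z] by (cases "K z = 0") (auto intro!: mult_left_mono)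
  qed (use K in auto)
  also have "\<dots> = \<epsilon>" by (simp add: K(3))
  finally show ?thesis .
qed

lemma integrable_mult_bounded:
  fixes f g :: "'a \<Rightarrow> real"
  assumes "integrable M f" "g \<in> borel_measurable M" "\<And>x. \<bar>g x\<bar> \<le> B"
  shows "integrable M (\<lambda>x. f x * g x)" "integrable M (\<lambda>x. g x * f x)"
proof -
  show *: "integrable M (\<lambda>x. f x * g x)"
  proof (rule Bochner_Integration.integrable_bound)
    show "integrable M (\<lambda>x. B * f x)" using assms(1) by simp
    show "AE x in M. norm (f x * g x) \<le> norm (B * f x)"
    proof (intro AE_I2)
      fix x
      have "\<bar>g x\<bar> \<le> \<bar>B\<bar>" using assms(3)[of x] by linarith
      then have "\<bar>g x\<bar> * \<bar>f x\<bar> \<le> \<bar>B\<bar> * \<bar>f x\<bar>" by (intro mult_right_mono) auto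
      then show "norm (f x * g x) \<le> norm (B * f x)" by (simp add: abs_mult mult.commute)
    qed
  qed (use assms in auto)
  then show "integrable M (\<lambda>x. g x * f x)" by (simp add: mult.commute)
qed

text \<open>Let \<open>G\<close> be \<open>h\<close> times a bump. Its mollifications are pairings
  of \<open>h\<close> with test functions, hence 0, and they approach \<open>G\<close> in the
  1-norm; so \<open>h\<close> vanishes almost everywhere near each point. Lindelof's theorem reduces
  the union of these neighbourhoods to a countable one.\<close>

lemma AE_eq_0_if_orthogonal_to_tests:
  fixes h :: "real^'n::finite \<Rightarrow> real"
  assumes U: "open U" and h: "h \<in> borel_measurable borel" "\<And>S. compact S \<Longrightarrow> S \<subseteq> U \<Longrightarrow> set_integrable lborel S h"
    and o: "\<And>\<phi>. test_function U \<phi> \<Longrightarrow> (LINT x|lborel. h x * \<phi> x) = 0"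
  shows "AE x in lborel. x \<in> U \<longrightarrow> h x = 0"
proof -
  have loc: "\<exists>r>0. ball x0 r \<subseteq> U \<and> (AE x in lborel. x \<in> ball x0 r \<longrightarrow> h x = 0)" if x0: "x0 \<in> U" for x0
  proof -
    obtain r where r: "0 < r" "cball x0 r \<subseteq> U" using U x0 open_contains_cball by blast
    define \<psi> where "\<psi> = bump x0 r"
    have sm: "smooth \<psi>" unfolding \<psi>_def by (rule smooth_bump)
    have supp: "x \<in> cball x0 r" if "\<psi> x \<noteq> 0" for x
      using that bump_eq_0[OF r(1), of x x0] unfolding \<psi>_def by (force simp: dist_norm norm_minus_commute)
    have \<psi>b: "\<bar>\<psi> x\<bar> \<le> 1" for x using bump_range[of x0 r x] by (simp add: \<psi>_def)
    have \<psi>m: "\<psi> \<in> borel_measurable borel" by (rule borel_measurable_continuous_onI[OF smooth_continuous[OF sm]])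
    define G where "G x = indicator (cball x0 r) x * h x * \<psi> x" for x
    have Gh: "G x = h x * \<psi> x" for x using supp[of x] by (auto simp: G_def indicator_def)
    have G: "integrable lborel G"
      unfolding G_def using h(2)[OF _ r(2)] \<psi>m \<psi>b 
      by (intro integrable_mult_bounded(1)[where f = "\<lambda>x. indicator (cball x0 r) x * h x"]) (auto simp: set_integrable_def)
    have "(LINT x|lborel. \<bar>G x\<bar>) \<le> \<epsilon>" if \<epsilon>: "0 < \<epsilon>" for \<epsilon>
    proof -
      obtain \<delta> where \<delta>: "0 < \<delta>" "\<And>z. norm z < \<delta> \<Longrightarrow> (LINT x|lborel. \<bar>G (x + z) - G x\<bar>) < \<epsilon>"
        using L1_translation_continuous[OF G bounded_cball[of x0 r] _ \<epsilon>] by (auto simp: G_def)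
      obtain K :: "real^'n \<Rightarrow> real" where K: "smooth K" "\<And>x. 0 \<le> K x" "\<And>x. K x \<noteq> 0 \<Longrightarrow> x \<in> ball 0 \<delta>" "integrable lborel K" "(LINT x|lborel. K x) = 1"
        using mollifier_exists[OF \<delta>(1), of 0] by blast
      have "conv K G x = 0" for x
      proof -
        have "conv K G x = (LINT z|lborel. (\<lambda>y. K (y - x) * G y) (z + x))" by (simp add: conv_def add.commute)
        also have "\<dots> = (LINT y|lborel. K (y - x) * G y)" by (rule lborel_integral_translate)
        also have "\<dots> = (LINT y|lborel. h y * (K (1 *\<^sub>R y + (- x)) * \<psi> y))" by (simp add: Gh mult_ac)
        also have "\<dots> = 0"
        proof (rule o)
          show "test_function U (\<lambda>y. K (1 *\<^sub>R y + (- x)) * \<psi> y)"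
          proof (rule test_functionI[OF _ compact_cball r(2)])
            show "smooth (\<lambda>y. K (1 *\<^sub>R y + (- x)) * \<psi> y)"
              using Ck_mult[OF Ck_affine[of _ K 1 "- x"]] K(1) sm by blast
          qed (use supp in auto)
        qed
        finally show ?thesis .
      qed
      then show ?thesis
        using conv_L1_bound[OF K(4,2,5) G, of \<epsilon>] \<delta>(2) K(3) by (auto simp: less_imp_le)
    qed
    then have "(LINT x|lborel. \<bar>G x\<bar>) \<le> 0" by (rule field_le_epsilon) simp
    then have "AE x in lborel. G x = 0"
      using integral_nonneg_eq_0_iff_AE[of lborel "\<lambda>x. \<bar>G x\<bar>"] G by (auto simp: antisym)
    then have "AE x in lborel. x \<in> ball x0 (r/2) \<longrightarrow> h x = 0"
    proof eventually_elim
      case (elim x)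
      have "\<psi> x = 1" if "x \<in> ball x0 (r/2)"
        unfolding \<psi>_def using that by (intro bump_eq_1[OF r(1)]) (auto simp: dist_norm norm_minus_commute)
      then show ?case using elim by (auto simp: Gh)
    qed
    moreover have "ball x0 (r/2) \<subseteq> U" using r by (auto simp: subset_iff)
    ultimately show ?thesis using r(1) by (intro exI[of _ "r/2"]) auto
  qed
  define \<B> where "\<B> = {B. open B \<and> B \<subseteq> U \<and> (AE x in lborel. x \<in> B \<longrightarrow> h x = 0)}"
  have op: "\<And>B. B \<in> \<B> \<Longrightarrow> open B" by (simp add: \<B>_def)
  obtain \<C> where \<C>: "\<C> \<subseteq> \<B>" "countable \<C>" "\<Union>\<C> = \<Union>\<B>" using Lindelof[OF op] by metis
  have "U \<subseteq> \<Union>\<B>"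
  proof
    fix x assume "x \<in> U"
    from loc[OF this] obtain r where "0 < r" "ball x r \<in> \<B>" unfolding \<B>_def by auto
    then show "x \<in> \<Union>\<B>" by (meson UnionI centre_in_ball)
  qed
  moreover have "AE x in lborel. \<forall>B\<in>\<C>. x \<in> B \<longrightarrow> h x = 0"
    using \<C>(1,2) by (subst AE_ball_countable) (auto simp: \<B>_def)
  ultimately show ?thesis using \<C>(3) by (auto elim!: eventually_mono)
qed

section \<open>Weak gradients\<close>

lemma AE_lebesgue_on_iff:
  assumes "U \<in> sets borel"
  shows "(AE x in lebesgue_on U. P x) \<longleftrightarrow> (AE x in lborel. x \<in> U \<longrightarrow> P x)"
  using assms by (simp add: AE_restrict_space_iff AE_completion_iff)

text \<open>Functions of the statement are Lebesgue measurable on \<open>U\<close> only. Borel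
  representatives that vanish outside \<open>U\<close> make translation and Fubini's theorem for
  \<open>lborel\<close> available.\<close>

lemma borel_representative:
  fixes f :: "'a::euclidean_space \<Rightarrow> 'b::euclidean_space"
  assumes U: "U \<in> sets borel" and f: "f \<in> borel_measurable (lebesgue_on U)"
  shows "\<exists>g\<in>borel_measurable borel. (\<forall>x. x \<notin> U \<longrightarrow> g x = 0) \<and> (AE x in lborel. x \<in> U \<longrightarrow> f x = g x)"
proof -
  have "(\<lambda>x. indicator U x *\<^sub>R f x) \<in> borel_measurable lebesgue"
    using f U by (subst (asm) borel_measurable_restrict_space_iff) auto
  then have "(\<lambda>x. (indicator U x *\<^sub>R f x) \<bullet> b) \<in> borel_measurable lebesgue" for b by measurable
  then have "\<forall>b. \<exists>g\<in>borel_measurable lborel. (AE x in lborel. (indicator U x *\<^sub>R f x) \<bullet> b = g x)"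
    using completion_ex_borel_measurable_real by blast
  then obtain g where g: "\<And>b. g b \<in> borel_measurable lborel" "\<And>b. AE x in lborel. (indicator U x *\<^sub>R f x) \<bullet> b = g b x"
    by metis
  define h where "h x = indicator U x *\<^sub>R (\<Sum>b\<in>Basis. g b x *\<^sub>R b)" for x
  have "AE x in lborel. \<forall>b\<in>Basis. (indicator U x *\<^sub>R f x) \<bullet> b = g b x"
    using g(2) by (intro eventually_ball_finite) auto
  then have "AE x in lborel. x \<in> U \<longrightarrow> f x = h x"
  proof eventually_elim
    case (elim x)
    show ?case
    proof
      assume "x \<in> U"
      then have "h x = (\<Sum>b\<in>Basis. (f x \<bullet> b) *\<^sub>R b)" unfolding h_def using elim by (simp add: indicator_def)
      then show "f x = h x" by (simp add: euclidean_representation)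
    qed
  qed
  moreover have "h \<in> borel_measurable borel" unfolding h_def using g(1) U by measurable
  ultimately show ?thesis by (intro bexI[of _ h]) (auto simp: h_def)
qed

text \<open>The bridge between the integrals of the statement and those of Borel
  representatives.\<close>

lemma lebesgue_on_integral_transfer:
  fixes f g :: "'a::euclidean_space \<Rightarrow> 'b::euclidean_space"
  assumes U: "U \<in> sets borel" and g: "g \<in> borel_measurable borel" and ae: "AE x in lborel. x \<in> U \<longrightarrow> f x = g x"
    and f: "f \<in> borel_measurable (lebesgue_on U)"
  shows "integrable (lebesgue_on U) f \<longleftrightarrow> set_integrable lborel U g"
    and "set_integrable lebesgue U f \<longleftrightarrow> set_integrable lborel U g"
    and "(\<integral>x\<in>U. f x \<partial>lebesgue) = (LINT x:U|lborel. g x)"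
proof -
  have Ul: "U \<in> sets lebesgue" using U by simp
  have fm: "(\<lambda>x. indicator U x *\<^sub>R f x) \<in> borel_measurable lebesgue"
    using f U by (subst (asm) borel_measurable_restrict_space_iff) auto
  have gm: "(\<lambda>x. indicator U x *\<^sub>R g x) \<in> borel_measurable lborel" using g U by measurable
  have gm': "(\<lambda>x. indicator U x *\<^sub>R g x) \<in> borel_measurable lebesgue" using gm by (rule measurable_completion)
  have ae': "AE x in lebesgue. indicator U x *\<^sub>R f x = indicator U x *\<^sub>R g x"
    unfolding AE_completion_iff using ae by eventually_elim (auto simp: indicator_def)
  show 1: "set_integrable lebesgue U f \<longleftrightarrow> set_integrable lborel U g"
    unfolding set_integrable_def
    by (subst integrable_cong_AE[OF fm gm' ae']) (rule integrable_completion[OF gm])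
  show "integrable (lebesgue_on U) f \<longleftrightarrow> set_integrable lborel U g"
    using 1 Ul by (simp add: integrable_restrict_space set_integrable_def)
  show "(\<integral>x\<in>U. f x \<partial>lebesgue) = (LINT x:U|lborel. g x)"
    unfolding set_lebesgue_integral_def
    by (subst integral_cong_AE[OF fm gm' ae']) (rule integral_completion[OF gm])
qed

lemma borel_measurable_lebesgue_onI:
  fixes f :: "'a::euclidean_space \<Rightarrow> 'b::euclidean_space"
  shows "f \<in> borel_measurable borel \<Longrightarrow> f \<in> borel_measurable (lebesgue_on U)"
  by (intro measurable_restrict_space1 measurable_completion) simp

lemma Lp_iff_borel:
  fixes f g :: "'a::euclidean_space \<Rightarrow> 'b::euclidean_space"
  assumes U: "U \<in> sets borel" and g: "g \<in> borel_measurable borel"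
  shows "g \<in> Lp p U \<longleftrightarrow> set_integrable lborel U (\<lambda>x. norm (g x) powr p)"
proof -
  have gm: "(\<lambda>x. norm (g x) powr p) \<in> borel_measurable borel" using g by measurable
  have "integrable (lebesgue_on U) (\<lambda>x. norm (g x) powr p) \<longleftrightarrow> set_integrable lborel U (\<lambda>x. norm (g x) powr p)"
    by (rule lebesgue_on_integral_transfer(1)[OF U gm]) (use gm in \<open>auto intro: borel_measurable_lebesgue_onI\<close>)
  then show ?thesis using g by (simp add: Lp_def borel_measurable_lebesgue_onI)
qed

lemma Lp_diff:
  assumes "0 \<le> p" "f \<in> Lp p U" "g \<in> Lp p U"
  shows "(\<lambda>x. f x - g x) \<in> Lp p U"
  using assms unfolding Lp_def by (auto intro!: integrable_norm_diff_powr)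

lemma Lp_imp_integrable:
  fixes f :: "'a::euclidean_space \<Rightarrow> 'b::euclidean_space"
  assumes p: "1 \<le> p" and U: "U \<in> sets borel" "bounded U" and f: "f \<in> Lp p U"
  shows "integrable (lebesgue_on U) f"
proof (rule Bochner_Integration.integrable_bound)
  have "integrable lborel (\<lambda>x. indicator U x *\<^sub>R (1::real))"
    using U emeasure_bounded_finite[OF U(2)] by simp
  then have "integrable lebesgue (\<lambda>x. indicator U x *\<^sub>R (1::real))"
    using U by (subst integrable_completion) auto
  then have "integrable (lebesgue_on U) (\<lambda>x. 1 :: real)"
    using U by (subst integrable_restrict_space) auto
  then show "integrable (lebesgue_on U) (\<lambda>x. 1 + norm (f x) powr p)" using f by (auto simp: Lp_def)
  show "AE x in lebesgue_on U. norm (f x) \<le> norm (1 + norm (f x) powr p)"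
  proof (rule AE_I2)
    fix x
    have "norm (f x) \<le> 1 + norm (f x) powr p"
    proof (cases "norm (f x) \<le> 1")
      case False
      then have "norm (f x) powr 1 \<le> norm (f x) powr p" using p by (intro powr_mono) auto
      then show ?thesis using False by simp
    qed (simp add: add_increasing2)
    then show "norm (f x) \<le> norm (1 + norm (f x) powr p)" by simp
  qed
qed (use f in \<open>simp add: Lp_def\<close>)

lemma integrable_imp_locally_integrable:
  assumes U: "U \<in> sets borel" and f: "integrable (lebesgue_on U) f"
  shows "locally_integrable_on f U"
  unfolding locally_integrable_on_def
proof (intro allI impI)
  fix K assume K: "compact K \<and> K \<subseteq> U"
  have "set_integrable lebesgue U f" using f U by (simp add: integrable_restrict_space set_integrable_def)
  moreover have "K \<in> sets lebesgue" using K by (simp add: compact_imp_closed borel_closed)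
  ultimately show "set_integrable lebesgue K f" using K by (auto intro: set_integrable_subset)
qed

lemma locally_integrable_diff:
  "locally_integrable_on f U \<Longrightarrow> locally_integrable_on g U \<Longrightarrow> locally_integrable_on (\<lambda>x. f x - g x) U"
  unfolding locally_integrable_on_def by (auto intro: set_integral_diff)

text \<open>The restrictions to an exhaustion of \<open>U\<close> by compact sets are measurable and
  converge pointwise.\<close>

lemma locally_integrable_measurable:
  fixes f :: "'a::euclidean_space \<Rightarrow> 'b::euclidean_space"
  assumes U: "open U" and f: "locally_integrable_on f U"
  shows "f \<in> borel_measurable (lebesgue_on U)"
proof -
  obtain C :: "nat \<Rightarrow> 'a set" where C: "\<And>n. compact (C n)" "\<And>n. C n \<subseteq> U" "\<Union>(range C) = U"
      "\<And>K. \<lbrakk>compact K; K \<subseteq> U\<rbrakk> \<Longrightarrow> \<exists>N. \<forall>n\<ge>N. K \<subseteq> C n"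
    using open_Union_compact_subsets[OF U] by metis
  have m: "(\<lambda>x. indicator (C n) x *\<^sub>R f x) \<in> borel_measurable lebesgue" for n
  proof (rule borel_measurable_integrable)
    show "integrable lebesgue (\<lambda>x. indicator (C n) x *\<^sub>R f x)"
      using f C(1)[of n] C(2)[of n] by (simp add: locally_integrable_on_def set_integrable_def)
  qed
  have "(\<lambda>x. indicator U x *\<^sub>R f x) \<in> borel_measurable lebesgue"
  proof (rule borel_measurable_LIMSEQ_metric[OF m])
    fix x
    show "(\<lambda>n. indicator (C n) x *\<^sub>R f x) \<longlonglongrightarrow> indicator U x *\<^sub>R f x"
    proof (cases "x \<in> U")
      case True
      then obtain N where "\<And>n. n \<ge> N \<Longrightarrow> x \<in> C n" using C(4)[of "{x}"] by auto
      then show ?thesis using True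
        by (intro tendsto_eventually) (auto simp: eventually_sequentially intro!: exI[of _ N])
    next
      case False
      then have "x \<notin> C n" for n using C(2) by blast
      then show ?thesis using False by simp
    qed
  qed
  then show ?thesis using U by (subst borel_measurable_restrict_space_iff) (auto simp: borel_open)
qed

lemma locally_integrable_mult_test:
  fixes f :: "real^'n::finite \<Rightarrow> real"
  assumes U: "open U" and f: "locally_integrable_on f U" and \<phi>: "test_function U \<phi>"
  shows "set_integrable lebesgue U (\<lambda>x. f x * \<phi> x)" "set_integrable lebesgue U (\<lambda>x. f x * partial_deriv j \<phi> x)"
proof -
  obtain S where S: "compact S" "S \<subseteq> U" "\<And>x. x \<notin> S \<Longrightarrow> \<phi> x = 0" "\<And>x j. x \<notin> S \<Longrightarrow> partial_deriv j \<phi> x = 0"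
    using test_function_support[OF \<phi>] by metis
  obtain B where B: "\<And>x. \<bar>\<phi> x\<bar> \<le> B" "\<And>x j. \<bar>partial_deriv j \<phi> x\<bar> \<le> B" using test_function_bounded[OF \<phi>] by metis
  have sm: "smooth \<phi>" using \<phi> by (rule test_function_smooth)
  have c: "continuous_on UNIV \<phi>" "continuous_on UNIV (partial_deriv j \<phi>)"
    by (rule smooth_continuous[OF sm], rule smooth_continuous[OF smooth_partial_deriv[OF sm]])
  have main: "set_integrable lebesgue U (\<lambda>x. f x * g x)"
    if "continuous_on UNIV g" "\<And>x. \<bar>g x\<bar> \<le> B" "\<And>x. x \<notin> S \<Longrightarrow> g x = 0" for g
  proof -
    have "integrable lebesgue (\<lambda>x. indicator S x * f x)"
      using f S by (auto simp: locally_integrable_on_def set_integrable_def)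
    moreover have "g \<in> borel_measurable lebesgue"
      using borel_measurable_continuous_onI[OF that(1)] by (simp add: measurable_completion)
    ultimately have "integrable lebesgue (\<lambda>x. indicator S x * f x * g x)"
      using that(2) by (rule integrable_mult_bounded(1))
    moreover have "(\<lambda>x. indicator S x * f x * g x) = (\<lambda>x. indicator U x *\<^sub>R (f x * g x))"
      using S(2) that(3) by (auto simp: fun_eq_iff indicator_def)
    ultimately show ?thesis by (simp add: set_integrable_def)
  qed
  show "set_integrable lebesgue U (\<lambda>x. f x * \<phi> x)" "set_integrable lebesgue U (\<lambda>x. f x * partial_deriv j \<phi> x)"
    by (rule main[OF c(1) B(1)], erule S(3)) (rule main[OF c(2) B(2)], erule S(4))
qed

lemma locally_integrable_component:
  fixes f :: "'a::euclidean_space \<Rightarrow> 'b::euclidean_space^'n"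
  assumes "locally_integrable_on f U"
  shows "locally_integrable_on (\<lambda>x. f x $ i) U"
  unfolding locally_integrable_on_def set_integrable_def
proof (intro allI impI)
  fix K assume "compact K \<and> K \<subseteq> U"
  then have "integrable lebesgue (\<lambda>x. indicator K x *\<^sub>R f x)"
    using assms unfolding locally_integrable_on_def set_integrable_def by blast
  from integrable_bounded_linear[OF bounded_linear_vec_nth this, of i]
  show "integrable lebesgue (\<lambda>x. indicator K x *\<^sub>R f x $ i)" by simp
qed

lemma borel_measurable_vec_nth [measurable (raw)]:
  fixes f :: "'a \<Rightarrow> 'b::euclidean_space^'n"
  shows "f \<in> borel_measurable M \<Longrightarrow> (\<lambda>x. f x $ i) \<in> borel_measurable M"
  by (rule measurable_compose[OF _ borel_measurable_continuous_onI[OF linear_continuous_on[OF bounded_linear_vec_nth]]])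

lemma has_weak_gradient_diff:
  assumes U: "open U" and u: "has_weak_gradient u Du U" and w: "has_weak_gradient w Dw U"
  shows "has_weak_gradient (\<lambda>x. u x - w x) (\<lambda>x. Du x - Dw x) U"
  unfolding has_weak_gradient_def
proof (intro conjI allI impI)
  fix \<phi> i j assume \<phi>: "test_function U \<phi>"
  note loc = u[unfolded has_weak_gradient_def, THEN conjunct1] u[unfolded has_weak_gradient_def, THEN conjunct2, THEN conjunct1]
     w[unfolded has_weak_gradient_def, THEN conjunct1] w[unfolded has_weak_gradient_def, THEN conjunct2, THEN conjunct1]
  note i1 = locally_integrable_mult_test[OF U locally_integrable_component[OF loc(1)] \<phi>]
    locally_integrable_mult_test[OF U locally_integrable_component[OF loc(3)] \<phi>]
  note i2 = locally_integrable_mult_test[OF U locally_integrable_component[OF locally_integrable_component[OF loc(2)]] \<phi>]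
    locally_integrable_mult_test[OF U locally_integrable_component[OF locally_integrable_component[OF loc(4)]] \<phi>]
  have "(\<integral>x\<in>U. (u x - w x) $ i * partial_deriv j \<phi> x \<partial>lebesgue)
      = (\<integral>x\<in>U. u x $ i * partial_deriv j \<phi> x \<partial>lebesgue) - (\<integral>x\<in>U. w x $ i * partial_deriv j \<phi> x \<partial>lebesgue)"
    using i1 by (simp add: left_diff_distrib set_integral_diff)
  also have "\<dots> = - (\<integral>x\<in>U. Du x $ i $ j * \<phi> x \<partial>lebesgue) + (\<integral>x\<in>U. Dw x $ i $ j * \<phi> x \<partial>lebesgue)"
    using u w \<phi> unfolding has_weak_gradient_def by simp
  also have "\<dots> = - (\<integral>x\<in>U. (Du x - Dw x) $ i $ j * \<phi> x \<partial>lebesgue)"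
    using i2 by (simp add: left_diff_distrib set_integral_diff)
  finally show "(\<integral>x\<in>U. (u x - w x) $ i * partial_deriv j \<phi> x \<partial>lebesgue)
      = - (\<integral>x\<in>U. (Du x - Dw x) $ i $ j * \<phi> x \<partial>lebesgue)" .
qed (use u w in \<open>auto simp: has_weak_gradient_def intro: locally_integrable_diff\<close>)

text \<open>The gradient \<open>Du\<close> of the theorem is an arbitrary weak gradient, while
  \<open>W1p\<close> only provides some gradient in \<open>Lp\<close>; they agree almost
  everywhere.\<close>

lemma weak_gradient_unique:
  fixes u :: "real^'n::finite \<Rightarrow> real^'m::finite"
  assumes U: "open U" and D: "has_weak_gradient u D U" and E: "has_weak_gradient u E U"
  shows "AE x in lborel. x \<in> U \<longrightarrow> D x = E x"
proof -
  have Ub: "U \<in> sets borel" using U by simp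
  have "AE x in lborel. x \<in> U \<longrightarrow> D x $ i $ j = E x $ i $ j" for i j
  proof -
    define h where "h x = D x $ i $ j - E x $ i $ j" for x
    have ld: "locally_integrable_on (\<lambda>x. D x $ i $ j) U" "locally_integrable_on (\<lambda>x. E x $ i $ j) U"
      using D E unfolding has_weak_gradient_def by (auto intro!: locally_integrable_component)
    have lh: "locally_integrable_on h U" unfolding h_def by (rule locally_integrable_diff[OF ld])
    have hm: "h \<in> borel_measurable (lebesgue_on U)" by (rule locally_integrable_measurable[OF U lh])
    obtain g where g: "g \<in> borel_measurable borel" "\<And>x. x \<notin> U \<Longrightarrow> g x = 0" "AE x in lborel. x \<in> U \<longrightarrow> h x = g x"
      using borel_representative[OF Ub hm] by blast
    have "AE x in lborel. x \<in> U \<longrightarrow> g x = 0"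
    proof (rule AE_eq_0_if_orthogonal_to_tests[OF U g(1)])
      fix S assume S: "compact S" "S \<subseteq> U"
      have Sb: "S \<in> sets borel" using S by (simp add: compact_imp_closed)
      have hS: "set_integrable lebesgue S h" using lh S by (auto simp: locally_integrable_on_def)
      have "h \<in> borel_measurable (lebesgue_on S)"
        using hS Sb by (subst borel_measurable_restrict_space_iff) (auto simp: set_integrable_def)
      moreover have "AE x in lborel. x \<in> S \<longrightarrow> h x = g x" using g(3) S(2) by (auto elim!: eventually_mono)
      ultimately show "set_integrable lborel S g"
        using lebesgue_on_integral_transfer(2)[OF Sb g(1)] hS by blast
    next
      fix \<phi> assume \<phi>: "test_function U \<phi>"
      have c: "\<phi> \<in> borel_measurable borel"
        by (rule borel_measurable_continuous_onI[OF smooth_continuous[OF test_function_smooth[OF \<phi>]]])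
      have "(LINT x|lborel. g x * \<phi> x) = (LINT x:U|lborel. g x * \<phi> x)"
        unfolding set_lebesgue_integral_def using g(2) by (intro Bochner_Integration.integral_cong) (auto simp: indicator_def)
      also have "\<dots> = (\<integral>x\<in>U. h x * \<phi> x \<partial>lebesgue)"
      proof (rule lebesgue_on_integral_transfer(3)[OF Ub, symmetric])
        show "(\<lambda>x. h x * \<phi> x) \<in> borel_measurable (lebesgue_on U)"
          using hm borel_measurable_lebesgue_onI[OF c, of U] by measurable
        show "AE x in lborel. x \<in> U \<longrightarrow> h x * \<phi> x = g x * \<phi> x" using g(3) by eventually_elim auto
      qed (use g c in measurable)
      also have "\<dots> = (\<integral>x\<in>U. D x $ i $ j * \<phi> x \<partial>lebesgue) - (\<integral>x\<in>U. E x $ i $ j * \<phi> x \<partial>lebesgue)"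
        unfolding h_def left_diff_distrib
        by (rule set_integral_diff(2)[OF locally_integrable_mult_test(1)[OF U ld(1) \<phi>] locally_integrable_mult_test(1)[OF U ld(2) \<phi>]])
      also have "\<dots> = 0"
      proof -
        have "(\<integral>x\<in>U. u x $ i * partial_deriv j \<phi> x \<partial>lebesgue) = - (\<integral>x\<in>U. D x $ i $ j * \<phi> x \<partial>lebesgue)"
          using D \<phi> unfolding has_weak_gradient_def by blast
        moreover have "(\<integral>x\<in>U. u x $ i * partial_deriv j \<phi> x \<partial>lebesgue) = - (\<integral>x\<in>U. E x $ i $ j * \<phi> x \<partial>lebesgue)"
          using E \<phi> unfolding has_weak_gradient_def by blast
        ultimately show ?thesis by simp
      qed
      finally show "(LINT x|lborel. g x * \<phi> x) = 0" .
    qed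
    with g(3) show ?thesis by eventually_elim (auto simp: h_def)
  qed
  then have "AE x in lborel. \<forall>i\<in>UNIV. \<forall>j\<in>UNIV. x \<in> U \<longrightarrow> D x $ i $ j = E x $ i $ j"
    by (intro eventually_ball_finite ballI finite_class.finite_UNIV)
  then show ?thesis by eventually_elim (auto simp: vec_eq_iff)
qed

lemma has_weak_gradientI_borel:
  fixes u :: "real^'n::finite \<Rightarrow> real^'m::finite"
  assumes U: "U \<in> sets borel" and m: "u \<in> borel_measurable borel" "Du \<in> borel_measurable borel"
    and i: "set_integrable lborel U u" "set_integrable lborel U Du"
    and eq: "\<And>\<phi> i j. test_function U \<phi> \<Longrightarrow> (LINT x|lborel. u x $ i * partial_deriv j \<phi> x) = - (LINT x|lborel. Du x $ i $ j * \<phi> x)"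
  shows "has_weak_gradient u Du U"
  unfolding has_weak_gradient_def
proof (intro conjI allI impI)
  show "locally_integrable_on u U" "locally_integrable_on Du U"
    using lebesgue_on_integral_transfer(1)[OF U m(1) _ borel_measurable_lebesgue_onI[OF m(1)]]
      lebesgue_on_integral_transfer(1)[OF U m(2) _ borel_measurable_lebesgue_onI[OF m(2)]] i
    by (auto intro!: integrable_imp_locally_integrable[OF U])
  fix \<phi> i j assume \<phi>: "test_function U \<phi>"
  have sm: "smooth \<phi>" using \<phi> by (rule test_function_smooth)
  have [measurable]: "\<phi> \<in> borel_measurable borel" "partial_deriv j \<phi> \<in> borel_measurable borel" "u \<in> borel_measurable borel" "Du \<in> borel_measurable borel"
    using borel_measurable_continuous_onI[OF smooth_continuous[OF sm]]
     borel_measurable_continuous_onI[OF smooth_continuous[OF smooth_partial_deriv[OF sm]]] m by auto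
  obtain S where S: "S \<subseteq> U" "\<And>x. x \<notin> S \<Longrightarrow> \<phi> x = 0" "\<And>x j. x \<notin> S \<Longrightarrow> partial_deriv j \<phi> x = 0"
    using test_function_support[OF \<phi>] by metis
  have tr: "(\<integral>x\<in>U. f x \<partial>lebesgue) = (LINT x|lborel. f x)" if "f \<in> borel_measurable borel" "\<And>x. x \<notin> U \<Longrightarrow> f x = 0" for f :: "real^'n \<Rightarrow> real"
  proof -
    have "(\<integral>x\<in>U. f x \<partial>lebesgue) = (LINT x:U|lborel. f x)"
      by (rule lebesgue_on_integral_transfer(3)[OF U that(1)]) (auto intro: borel_measurable_lebesgue_onI that)
    also have "\<dots> = (LINT x|lborel. f x)"
      unfolding set_lebesgue_integral_def using that(2) by (intro Bochner_Integration.integral_cong) (auto simp: indicator_def)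
    finally show ?thesis .
  qed
  have "(\<integral>x\<in>U. u x $ i * partial_deriv j \<phi> x \<partial>lebesgue) = (LINT x|lborel. u x $ i * partial_deriv j \<phi> x)"
    using S by (intro tr) auto
  moreover have "(\<integral>x\<in>U. Du x $ i $ j * \<phi> x \<partial>lebesgue) = (LINT x|lborel. Du x $ i $ j * \<phi> x)"
    using S by (intro tr) auto
  ultimately show "(\<integral>x\<in>U. u x $ i * partial_deriv j \<phi> x \<partial>lebesgue) = - (\<integral>x\<in>U. Du x $ i $ j * \<phi> x \<partial>lebesgue)"
    using eq[OF \<phi>] by simp
qed

section \<open>The divergence equation in Lebesgue spaces\<close>

text \<open>Subtracting a matrix in \<open>sl\<close> leaves the trace unchanged, and each diagonal
  entry is at most the Frobenius norm.\<close>

lemma trace_le_infdist_sl: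
  fixes A :: "real^'n^'n"
  shows "\<bar>trace A\<bar> \<le> CARD('n) * infdist A sl"
proof -
  have tr: "\<bar>trace B\<bar> \<le> CARD('n) * norm B" for B :: "real^'n^'n"
  proof -
    have "\<bar>trace B\<bar> \<le> (\<Sum>i\<in>UNIV. \<bar>B $ i $ i\<bar>)" unfolding trace_def by (rule sum_abs)
    also have "\<dots> \<le> (\<Sum>i\<in>(UNIV::'n set). norm B)"
      by (intro sum_mono order_trans[OF component_le_norm_cart] Finite_Cartesian_Product.norm_nth_le)
    finally show ?thesis by simp
  qed
  have ne: "(sl :: (real^'n^'n) set) \<noteq> {}" by (auto simp: sl_def trace_def intro!: exI[of _ 0])
  have "\<bar>trace A\<bar> / CARD('n) \<le> infdist A sl"
    unfolding infdist_notempty[OF ne]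
  proof (rule cINF_greatest[OF ne])
    fix B :: "real^'n^'n" assume "B \<in> sl"
    then have "trace A = trace (A - B)" by (simp add: sl_def trace_sub)
    then show "\<bar>trace A\<bar> / CARD('n) \<le> dist A B" using tr[of "A - B"] by (simp add: dist_norm divide_le_eq mult.commute)
  qed
  then show ?thesis by (simp add: divide_le_eq mult.commute)
qed

lemma infdist_sl_le_norm: "infdist (A :: real^'n^'n) sl \<le> norm A"
proof -
  have "(0 :: real^'n^'n) \<in> sl" by (simp add: sl_def trace_def)
  from infdist_le[OF this, of A] show ?thesis by simp
qed

lemma set_integrable_L1_of_Lp:
  fixes f :: "'a::euclidean_space \<Rightarrow> real"
  assumes p: "1 \<le> p" and A: "A \<in> sets borel" "bounded A" and f: "f \<in> borel_measurable borel" "set_integrable lborel A (\<lambda>x. \<bar>f x\<bar> powr p)"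
  shows "set_integrable lborel A f"
proof -
  have "f \<in> Lp p A" using f by (simp add: Lp_iff_borel[OF A(1) f(1)])
  then have "integrable (lebesgue_on A) f" by (rule Lp_imp_integrable[OF p A])
  moreover have "integrable (lebesgue_on A) f \<longleftrightarrow> set_integrable lborel A f"
    by (rule lebesgue_on_integral_transfer(1)[OF A(1) f(1) _ borel_measurable_lebesgue_onI[OF f(1)]]) simp
  ultimately show ?thesis by blast
qed

lemma tendsto_powr_0_imp:
  fixes a :: "nat \<Rightarrow> real"
  assumes "0 < p" "\<And>k. 0 \<le> a k" "(\<lambda>k. a k powr p) \<longlonglongrightarrow> 0"
  shows "a \<longlonglongrightarrow> 0"
proof -
  have "(\<lambda>k. (a k powr p) powr (1/p)) \<longlonglongrightarrow> 0 powr (1/p)"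
    using assms by (intro tendsto_powr' tendsto_const assms(3)) auto
  then show ?thesis using assms by (simp add: powr_powr)
qed

text \<open>\<open>U\<close> is placed in a cell and \<open>f\<close>, extended by 0, is
  approximated by trigonometric polynomials. The explicit solutions are Cauchy in the p-norm
  together with their gradients, and trace, gradient bound and integration by parts pass to the
  limit. \<open>C\<close> comes before \<open>U\<close>, because the gradient bound does not depend
  on the period.\<close>

lemma divergence_solution:
  fixes p :: real
  assumes p: "1 < p"
  shows "\<exists>C>0. \<forall>(U :: (real^'n::finite) set) f. open U \<longrightarrow> bounded U \<longrightarrow> f \<in> borel_measurable borel \<longrightarrow> (\<forall>x. x \<notin> U \<longrightarrow> f x = 0) \<longrightarrow>
     integrable lborel (\<lambda>x. \<bar>f x\<bar> powr p) \<longrightarrow>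
     (\<exists>w Dw. w \<in> borel_measurable borel \<and> Dw \<in> borel_measurable borel \<and> w \<in> Lp p U \<and> Dw \<in> Lp p U \<and> has_weak_gradient w Dw U \<and>
        (AE x in lborel. x \<in> U \<longrightarrow> trace (Dw x) = f x) \<and>
        (LINT x:U|lborel. norm (Dw x) powr p) \<le> C * (LINT x|lborel. \<bar>f x\<bar> powr p))"
proof -
  obtain C0 where C0: "C0 > 0" "\<And>l. l > 0 \<Longrightarrow> \<exists>K>0. \<forall>xs :: 'n trig. lattice_trig l xs \<longrightarrow>
     (LINT x:cell l|lborel. norm (sol_Dw xs x) powr p) \<le> C0 * (LINT x:cell l|lborel. \<bar>tp xs x\<bar> powr p) \<and>
     (LINT x:cell l|lborel. norm (sol_w xs x) powr p) \<le> K * (LINT x:cell l|lborel. \<bar>tp xs x\<bar> powr p)"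
    using sol_bounds[OF p, where 'n='n] by blast
  have p1: "1 \<le> p" and p0: "0 < p" "0 \<le> p" using p by auto
  show ?thesis
  proof (rule exI[of _ "C0 * 2 powr p"], intro conjI allI impI)
    show "0 < C0 * 2 powr p" using C0 by simp
    fix U :: "(real^'n) set" and f
    assume U: "open U" "bounded U" and fm: "f \<in> borel_measurable borel" and f0: "\<forall>x. x \<notin> U \<longrightarrow> f x = 0"
      and fi: "integrable lborel (\<lambda>x. \<bar>f x\<bar> powr p)"
    have Ub: "U \<in> sets borel" using U by simp
    obtain R where R: "0 < R" "\<And>x. x \<in> closure U \<Longrightarrow> norm x \<le> R"
      using bounded_closure[OF U(2)] bounded_pos by metis
    \<comment> \<open>The margin 1 keeps the closure of \<open>U\<close> away from the faces of the
      cell, where the approximated function has to vanish.\<close>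
    define l where "l = R + 1"
    have l: "l > 0" using R by (simp add: l_def)
    have Ul: "\<bar>x $ i\<bar> < l" if "x \<in> closure U" for x i
      using R(2)[OF that] component_le_norm_cart[of x i] by (simp add: l_def)
    have Uc: "x \<in> cell l" if "x \<in> U" for x
    proof -
      have "\<bar>x $ i\<bar> < l" for i using Ul closure_subset that by blast
      then show ?thesis unfolding cell_def by (simp add: abs_less_iff) (smt (verit))
    qed
    obtain K where K: "K > 0" "\<And>xs :: 'n trig. lattice_trig l xs \<Longrightarrow>
       (LINT x:cell l|lborel. norm (sol_Dw xs x) powr p) \<le> C0 * (LINT x:cell l|lborel. \<bar>tp xs x\<bar> powr p)"
       "\<And>xs :: 'n trig. lattice_trig l xs \<Longrightarrow>
       (LINT x:cell l|lborel. norm (sol_w xs x) powr p) \<le> K * (LINT x:cell l|lborel. \<bar>tp xs x\<bar> powr p)"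
      using C0(2)[OF l] by blast
    define M where "M = restrict_space lborel (cell l :: (real^'n) set)"
    have MI: "(LINT x|M. g x) = (LINT x:cell l|lborel. g x)" "integrable M g \<longleftrightarrow> set_integrable lborel (cell l) g"
      for g :: "real^'n \<Rightarrow> real"
      unfolding M_def by (simp_all add: integral_restrict_space integrable_restrict_space set_lebesgue_integral_def set_integrable_def)
    have Mm: "g \<in> borel_measurable M" if "g \<in> borel_measurable borel" for g :: "real^'n \<Rightarrow> 'z::euclidean_space"
      unfolding M_def using that by (intro measurable_restrict_space1) simp
    have AEM: "(AE x in M. Q x) \<longleftrightarrow> (AE x in lborel. x \<in> cell l \<longrightarrow> Q x)" for Q
      unfolding M_def by (simp add: AE_restrict_space_iff)
    have Mc: "integrable M (\<lambda>x. norm (g x) powr p)" if "continuous_on UNIV g" for g :: "real^'n \<Rightarrow> 'z::euclidean_space"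
      unfolding MI using p0 that by (intro cell_integrable continuous_on_powr' continuous_intros) auto
    \<comment> \<open>The rate that \<open>Lp_Cauchy_AE_convergent\<close> asks for.\<close>
    define \<epsilon> where "\<epsilon> k = (1/2) ^ k / (2 ^ k) powr p" for k :: nat
    have \<epsilon>: "0 < \<epsilon> k" "\<epsilon> (Suc k) \<le> \<epsilon> k" "\<epsilon> k \<le> (1/2) ^ k" for k
    proof -
      show "0 < \<epsilon> k" by (simp add: \<epsilon>_def)
      have "(2 ^ k) powr p \<le> ((2::real) ^ Suc k) powr p" using p0 by (intro powr_mono2) auto
      then show "\<epsilon> (Suc k) \<le> \<epsilon> k" unfolding \<epsilon>_def by (intro frac_le) auto
      have "(1::real) powr p \<le> (2 ^ k) powr p" using p0 by (intro powr_mono2) auto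
      then show "\<epsilon> k \<le> (1/2) ^ k" unfolding \<epsilon>_def by (simp add: divide_le_eq mult_left_le)
    qed
    have \<epsilon>0: "\<epsilon> \<longlonglongrightarrow> 0"
      by (rule tendsto_sandwich[OF _ _ tendsto_const LIMSEQ_realpow_zero[of "1/2"]]) (use \<epsilon> in \<open>auto intro!: always_eventually less_imp_le\<close>)
    have f0': "f x = 0" if "x \<notin> closure U" for x using f0 closure_subset that by blast
    have "\<exists>xs. lattice_trig l xs \<and> set_integrable lborel (cell l) (\<lambda>x. \<bar>tp xs x - f x\<bar> powr p) \<and>
       (LINT x:cell l|lborel. \<bar>tp xs x - f x\<bar> powr p) < \<epsilon> k" for k
      by (rule dense_trig_Lp[OF p1 l fm fi closed_closure[of U]]) (use f0' Ul \<epsilon>(1) in auto)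
    then have "\<exists>xs. \<forall>k. lattice_trig l (xs k) \<and> set_integrable lborel (cell l) (\<lambda>x. \<bar>tp (xs k) x - f x\<bar> powr p) \<and>
       (LINT x:cell l|lborel. \<bar>tp (xs k) x - f x\<bar> powr p) < \<epsilon> k" by (intro choice allI)
    then obtain xs where xs': "\<forall>k. lattice_trig l (xs k) \<and> set_integrable lborel (cell l) (\<lambda>x. \<bar>tp (xs k) x - f x\<bar> powr p) \<and>
       (LINT x:cell l|lborel. \<bar>tp (xs k) x - f x\<bar> powr p) < \<epsilon> k" ..
    have xs: "lattice_trig l (xs k)"
      "set_integrable lborel (cell l) (\<lambda>x. \<bar>tp (xs k) x - f x\<bar> powr p)"
      "(LINT x:cell l|lborel. \<bar>tp (xs k) x - f x\<bar> powr p) < \<epsilon> k" for k using xs' by auto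
    \<comment> \<open>Field and gradient are paired, so that a single limit argument yields both on
      a common set of full measure.\<close>
    define F where "F k x = (sol_w (xs k) x, sol_Dw (xs k) x)" for k x
    have Fc: "continuous_on UNIV (F k)" for k
      unfolding F_def by (intro continuous_intros continuous_on_sol)
    have tpc: "continuous_on UNIV (tp (xs k))" for k by (intro continuous_intros)
    have [measurable]: "F k \<in> borel_measurable borel" for k by (rule borel_measurable_continuous_onI[OF Fc])
    have tm [measurable]: "tp (xs k) \<in> borel_measurable borel" for k by (rule borel_measurable_continuous_onI[OF tpc])
    note fm [measurable]
    define IF where "IF = (LINT x|lborel. \<bar>f x\<bar> powr p)"
    have fi': "integrable M (\<lambda>x. \<bar>f x\<bar> powr p)" and fle: "(LINT x|M. \<bar>f x\<bar> powr p) = IF"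
    proof -
      have e: "indicator (cell l) x *\<^sub>R \<bar>f x\<bar> powr p = \<bar>f x\<bar> powr p" for x
        using f0 Uc[of x] p0 by (cases "x \<in> U") auto
      show "integrable M (\<lambda>x. \<bar>f x\<bar> powr p)" unfolding MI set_integrable_def e by (rule fi)
      show "(LINT x|M. \<bar>f x\<bar> powr p) = IF" unfolding MI set_lebesgue_integral_def e IF_def ..
    qed
    have tpf: "(LINT x:cell l|lborel. \<bar>tp (xs k) x\<bar> powr p) \<le> 2 powr p * (\<epsilon> k + IF)" for k
    proof -
      have "(LINT x|M. norm (tp (xs k) x - 0) powr p) \<le> (LINT x|M. 2 powr p * (norm (tp (xs k) x - f x) powr p + norm (f x - 0) powr p))"
        using norm_diff_powr_le[OF p0(2), of "tp (xs k) _" 0 "f _"] xs(2)[of k] fi' Mc[OF tpc]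
        by (intro integral_mono) (auto simp: MI(2)[of "\<lambda>x. \<bar>tp (xs k) x - f x\<bar> powr p"])
      also have "\<dots> = 2 powr p * ((LINT x|M. \<bar>tp (xs k) x - f x\<bar> powr p) + IF)"
        using xs(2)[of k] fi' by (simp add: MI(2)[of "\<lambda>x. \<bar>tp (xs k) x - f x\<bar> powr p"] fle)
      also have "\<dots> \<le> 2 powr p * (\<epsilon> k + IF)" using xs(3)[of k] by (simp add: MI)
      finally show ?thesis by (simp add: MI)
    qed
    have tpd: "(LINT x:cell l|lborel. \<bar>tp (xs k) x - tp (xs m) x\<bar> powr p) \<le> 2 powr p * (\<epsilon> k + \<epsilon> m)" for k m
    proof -
      have i: "integrable M (\<lambda>x. \<bar>tp (xs k) x - f x\<bar> powr p)" for k using xs(2)[of k] by (simp add: MI)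
      have "(LINT x|M. norm (tp (xs k) x - tp (xs m) x) powr p) \<le> (LINT x|M. 2 powr p * (norm (tp (xs k) x - f x) powr p + norm (f x - tp (xs m) x) powr p))"
        using norm_diff_powr_le[OF p0(2), of "tp (xs k) _" "tp (xs m) _" "f _"] i[of k] i[of m] Mc[OF continuous_on_diff[OF tpc[of k] tpc[of m]]]
        by (intro integral_mono) (auto simp: abs_minus_commute[of "f _"])
      also have "\<dots> = 2 powr p * ((LINT x|M. \<bar>tp (xs k) x - f x\<bar> powr p) + (LINT x|M. \<bar>tp (xs m) x - f x\<bar> powr p))"
        using i[of k] i[of m] by (simp add: abs_minus_commute[of "f _"])
      also have "\<dots> \<le> 2 powr p * (\<epsilon> k + \<epsilon> m)" using xs(3)[of k] xs(3)[of m] by (simp add: MI)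
      finally show ?thesis by (simp add: MI)
    qed
    define c where "c = 2 powr p * ((K + C0) * 2 powr p)"
    have c: "0 < c" using K C0 by (simp add: c_def)
    have Fd: "(LINT x|M. norm (F k x - F m x) powr p) \<le> c * (\<epsilon> k + \<epsilon> m)" for k m
    proof -
      define ys where "ys = xs k @ scale_freq (\<lambda>_. - 1) (xs m)"
      have ys: "lattice_trig l ys" using xs(1) by (simp add: ys_def)
      have eq: "F k x - F m x = (sol_w ys x, sol_Dw ys x)" for x unfolding F_def ys_def sol_diff by simp
      have "norm (F k x - F m x) powr p \<le> 2 powr p * (norm (sol_w ys x) powr p + norm (sol_Dw ys x) powr p)" for x
      proof -
        have "norm (F k x - F m x) powr p \<le> (norm (sol_w ys x) + norm (sol_Dw ys x)) powr p"
          unfolding eq using p0 norm_Pair_le[of "sol_w ys x" "sol_Dw ys x"] by (intro powr_mono2) auto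
        also have "\<dots> \<le> 2 powr p * (norm (sol_w ys x) powr p + norm (sol_Dw ys x) powr p)"
          using p0 by (intro powr_add_le) auto
        finally show ?thesis .
      qed
      then have "(LINT x|M. norm (F k x - F m x) powr p) \<le> (LINT x|M. 2 powr p * (norm (sol_w ys x) powr p + norm (sol_Dw ys x) powr p))"
        using Mc[OF continuous_on_sol(1)] Mc[OF continuous_on_sol(2)] Mc[OF continuous_on_diff[OF Fc Fc]]
        by (intro integral_mono) auto
      also have "\<dots> = 2 powr p * ((LINT x|M. norm (sol_w ys x) powr p) + (LINT x|M. norm (sol_Dw ys x) powr p))"
        using Mc[OF continuous_on_sol(1)] Mc[OF continuous_on_sol(2)] by simp
      also have "\<dots> \<le> 2 powr p * (K * (LINT x:cell l|lborel. \<bar>tp ys x\<bar> powr p) + C0 * (LINT x:cell l|lborel. \<bar>tp ys x\<bar> powr p))"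
        using K(2,3)[OF ys] by (intro mult_left_mono add_mono) (auto simp: MI)
      also have "\<dots> = 2 powr p * ((K + C0) * (LINT x:cell l|lborel. \<bar>tp (xs k) x - tp (xs m) x\<bar> powr p))"
        by (simp only: ys_def sol_diff(1) distrib_right)
      also have "\<dots> \<le> 2 powr p * ((K + C0) * (2 powr p * (\<epsilon> k + \<epsilon> m)))"
        using K C0 tpd by (intro mult_left_mono) auto
      finally show ?thesis by (simp add: c_def mult.assoc)
    qed
    have Fi: "integrable M (\<lambda>x. norm (F k x - F m x) powr p)" for k m by (rule Mc[OF continuous_on_diff[OF Fc Fc]])
    have "AE x in M. convergent (\<lambda>k. F k x)"
    proof (rule Lp_Cauchy_AE_convergent[OF p0(1) Mm, of F "2 * c"])
      show "(LINT x|M. norm (F (Suc k) x - F k x) powr p) \<le> 2 * c * (1/2) ^ k / (2 ^ k) powr p" for k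
      proof -
        have "c * (\<epsilon> (Suc k) + \<epsilon> k) \<le> c * (2 * \<epsilon> k)" using \<epsilon>(2)[of k] c by (intro mult_left_mono) auto
        then show ?thesis using Fd[of "Suc k" k] by (simp add: \<epsilon>_def)
      qed
    qed (use c Fi in auto)
    define G where "G x = lim (\<lambda>k. F k x)" for x
    have Gm [measurable]: "G \<in> borel_measurable borel" unfolding G_def by measurable
    have lim: "AE x in M. (\<lambda>k. F k x) \<longlonglongrightarrow> G x"
      using \<open>AE x in M. convergent (\<lambda>k. F k x)\<close> by eventually_elim (simp add: G_def convergent_LIMSEQ_iff)
    define w where "w x = fst (G x)" for x
    define Dw where "Dw x = snd (G x)" for x
    have wm [measurable]: "w \<in> borel_measurable borel" "Dw \<in> borel_measurable borel" unfolding w_def Dw_def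
      using Gm by (auto intro!: borel_measurable_continuous_onI measurable_compose[OF Gm] continuous_intros)
    have limw: "AE x in M. (\<lambda>k. sol_w (xs k) x) \<longlonglongrightarrow> w x" "AE x in M. (\<lambda>k. sol_Dw (xs k) x) \<longlonglongrightarrow> Dw x"
    proof -
      show "AE x in M. (\<lambda>k. sol_w (xs k) x) \<longlonglongrightarrow> w x"
        using lim
      proof eventually_elim
        case (elim x) show ?case using tendsto_fst[OF elim] by (simp add: F_def w_def)
      qed
      show "AE x in M. (\<lambda>k. sol_Dw (xs k) x) \<longlonglongrightarrow> Dw x"
        using lim
      proof eventually_elim
        case (elim x) show ?case using tendsto_snd[OF elim] by (simp add: F_def Dw_def)
      qed
    qed
    have bnd: "(\<lambda>k. B * (2 powr p * (\<epsilon> k + IF))) \<longlonglongrightarrow> B * (2 powr p * (0 + IF))" for B by (intro tendsto_intros \<epsilon>0)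
    have "integrable M (\<lambda>x. norm (Dw x) powr p) \<and> (LINT x|M. norm (Dw x) powr p) \<le> C0 * (2 powr p * (0 + IF))"
    proof (rule Lp_fatou[OF p0(1) _ Mm limw(2) _ _ bnd])
      fix k
      show "sol_Dw (xs k) \<in> borel_measurable M" by (rule Mm[OF borel_measurable_continuous_onI[OF continuous_on_sol(2)]])
      show "integrable M (\<lambda>x. norm (sol_Dw (xs k) x) powr p)" by (rule Mc[OF continuous_on_sol(2)])
      have "C0 * (LINT x:cell l|lborel. \<bar>tp (xs k) x\<bar> powr p) \<le> C0 * (2 powr p * (\<epsilon> k + IF))"
        using C0(1) tpf by (intro mult_left_mono) auto
      then show "(LINT x|M. norm (sol_Dw (xs k) x) powr p) \<le> C0 * (2 powr p * (\<epsilon> k + IF))"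
        unfolding MI using K(2)[OF xs(1)[of k]] by linarith
    qed measurable
    then have iDw: "integrable M (\<lambda>x. norm (Dw x) powr p)" and bDw: "(LINT x|M. norm (Dw x) powr p) \<le> C0 * 2 powr p * IF" by simp_all
    have iw: "integrable M (\<lambda>x. norm (w x) powr p)"
    proof (rule conjunct1[OF Lp_fatou, OF p0(1) _ Mm limw(1) _ _ bnd])
      fix k
      show "sol_w (xs k) \<in> borel_measurable M" by (rule Mm[OF borel_measurable_continuous_onI[OF continuous_on_sol(1)]])
      show "integrable M (\<lambda>x. norm (sol_w (xs k) x) powr p)" by (rule Mc[OF continuous_on_sol(1)])
      have "K * (LINT x:cell l|lborel. \<bar>tp (xs k) x\<bar> powr p) \<le> K * (2 powr p * (\<epsilon> k + IF))"
        using K(1) tpf by (intro mult_left_mono) auto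
      then show "(LINT x|M. norm (sol_w (xs k) x) powr p) \<le> K * (2 powr p * (\<epsilon> k + IF))"
        unfolding MI using K(3)[OF xs(1)[of k]] by linarith
    qed measurable
    have Usub: "U \<subseteq> cell l" using Uc by blast
    have LpU: "w \<in> Lp p U" "Dw \<in> Lp p U"
      using set_integrable_subset[OF iw[unfolded MI] _ Usub] set_integrable_subset[OF iDw[unfolded MI] _ Usub] Ub wm
      by (simp_all add: Lp_iff_borel)
    have bound: "(LINT x:U|lborel. norm (Dw x) powr p) \<le> C0 * 2 powr p * IF"
    proof -
      have "(LINT x:U|lborel. norm (Dw x) powr p) \<le> (LINT x:cell l|lborel. norm (Dw x) powr p)"
        unfolding set_lebesgue_integral_def
        using set_integrable_subset[OF iDw[unfolded MI] _ Usub] Ub iDw[unfolded MI] Uc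
        by (intro integral_mono) (auto simp: set_integrable_def indicator_def)
      then show ?thesis using bDw by (simp add: MI)
    qed
    have trm: "(\<lambda>x. trace (Dw x) - f x) \<in> borel_measurable borel" unfolding trace_def by measurable
    have "integrable M (\<lambda>x. norm (trace (Dw x) - f x) powr p) \<and> (LINT x|M. norm (trace (Dw x) - f x) powr p) \<le> 0"
    proof (rule Lp_fatou[OF p0(1) _ Mm[OF trm] _ _ _ \<epsilon>0])
      show "(\<lambda>x. tp (xs k) x - f x) \<in> borel_measurable M" for k by (rule Mm) measurable
      show "AE x in M. (\<lambda>k. tp (xs k) x - f x) \<longlonglongrightarrow> trace (Dw x) - f x"
        using limw(2)
      proof eventually_elim
        case (elim x)
        have "(\<lambda>k. trace (sol_Dw (xs k) x)) \<longlonglongrightarrow> trace (Dw x)"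
          unfolding trace_def by (intro tendsto_sum tendsto_vec_nth elim)
        then show ?case by (intro tendsto_diff tendsto_const) (simp add: trace_def sol_Dw_trace)
      qed
      show "integrable M (\<lambda>x. norm (tp (xs k) x - f x) powr p)" for k using xs(2)[of k] by (simp add: MI)
      show "(LINT x|M. norm (tp (xs k) x - f x) powr p) \<le> \<epsilon> k" for k using xs(3)[of k] by (simp add: MI)
    qed
    then have "AE x in M. norm (trace (Dw x) - f x) powr p = 0"
      using integral_nonneg_eq_0_iff_AE[of M "\<lambda>x. norm (trace (Dw x) - f x) powr p"]
      by (metis (no_types, lifting) AE_I2 antisym integral_nonneg_AE powr_ge_zero)
    then have trD: "AE x in lborel. x \<in> U \<longrightarrow> trace (Dw x) = f x"
      unfolding AEM using Uc by (auto elim!: eventually_mono)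
    define m where "m = measure lborel (cell l :: (real^'n) set)"
    have m: "m > 0" unfolding m_def by (rule cell_measure_pos[OF l])
    \<comment> \<open>Fatou's lemma in the second index of the Cauchy estimate, with
      \<open>k\<close> fixed, turns almost everywhere convergence into convergence in the p-norm.
      The convergence \<open>a0\<close> in the 1-norm then follows on the cell.\<close>
    have FG': "integrable M (\<lambda>x. norm (F k x - G x) powr p) \<and> (LINT x|M. norm (F k x - G x) powr p) \<le> c * (\<epsilon> k + 0)" for k
    proof (rule Lp_fatou[OF p0(1), where F = "\<lambda>m x. F k x - F m x" and c = "\<lambda>m. c * (\<epsilon> k + \<epsilon> m)"])
      show "(\<lambda>x. F k x - F m x) \<in> borel_measurable M" "(\<lambda>x. F k x - G x) \<in> borel_measurable M" for m
        by (rule Mm; measurable)+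
      show "AE x in M. (\<lambda>m. F k x - F m x) \<longlonglongrightarrow> F k x - G x"
        using lim by eventually_elim (intro tendsto_intros)
      show "(\<lambda>m. c * (\<epsilon> k + \<epsilon> m)) \<longlonglongrightarrow> c * (\<epsilon> k + 0)" by (intro tendsto_intros \<epsilon>0)
    qed (use Fi Fd in auto)
    have FG: "integrable M (\<lambda>x. norm (F k x - G x) powr p)" "(LINT x|M. norm (F k x - G x) powr p) \<le> c * (\<epsilon> k + 0)" for k
      using FG'[of k] by auto
    define a where "a k = (LINT x|M. norm (F k x - G x))" for k
    have FG1: "integrable M (\<lambda>x. norm (F k x - G x))" for k
      unfolding MI
      by (rule set_integrable_L1_of_Lp[OF p1 cell_borel bounded_cell]) (use FG(1)[of k] in \<open>auto simp: MI\<close>)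
    have a0: "a \<longlonglongrightarrow> 0"
    proof (rule tendsto_powr_0_imp[OF p0(1)])
      show "0 \<le> a k" for k unfolding a_def by (intro integral_nonneg_AE) auto
      have "a k powr p \<le> 2 powr p * m powr (p - 1) * (c * \<epsilon> k)" for k
      proof -
        have "a k powr p \<le> 2 powr p * m powr (p - 1) * (LINT x:cell l|lborel. norm (F k x - G x) powr p)"
          unfolding a_def MI m_def
          by (rule set_integral_powr_le[OF p1]) (use m FG(1)[of k] FG1[of k] in \<open>auto simp: m_def MI\<close>)
        also have "\<dots> \<le> 2 powr p * m powr (p - 1) * (c * \<epsilon> k)"
          using FG(2)[of k] by (intro mult_left_mono) (auto simp: MI)
        finally show ?thesis .
      qed
      moreover have "(\<lambda>k. 2 powr p * m powr (p - 1) * (c * \<epsilon> k)) \<longlonglongrightarrow> 2 powr p * m powr (p - 1) * (c * 0)"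
        by (intro tendsto_intros \<epsilon>0)
      ultimately show "(\<lambda>k. a k powr p) \<longlonglongrightarrow> 0"
        by (intro tendsto_sandwich[where f = "\<lambda>_. 0" and g = "\<lambda>k. a k powr p"]) auto
    qed
    \<comment> \<open>The passage to the limit is stated once for both sides of the integration by
      parts; \<open>le\<close> holds for every component of the field and of the gradient.\<close>
    have pass: "(\<lambda>k. LINT x|lborel. g k x * \<psi> x) \<longlonglongrightarrow> (LINT x|lborel. h x * \<psi> x)"
      if g: "\<And>k. continuous_on UNIV (g k)" and h: "h \<in> borel_measurable borel" and le: "\<And>k x. \<bar>g k x - h x\<bar> \<le> norm (F k x - G x)"
        and \<psi>: "continuous_on UNIV \<psi>" "\<And>x. \<bar>\<psi> x\<bar> \<le> B" "\<And>x. x \<notin> U \<Longrightarrow> \<psi> x = 0" for g :: "nat \<Rightarrow> real^'n \<Rightarrow> real" and h \<psi> B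
    proof -
      have gm [measurable]: "g k \<in> borel_measurable borel" for k by (rule borel_measurable_continuous_onI[OF g])
      note h [measurable] borel_measurable_continuous_onI[OF \<psi>(1), measurable]
      have toM: "(LINT x|lborel. q x * \<psi> x) = (LINT x|M. q x * \<psi> x)" for q
        unfolding MI set_lebesgue_integral_def using \<psi>(3) Uc
        by (intro Bochner_Integration.integral_cong) (auto simp: indicator_def)
      have ig: "integrable M (g k)" for k unfolding MI by (rule cell_integrable[OF g])
      have igh: "integrable M (\<lambda>x. g k x - h x)" for k
        by (rule Bochner_Integration.integrable_bound[OF FG1[of k]]) (use le in \<open>auto intro!: AE_I2 Mm\<close>)
      have ih: "integrable M h"
        using Bochner_Integration.integrable_diff[OF ig[of 0] igh[of 0]] by simp
      have B0: "0 \<le> B" using \<psi>(2)[of 0] by linarith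
      have "norm ((LINT x|lborel. g k x * \<psi> x) - (LINT x|lborel. h x * \<psi> x)) \<le> B * a k" for k
      proof -
        have "(LINT x|lborel. g k x * \<psi> x) - (LINT x|lborel. h x * \<psi> x) = (LINT x|M. (g k x - h x) * \<psi> x)"
          unfolding toM left_diff_distrib
          using integrable_mult_bounded(1)[OF ig Mm \<psi>(2)] integrable_mult_bounded(1)[OF ih Mm \<psi>(2)] by simp
        also have "norm \<dots> \<le> (LINT x|M. \<bar>(g k x - h x) * \<psi> x\<bar>)" using integral_abs_bound by simp
        also have "\<dots> \<le> (LINT x|M. B * norm (F k x - G x))"
        proof (rule integral_mono)
          show "integrable M (\<lambda>x. \<bar>(g k x - h x) * \<psi> x\<bar>)"
            by (intro integrable_abs integrable_mult_bounded(1)[OF igh Mm \<psi>(2)]) measurable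
          show "\<bar>(g k x - h x) * \<psi> x\<bar> \<le> B * norm (F k x - G x)" for x
            unfolding abs_mult using mult_mono[OF le[of k x] \<psi>(2)[of x]] by (simp add: mult.commute)
        qed (use FG1[of k] in simp)
        also have "\<dots> = B * a k" by (simp add: a_def)
        finally show ?thesis .
      qed
      then have "(\<lambda>k. (LINT x|lborel. g k x * \<psi> x) - (LINT x|lborel. h x * \<psi> x)) \<longlonglongrightarrow> 0"
        by (intro Lim_null_comparison[OF always_eventually tendsto_mult_right_zero[OF a0]]) blast
      then show ?thesis by (rule LIM_zero_cancel)
    qed
    have tr: "set_integrable lborel U q" if "q \<in> borel_measurable borel" "q \<in> Lp p U" for q :: "real^'n \<Rightarrow> 'z::euclidean_space"
    proof -
      have "integrable (lebesgue_on U) q \<longleftrightarrow> set_integrable lborel U q"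
        by (rule lebesgue_on_integral_transfer(1)[OF Ub that(1) _ borel_measurable_lebesgue_onI[OF that(1)]]) simp
      then show ?thesis using Lp_imp_integrable[OF p1 Ub U(2) that(2)] by blast
    qed
    have "has_weak_gradient w Dw U"
    proof (rule has_weak_gradientI_borel[OF Ub wm])
      show "set_integrable lborel U w" "set_integrable lborel U Dw"
        by (rule tr[OF wm(1) LpU(1)], rule tr[OF wm(2) LpU(2)])
      fix \<phi> i j assume \<phi>: "test_function U \<phi>"
      obtain S where S: "S \<subseteq> U" "\<And>x. x \<notin> S \<Longrightarrow> \<phi> x = 0" "\<And>x j. x \<notin> S \<Longrightarrow> partial_deriv j \<phi> x = 0"
        using test_function_support[OF \<phi>] by metis
      have z: "\<phi> x = 0" "partial_deriv j \<phi> x = 0" if "x \<notin> U" for x using S that by blast+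
      obtain B where B: "\<And>x. \<bar>\<phi> x\<bar> \<le> B" "\<And>x j. \<bar>partial_deriv j \<phi> x\<bar> \<le> B" using test_function_bounded[OF \<phi>] by metis
      have sm: "smooth \<phi>" using \<phi> by (rule test_function_smooth)
      have c\<phi>: "continuous_on UNIV \<phi>" "continuous_on UNIV (partial_deriv j \<phi>)"
        by (rule smooth_continuous[OF sm], rule smooth_continuous[OF smooth_partial_deriv[OF sm]])
      have cw: "continuous_on UNIV (\<lambda>x. sol_w (xs k) x $ i)" "continuous_on UNIV (\<lambda>x. sol_Dw (xs k) x $ i $ j)" for k
        by (intro continuous_intros continuous_on_sol)+
      have n1: "\<bar>sol_w (xs k) x $ i - w x $ i\<bar> \<le> norm (F k x - G x)" for k x
      proof -
        have "\<bar>(sol_w (xs k) x - w x) $ i\<bar> \<le> norm (fst (F k x - G x))" by (simp add: F_def w_def component_le_norm_cart flip: vector_minus_component)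
        also have "\<dots> \<le> norm (F k x - G x)" using norm_fst_le[of "fst (F k x - G x)" "snd (F k x - G x)"] unfolding prod.collapse .
        finally show ?thesis by simp
      qed
      have n2: "\<bar>sol_Dw (xs k) x $ i $ j - Dw x $ i $ j\<bar> \<le> norm (F k x - G x)" for k x
      proof -
        have "\<bar>(sol_Dw (xs k) x - Dw x) $ i $ j\<bar> \<le> norm ((sol_Dw (xs k) x - Dw x) $ i)" by (rule component_le_norm_cart)
        also have "\<dots> \<le> norm (snd (F k x - G x))" by (simp add: F_def Dw_def Finite_Cartesian_Product.norm_nth_le flip: vector_minus_component)
        also have "\<dots> \<le> norm (F k x - G x)" using norm_snd_le[of "snd (F k x - G x)" "fst (F k x - G x)"] unfolding prod.collapse .
        finally show ?thesis by simp
      qed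
      have X: "(\<lambda>k. LINT x|lborel. sol_w (xs k) x $ i * partial_deriv j \<phi> x) \<longlonglongrightarrow> (LINT x|lborel. w x $ i * partial_deriv j \<phi> x)"
        by (rule pass[OF cw(1) _ n1 c\<phi>(2) B(2) z(2)]) measurable
      have Y: "(\<lambda>k. - (LINT x|lborel. sol_Dw (xs k) x $ i $ j * \<phi> x)) \<longlonglongrightarrow> - (LINT x|lborel. Dw x $ i $ j * \<phi> x)"
        by (rule tendsto_minus[OF pass[OF cw(2) _ n2 c\<phi>(1) B(1) z(1)]]) measurable
      have "(LINT x|lborel. sol_w (xs k) x $ i * partial_deriv j \<phi> x) = - (LINT x|lborel. sol_Dw (xs k) x $ i $ j * \<phi> x)" for k
        by (rule integration_by_parts_test[OF sol_w_has_derivative cw \<phi>])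
      with X have "(\<lambda>k. - (LINT x|lborel. sol_Dw (xs k) x $ i $ j * \<phi> x)) \<longlonglongrightarrow> (LINT x|lborel. w x $ i * partial_deriv j \<phi> x)" by simp
      from LIMSEQ_unique[OF this Y]
      show "(LINT x|lborel. w x $ i * partial_deriv j \<phi> x) = - (LINT x|lborel. Dw x $ i $ j * \<phi> x)" .
    qed
    with wm LpU trD bound
    show "\<exists>w Dw. w \<in> borel_measurable borel \<and> Dw \<in> borel_measurable borel \<and> w \<in> Lp p U \<and> Dw \<in> Lp p U \<and> has_weak_gradient w Dw U \<and>
        (AE x in lborel. x \<in> U \<longrightarrow> trace (Dw x) = f x) \<and>
        (LINT x:U|lborel. norm (Dw x) powr p) \<le> C0 * 2 powr p * (LINT x|lborel. \<bar>f x\<bar> powr p)"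
      unfolding IF_def by blast
  qed
qed

section \<open>Weak derivatives of convolutions\<close>

text \<open>The integrals run over the whole space and only the tests know \<open>U\<close>, so the
  same function can be differentiated on \<open>U\<close> and on \<open>UNIV\<close>, possibly with
  different results outside \<open>U\<close>.\<close>

definition weak_deriv :: "(real^'n::finite) set \<Rightarrow> 'n \<Rightarrow> (real^'n \<Rightarrow> real) \<Rightarrow> (real^'n \<Rightarrow> real) \<Rightarrow> bool" where
  "weak_deriv U j F g \<longleftrightarrow> (\<forall>\<phi>. test_function U \<phi> \<longrightarrow>
     (LINT x|lborel. F x * partial_deriv j \<phi> x) = - (LINT x|lborel. g x * \<phi> x))"

lemma test_function_continuous:
  assumes "test_function U \<phi>"
  shows "continuous_on UNIV \<phi>" "continuous_on UNIV (partial_deriv j \<phi>)"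
  using smooth_continuous[OF test_function_smooth[OF assms]]
    smooth_continuous[OF smooth_partial_deriv[OF test_function_smooth[OF assms]]] by auto

lemma integrable_mult_test:
  fixes F :: "real^'n::finite \<Rightarrow> real"
  assumes F: "integrable lborel F" and \<phi>: "test_function U \<phi>"
  shows "integrable lborel (\<lambda>x. F x * \<phi> x)" "integrable lborel (\<lambda>x. F x * partial_deriv j \<phi> x)"
proof -
  obtain B where B: "\<And>x. \<bar>\<phi> x\<bar> \<le> B" "\<And>x j. \<bar>partial_deriv j \<phi> x\<bar> \<le> B" using test_function_bounded[OF \<phi>] by metis
  note c = test_function_continuous[OF \<phi>, THEN borel_measurable_continuous_onI]
  show "integrable lborel (\<lambda>x. F x * \<phi> x)" "integrable lborel (\<lambda>x. F x * partial_deriv j \<phi> x)"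
    using integrable_mult_bounded(1)[OF F _ B(1)] integrable_mult_bounded(1)[OF F _ B(2)] c by auto
qed

lemma weak_deriv_add:
  assumes "weak_deriv U j F f" "weak_deriv U j G g"
    and "integrable lborel F" "integrable lborel f" "integrable lborel G" "integrable lborel g"
  shows "weak_deriv U j (\<lambda>x. F x + G x) (\<lambda>x. f x + g x)"
  unfolding weak_deriv_def
proof (intro allI impI)
  fix \<phi> assume \<phi>: "test_function U \<phi>"
  show "(LINT x|lborel. (F x + G x) * partial_deriv j \<phi> x) = - (LINT x|lborel. (f x + g x) * \<phi> x)"
    using assms(1,2) \<phi> integrable_mult_test[OF assms(3) \<phi>] integrable_mult_test[OF assms(4) \<phi>]
      integrable_mult_test[OF assms(5) \<phi>] integrable_mult_test[OF assms(6) \<phi>]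
    by (simp add: weak_deriv_def distrib_right)
qed

lemma weak_deriv_sum:
  assumes "finite I" "\<And>i. i \<in> I \<Longrightarrow> weak_deriv U j (F i) (f i)"
    and "\<And>i. i \<in> I \<Longrightarrow> integrable lborel (F i)" "\<And>i. i \<in> I \<Longrightarrow> integrable lborel (f i)"
  shows "weak_deriv U j (\<lambda>x. \<Sum>i\<in>I. F i x) (\<lambda>x. \<Sum>i\<in>I. f i x)"
  using assms
proof (induction I)
  case (insert i I)
  then show ?case by (simp add: weak_deriv_add)
qed (simp add: weak_deriv_def)

lemma weak_deriv_mono: "weak_deriv U j F f \<Longrightarrow> V \<subseteq> U \<Longrightarrow> weak_deriv V j F f"
  unfolding weak_deriv_def using test_function_mono by blast

lemma test_function_translate:
  fixes \<phi> :: "real^'n::finite \<Rightarrow> real"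
  assumes \<phi>: "smooth \<phi>" and S: "compact S" "\<And>x. \<phi> x \<noteq> 0 \<Longrightarrow> x \<in> S" "\<And>x. x \<in> S \<Longrightarrow> x + z \<in> U"
  shows "test_function U (\<lambda>y. \<phi> (y - z))" "partial_deriv j (\<lambda>y. \<phi> (y - z)) y = partial_deriv j \<phi> (y - z)"
proof -
  show "test_function U (\<lambda>y. \<phi> (y - z))"
  proof (rule test_functionI)
    show "smooth (\<lambda>y. \<phi> (y - z))" using Ck_affine[of _ \<phi> 1 "- z"] \<phi> by simp
    show "compact ((\<lambda>x. x + z) ` S)" using S(1) compact_translation[of S z] by (simp add: add.commute)
    show "y \<in> (\<lambda>x. x + z) ` S" if "\<phi> (y - z) \<noteq> 0" for y using S(2)[OF that] by (intro image_eqI[of _ _ "y - z"]) auto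
  qed (use S(3) in auto)
  show "partial_deriv j (\<lambda>y. \<phi> (y - z)) y = partial_deriv j \<phi> (y - z)"
    using partial_deriv_affine[OF \<phi>, of j 1 "- z" y] by simp
qed

text \<open>The derivative falls on the convolved function, so it is only valid where the kernel looks into \<open>U\<close>;
  in \<open>weak_deriv_smooth_conv\<close> below it falls on the kernel, which is valid everywhere.\<close>

lemma weak_deriv_localized_conv:
  fixes u d :: "real^'n::finite \<Rightarrow> real"
  assumes \<psi>: "smooth \<psi>" "\<And>x. \<psi> x \<noteq> 0 \<Longrightarrow> x \<in> B" and B: "closed B" and K: "integrable lborel K"
    and UB: "\<And>x z. x \<in> U \<Longrightarrow> x \<in> B \<Longrightarrow> K z \<noteq> 0 \<Longrightarrow> x + z \<in> U"
    and u: "integrable lborel u" "integrable lborel d" and wd: "weak_deriv U l u d"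
  shows "weak_deriv U l (\<lambda>x. \<psi> x * conv K u x) (\<lambda>x. partial_deriv l \<psi> x * conv K u x + \<psi> x * conv K d x)"
  unfolding weak_deriv_def
proof (intro allI impI)
  fix \<phi> assume \<phi>: "test_function U \<phi>"
  have sm: "smooth \<phi>" using \<phi> by (rule test_function_smooth)
  define \<theta> where "\<theta> x = \<psi> x * \<phi> x" for x
  have \<theta>: "test_function U \<theta>" unfolding \<theta>_def by (rule test_function_mult[OF \<psi>(1) \<phi>])
  define \<omega> where "\<omega> x = partial_deriv l \<psi> x * \<phi> x" for x
  have \<omega>: "test_function U \<omega>" unfolding \<omega>_def by (rule test_function_mult[OF smooth_partial_deriv[OF \<psi>(1)] \<phi>])
  have d\<theta>: "partial_deriv l \<theta> x = \<psi> x * partial_deriv l \<phi> x + \<omega> x" for x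
    unfolding \<theta>_def \<omega>_def by (rule partial_deriv_mult[OF \<psi>(1) sm])
  obtain S0 where S0: "compact S0" "S0 \<subseteq> U" "\<And>x. x \<notin> S0 \<Longrightarrow> \<phi> x = 0" using test_function_support[OF \<phi>] by metis
  define S where "S = S0 \<inter> B"
  have S: "compact S" using S0(1) B by (simp add: S_def compact_Int_closed)
  have \<theta>S: "x \<in> S" if "\<theta> x \<noteq> 0" for x using that S0(3)[of x] \<psi>(2)[of x] by (auto simp: \<theta>_def S_def)
  obtain b where b: "\<And>x. \<bar>\<theta> x\<bar> \<le> b" "\<And>x j. \<bar>partial_deriv j \<theta> x\<bar> \<le> b" using test_function_bounded[OF \<theta>] by metis
  note \<theta>m = test_function_continuous[OF \<theta>, THEN borel_measurable_continuous_onI]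
  note iu = conv_integrable[OF K u(1)] and id = conv_integrable[OF K u(2)]
  have "(LINT x|lborel. conv K u x * partial_deriv l \<theta> x) = (LINT z|lborel. K z * (LINT y|lborel. u y * partial_deriv l \<theta> (y - z)))"
    by (rule conv_duality[OF K u(1) _ b(2)]) (use \<theta>m in simp)
  also have "\<dots> = (LINT z|lborel. - (K z * (LINT y|lborel. d y * \<theta> (y - z))))"
  proof (rule Bochner_Integration.integral_cong[OF refl])
    fix z
    show "K z * (LINT y|lborel. u y * partial_deriv l \<theta> (y - z)) = - (K z * (LINT y|lborel. d y * \<theta> (y - z)))"
    proof (cases "K z = 0")
      case False
      \<comment> \<open>The support of \<open>\<theta>\<close> lies in \<open>B\<close>, so its
        translate by a vector in the support of the kernel stays in \<open>U\<close> and is a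
        legitimate test for \<open>u\<close>.\<close>
      have "x + z \<in> U" if "x \<in> S" for x using UB[OF _ _ False, of x] that S0(2) by (auto simp: S_def)
      note tt = test_function_translate[OF test_function_smooth[OF \<theta>] S \<theta>S this]
      have "(LINT y|lborel. u y * partial_deriv l \<theta> (y - z)) = - (LINT y|lborel. d y * \<theta> (y - z))"
        using wd[unfolded weak_deriv_def, rule_format, OF tt(1)] by (simp add: tt(2))
      then show ?thesis by simp
    qed simp
  qed
  also have "\<dots> = - (LINT x|lborel. conv K d x * \<theta> x)"
    using conv_duality[OF K u(2) _ b(1)] \<theta>m by simp
  finally have main: "(LINT x|lborel. conv K u x * partial_deriv l \<theta> x) = - (LINT x|lborel. conv K d x * \<theta> x)" .
  have "(LINT x|lborel. \<psi> x * conv K u x * partial_deriv l \<phi> x) = (LINT x|lborel. conv K u x * partial_deriv l \<theta> x - conv K u x * \<omega> x)"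
    by (simp add: d\<theta> algebra_simps)
  also have "\<dots> = - (LINT x|lborel. conv K d x * \<theta> x) - (LINT x|lborel. conv K u x * \<omega> x)"
    using integrable_mult_test(2)[OF iu \<theta>, of l] integrable_mult_test(1)[OF iu \<omega>] by (simp add: main)
  also have "\<dots> = - (LINT x|lborel. conv K d x * \<theta> x + conv K u x * \<omega> x)"
    using integrable_mult_test(1)[OF id \<theta>] integrable_mult_test(1)[OF iu \<omega>] by simp
  also have "\<dots> = - (LINT x|lborel. (partial_deriv l \<psi> x * conv K u x + \<psi> x * conv K d x) * \<phi> x)"
    by (simp add: \<theta>_def \<omega>_def algebra_simps)
  finally show "(LINT x|lborel. \<psi> x * conv K u x * partial_deriv l \<phi> x)
      = - (LINT x|lborel. (partial_deriv l \<psi> x * conv K u x + \<psi> x * conv K d x) * \<phi> x)" .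
qed

lemma conv_translate: "conv K G x = (LINT y|lborel. K (y - x) * G y)"
proof -
  have "conv K G x = (LINT z|lborel. (\<lambda>y. K (y - x) * G y) (z + x))" by (simp add: conv_def add.commute)
  then show ?thesis using lborel_integral_translate[of "\<lambda>y. K (y - x) * G y" x] by simp
qed

text \<open>In contrast to \<open>conv_duality\<close>, here \<open>h\<close> is integrated against
  the kernel first, so that derivatives of \<open>h\<close> can be moved to the kernel.\<close>

lemma conv_duality_continuous:
  fixes K G h :: "'a::euclidean_space \<Rightarrow> real"
  assumes K: "continuous_on UNIV K" "\<And>z. \<bar>K z\<bar> \<le> b" and G: "integrable lborel G"
    and h: "continuous_on UNIV h" "compact S" "\<And>x. x \<notin> S \<Longrightarrow> h x = 0"
  shows "(LINT x|lborel. conv K G x * h x) = (LINT y|lborel. G y * (LINT x|lborel. K (y - x) * h x))"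
proof -
  have [measurable]: "K \<in> borel_measurable borel" "h \<in> borel_measurable borel" "G \<in> borel_measurable borel"
    using borel_measurable_continuous_onI K h G by auto
  have hi: "integrable lborel h" by (rule integrable_continuous_bounded_support[OF h])
  have b0: "0 \<le> b" using K(2)[of 0] by linarith
  have "integrable (lborel \<Otimes>\<^sub>M lborel) (\<lambda>(x, y). h x * G y)"
  proof (rule lborel_pair.Fubini_integrable)
    show "integrable lborel (\<lambda>x. LINT y|lborel. norm (case (x, y) of (x, y) \<Rightarrow> h x * G y))"
      using hi by (simp add: abs_mult)
  qed (use G in \<open>auto intro!: AE_I2\<close>)
  then have "integrable (lborel \<Otimes>\<^sub>M lborel) (\<lambda>xy. (case xy of (x, y) \<Rightarrow> h x * G y) * (case xy of (x, y) \<Rightarrow> K (y - x)))"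
    by (rule integrable_mult_bounded(1)[where B = b]) (use K in \<open>auto split: prod.splits\<close>)
  then have int: "integrable (lborel \<Otimes>\<^sub>M lborel) (\<lambda>(x, y). h x * G y * K (y - x))" by (simp add: split_beta')
  have "(LINT x|lborel. conv K G x * h x) = (LINT x|lborel. LINT y|lborel. h x * G y * K (y - x))"
    unfolding conv_translate by (simp add: mult_ac flip: integral_mult_right_zero)
  also have "\<dots> = (LINT y|lborel. LINT x|lborel. h x * G y * K (y - x))"
    using lborel_pair.Fubini_integral[OF int] by simp
  also have "\<dots> = (LINT y|lborel. G y * (LINT x|lborel. K (y - x) * h x))"
    by (simp add: mult_ac flip: integral_mult_right_zero)
  finally show ?thesis .
qed

lemma integral_partial_deriv_test:
  assumes "test_function U \<phi>"
  shows "(LINT x|lborel. partial_deriv j \<phi> x) = 0"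
  using integration_by_parts_test[of "\<lambda>_. 1" j "\<lambda>_. 0", OF _ _ _ assms] by simp

text \<open>By \<open>conv_translate\<close> the point \<open>x\<close> enters the kernel as
  \<open>y - x\<close>, hence the minus sign.\<close>

lemma weak_deriv_smooth_conv:
  fixes a K G :: "real^'n::finite \<Rightarrow> real"
  assumes a: "smooth a" and K: "test_function UNIV K" and G: "integrable lborel G"
  shows "weak_deriv UNIV l (\<lambda>x. a x * conv K G x) (\<lambda>x. partial_deriv l a x * conv K G x - a x * conv (partial_deriv l K) G x)"
  unfolding weak_deriv_def
proof (intro allI impI)
  fix \<phi> :: "real^'n \<Rightarrow> real" assume \<phi>: "test_function UNIV \<phi>"
  have sK: "smooth K" and sm: "smooth \<phi>" using K \<phi> by (auto simp: test_function_def)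
  obtain S where S: "compact S" "\<And>x. x \<notin> S \<Longrightarrow> \<phi> x = 0" "\<And>x j. x \<notin> S \<Longrightarrow> partial_deriv j \<phi> x = 0"
    using test_function_support[OF \<phi>] by metis
  obtain b where b: "\<And>x. \<bar>K x\<bar> \<le> b" "\<And>x j. \<bar>partial_deriv j K x\<bar> \<le> b" using test_function_bounded[OF K] by metis
  note ca = smooth_continuous[OF a] smooth_continuous[OF smooth_partial_deriv[OF a], of l]
  note cK = smooth_continuous[OF sK] smooth_continuous[OF smooth_partial_deriv[OF sK], of l]
  note c\<phi> = smooth_continuous[OF sm] smooth_continuous[OF smooth_partial_deriv[OF sm], of l]
  have c1: "continuous_on UNIV (\<lambda>x. a x * partial_deriv l \<phi> x)" "continuous_on UNIV (\<lambda>x. a x * \<phi> x)" "continuous_on UNIV (\<lambda>x. partial_deriv l a x * \<phi> x)"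
    by (intro continuous_intros ca c\<phi>)+
  have cKy: "continuous_on UNIV (\<lambda>x. K (y - x))" "continuous_on UNIV (\<lambda>x. partial_deriv l K (y - x))" for y
    by (rule continuous_on_compose2[OF cK(1)] continuous_on_compose2[OF cK(2)]; auto intro!: continuous_intros)+
  have inner: "(LINT x|lborel. K (y - x) * (a x * partial_deriv l \<phi> x))
      = (LINT x|lborel. partial_deriv l K (y - x) * (a x * \<phi> x)) - (LINT x|lborel. K (y - x) * (partial_deriv l a x * \<phi> x))" for y
  proof -
    define \<kappa> where "\<kappa> x = K ((- 1) *\<^sub>R x + y)" for x
    have s\<kappa>: "smooth \<kappa>" unfolding \<kappa>_def using Ck_affine sK by blast
    have d\<kappa>: "partial_deriv l \<kappa> x = - partial_deriv l K (y - x)" for x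
      unfolding \<kappa>_def using partial_deriv_affine[OF sK, of l "- 1" y x] by simp
    have \<kappa>e: "\<kappa> x = K (y - x)" for x by (simp add: \<kappa>_def)
    have s\<kappa>a: "smooth (\<lambda>x. \<kappa> x * a x)" using s\<kappa> a by (auto intro: Ck_mult)
    have t: "test_function UNIV (\<lambda>x. (\<kappa> x * a x) * \<phi> x)" by (rule test_function_mult[OF s\<kappa>a \<phi>])
    have p: "partial_deriv l (\<lambda>x. (\<kappa> x * a x) * \<phi> x) x
       = K (y - x) * (a x * partial_deriv l \<phi> x) - partial_deriv l K (y - x) * (a x * \<phi> x) + K (y - x) * (partial_deriv l a x * \<phi> x)" for x
      unfolding partial_deriv_mult[OF s\<kappa>a sm] unfolding partial_deriv_mult[OF s\<kappa> a] unfolding d\<kappa> \<kappa>e by (simp add: algebra_simps)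
    have i: "integrable lborel (\<lambda>x. K (y - x) * (a x * partial_deriv l \<phi> x))" "integrable lborel (\<lambda>x. partial_deriv l K (y - x) * (a x * \<phi> x))"
       "integrable lborel (\<lambda>x. K (y - x) * (partial_deriv l a x * \<phi> x))"
      using S c1 cKy by (auto intro!: integrable_continuous_bounded_support[of _ S] continuous_on_mult)
    have "0 = (LINT x|lborel. K (y - x) * (a x * partial_deriv l \<phi> x) - partial_deriv l K (y - x) * (a x * \<phi> x) + K (y - x) * (partial_deriv l a x * \<phi> x))"
      using integral_partial_deriv_test[OF t, of l] unfolding p by simp
    then show ?thesis using i by simp
  qed
  have Ki: "integrable lborel K" "integrable lborel (partial_deriv l K)"
  proof -
    obtain T where "compact T" "\<And>x. x \<notin> T \<Longrightarrow> K x = 0" "\<And>x j. x \<notin> T \<Longrightarrow> partial_deriv j K x = 0"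
      using test_function_support[OF K] by metis
    then show "integrable lborel K" "integrable lborel (partial_deriv l K)"
      using cK by (auto intro: integrable_continuous_bounded_support)
  qed
  define \<alpha> where "\<alpha> = (LINT x|lborel. conv (partial_deriv l K) G x * (a x * \<phi> x))"
  define \<beta> where "\<beta> = (LINT x|lborel. conv K G x * (partial_deriv l a x * \<phi> x))"
  have ia: "integrable lborel (\<lambda>y. G y * (LINT x|lborel. \<kappa> (y - x) * \<rho> x))"
    if "continuous_on UNIV \<kappa>" "\<And>x. \<bar>\<kappa> x\<bar> \<le> b" "continuous_on UNIV \<rho>" "\<And>x. x \<notin> S \<Longrightarrow> \<rho> x = 0" for \<kappa> \<rho> :: "real^'n \<Rightarrow> real"
  proof (rule integrable_mult_bounded(1)[OF G, where B = "\<bar>b\<bar> * (LINT x|lborel. \<bar>\<rho> x\<bar>)"])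
    have [measurable]: "\<kappa> \<in> borel_measurable borel" "\<rho> \<in> borel_measurable borel" using that borel_measurable_continuous_onI by auto
    show "(\<lambda>y. LINT x|lborel. \<kappa> (y - x) * \<rho> x) \<in> borel_measurable lborel" by measurable
    have \<rho>i: "integrable lborel \<rho>" by (rule integrable_continuous_bounded_support[OF that(3) S(1) that(4)])
    show "\<bar>LINT x|lborel. \<kappa> (y - x) * \<rho> x\<bar> \<le> \<bar>b\<bar> * (LINT x|lborel. \<bar>\<rho> x\<bar>)" for y
    proof -
      have "\<bar>LINT x|lborel. \<kappa> (y - x) * \<rho> x\<bar> \<le> (LINT x|lborel. \<bar>\<kappa> (y - x) * \<rho> x\<bar>)" by (rule integral_abs_bound)
      also have "\<dots> \<le> (LINT x|lborel. \<bar>b\<bar> * \<bar>\<rho> x\<bar>)"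
      proof (rule integral_mono)
        show "integrable lborel (\<lambda>x. \<bar>\<kappa> (y - x) * \<rho> x\<bar>)"
          by (intro integrable_abs integrable_mult_bounded(2)[OF \<rho>i _ that(2)]) measurable
        show "\<bar>\<kappa> (y - x) * \<rho> x\<bar> \<le> \<bar>b\<bar> * \<bar>\<rho> x\<bar>" for x
          unfolding abs_mult using that(2)[of "y - x"] by (intro mult_right_mono) auto
      qed (use \<rho>i in simp)
      finally show ?thesis by simp
    qed
  qed
  have "(LINT x|lborel. conv K G x * (a x * partial_deriv l \<phi> x)) = (LINT y|lborel. G y * (LINT x|lborel. K (y - x) * (a x * partial_deriv l \<phi> x)))"
    by (rule conv_duality_continuous[OF cK(1) b(1) G c1(1) S(1)]) (simp add: S)
  also have "\<dots> = (LINT y|lborel. G y * (LINT x|lborel. partial_deriv l K (y - x) * (a x * \<phi> x)) - G y * (LINT x|lborel. K (y - x) * (partial_deriv l a x * \<phi> x)))"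
    by (simp add: inner right_diff_distrib)
  also have "\<dots> = (LINT y|lborel. G y * (LINT x|lborel. partial_deriv l K (y - x) * (a x * \<phi> x)))
      - (LINT y|lborel. G y * (LINT x|lborel. K (y - x) * (partial_deriv l a x * \<phi> x)))"
    by (rule Bochner_Integration.integral_diff[OF ia[OF cK(2) b(2) c1(2)] ia[OF cK(1) b(1) c1(3)]]) (simp_all add: S)
  also have "(LINT y|lborel. G y * (LINT x|lborel. partial_deriv l K (y - x) * (a x * \<phi> x))) = \<alpha>"
    unfolding \<alpha>_def by (rule conv_duality_continuous[OF cK(2) b(2) G c1(2) S(1), symmetric]) (simp add: S)
  also have "(LINT y|lborel. G y * (LINT x|lborel. K (y - x) * (partial_deriv l a x * \<phi> x))) = \<beta>"
    unfolding \<beta>_def by (rule conv_duality_continuous[OF cK(1) b(1) G c1(3) S(1), symmetric]) (simp add: S)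
  finally have main: "(LINT x|lborel. conv K G x * (a x * partial_deriv l \<phi> x)) = \<alpha> - \<beta>" .
  have t1: "test_function UNIV (\<lambda>x. a x * \<phi> x)" by (rule test_function_mult[OF a \<phi>])
  have t2: "test_function UNIV (\<lambda>x. partial_deriv l a x * \<phi> x)" by (rule test_function_mult[OF smooth_partial_deriv[OF a] \<phi>])
  have "(LINT x|lborel. (partial_deriv l a x * conv K G x - a x * conv (partial_deriv l K) G x) * \<phi> x)
      = (LINT x|lborel. conv K G x * (partial_deriv l a x * \<phi> x) - conv (partial_deriv l K) G x * (a x * \<phi> x))"
    by (simp add: algebra_simps)
  also have "\<dots> = \<beta> - \<alpha>"
    unfolding \<alpha>_def \<beta>_def
    by (rule Bochner_Integration.integral_diff[OF integrable_mult_test(1)[OF conv_integrable[OF Ki(1) G] t2] integrable_mult_test(1)[OF conv_integrable[OF Ki(2) G] t1]])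
  finally show "(LINT x|lborel. a x * conv K G x * partial_deriv l \<phi> x)
      = - (LINT x|lborel. (partial_deriv l a x * conv K G x - a x * conv (partial_deriv l K) G x) * \<phi> x)"
    using main by (simp add: mult_ac)
qed

section \<open>Integration along a coordinate axis\<close>

text \<open>An antiderivative of \<open>- h\<close> along axis i at points beyond which, at distance
  \<open>L\<close>, \<open>h\<close> vanishes. The finite length keeps it integrable on the whole
  space.\<close>

definition axis_integral :: "real \<Rightarrow> 'n \<Rightarrow> (real^'n::finite \<Rightarrow> real) \<Rightarrow> real^'n \<Rightarrow> real" where
  "axis_integral L i h x = (LINT s|lborel. indicator {0..L} s * h (x + s *\<^sub>R axis i 1))"

lemma integrable_indicator_interval: "integrable lborel (indicator {0..L::real} :: real \<Rightarrow> real)"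
  by (rule integrable_real_indicator) (auto simp: emeasure_lborel_Icc_eq)

lemma axis_product_integrable:
  fixes h \<rho> :: "real^'n::finite \<Rightarrow> real"
  assumes h: "integrable lborel h" and \<rho>: "\<rho> \<in> borel_measurable borel" "\<And>x. \<bar>\<rho> x\<bar> \<le> B"
  shows "integrable (lborel \<Otimes>\<^sub>M lborel) (\<lambda>(s, y). indicator {0..L} s * (h y * \<rho> (y - s *\<^sub>R axis i 1)))"
    and "integrable (lborel \<Otimes>\<^sub>M lborel) (\<lambda>(s, x). indicator {0..L} s * (h (x + s *\<^sub>R axis i 1) * \<rho> x))"
proof -
  have [measurable]: "h \<in> borel_measurable borel" "\<rho> \<in> borel_measurable borel" using h \<rho> by auto
  have "integrable (lborel \<Otimes>\<^sub>M lborel) (\<lambda>(s::real, y). indicator {0..L} s * h y)"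
  proof (rule lborel_pair.Fubini_integrable)
    show "integrable lborel (\<lambda>s. LINT y|lborel. norm (case (s, y) of (s, y) \<Rightarrow> indicator {0..L} s * h y))"
      using integrable_indicator_interval by (simp add: abs_mult)
  qed (use h in \<open>auto intro!: AE_I2\<close>)
  then have "integrable (lborel \<Otimes>\<^sub>M lborel) (\<lambda>p. (case p of (s::real, y) \<Rightarrow> indicator {0..L} s * h y) * (case p of (s, y) \<Rightarrow> \<rho> (y - s *\<^sub>R axis i 1)))"
    by (rule integrable_mult_bounded(1)[where B = B]) (use \<rho>(2) in \<open>auto split: prod.splits\<close>)
  then show "integrable (lborel \<Otimes>\<^sub>M lborel) (\<lambda>(s, y). indicator {0..L} s * (h y * \<rho> (y - s *\<^sub>R axis i 1)))"
    by (simp add: split_beta' mult.assoc)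
  have "integrable (lborel \<Otimes>\<^sub>M lborel) (\<lambda>(s::real, x). indicator {0..L} s * h (x + s *\<^sub>R axis i 1))"
  proof (rule lborel_pair.Fubini_integrable)
    have "(LINT x|lborel. norm (indicator {0..L} s * h (x + s *\<^sub>R axis i 1))) = indicator {0..L} s * (LINT x|lborel. \<bar>h x\<bar>)" for s :: real
      using lborel_integral_translate[of "\<lambda>x. \<bar>h x\<bar>" "s *\<^sub>R axis i 1"] by (simp add: abs_mult)
    then show "integrable lborel (\<lambda>s. LINT x|lborel. norm (case (s, x) of (s, x) \<Rightarrow> indicator {0..L} s * h (x + s *\<^sub>R axis i 1)))"
      using integrable_indicator_interval by simp
    show "AE s in lborel. integrable lborel (\<lambda>x. case (s::real, x) of (s, x) \<Rightarrow> indicator {0..L} s * h (x + s *\<^sub>R axis i 1))"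
      using h by (intro AE_I2) (simp add: lborel_integrable_translate)
  qed measurable
  then have "integrable (lborel \<Otimes>\<^sub>M lborel) (\<lambda>p. (case p of (s::real, x) \<Rightarrow> indicator {0..L} s * h (x + s *\<^sub>R axis i 1)) * (case p of (s, x) \<Rightarrow> \<rho> x))"
    by (rule integrable_mult_bounded(1)[where B = B]) (use \<rho>(2) in \<open>auto split: prod.splits\<close>)
  then show "integrable (lborel \<Otimes>\<^sub>M lborel) (\<lambda>(s, x). indicator {0..L} s * (h (x + s *\<^sub>R axis i 1) * \<rho> x))"
    by (simp add: split_beta' mult.assoc)
qed

lemma axis_integral_integrable:
  assumes "integrable lborel h"
  shows "integrable lborel (axis_integral L i h)"
proof -
  have "integrable (lborel \<Otimes>\<^sub>M lborel) (\<lambda>(x, s). indicator {0..L} s * h (x + s *\<^sub>R axis i 1))"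
    using lborel_pair.integrable_product_swap[OF axis_product_integrable(2)[OF assms, of "\<lambda>_. 1" 1 L i]] by simp
  from lborel_pair.integrable_fst'[OF this] show ?thesis by (simp add: axis_integral_def[abs_def])
qed

lemma axis_integral_duality:
  fixes h :: "real^'n::finite \<Rightarrow> real"
  assumes h: "integrable lborel h" and \<rho>: "\<rho> \<in> borel_measurable borel" "\<And>x. \<bar>\<rho> x\<bar> \<le> B"
  shows "(LINT x|lborel. axis_integral L i h x * \<rho> x)
    = (LINT s|lborel. indicator {0..L} s * (LINT y|lborel. h y * \<rho> (y - s *\<^sub>R axis i 1)))"
proof -
  have "(LINT x|lborel. axis_integral L i h x * \<rho> x) = (LINT x|lborel. LINT s|lborel. indicator {0..L} s * (h (x + s *\<^sub>R axis i 1) * \<rho> x))"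
    by (simp add: axis_integral_def flip: mult.assoc)
  also have "\<dots> = (LINT s|lborel. LINT x|lborel. indicator {0..L} s * (h (x + s *\<^sub>R axis i 1) * \<rho> x))"
    using lborel_pair.Fubini_integral[OF axis_product_integrable(2)[OF assms]] by simp
  also have "\<dots> = (LINT s|lborel. indicator {0..L} s * (LINT y|lborel. h y * \<rho> (y - s *\<^sub>R axis i 1)))"
  proof (rule Bochner_Integration.integral_cong[OF refl])
    fix s :: real
    show "(LINT x|lborel. indicator {0..L} s * (h (x + s *\<^sub>R axis i 1) * \<rho> x)) = indicator {0..L} s * (LINT y|lborel. h y * \<rho> (y - s *\<^sub>R axis i 1))"
      using lborel_integral_translate[of "\<lambda>y. h y * \<rho> (y - s *\<^sub>R axis i 1)" "s *\<^sub>R axis i 1"] by simp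
  qed
  finally show ?thesis .
qed

lemma axis_integral_L1_bound:
  fixes h :: "real^'n::finite \<Rightarrow> real"
  assumes L: "0 \<le> L" and h: "integrable lborel h"
  shows "(LINT x|lborel. \<bar>axis_integral L i h x\<bar>) \<le> L * (LINT x|lborel. \<bar>h x\<bar>)"
proof -
  have ha: "integrable lborel (\<lambda>x. \<bar>h x\<bar>)" using h by simp
  have "(LINT x|lborel. \<bar>axis_integral L i h x\<bar>) \<le> (LINT x|lborel. axis_integral L i (\<lambda>x. \<bar>h x\<bar>) x)"
  proof (rule integral_mono)
    show "\<bar>axis_integral L i h x\<bar> \<le> axis_integral L i (\<lambda>x. \<bar>h x\<bar>) x" for x
      unfolding axis_integral_def by (rule order_trans[OF integral_abs_bound]) (simp add: abs_mult)
  qed (use axis_integral_integrable[OF h] axis_integral_integrable[OF ha] in auto)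
  also have "\<dots> = (LINT s|lborel. indicator {0..L} s * (LINT y|lborel. \<bar>h y\<bar>))"
    using axis_integral_duality[OF ha, of "\<lambda>_. 1" 1 L i] by simp
  also have "\<dots> = L * (LINT x|lborel. \<bar>h x\<bar>)" using L by simp
  finally show ?thesis .
qed

text \<open>The axis integral is an average of translates, and translation commutes with weak
  derivatives. This is where \<open>h\<close> has to be weakly differentiable in the direction
  \<open>l\<close>.\<close>

lemma weak_deriv_axis_integral:
  fixes h d :: "real^'n::finite \<Rightarrow> real"
  assumes h: "integrable lborel h" and d: "integrable lborel d" and wd: "weak_deriv UNIV l h d"
  shows "weak_deriv UNIV l (axis_integral L i h) (axis_integral L i d)"
  unfolding weak_deriv_def
proof (intro allI impI)
  fix \<phi> :: "real^'n \<Rightarrow> real" assume \<phi>: "test_function UNIV \<phi>"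
  obtain b where b: "\<And>x. \<bar>\<phi> x\<bar> \<le> b" "\<And>x j. \<bar>partial_deriv j \<phi> x\<bar> \<le> b" using test_function_bounded[OF \<phi>] by metis
  note m = test_function_continuous[OF \<phi>, THEN borel_measurable_continuous_onI]
  obtain S where S: "compact S" "\<And>x. x \<notin> S \<Longrightarrow> \<phi> x = 0" using test_function_support[OF \<phi>] by metis
  have "(LINT y|lborel. h y * partial_deriv l \<phi> (y - z)) = - (LINT y|lborel. d y * \<phi> (y - z))" for z
  proof -
    note tt = test_function_translate[OF test_function_smooth[OF \<phi>] S(1), of z UNIV]
    have "test_function UNIV (\<lambda>y. \<phi> (y - z))" using tt(1) S(2) by blast
    then show ?thesis using wd S(2) tt(2)[of l] unfolding weak_deriv_def by force
  qed
  then show "(LINT x|lborel. axis_integral L i h x * partial_deriv l \<phi> x) = - (LINT x|lborel. axis_integral L i d x * \<phi> x)"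
    unfolding axis_integral_duality[OF h m(2) b(2)] axis_integral_duality[OF d m(1) b(1)] by simp
qed

text \<open>The fundamental theorem along the axis leaves the test function at \<open>y\<close> and
  at \<open>y - L *\<^sub>R axis i 1\<close>; by \<open>far\<close> the second point lies outside
  \<open>U\<close> wherever \<open>h\<close> does not vanish.\<close>

lemma weak_deriv_axis_integral_self:
  fixes h :: "real^'n::finite \<Rightarrow> real"
  assumes L: "0 \<le> L" and h: "integrable lborel h" and far: "\<And>y. h y \<noteq> 0 \<Longrightarrow> y - L *\<^sub>R axis i 1 \<notin> U"
  shows "weak_deriv U i (axis_integral L i h) (\<lambda>x. - h x)"
  unfolding weak_deriv_def
proof (intro allI impI)
  fix \<phi> assume \<phi>: "test_function U \<phi>"
  obtain b where b: "\<And>x. \<bar>partial_deriv i \<phi> x\<bar> \<le> b" using test_function_bounded[OF \<phi>] by metis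
  note c = test_function_continuous[OF \<phi>]
  have m: "partial_deriv i \<phi> \<in> borel_measurable borel" by (rule borel_measurable_continuous_onI[OF c(2)])
  obtain S where S: "S \<subseteq> U" "\<And>x. x \<notin> S \<Longrightarrow> \<phi> x = 0" using test_function_support[OF \<phi>] by metis
  let ?e = "axis i 1 :: real^'n"
  have ftc: "(LINT s|lborel. indicator {0..L} s * partial_deriv i \<phi> (y - s *\<^sub>R ?e)) = \<phi> y - \<phi> (y - L *\<^sub>R ?e)" for y
  proof -
    have "((\<lambda>s. - \<phi> (y - s *\<^sub>R ?e)) has_real_derivative partial_deriv i \<phi> (y - s *\<^sub>R ?e)) (at s)" for s
    proof -
      have "((\<lambda>t. \<phi> (y + t *\<^sub>R ?e)) has_real_derivative partial_deriv i \<phi> (y + (- s) *\<^sub>R ?e)) (at (- s))"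
        by (rule smooth_partial_has_derivative[OF test_function_smooth[OF \<phi>]])
      from DERIV_minus[OF DERIV_chain'[OF DERIV_minus[OF DERIV_ident] this]] show ?thesis by simp
    qed
    moreover have "isCont (\<lambda>s. partial_deriv i \<phi> (y - s *\<^sub>R ?e)) s" for s
      using continuous_on_compose2[OF c(2), of UNIV "\<lambda>s. y - s *\<^sub>R ?e" i]
      by (simp add: continuous_on_eq_continuous_at continuous_intros)
    ultimately have "(LINT s|lborel. partial_deriv i \<phi> (y - s *\<^sub>R ?e) * indicator {0..L} s) = - \<phi> (y - L *\<^sub>R ?e) - (- \<phi> (y - 0 *\<^sub>R ?e))"
      by (intro integral_FTC_Icc_real L) auto
    then show ?thesis by (simp add: mult.commute)
  qed
  have "(LINT x|lborel. axis_integral L i h x * partial_deriv i \<phi> x)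
      = (LINT s|lborel. LINT y|lborel. indicator {0..L} s * (h y * partial_deriv i \<phi> (y - s *\<^sub>R ?e)))"
    by (simp add: axis_integral_duality[OF h m b])
  also have "\<dots> = (LINT y|lborel. LINT s|lborel. indicator {0..L} s * (h y * partial_deriv i \<phi> (y - s *\<^sub>R ?e)))"
    using lborel_pair.Fubini_integral[OF axis_product_integrable(1)[OF h m b, of L i]] by simp
  also have "\<dots> = (LINT y|lborel. h y * (LINT s|lborel. indicator {0..L} s * partial_deriv i \<phi> (y - s *\<^sub>R ?e)))"
    by (simp add: mult.left_commute)
  also have "\<dots> = (LINT y|lborel. h y * \<phi> y)"
  proof (rule Bochner_Integration.integral_cong[OF refl])
    fix y
    show "h y * (LINT s|lborel. indicator {0..L} s * partial_deriv i \<phi> (y - s *\<^sub>R ?e)) = h y * \<phi> y"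
      unfolding ftc using far[of y] S by (cases "h y = 0") (auto simp: subset_iff)
  qed
  finally show "(LINT x|lborel. axis_integral L i h x * partial_deriv i \<phi> x) = - (LINT x|lborel. - h x * \<phi> x)" by simp
qed

section \<open>Mollification up to a Lipschitz boundary\<close>

text \<open>A step \<open>t *\<^sub>R z\<close> with \<open>z\<close> close to \<open>e\<close>
  raises the height over the graph by more than the Lipschitz function can change along its
  horizontal part. The radius is at most 1 so that everything built later stays within distance 1 of
  the closure of \<open>U\<close>.\<close>

lemma lipschitz_boundary_cone:
  fixes U :: "'a::euclidean_space set"
  assumes U: "open U" "lipschitz_boundary U" and x0: "x0 \<in> closure U"
  shows "\<exists>r e c t0. 0 < r \<and> r \<le> 1 \<and> 0 < c \<and> 0 < t0 \<and>
    (\<forall>x z t. x \<in> U \<longrightarrow> x \<in> cball x0 r \<longrightarrow> z \<in> ball e c \<longrightarrow> 0 < t \<longrightarrow> t < t0 \<longrightarrow> x + t *\<^sub>R z \<in> U)"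
proof (cases "x0 \<in> U")
  case True
  then obtain \<rho> where \<rho>: "0 < \<rho>" "ball x0 \<rho> \<subseteq> U" using U(1) open_contains_ball by blast
  have "x + t *\<^sub>R z \<in> U" if "x \<in> cball x0 (min 1 (\<rho> / 2))" "z \<in> ball 0 1" "0 < t" "t < \<rho> / 2" for x z t
  proof -
    have "t * norm z \<le> t * 1" using that by (intro mult_left_mono) auto
    moreover have "dist x0 (x + t *\<^sub>R z) \<le> dist x0 x + t * norm z"
      using dist_triangle[of x0 "x + t *\<^sub>R z" x] that by (simp add: dist_norm)
    ultimately have "dist x0 (x + t *\<^sub>R z) < \<rho>" using that by (simp; linarith)
    then show ?thesis using \<rho>(2) by auto
  qed
  \<comment> \<open>At an interior point all short steps are admissible; the centre 0 gives this
    case the form of a cone as well.\<close>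
  then show ?thesis using \<rho>(1)
    by (intro exI[of _ "min 1 (\<rho>/2)"] exI[of _ "0::'a"] exI[of _ 1] exI[of _ "\<rho>/2"]) auto
next
  case False
  then have fr: "x0 \<in> frontier U" using x0 U(1) by (simp add: frontier_def interior_open)
  obtain \<rho> e \<gamma> L where \<rho>: "0 < \<rho>" and e: "norm e = 1" and lip: "L-lipschitz_on {y. y \<bullet> e = 0} \<gamma>"
    and UB: "U \<inter> ball x0 \<rho> = {x \<in> ball x0 \<rho>. x \<bullet> e > (\<gamma> (x - (x \<bullet> e) *\<^sub>R e) :: real)}"
    using bspec[OF U(2)[unfolded lipschitz_boundary_def] fr] by (elim exE conjE)
  have L: "0 \<le> L" using lip by (rule lipschitz_on_nonneg)
  have ee: "e \<bullet> e = 1" using e by (simp add: norm_eq_1)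
  \<comment> \<open>The horizontal part of \<open>z\<close> has norm at most \<open>2 * c\<close>
    and the vertical part exceeds \<open>1 - c\<close>, so the condition is
    \<open>L * (2 * c) \<le> 1 - c\<close>; this \<open>c\<close> gives equality.\<close>
  define c where "c = 1 / (2 * L + 1)"
  have c: "0 < c" "c \<le> 1" "L * (2 * c) + c = 1" using L by (auto simp: c_def field_simps)
  \<comment> \<open>As \<open>z\<close> has norm at most 2, a step shorter than
    \<open>\<rho> / 4\<close> moves \<open>x\<close> by less than \<open>\<rho> / 2\<close> and
    stays in the ball where the graph is available.\<close>
  have "x + t *\<^sub>R z \<in> U" if x: "x \<in> U" "x \<in> cball x0 (min 1 (\<rho> / 2))" and z: "z \<in> ball e c" and t: "0 < t" "t < \<rho> / 4" for x z t
  proof -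
    define pr where "pr y = y - (y \<bullet> e) *\<^sub>R e" for y
    have pr0: "pr y \<bullet> e = 0" for y by (simp add: pr_def inner_diff_left ee)
    have zc: "norm (z - e) < c" using z by (simp add: dist_norm norm_minus_commute)
    have ze: "\<bar>(z - e) \<bullet> e\<bar> < c" using Cauchy_Schwarz_ineq2[of "z - e" e] e zc by simp
    then have a: "1 - c < z \<bullet> e" by (simp add: inner_diff_left ee)
    have "pr z = (z - e) - ((z - e) \<bullet> e) *\<^sub>R e" by (simp add: pr_def inner_diff_left ee algebra_simps)
    then have "norm (pr z) \<le> norm (z - e) + \<bar>(z - e) \<bullet> e\<bar>" using norm_triangle_ineq4[of "z - e" "((z - e) \<bullet> e) *\<^sub>R e"] e by simp
    then have b: "norm (pr z) \<le> 2 * c" using zc ze by linarith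
    have "norm z \<le> norm (z - e) + norm e" using norm_triangle_ineq[of "z - e" e] by simp
    then have "norm z \<le> 2" using zc c e by linarith
    then have "t * norm z \<le> t * 2" using t by (intro mult_left_mono) auto
    moreover have "dist x0 (x + t *\<^sub>R z) \<le> dist x0 x + t * norm z"
      using dist_triangle[of x0 "x + t *\<^sub>R z" x] t by (simp add: dist_norm)
    moreover have "dist x0 x \<le> \<rho> / 2" using x(2) by simp
    ultimately have "dist x0 (x + t *\<^sub>R z) < \<rho>" using t by linarith
    then have in': "x + t *\<^sub>R z \<in> ball x0 \<rho>" by simp
    have "x \<in> U \<inter> ball x0 \<rho>" using x \<rho> by auto
    then have gx: "\<gamma> (pr x) < x \<bullet> e" unfolding UB pr_def by auto
    have prx: "pr (x + t *\<^sub>R z) = pr x + t *\<^sub>R pr z" by (simp add: pr_def inner_add_left algebra_simps)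
    have "dist (\<gamma> (pr (x + t *\<^sub>R z))) (\<gamma> (pr x)) \<le> L * dist (pr (x + t *\<^sub>R z)) (pr x)"
      by (rule lipschitz_onD[OF lip]) (simp_all add: pr0)
    also have "\<dots> = L * (t * norm (pr z))" using t by (simp add: prx dist_norm)
    also have "\<dots> \<le> L * (t * (2 * c))" using L t b by (intro mult_left_mono) auto
    also have "\<dots> = t * (L * (2 * c))" by simp
    also have "L * (2 * c) = 1 - c" using c(3) by linarith
    also have "t * (1 - c) \<le> t * (z \<bullet> e)" using a t by (intro mult_left_mono) auto
    finally have "\<gamma> (pr (x + t *\<^sub>R z)) < (x + t *\<^sub>R z) \<bullet> e" using gx by (simp add: dist_real_def inner_add_left)
    then have "x + t *\<^sub>R z \<in> U \<inter> ball x0 \<rho>" unfolding UB using in' by (simp add: pr_def)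
    then show ?thesis by simp
  qed
  then show ?thesis using \<rho> c
    by (intro exI[of _ "min 1 (\<rho>/2)"] exI[of _ e] exI[of _ c] exI[of _ "\<rho>/4"]) auto
qed

text \<open>A kernel supported in the cone \<open>t *\<^sub>R ball e c\<close>, which is the ball of
  radius \<open>t * c\<close> around \<open>t *\<^sub>R e\<close>, averages \<open>u\<close> only
  over points that are still in \<open>U\<close>.\<close>

lemma translated_mollifier:
  fixes U :: "'a::euclidean_space set"
  assumes c: "0 < c" and t0: "0 < t0" and \<tau>: "0 < \<tau>"
    and cone: "\<forall>x z t. x \<in> U \<longrightarrow> x \<in> cball x0 r \<longrightarrow> z \<in> ball e c \<longrightarrow> 0 < t \<longrightarrow> t < t0 \<longrightarrow> x + t *\<^sub>R z \<in> U"
  shows "\<exists>K. test_function UNIV K \<and> (\<forall>z. 0 \<le> K z) \<and> (LINT z|lborel. K z) = 1 \<and>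
     (\<forall>z. K z \<noteq> 0 \<longrightarrow> norm z < \<tau> \<and> (\<forall>x. x \<in> U \<longrightarrow> x \<in> cball x0 r \<longrightarrow> x + z \<in> U))"
proof -
  \<comment> \<open>The second bound keeps the support of the kernel within distance
    \<open>\<tau>\<close> of the origin.\<close>
  define t where "t = min (t0 / 2) (\<tau> / (norm e + c))"
  have ec: "0 < norm e + c" using c norm_ge_zero[of e] by linarith
  have "t \<le> \<tau> / (norm e + c)" by (simp add: t_def)
  then have t: "t * (norm e + c) \<le> \<tau>" "0 < t" "t < t0" using t0 \<tau> ec by (simp_all add: pos_le_divide_eq) (auto simp: t_def)
  have tc: "0 < t * c" using t c by simp
  obtain K where K: "smooth K" "\<forall>x. 0 \<le> K x" "\<forall>x. K x \<noteq> 0 \<longrightarrow> x \<in> ball (t *\<^sub>R e) (t * c)" "(LINT x|lborel. K x) = 1"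
    using mollifier_exists[OF tc, of "t *\<^sub>R e"] by blast
  have "norm z < \<tau> \<and> (\<forall>x. x \<in> U \<longrightarrow> x \<in> cball x0 r \<longrightarrow> x + z \<in> U)" if "K z \<noteq> 0" for z
  proof -
    define y where "y = z /\<^sub>R t"
    have z: "z = t *\<^sub>R y" using t by (simp add: y_def)
    have "norm (z - t *\<^sub>R e) < t * c" using K(3) that by (auto simp: dist_norm norm_minus_commute)
    moreover have "norm (z - t *\<^sub>R e) = t * norm (y - e)" unfolding z using t(2) by (simp flip: scaleR_diff_right)
    ultimately have y: "norm (y - e) < c" using t(2) by simp
    have "norm y < norm e + c" using norm_triangle_sub[of y e] y by linarith
    then have "norm z < t * (norm e + c)" using t(2) by (simp add: z)
    then have "norm z < \<tau>" using t(1) by linarith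
    moreover have "x + z \<in> U" if "x \<in> U" "x \<in> cball x0 r" for x
      using cone[rule_format, OF that, of y t] y t unfolding z by (simp add: dist_norm norm_minus_commute)
    ultimately show ?thesis by blast
  qed
  moreover have "test_function UNIV K"
    by (rule test_functionI[OF K(1) compact_cball[of "t *\<^sub>R e" "t * c"]]) (use K(3) in force)+
  ultimately show ?thesis using K by blast
qed

text \<open>Each new bump is multiplied by the product of one minus the earlier ones, so the sum
  telescopes. It equals 1 wherever some bump does.\<close>

lemma partition_of_unity_bumps:
  fixes X :: "'a::euclidean_space set"
  assumes "finite X" "\<And>x. x \<in> X \<Longrightarrow> 0 < r x"
  shows "\<exists>\<psi>. (\<forall>x\<in>X. smooth (\<psi> x) \<and> (\<forall>y. 0 \<le> \<psi> x y) \<and> (\<forall>y. \<psi> x y \<noteq> 0 \<longrightarrow> y \<in> cball x (r x))) \<and>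
    (\<forall>y. (\<Sum>x\<in>X. \<psi> x y) = 1 - (\<Prod>x\<in>X. 1 - bump x (r x) y))"
  using assms
proof (induction X)
  case (insert x X)
  then obtain \<psi> where \<psi>: "\<forall>x\<in>X. smooth (\<psi> x) \<and> (\<forall>y. 0 \<le> \<psi> x y) \<and> (\<forall>y. \<psi> x y \<noteq> 0 \<longrightarrow> y \<in> cball x (r x))"
    "\<forall>y. (\<Sum>x\<in>X. \<psi> x y) = 1 - (\<Prod>x\<in>X. 1 - bump x (r x) y)" by auto
  define \<theta> where "\<theta> y = bump x (r x) y * (\<Prod>x\<in>X. 1 - bump x (r x) y)" for y
  have rx: "0 < r x" using insert by simp
  have "smooth \<theta>" unfolding \<theta>_def by (intro allI Ck_mult Ck_prod Ck_diff Ck_const smooth_bump[rule_format])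
  moreover have "0 \<le> \<theta> y" for y unfolding \<theta>_def by (intro mult_nonneg_nonneg prod_nonneg) (auto simp: bump_range)
  moreover have "y \<in> cball x (r x)" if "\<theta> y \<noteq> 0" for y
    using that bump_eq_0[OF rx, of y x] by (force simp: \<theta>_def dist_norm norm_minus_commute)
  moreover have "(\<Sum>z\<in>insert x X. (\<psi>(x := \<theta>)) z y) = 1 - (\<Prod>x\<in>insert x X. 1 - bump x (r x) y)" for y
  proof -
    have "(\<Sum>z\<in>insert x X. (\<psi>(x := \<theta>)) z y) = \<theta> y + (\<Sum>z\<in>X. \<psi> z y)"
      using insert.hyps by (auto intro!: sum.cong)
    then show ?thesis using \<psi>(2) insert.hyps by (simp add: \<theta>_def algebra_simps)
  qed
  ultimately show ?case using \<psi>(1) by (intro exI[of _ "\<psi>(x := \<theta>)"]) auto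
qed simp

text \<open>On each piece of a partition of unity the kernel looks in directions that do not leave
  \<open>U\<close>, so the product rule gives the weak gradient \<open>D\<close> of \<open>v\<close>
  on \<open>U\<close>. The formula for \<open>D\<close> makes sense everywhere, and as the cutoffs
  and kernels are smooth, the sum of the \<open>D i i\<close> has weak derivatives \<open>g\<close>
  on the whole space. Outside \<open>U\<close> that sum need not be the divergence of
  \<open>v\<close>.\<close>

lemma mollified_approximation:
  fixes U :: "(real^'n::finite) set" and u :: "'n \<Rightarrow> real^'n \<Rightarrow> real" and d :: "'n \<Rightarrow> 'n \<Rightarrow> real^'n \<Rightarrow> real"
  assumes U: "open U" "bounded U" "lipschitz_boundary U" and \<epsilon>: "0 < \<epsilon>"
    and ui: "\<And>i. integrable lborel (u i)" and di: "\<And>i l. integrable lborel (d i l)"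
    and u0: "\<And>i x. x \<notin> U \<Longrightarrow> u i x = 0" and d0: "\<And>i l x. x \<notin> U \<Longrightarrow> d i l x = 0"
    and wd: "\<And>i l. weak_deriv U l (u i) (d i l)"
  shows "\<exists>v D g. (\<forall>i. integrable lborel (v i)) \<and> (\<forall>i l. integrable lborel (D i l)) \<and> (\<forall>l. integrable lborel (g l)) \<and>
     (\<forall>i l. weak_deriv U l (v i) (D i l)) \<and> (\<forall>l. weak_deriv UNIV l (\<lambda>x. \<Sum>i\<in>UNIV. D i i x) (g l)) \<and>
     (\<forall>i. (LINT x|lborel. \<bar>v i x - u i x\<bar>) < \<epsilon>) \<and> (\<forall>i l. (LINT x|lborel. \<bar>D i l x - d i l x\<bar>) < \<epsilon>) \<and>
     (\<forall>x i l. D i l x \<noteq> 0 \<longrightarrow> (\<exists>y\<in>closure U. dist y x \<le> 1))"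
proof -
  let ?P = "\<lambda>x0 r e c t0. 0 < r \<and> r \<le> 1 \<and> 0 < c \<and> 0 < t0 \<and>
    (\<forall>x z t. x \<in> U \<longrightarrow> x \<in> cball x0 r \<longrightarrow> z \<in> ball e c \<longrightarrow> 0 < t \<longrightarrow> t < t0 \<longrightarrow> x + t *\<^sub>R z \<in> U)"
  have "\<forall>x0\<in>closure U. \<exists>r e c t0. ?P x0 r e c t0" using lipschitz_boundary_cone[OF U(1,3)] by blast
  then have "\<exists>r. \<forall>x0\<in>closure U. \<exists>e c t0. ?P x0 (r x0) e c t0" by (rule bchoice)
  then obtain r where r: "\<And>x0. x0 \<in> closure U \<Longrightarrow> \<exists>e c t0. ?P x0 (r x0) e c t0" by blast
  have rp: "0 < r x" "r x \<le> 1" if "x \<in> closure U" for x using r[OF that] by blast+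
  have cU: "compact (closure U)" using U(2) by (simp add: compact_eq_bounded_closed bounded_closure)
  have cov: "closure U \<subseteq> (\<Union>x\<in>closure U. ball x (r x / 2))" using rp by force
  obtain X where X: "X \<subseteq> closure U" "finite X" "closure U \<subseteq> (\<Union>x\<in>X. ball x (r x / 2))"
    by (rule compactE_image[OF cU _ cov]) auto
  have rX: "0 < r x" "r x \<le> 1" if "x \<in> X" for x using rp X(1) that by blast+
  obtain \<psi> where \<psi>': "\<forall>x\<in>X. smooth (\<psi> x) \<and> (\<forall>y. 0 \<le> \<psi> x y) \<and> (\<forall>y. \<psi> x y \<noteq> 0 \<longrightarrow> y \<in> cball x (r x))"
    and \<psi>s: "\<forall>y. (\<Sum>x\<in>X. \<psi> x y) = 1 - (\<Prod>x\<in>X. 1 - bump x (r x) y)"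
    using partition_of_unity_bumps[of X r, OF X(2) rX(1)] by blast
  have \<psi>: "smooth (\<psi> x)" "0 \<le> \<psi> x y" "\<psi> x y \<noteq> 0 \<Longrightarrow> y \<in> cball x (r x)" if "x \<in> X" for x y using \<psi>' that by blast+
  have \<psi>t: "test_function UNIV (\<psi> x)" if "x \<in> X" for x
    by (rule test_functionI[OF \<psi>(1)[OF that] compact_cball[of x "r x"]]) (use \<psi>(3)[OF that] in auto)
  have \<psi>1: "(\<Sum>x\<in>X. \<psi> x y) = 1" if y: "y \<in> U" for y
  proof -
    have "y \<in> closure U" using y closure_subset by blast
    then obtain x where x: "x \<in> X" "y \<in> ball x (r x / 2)" using X(3) by blast
    then have "bump x (r x) y = 1" by (intro bump_eq_1 rX) (auto simp: dist_norm norm_minus_commute)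
    then have "\<exists>x\<in>X. 1 - bump x (r x) y = 0" using x(1) by auto
    then have "(\<Prod>x\<in>X. 1 - bump x (r x) y) = 0" using X(2) by (simp only: prod_zero_iff)
    then show ?thesis using \<psi>s by simp
  qed
  have \<psi>le: "\<psi> x y \<le> 1" if "x \<in> X" for x y
  proof -
    have "\<psi> x y \<le> (\<Sum>x\<in>X. \<psi> x y)" using X(2) that \<psi>(2) by (intro member_le_sum) auto
    also have "\<dots> \<le> 1" unfolding \<psi>s[rule_format] by (simp add: prod_nonneg bump_range)
    finally show ?thesis .
  qed
  \<comment> \<open>The derivatives of a partition of unity cancel. Therefore they multiply only the
    small errors \<open>conv (K x) (u i) - u i\<close> in \<open>Derr\<close>, not
    \<open>u i\<close> itself.\<close>
  have d\<psi>: "(\<Sum>x\<in>X. partial_deriv l (\<psi> x) y) = 0" if y: "y \<in> U" for l y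
  proof -
    have "((\<lambda>y. \<Sum>x\<in>X. \<psi> x y) has_derivative (\<lambda>_. 0)) (at y)"
      by (rule has_derivative_transform_within_open[OF has_derivative_const[of 1] U(1) y]) (simp add: \<psi>1)
    from partial_deriv_eqI[OF this, of l] show ?thesis using partial_deriv_sum[of X \<psi> l y] \<psi>(1) by simp
  qed
  have "\<forall>x\<in>X. \<exists>M. \<forall>y l. \<bar>partial_deriv l (\<psi> x) y\<bar> \<le> M"
  proof
    fix x assume "x \<in> X"
    from test_function_bounded[OF \<psi>t[OF this]] show "\<exists>M. \<forall>y l. \<bar>partial_deriv l (\<psi> x) y\<bar> \<le> M" by metis
  qed
  then obtain m where m: "\<And>x y l. x \<in> X \<Longrightarrow> \<bar>partial_deriv l (\<psi> x) y\<bar> \<le> m x" by (metis bchoice)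
  define M where "M = (\<Sum>x\<in>X. \<bar>m x\<bar>)"
  have M: "\<bar>partial_deriv l (\<psi> x) y\<bar> \<le> M" if "x \<in> X" for x y l
  proof -
    have "\<bar>partial_deriv l (\<psi> x) y\<bar> \<le> \<bar>m x\<bar>" using m[OF that, of l y] by linarith
    also have "\<dots> \<le> M" unfolding M_def using X(2) that by (intro member_le_sum) auto
    finally show ?thesis .
  qed
  have M0: "0 \<le> M" unfolding M_def by (simp add: sum_nonneg)
  \<comment> \<open>The partition, hence \<open>card X\<close> and \<open>M\<close>, is fixed before
    the kernels are chosen. Each piece contributes at most \<open>(M + 1) * \<delta>\<close>, from
    the derivative of the cutoff and from the cutoff itself.\<close>
  define \<delta> where "\<delta> = \<epsilon> / (2 * (real (card X) + 1) * (M + 1))"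
  have \<delta>: "0 < \<delta>" using \<epsilon> M0 unfolding \<delta>_def by (intro divide_pos_pos mult_pos_pos) auto
  have \<delta>e: "real (card X) * ((M + 1) * \<delta>) < \<epsilon>"
  proof -
    have "2 * (real (card X) + 1) * ((M + 1) * \<delta>) = \<epsilon>" using M0 by (simp add: \<delta>_def field_simps add_nonneg_eq_0_iff)
    moreover have "0 < (M + 1) * \<delta>" using M0 \<delta> by simp
    ultimately show ?thesis using mult_nonneg_nonneg[of "real (card X)" "(M + 1) * \<delta>"] by (simp add: algebra_simps)
  qed
  have "\<forall>\<^sub>F z in nhds 0. (LINT x|lborel. \<bar>u i (x + z) - u i x\<bar>) < \<delta>" for i
    using L1_translation_continuous[OF ui[of i] U(2) u0[of _ i] \<delta>] by (simp add: eventually_nhds_metric)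
  moreover have "\<forall>\<^sub>F z in nhds 0. (LINT x|lborel. \<bar>d i l (x + z) - d i l x\<bar>) < \<delta>" for i l
    using L1_translation_continuous[OF di[of i l] U(2) d0[of _ i l] \<delta>] by (simp add: eventually_nhds_metric)
  ultimately have "\<forall>\<^sub>F z in nhds 0. (\<forall>i. (LINT x|lborel. \<bar>u i (x + z) - u i x\<bar>) < \<delta>) \<and> (\<forall>i l. (LINT x|lborel. \<bar>d i l (x + z) - d i l x\<bar>) < \<delta>)"
    by (intro eventually_conj eventually_all_finite)
  then obtain \<tau> where \<tau>: "0 < \<tau>" "\<And>z i. norm z < \<tau> \<Longrightarrow> (LINT x|lborel. \<bar>u i (x + z) - u i x\<bar>) < \<delta>"
    "\<And>z i l. norm z < \<tau> \<Longrightarrow> (LINT x|lborel. \<bar>d i l (x + z) - d i l x\<bar>) < \<delta>"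
    unfolding eventually_nhds_metric dist_norm by auto
  have "\<forall>x\<in>X. \<exists>K. test_function UNIV K \<and> (\<forall>z. 0 \<le> K z) \<and> (LINT z|lborel. K z) = 1 \<and>
     (\<forall>z. K z \<noteq> 0 \<longrightarrow> norm z < \<tau> \<and> (\<forall>y. y \<in> U \<longrightarrow> y \<in> cball x (r x) \<longrightarrow> y + z \<in> U))"
  proof
    fix x assume "x \<in> X"
    then have "x \<in> closure U" using X(1) by blast
    from r[OF this] obtain e c t0 where "?P x (r x) e c t0" by (elim exE)
    then have "0 < c" "0 < t0" and cone: "\<forall>y z t. y \<in> U \<longrightarrow> y \<in> cball x (r x) \<longrightarrow> z \<in> ball e c \<longrightarrow> 0 < t \<longrightarrow> t < t0 \<longrightarrow> y + t *\<^sub>R z \<in> U"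
      by simp_all
    from translated_mollifier[OF this(1,2) \<tau>(1) cone]
    show "\<exists>K. test_function UNIV K \<and> (\<forall>z. 0 \<le> K z) \<and> (LINT z|lborel. K z) = 1 \<and>
       (\<forall>z. K z \<noteq> 0 \<longrightarrow> norm z < \<tau> \<and> (\<forall>y. y \<in> U \<longrightarrow> y \<in> cball x (r x) \<longrightarrow> y + z \<in> U))" .
  qed
  then obtain K where K': "\<forall>x\<in>X. test_function UNIV (K x) \<and> (\<forall>z. 0 \<le> K x z) \<and> (LINT z|lborel. K x z) = 1 \<and>
     (\<forall>z. K x z \<noteq> 0 \<longrightarrow> norm z < \<tau> \<and> (\<forall>y. y \<in> U \<longrightarrow> y \<in> cball x (r x) \<longrightarrow> y + z \<in> U))"
    by (rule bchoice[THEN exE])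
  have K: "test_function UNIV (K x)" "0 \<le> K x z" "(LINT z|lborel. K x z) = 1" "K x z \<noteq> 0 \<Longrightarrow> norm z < \<tau>"
    "K x z \<noteq> 0 \<Longrightarrow> y \<in> U \<Longrightarrow> y \<in> cball x (r x) \<Longrightarrow> y + z \<in> U" if "x \<in> X" for x y z using K' that by blast+
  have Ki: "integrable lborel (K x)" "integrable lborel (partial_deriv l (K x))" if x: "x \<in> X" for x l
  proof -
    obtain S where S: "compact S" "\<And>y. y \<notin> S \<Longrightarrow> K x y = 0" "\<And>y j. y \<notin> S \<Longrightarrow> partial_deriv j (K x) y = 0"
      using test_function_support[OF K(1)[OF x]] by metis
    show "integrable lborel (K x)" "integrable lborel (partial_deriv l (K x))"
      using test_function_continuous[OF K(1)[OF x]] S by (auto intro: integrable_continuous_bounded_support)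
  qed
  have cu: "(LINT y|lborel. \<bar>conv (K x) (u i) y - u i y\<bar>) \<le> \<delta>" if x: "x \<in> X" for x i
    by (rule conv_L1_bound[OF Ki(1)[OF x] K(2)[OF x] K(3)[OF x] ui]) (use \<tau>(2) K(4)[OF x] in \<open>auto intro: less_imp_le\<close>)
  have cd: "(LINT y|lborel. \<bar>conv (K x) (d i l) y - d i l y\<bar>) \<le> \<delta>" if x: "x \<in> X" for x i l
    by (rule conv_L1_bound[OF Ki(1)[OF x] K(2)[OF x] K(3)[OF x] di]) (use \<tau>(3) K(4)[OF x] in \<open>auto intro: less_imp_le\<close>)
  have dt: "test_function UNIV (partial_deriv l (\<psi> x))" if xX: "x \<in> X" for x l
  proof -
    obtain S where "compact S" "\<And>y. y \<notin> S \<Longrightarrow> \<psi> x y = 0" "\<And>y j. y \<notin> S \<Longrightarrow> partial_deriv j (\<psi> x) y = 0"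
      using test_function_support[OF \<psi>t[OF xX]] by metis
    then show ?thesis using smooth_partial_deriv[OF \<psi>(1)[OF xX]] by (intro test_functionI[of _ S]) auto
  qed
  have it: "integrable lborel (\<lambda>y. \<rho> y * conv k G y)" if "test_function UNIV \<rho>" "integrable lborel k" "integrable lborel G"
    for \<rho> k G :: "real^'n \<Rightarrow> real"
    using integrable_mult_test(1)[OF conv_integrable[OF that(2,3)] that(1)] by (simp add: mult.commute)
  define v where "v i y = (\<Sum>x\<in>X. \<psi> x y * conv (K x) (u i) y)" for i y
  define D where "D i l y = (\<Sum>x\<in>X. partial_deriv l (\<psi> x) y * conv (K x) (u i) y + \<psi> x y * conv (K x) (d i l) y)" for i l y
  \<comment> \<open>The derivative of the sum of the \<open>D i i\<close>, with each convolution
    differentiated through its kernel by \<open>weak_deriv_smooth_conv\<close>.\<close>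
  define g where "g l y = (\<Sum>i\<in>UNIV. \<Sum>x\<in>X. (partial_deriv l (partial_deriv i (\<psi> x)) y * conv (K x) (u i) y
       - partial_deriv i (\<psi> x) y * conv (partial_deriv l (K x)) (u i) y)
     + (partial_deriv l (\<psi> x) y * conv (K x) (d i i) y - \<psi> x y * conv (partial_deriv l (K x)) (d i i) y))" for l y
  have i0: "integrable lborel (\<lambda>y. \<psi> x y * conv (K x) G y)" "integrable lborel (\<lambda>y. partial_deriv l (\<psi> x) y * conv (K x) G y)"
    if "x \<in> X" "integrable lborel G" for x G l
    using it \<psi>t dt Ki that by blast+
  have iD: "integrable lborel (\<lambda>y. partial_deriv l (\<psi> x) y * conv (K x) (u i) y + \<psi> x y * conv (K x) (d i l) y)" if "x \<in> X" for x i l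
    using i0[OF that] ui di by (intro Bochner_Integration.integrable_add) auto
  have ddt: "test_function UNIV (partial_deriv l (partial_deriv j (\<psi> x)))" if xX: "x \<in> X" for x l j
  proof -
    obtain S where "compact S" "\<And>y. y \<notin> S \<Longrightarrow> partial_deriv j (\<psi> x) y = 0" "\<And>y i. y \<notin> S \<Longrightarrow> partial_deriv i (partial_deriv j (\<psi> x)) y = 0"
      using test_function_support[OF dt[OF xX]] by metis
    then show ?thesis using smooth_partial_deriv[OF smooth_partial_deriv[OF \<psi>(1)[OF xX]]] by (intro test_functionI[of _ S]) auto
  qed
  have ig: "integrable lborel (\<lambda>y. partial_deriv l (partial_deriv i (\<psi> x)) y * conv (K x) (u i) y
       - partial_deriv i (\<psi> x) y * conv (partial_deriv l (K x)) (u i) y)"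
    "integrable lborel (\<lambda>y. partial_deriv l (\<psi> x) y * conv (K x) (d i i) y - \<psi> x y * conv (partial_deriv l (K x)) (d i i) y)" if "x \<in> X" for x i l
    by (intro Bochner_Integration.integrable_diff it \<psi>t dt ddt Ki ui di that)+
  have vint: "integrable lborel (v i)" for i
    unfolding v_def[abs_def] by (intro Bochner_Integration.integrable_sum i0 ui)
  have Dint: "integrable lborel (D i l)" for i l
    unfolding D_def[abs_def] by (intro Bochner_Integration.integrable_sum iD)
  have gint: "integrable lborel (g l)" for l
    unfolding g_def[abs_def] by (intro Bochner_Integration.integrable_sum Bochner_Integration.integrable_add ig)
  have vwd: "weak_deriv U l (v i) (D i l)" for i l
    unfolding v_def[abs_def] D_def[abs_def]
  proof (rule weak_deriv_sum[OF X(2) _ i0(1) iD])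
    fix x assume x: "x \<in> X"
    show "weak_deriv U l (\<lambda>y. \<psi> x y * conv (K x) (u i) y) (\<lambda>y. partial_deriv l (\<psi> x) y * conv (K x) (u i) y + \<psi> x y * conv (K x) (d i l) y)"
      by (rule weak_deriv_localized_conv[OF \<psi>(1)[OF x] \<psi>(3)[OF x] closed_cball Ki(1)[OF x] K(5)[OF x] ui di wd])
  qed (use ui in auto)
  have fwd: "weak_deriv UNIV l (\<lambda>y. \<Sum>i\<in>UNIV. D i i y) (g l)" for l
    unfolding D_def g_def[abs_def]
  proof (rule weak_deriv_sum[OF finite weak_deriv_sum[OF X(2)]])
    fix x i assume x: "x \<in> X"
    show "weak_deriv UNIV l (\<lambda>y. partial_deriv i (\<psi> x) y * conv (K x) (u i) y + \<psi> x y * conv (K x) (d i i) y)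
      (\<lambda>y. (partial_deriv l (partial_deriv i (\<psi> x)) y * conv (K x) (u i) y - partial_deriv i (\<psi> x) y * conv (partial_deriv l (K x)) (u i) y)
       + (partial_deriv l (\<psi> x) y * conv (K x) (d i i) y - \<psi> x y * conv (partial_deriv l (K x)) (d i i) y))"
      by (rule weak_deriv_add[OF weak_deriv_smooth_conv[OF smooth_partial_deriv[OF \<psi>(1)[OF x]] K(1)[OF x] ui]
          weak_deriv_smooth_conv[OF \<psi>(1)[OF x] K(1)[OF x] di] i0(2)[OF x ui] ig(1)[OF x] i0(1)[OF x di] ig(2)[OF x]])
  qed (intro iD Bochner_Integration.integrable_sum Bochner_Integration.integrable_add ig; assumption)+
  have L1: "(LINT y|lborel. \<bar>\<rho> y * (conv (K x) G y - G y)\<bar>) \<le> b * \<delta>"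
    if "x \<in> X" "test_function UNIV \<rho>" "\<And>y. \<bar>\<rho> y\<bar> \<le> b" "0 \<le> b" "integrable lborel G" "(LINT y|lborel. \<bar>conv (K x) G y - G y\<bar>) \<le> \<delta>"
    for x \<rho> b G
  proof -
    have i: "integrable lborel (\<lambda>y. conv (K x) G y - G y)" using conv_integrable[OF Ki(1)[OF that(1)] that(5)] that(5) by simp
    have "(LINT y|lborel. \<bar>\<rho> y * (conv (K x) G y - G y)\<bar>) \<le> (LINT y|lborel. b * \<bar>conv (K x) G y - G y\<bar>)"
    proof (rule integral_mono)
      show "integrable lborel (\<lambda>y. \<bar>\<rho> y * (conv (K x) G y - G y)\<bar>)"
        using integrable_mult_test(1)[OF i that(2)] by (simp add: mult.commute)
      show "\<bar>\<rho> y * (conv (K x) G y - G y)\<bar> \<le> b * \<bar>conv (K x) G y - G y\<bar>" for y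
        unfolding abs_mult by (intro mult_right_mono that(3)) simp
    qed (use i in simp)
    also have "\<dots> = b * (LINT y|lborel. \<bar>conv (K x) G y - G y\<bar>)" by simp
    also have "\<dots> \<le> b * \<delta>" by (intro mult_left_mono that(4,6))
    finally show ?thesis .
  qed
  have i1: "integrable lborel (\<lambda>y. \<bar>\<rho> y * (conv (K x) G y - G y)\<bar>)" if "x \<in> X" "test_function UNIV \<rho>" "integrable lborel G" for x \<rho> G
    using integrable_mult_test(1)[OF Bochner_Integration.integrable_diff[OF conv_integrable[OF Ki(1)[OF that(1)] that(3)] that(3)] that(2)] by (simp add: mult.commute)
  have \<psi>b: "\<bar>\<psi> x y\<bar> \<le> 1" if "x \<in> X" for x y using \<psi>(2)[OF that, of y] \<psi>le[OF that, of y] by simp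
  have verr: "(LINT y|lborel. \<bar>v i y - u i y\<bar>) < \<epsilon>" for i
  proof -
    have e: "v i y - u i y = (\<Sum>x\<in>X. \<psi> x y * (conv (K x) (u i) y - u i y))" for y
      using \<psi>1[of y] u0[of y i] by (cases "y \<in> U") (simp_all add: v_def right_diff_distrib sum_subtractf flip: sum_distrib_right)
    have "(LINT y|lborel. \<bar>v i y - u i y\<bar>) \<le> (LINT y|lborel. (\<Sum>x\<in>X. \<bar>\<psi> x y * (conv (K x) (u i) y - u i y)\<bar>))"
    proof (rule integral_mono)
      show "integrable lborel (\<lambda>y. \<bar>v i y - u i y\<bar>)" using vint ui by simp
      show "integrable lborel (\<lambda>y. \<Sum>x\<in>X. \<bar>\<psi> x y * (conv (K x) (u i) y - u i y)\<bar>)"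
        by (intro Bochner_Integration.integrable_sum i1 \<psi>t ui)
    qed (simp add: e sum_abs)
    also have "\<dots> = (\<Sum>x\<in>X. (LINT y|lborel. \<bar>\<psi> x y * (conv (K x) (u i) y - u i y)\<bar>))"
      by (intro Bochner_Integration.integral_sum i1 \<psi>t ui)
    also have "\<dots> \<le> (\<Sum>x\<in>X. 1 * \<delta>)" by (intro sum_mono L1 \<psi>t \<psi>b ui cu) auto
    also have "\<dots> \<le> real (card X) * ((M + 1) * \<delta>)" using M0 \<delta> by (simp add: mult_left_mono distrib_right)
    also have "\<dots> < \<epsilon>" by (rule \<delta>e)
    finally show ?thesis .
  qed
  have Derr: "(LINT y|lborel. \<bar>D i l y - d i l y\<bar>) < \<epsilon>" for i l
  proof -
    let ?p = "\<lambda>x y. partial_deriv l (\<psi> x) y * (conv (K x) (u i) y - u i y)"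
    let ?q = "\<lambda>x y. \<psi> x y * (conv (K x) (d i l) y - d i l y)"
    \<comment> \<open>Inside \<open>U\<close> this uses that the cutoffs sum to 1 and their
      derivatives to 0; outside, that \<open>u i\<close> and \<open>d i l\<close> vanish.\<close>
    have e: "D i l y - d i l y = (\<Sum>x\<in>X. ?p x y + ?q x y)" for y
    proof -
      have "(\<Sum>x\<in>X. partial_deriv l (\<psi> x) y) * u i y = 0" using d\<psi>[of y l] u0[of y i] by (cases "y \<in> U") auto
      moreover have "(\<Sum>x\<in>X. \<psi> x y) * d i l y = d i l y" using \<psi>1[of y] d0[of y i l] by (cases "y \<in> U") auto
      moreover have "(\<Sum>x\<in>X. ?p x y + ?q x y) = D i l y - ((\<Sum>x\<in>X. partial_deriv l (\<psi> x) y) * u i y + (\<Sum>x\<in>X. \<psi> x y) * d i l y)"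
        unfolding D_def sum_distrib_right sum.distrib[symmetric] sum_subtractf[symmetric] by (intro sum.cong refl) (simp add: algebra_simps)
      ultimately show ?thesis by linarith
    qed
    have ip: "integrable lborel (\<lambda>y. \<bar>?p x y\<bar>)" and iq: "integrable lborel (\<lambda>y. \<bar>?q x y\<bar>)" if "x \<in> X" for x
      by (intro i1 that dt \<psi>t ui di)+
    have "(LINT y|lborel. \<bar>D i l y - d i l y\<bar>) \<le> (LINT y|lborel. (\<Sum>x\<in>X. \<bar>?p x y\<bar> + \<bar>?q x y\<bar>))"
    proof (rule integral_mono)
      show "integrable lborel (\<lambda>y. \<bar>D i l y - d i l y\<bar>)" using Dint di by simp
      show "integrable lborel (\<lambda>y. \<Sum>x\<in>X. \<bar>?p x y\<bar> + \<bar>?q x y\<bar>)"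
        by (intro Bochner_Integration.integrable_sum Bochner_Integration.integrable_add ip iq)
      show "\<bar>D i l y - d i l y\<bar> \<le> (\<Sum>x\<in>X. \<bar>?p x y\<bar> + \<bar>?q x y\<bar>)" for y
        unfolding e by (intro order_trans[OF sum_abs] sum_mono abs_triangle_ineq)
    qed
    also have "\<dots> = (\<Sum>x\<in>X. (LINT y|lborel. \<bar>?p x y\<bar> + \<bar>?q x y\<bar>))"
      by (intro Bochner_Integration.integral_sum Bochner_Integration.integrable_add ip iq)
    also have "\<dots> = (\<Sum>x\<in>X. (LINT y|lborel. \<bar>?p x y\<bar>) + (LINT y|lborel. \<bar>?q x y\<bar>))"
      by (intro sum.cong refl Bochner_Integration.integral_add ip iq)
    also have "\<dots> \<le> (\<Sum>x\<in>X. M * \<delta> + 1 * \<delta>)"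
      by (intro sum_mono add_mono L1 dt \<psi>t M M0 \<psi>b ui di cu cd) auto
    also have "\<dots> = real (card X) * ((M + 1) * \<delta>)" by (simp add: distrib_right)
    also have "\<dots> < \<epsilon>" by (rule \<delta>e)
    finally show ?thesis .
  qed
  have Dsupp: "\<exists>y\<in>closure U. dist y x \<le> 1" if Dne: "D i l x \<noteq> 0" for x i l
  proof -
    obtain z where z: "z \<in> X" "partial_deriv l (\<psi> z) x * conv (K z) (u i) x + \<psi> z x * conv (K z) (d i l) x \<noteq> 0"
      using Dne sum.neutral[of X "\<lambda>z. partial_deriv l (\<psi> z) x * conv (K z) (u i) x + \<psi> z x * conv (K z) (d i l) x"]
      unfolding D_def by blast
    then have "\<psi> z x \<noteq> 0 \<or> partial_deriv l (\<psi> z) x \<noteq> 0" by auto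
    moreover have "partial_deriv l (\<psi> z) x = 0" if out: "x \<notin> cball z (r z)"
    proof -
      have "(\<psi> z has_derivative (\<lambda>_. 0)) (at x)"
      proof (rule has_derivative_transform_within_open[OF has_derivative_const[of 0], of "- cball z (r z)"])
        show "open (- cball z (r z))" by (simp add: open_Compl)
        show "0 = \<psi> z y" if "y \<in> - cball z (r z)" for y using \<psi>(3)[OF z(1), of y] that by auto
      qed (use out in simp)
      from partial_deriv_eqI[OF this] show ?thesis by simp
    qed
    ultimately have "x \<in> cball z (r z)" using \<psi>(3)[OF z(1), of x] by blast
    then show ?thesis using z(1) X(1) rX[OF z(1)] by (intro bexI[of _ z]) auto
  qed
  show ?thesis
    by (intro exI[of _ v] exI[of _ D] exI[of _ g] conjI allI impI vint Dint gint vwd fwd verr Derr) (rule Dsupp)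
qed

section \<open>Nearby divergence-free fields\<close>

lemma integrable_vec_lambda:
  fixes F :: "'n::finite \<Rightarrow> 'a \<Rightarrow> 'b::euclidean_space"
  assumes "\<And>i. integrable M (F i)"
  shows "integrable M (\<lambda>x. \<chi> i. F i x)"
proof -
  have "linear (axis i :: 'b \<Rightarrow> 'b^'n)" for i :: 'n by (auto intro!: linearI simp: vec_eq_iff axis_def)
  then have bl: "bounded_linear (axis i :: 'b \<Rightarrow> 'b^'n)" for i by (simp add: linear_conv_bounded_linear)
  have "(\<chi> i. F i x) = (\<Sum>i\<in>UNIV. axis i (F i x))" for x
    by (simp add: vec_eq_iff axis_def if_distrib[of "\<lambda>v. v $ _"] cong: if_cong)
  then show ?thesis by (simp add: integrable_bounded_linear[OF bl assms])
qed

text \<open>Let \<open>f\<close> be the divergence of the mollified field. Adding the axis integral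
  of \<open>f\<close> to a single component adds \<open>- f\<close> to the divergence and costs at
  most \<open>L\<close> times the 1-norm of \<open>f\<close>.\<close>

lemma divergence_correction_L1:
  fixes U :: "(real^'n::finite) set" and u :: "real^'n \<Rightarrow> real^'n" and D :: "real^'n \<Rightarrow> real^'n^'n"
  assumes U: "open U" "bounded U" "lipschitz_boundary U"
    and ui: "integrable lborel u" and Di: "integrable lborel D"
    and u0: "\<forall>x. x \<notin> U \<longrightarrow> u x = 0" and D0: "\<forall>x. x \<notin> U \<longrightarrow> D x = 0"
    and wd: "\<And>i l. weak_deriv U l (\<lambda>x. u x $ i) (\<lambda>x. D x $ i $ l)"
  shows "\<exists>v Dv. integrable lborel v \<and> integrable lborel Dv \<and> (\<forall>i l. weak_deriv U l (\<lambda>x. v x $ i) (\<lambda>x. Dv x $ i $ l)) \<and>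
     (AE x in lborel. trace (Dv x) = 0) \<and>
     (LINT x|lborel. norm (u x - v x)) \<le> (diameter U + 4) * (LINT x|lborel. \<bar>trace (D x)\<bar>)"
proof -
  have uii: "integrable lborel (\<lambda>x. u x $ i)" for i
    by (rule integrable_bounded_linear[OF bounded_linear_vec_nth ui])
  have Dii: "integrable lborel (\<lambda>x. D x $ i $ l)" for i l
    by (rule integrable_bounded_linear[OF bounded_linear_vec_nth integrable_bounded_linear[OF bounded_linear_vec_nth Di]])
  have ti: "integrable lborel (\<lambda>x. trace (D x))" unfolding trace_def by (intro Bochner_Integration.integrable_sum Dii)
  define F where "F = (LINT x|lborel. \<bar>trace (D x)\<bar>)"
  have F0: "0 \<le> F" unfolding F_def by (intro integral_nonneg_AE) auto
  \<comment> \<open>\<open>f\<close> is supported within distance 1 of the closure of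
    \<open>U\<close>. Moving back from there by more than \<open>diameter U + 1\<close> leads out of
    \<open>U\<close>, as \<open>far\<close> requires.\<close>
  define L where "L = diameter U + 3"
  have L: "3 \<le> L" using diameter_ge_0[OF U(2)] by (simp add: L_def)
  show ?thesis
  proof (cases "F = 0")
    \<comment> \<open>The tolerance \<open>\<epsilon>\<close> below is proportional to
      \<open>F\<close> and would be 0; but here \<open>u\<close> itself is divergence-free.\<close>
    case True
    then have "AE x in lborel. \<bar>trace (D x)\<bar> = 0"
      using integral_nonneg_eq_0_iff_AE[of lborel "\<lambda>x. \<bar>trace (D x)\<bar>"] ti unfolding F_def by simp
    then show ?thesis using ui Di wd F0 True unfolding F_def by (intro exI[of _ u] exI[of _ D]) auto
  next
    case False
    then have Fp: "0 < F" using F0 by simp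
    \<comment> \<open>The mollification contributes \<open>CARD('n) * \<epsilon>\<close> directly
      and \<open>L\<close> times as much through the axis integral, in total exactly
      \<open>F\<close>. With the main term \<open>L * F\<close> this gives
      \<open>L + 1 = diameter U + 4\<close>.\<close>
    define \<epsilon> where "\<epsilon> = F / (CARD('n) * (1 + L))"
    have N: "0 < real CARD('n)" by simp
    have \<epsilon>: "0 < \<epsilon>" using Fp L N unfolding \<epsilon>_def by (intro divide_pos_pos mult_pos_pos) auto
    have \<epsilon>F: "CARD('n) * \<epsilon> * (1 + L) = F" 
    proof -
      have "1 + L \<noteq> 0" using L by linarith
      then show ?thesis by (simp add: \<epsilon>_def)
    qed
    obtain v1 D1 g where M: "\<forall>i. integrable lborel (v1 i)" "\<forall>i l. integrable lborel (D1 i l)" "\<forall>l. integrable lborel (g l)"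
      "\<forall>i l. weak_deriv U l (v1 i) (D1 i l)" "\<forall>l. weak_deriv UNIV l (\<lambda>x. \<Sum>i\<in>UNIV. D1 i i x) (g l)"
      "\<forall>i. (LINT x|lborel. \<bar>v1 i x - u x $ i\<bar>) < \<epsilon>" "\<forall>i l. (LINT x|lborel. \<bar>D1 i l x - D x $ i $ l\<bar>) < \<epsilon>"
      "\<forall>x i l. D1 i l x \<noteq> 0 \<longrightarrow> (\<exists>y\<in>closure U. dist y x \<le> 1)"
    proof -
      have "\<exists>v1 D1 g. (\<forall>i. integrable lborel (v1 i)) \<and> (\<forall>i l. integrable lborel (D1 i l)) \<and> (\<forall>l. integrable lborel (g l)) \<and>
         (\<forall>i l. weak_deriv U l (v1 i) (D1 i l)) \<and> (\<forall>l. weak_deriv UNIV l (\<lambda>x. \<Sum>i\<in>UNIV. D1 i i x) (g l)) \<and>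
         (\<forall>i. (LINT x|lborel. \<bar>v1 i x - u x $ i\<bar>) < \<epsilon>) \<and> (\<forall>i l. (LINT x|lborel. \<bar>D1 i l x - D x $ i $ l\<bar>) < \<epsilon>) \<and>
         (\<forall>x i l. D1 i l x \<noteq> 0 \<longrightarrow> (\<exists>y\<in>closure U. dist y x \<le> 1))"
        by (rule mollified_approximation[OF U \<epsilon> uii Dii _ _ wd]) (use u0 D0 in auto)
      then show thesis by (elim exE conjE) (rule that)
    qed
    have i1: "\<And>i. integrable lborel (v1 i)" "\<And>i l. integrable lborel (D1 i l)" "\<And>l. integrable lborel (g l)"
      and w1: "\<And>i l. weak_deriv U l (v1 i) (D1 i l)" and wf: "\<And>l. weak_deriv UNIV l (\<lambda>x. \<Sum>i\<in>UNIV. D1 i i x) (g l)"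
      and e1: "\<And>i. (LINT x|lborel. \<bar>v1 i x - u x $ i\<bar>) < \<epsilon>" "\<And>i l. (LINT x|lborel. \<bar>D1 i l x - D x $ i $ l\<bar>) < \<epsilon>"
      and supp: "\<And>x i l. D1 i l x \<noteq> 0 \<Longrightarrow> \<exists>y\<in>closure U. dist y x \<le> 1"
      using M by blast+
    define f where "f x = (\<Sum>i\<in>UNIV. D1 i i x)" for x
    have fi: "integrable lborel f" unfolding f_def[abs_def] by (intro Bochner_Integration.integrable_sum i1)
    have fL1: "(LINT x|lborel. \<bar>f x\<bar>) \<le> F + CARD('n) * \<epsilon>"
    proof -
      have "(LINT x|lborel. \<bar>f x\<bar>) \<le> (LINT x|lborel. \<bar>trace (D x)\<bar> + (\<Sum>i\<in>UNIV. \<bar>D1 i i x - D x $ i $ i\<bar>))"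
      proof (rule integral_mono)
        show "integrable lborel (\<lambda>x. \<bar>trace (D x)\<bar> + (\<Sum>i\<in>UNIV. \<bar>D1 i i x - D x $ i $ i\<bar>))" using ti i1 Dii by simp
        fix x
        have "f x - trace (D x) = (\<Sum>i\<in>UNIV. D1 i i x - D x $ i $ i)" by (simp add: f_def trace_def sum_subtractf)
        then have "\<bar>f x - trace (D x)\<bar> \<le> (\<Sum>i\<in>UNIV. \<bar>D1 i i x - D x $ i $ i\<bar>)" by (simp add: sum_abs)
        then show "\<bar>f x\<bar> \<le> \<bar>trace (D x)\<bar> + (\<Sum>i\<in>UNIV. \<bar>D1 i i x - D x $ i $ i\<bar>)" by linarith
      qed (use fi in simp)
      also have "\<dots> = F + (\<Sum>i\<in>UNIV. (LINT x|lborel. \<bar>D1 i i x - D x $ i $ i\<bar>))"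
        using ti i1 Dii by (simp add: F_def Bochner_Integration.integral_add)
      also have "\<dots> \<le> F + (\<Sum>i\<in>(UNIV::'n set). \<epsilon>)" by (intro add_left_mono sum_mono less_imp_le e1)
      finally show ?thesis by simp
    qed
    \<comment> \<open>Any axis serves; an index type is never empty.\<close>
    define k :: 'n where "k = undefined"
    define W where "W = axis_integral L k"
    have Wi: "integrable lborel (W h)" if "integrable lborel h" for h unfolding W_def by (rule axis_integral_integrable[OF that])
    have Wf: "(LINT x|lborel. \<bar>W f x\<bar>) \<le> L * (F + CARD('n) * \<epsilon>)"
    proof -
      have "(LINT x|lborel. \<bar>W f x\<bar>) \<le> L * (LINT x|lborel. \<bar>f x\<bar>)" unfolding W_def using L by (intro axis_integral_L1_bound fi) simp
      also have "\<dots> \<le> L * (F + CARD('n) * \<epsilon>)" using L fL1 by (intro mult_left_mono) auto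
      finally show ?thesis .
    qed
    have far: "y - L *\<^sub>R axis k 1 \<notin> U" if fy: "f y \<noteq> 0" for y
    proof
      assume *: "y - L *\<^sub>R axis k 1 \<in> U"
      obtain i where "D1 i i y \<noteq> 0" using fy sum.neutral[of UNIV "\<lambda>i. D1 i i y"] unfolding f_def by blast
      then obtain a where a: "a \<in> closure U" "dist a y \<le> 1" using supp by blast
      have "dist a (y - L *\<^sub>R axis k 1) \<le> diameter (closure U)"
        using * a(1) closure_subset by (intro diameter_bounded_bound bounded_closure U) auto
      then have "dist a (y - L *\<^sub>R axis k 1) \<le> diameter U" using diameter_closure[OF U(2)] by simp
      moreover have "dist y (y - L *\<^sub>R axis k 1) = L" using L by (simp add: dist_norm)
      moreover have "dist y (y - L *\<^sub>R axis k 1) \<le> dist a y + dist a (y - L *\<^sub>R axis k 1)" by (rule dist_triangle3)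
      ultimately show False using a(2) by (simp add: L_def)
    qed
    \<comment> \<open>Only component k changes. Its derivative along axis k gains
      \<open>- f\<close>, which cancels the trace, and along the other axes it gains the axis
      integral of \<open>g l\<close>.\<close>
    define vc where "vc i x = v1 i x + (if i = k then W f x else 0)" for i x
    define Dc where "Dc i l x = D1 i l x + (if i = k then if l = k then - f x else W (g l) x else 0)" for i l x
    have vci: "integrable lborel (vc i)" for i using i1(1) Wi[OF fi] by (cases "i = k") (simp_all add: vc_def[abs_def])
    have Dci: "integrable lborel (Dc i l)" for i l
      using i1(2) fi Wi[OF i1(3)] by (cases "i = k"; cases "l = k") (simp_all add: Dc_def[abs_def])
    have wc: "weak_deriv U l (vc i) (Dc i l)" for i l
    proof (cases "i = k")
      case i: True
      have "weak_deriv U l (W f) (if l = k then \<lambda>x. - f x else W (g l))"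
      proof (cases "l = k")
        case True
        then show ?thesis using weak_deriv_axis_integral_self[OF _ fi far] L by (simp add: W_def)
      next
        case False
        have "weak_deriv UNIV l (W f) (W (g l))" unfolding W_def
          by (rule weak_deriv_axis_integral[OF fi i1(3)]) (use wf in \<open>simp add: f_def[abs_def]\<close>)
        then show ?thesis using False by (auto intro: weak_deriv_mono)
      qed
      then have "weak_deriv U l (\<lambda>x. v1 i x + W f x) (\<lambda>x. D1 i l x + (if l = k then \<lambda>x. - f x else W (g l)) x)"
        using fi Wi[OF i1(3)] by (intro weak_deriv_add w1 i1 Wi[OF fi]) auto
      moreover have "vc i = (\<lambda>x. v1 i x + W f x)" "Dc i l = (\<lambda>x. D1 i l x + (if l = k then \<lambda>x. - f x else W (g l)) x)"
        using i by (auto simp: vc_def Dc_def)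
      ultimately show ?thesis by simp
    next
      case False
      then have "vc i = v1 i" "Dc i l = D1 i l" by (auto simp: vc_def Dc_def)
      then show ?thesis using w1 by simp
    qed
    define v where "v x = (\<chi> i. vc i x)" for x
    define Dv where "Dv x = (\<chi> i. \<chi> l. Dc i l x)" for x
    have vi: "integrable lborel v" unfolding v_def[abs_def] by (intro integrable_vec_lambda vci)
    have Dvi: "integrable lborel Dv" unfolding Dv_def[abs_def] by (intro integrable_vec_lambda Dci)
    have "trace (Dv x) = 0" for x
      by (simp add: trace_def Dv_def Dc_def sum.distrib f_def)
    moreover have "(LINT x|lborel. norm (u x - v x)) \<le> (diameter U + 4) * F"
    proof -
      have "(LINT x|lborel. norm (u x - v x)) \<le> (LINT x|lborel. (\<Sum>i\<in>UNIV. \<bar>v1 i x - u x $ i\<bar>) + \<bar>W f x\<bar>)"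
      proof (rule integral_mono)
        show "integrable lborel (\<lambda>x. norm (u x - v x))" using ui vi by simp
        show "integrable lborel (\<lambda>x. (\<Sum>i\<in>UNIV. \<bar>v1 i x - u x $ i\<bar>) + \<bar>W f x\<bar>)" using uii i1 Wi[OF fi] by simp
        fix x
        have "norm (u x - v x) \<le> (\<Sum>i\<in>UNIV. \<bar>(u x - v x) $ i\<bar>)" by (rule norm_le_l1_cart)
        also have "\<dots> \<le> (\<Sum>i\<in>UNIV. \<bar>v1 i x - u x $ i\<bar> + (if i = k then \<bar>W f x\<bar> else 0))"
          by (intro sum_mono) (auto simp: v_def vc_def)
        also have "\<dots> = (\<Sum>i\<in>UNIV. \<bar>v1 i x - u x $ i\<bar>) + \<bar>W f x\<bar>" by (simp add: sum.distrib)
        finally show "norm (u x - v x) \<le> (\<Sum>i\<in>UNIV. \<bar>v1 i x - u x $ i\<bar>) + \<bar>W f x\<bar>" .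
      qed
      also have "\<dots> = (\<Sum>i\<in>UNIV. (LINT x|lborel. \<bar>v1 i x - u x $ i\<bar>)) + (LINT x|lborel. \<bar>W f x\<bar>)"
        using uii i1 Wi[OF fi] by simp
      also have "\<dots> \<le> (\<Sum>i\<in>(UNIV::'n set). \<epsilon>) + L * (F + CARD('n) * \<epsilon>)" by (intro add_mono sum_mono less_imp_le e1 Wf)
      also have "\<dots> = CARD('n) * \<epsilon> * (1 + L) + L * F" by (simp add: algebra_simps)
      also have "\<dots> = (diameter U + 4) * F" unfolding \<epsilon>F by (simp add: L_def algebra_simps)
      finally show ?thesis .
    qed
    ultimately show ?thesis unfolding F_def
      using vi Dvi wc by (intro exI[of _ v] exI[of _ Dv]) (auto simp: v_def Dv_def)
  qed
qed

text \<open>\<open>Du\<close> is only known to be a weak gradient; that its representative lies in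
  \<open>Lp\<close> follows from \<open>weak_gradient_unique\<close>.\<close>

lemma W1p_borel_representative:
  fixes u :: "real^'n::finite \<Rightarrow> real^'m::finite"
  assumes U: "open U" and u: "u \<in> W1p p U" and D: "has_weak_gradient u Du U"
  shows "\<exists>ub Db. ub \<in> borel_measurable borel \<and> Db \<in> borel_measurable borel \<and> ub \<in> Lp p U \<and> Db \<in> Lp p U \<and>
    (\<forall>x. x \<notin> U \<longrightarrow> ub x = 0) \<and> (\<forall>x. x \<notin> U \<longrightarrow> Db x = 0) \<and>
    (AE x in lborel. x \<in> U \<longrightarrow> u x = ub x) \<and> (AE x in lborel. x \<in> U \<longrightarrow> Du x = Db x) \<and>
    u \<in> borel_measurable (lebesgue_on U) \<and> Du \<in> borel_measurable (lebesgue_on U)"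
proof -
  have Ub: "U \<in> sets borel" using U by simp
  have Lp_cong: "g \<in> Lp p U" if "f \<in> Lp p U" "g \<in> borel_measurable (lebesgue_on U)" "AE x in lborel. x \<in> U \<longrightarrow> f x = g x"
    for f g :: "real^'n \<Rightarrow> 'b::euclidean_space"
  proof -
    have "AE x in lebesgue_on U. norm (f x) powr p = norm (g x) powr p"
      unfolding AE_lebesgue_on_iff[OF Ub] using that(3) by eventually_elim auto
    moreover have "(\<lambda>x. norm (f x) powr p) \<in> borel_measurable (lebesgue_on U)" "(\<lambda>x. norm (g x) powr p) \<in> borel_measurable (lebesgue_on U)"
      using that by (auto simp: Lp_def)
    ultimately have "integrable (lebesgue_on U) (\<lambda>x. norm (f x) powr p) \<longleftrightarrow> integrable (lebesgue_on U) (\<lambda>x. norm (g x) powr p)"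
      by (intro integrable_cong_AE)
    then show ?thesis using that by (simp add: Lp_def)
  qed
  from u obtain D' where uLp: "u \<in> Lp p U" and D': "D' \<in> Lp p U" "has_weak_gradient u D' U" unfolding W1p_def by blast
  have um: "u \<in> borel_measurable (lebesgue_on U)" using uLp by (simp add: Lp_def)
  have "locally_integrable_on Du U" using D unfolding has_weak_gradient_def by blast
  then have Dm: "Du \<in> borel_measurable (lebesgue_on U)" by (rule locally_integrable_measurable[OF U])
  obtain ub where ub: "ub \<in> borel_measurable borel" "\<forall>x. x \<notin> U \<longrightarrow> ub x = 0" "AE x in lborel. x \<in> U \<longrightarrow> u x = ub x"
    using borel_representative[OF Ub um] by blast
  obtain Db where Db: "Db \<in> borel_measurable borel" "\<forall>x. x \<notin> U \<longrightarrow> Db x = 0" "AE x in lborel. x \<in> U \<longrightarrow> Du x = Db x"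
    using borel_representative[OF Ub Dm] by blast
  have "AE x in lborel. x \<in> U \<longrightarrow> D' x = Db x"
    using weak_gradient_unique[OF U D'(2) D] Db(3) by eventually_elim auto
  then have "Db \<in> Lp p U" using Lp_cong[OF D'(1) borel_measurable_lebesgue_onI[OF Db(1)]] by blast
  moreover have "ub \<in> Lp p U" using Lp_cong[OF uLp borel_measurable_lebesgue_onI[OF ub(1)] ub(3)] .
  ultimately show ?thesis using ub Db um Dm by (intro exI[of _ ub] exI[of _ Db] conjI)
qed

text \<open>The trace is dominated pointwise by the distance to \<open>sl\<close>, which is
  integrable because it is at most the norm. Outside \<open>U\<close> the representative is 0, so
  nothing is lost in passing to the whole space.\<close>

lemma infdist_sl_integrals:
  fixes Du Db :: "real^'n::finite \<Rightarrow> real^'n^'n"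
  assumes p: "0 < p" and U: "U \<in> sets borel" and Db: "Db \<in> borel_measurable borel" "Db \<in> Lp p U" "\<forall>x. x \<notin> U \<longrightarrow> Db x = 0"
    and ae: "AE x in lborel. x \<in> U \<longrightarrow> Du x = Db x" and Du: "Du \<in> borel_measurable (lebesgue_on U)"
  shows "integrable lborel (\<lambda>x. \<bar>trace (Db x)\<bar> powr p)"
    and "(LINT x|lborel. \<bar>trace (Db x)\<bar> powr p) \<le> CARD('n) powr p * (\<integral>x\<in>U. infdist (Du x) sl powr p \<partial>lebesgue)"
proof -
  have [measurable]: "(\<lambda>A. infdist A sl) \<in> borel_measurable (borel :: (real^'n^'n) measure)"
    by (intro borel_measurable_continuous_onI continuous_intros)
  have im: "(\<lambda>A. infdist A sl powr p) \<in> borel_measurable (borel :: (real^'n^'n) measure)" by measurable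
  have bi: "(\<lambda>x. infdist (Db x) sl powr p) \<in> borel_measurable borel" by (rule measurable_compose[OF Db(1) im])
  have tm: "(\<lambda>x. \<bar>trace (Db x)\<bar> powr p) \<in> borel_measurable borel" unfolding trace_def using Db(1) by measurable
  have ni: "set_integrable lborel U (\<lambda>x. norm (Db x) powr p)" using Db(2) unfolding Lp_iff_borel[OF U Db(1)] .
  have ii: "set_integrable lborel U (\<lambda>x. infdist (Db x) sl powr p)"
    by (rule set_integrable_bound[OF ni]) (use bi U p in \<open>auto simp: set_borel_measurable_def infdist_sl_le_norm infdist_nonneg intro!: powr_mono2 AE_I2\<close>)
  have le: "\<bar>trace (Db x)\<bar> powr p \<le> CARD('n) powr p * (indicator U x *\<^sub>R infdist (Db x) sl powr p)" for x
  proof (cases "x \<in> U")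
    case True
    have "\<bar>trace (Db x)\<bar> powr p \<le> (CARD('n) * infdist (Db x) sl) powr p" using p by (intro powr_mono2 trace_le_infdist_sl) auto
    then show ?thesis using True by (simp add: powr_mult infdist_nonneg)
  qed (simp add: Db(3) trace_def)
  have ii': "integrable lborel (\<lambda>x. CARD('n) powr p * (indicator U x *\<^sub>R infdist (Db x) sl powr p))"
    using ii unfolding set_integrable_def by (intro integrable_mult_right)
  show ti: "integrable lborel (\<lambda>x. \<bar>trace (Db x)\<bar> powr p)"
    by (rule Bochner_Integration.integrable_bound[OF ii']) (use tm le in \<open>auto intro!: AE_I2 order_trans[OF le]\<close>)
  have "(LINT x|lborel. \<bar>trace (Db x)\<bar> powr p) \<le> (LINT x|lborel. CARD('n) powr p * (indicator U x *\<^sub>R infdist (Db x) sl powr p))"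
    by (intro integral_mono ti ii' le)
  also have "\<dots> = CARD('n) powr p * (LINT x:U|lborel. infdist (Db x) sl powr p)" by (simp add: set_lebesgue_integral_def)
  also have "(LINT x:U|lborel. infdist (Db x) sl powr p) = (\<integral>x\<in>U. infdist (Du x) sl powr p \<partial>lebesgue)"
  proof (rule lebesgue_on_integral_transfer(3)[OF U bi, symmetric])
    show "AE x in lborel. x \<in> U \<longrightarrow> infdist (Du x) sl powr p = infdist (Db x) sl powr p" using ae by eventually_elim auto
  qed (rule measurable_compose[OF Du im])
  finally show "(LINT x|lborel. \<bar>trace (Db x)\<bar> powr p) \<le> CARD('n) powr p * (\<integral>x\<in>U. infdist (Du x) sl powr p \<partial>lebesgue)" .
qed

lemma div_freeI:
  assumes "open U" "AE x in lborel. x \<in> U \<longrightarrow> trace (Dv x) = 0"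
  shows "div_free U Dv"
  using assms unfolding div_free_def trace_def by (subst AE_lebesgue_on_iff) auto

lemma nearby_div_free_Lp:
  fixes p :: real
  assumes p: "1 < p"
  shows "\<exists>C::real. \<forall>(U::(real^'n::finite) set) (u::real^'n \<Rightarrow> real^'n) Du.
        open U \<and> bounded U \<and> u \<in> W1p p U \<and> has_weak_gradient u Du U \<longrightarrow>
        (\<exists>v Dv. v \<in> W1p p U \<and> has_weak_gradient v Dv U \<and> div_free U Dv \<and>
           (\<integral>x\<in>U. norm (Du x - Dv x) powr p \<partial>lebesgue)
             \<le> C * (\<integral>x\<in>U. infdist (Du x) sl powr p \<partial>lebesgue))"
proof -
  obtain C where C: "C > 0" "\<forall>(U :: (real^'n) set) f. open U \<longrightarrow> bounded U \<longrightarrow> f \<in> borel_measurable borel \<longrightarrow> (\<forall>x. x \<notin> U \<longrightarrow> f x = 0) \<longrightarrow>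
     integrable lborel (\<lambda>x. \<bar>f x\<bar> powr p) \<longrightarrow>
     (\<exists>w Dw. w \<in> borel_measurable borel \<and> Dw \<in> borel_measurable borel \<and> w \<in> Lp p U \<and> Dw \<in> Lp p U \<and> has_weak_gradient w Dw U \<and>
        (AE x in lborel. x \<in> U \<longrightarrow> trace (Dw x) = f x) \<and>
        (LINT x:U|lborel. norm (Dw x) powr p) \<le> C * (LINT x|lborel. \<bar>f x\<bar> powr p))"
    using divergence_solution[OF p, where 'n='n] by blast
  have p0: "0 \<le> p" "0 < p" using p by auto
  show ?thesis
  proof (intro exI[of _ "C * CARD('n) powr p"] allI impI, elim conjE)
    fix U :: "(real^'n) set" and u :: "real^'n \<Rightarrow> real^'n" and Du
    assume U: "open U" "bounded U" and u: "u \<in> W1p p U" and D: "has_weak_gradient u Du U"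
    have Ub: "U \<in> sets borel" using U by simp
    obtain ub Db where b: "ub \<in> borel_measurable borel" "Db \<in> borel_measurable borel" "ub \<in> Lp p U" "Db \<in> Lp p U"
      "\<forall>x. x \<notin> U \<longrightarrow> ub x = 0" "\<forall>x. x \<notin> U \<longrightarrow> Db x = 0"
      "AE x in lborel. x \<in> U \<longrightarrow> u x = ub x" "AE x in lborel. x \<in> U \<longrightarrow> Du x = Db x"
      "u \<in> borel_measurable (lebesgue_on U)" "Du \<in> borel_measurable (lebesgue_on U)"
      using W1p_borel_representative[OF U(1) u D] by (elim exE conjE) (rule that)
    note tr = infdist_sl_integrals[OF p0(2) Ub b(2,4,6,8,10)]
    have tm: "(\<lambda>x. trace (Db x)) \<in> borel_measurable borel" unfolding trace_def using b(2) by measurable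
    have t0: "\<forall>x. x \<notin> U \<longrightarrow> trace (Db x) = 0" using b(6) by (simp add: trace_def)
    from C(2)[THEN spec, THEN spec, THEN mp, THEN mp, THEN mp, THEN mp, THEN mp, OF U tm t0 tr(1)]
    obtain w Dw where w: "w \<in> borel_measurable borel" "Dw \<in> borel_measurable borel" "w \<in> Lp p U" "Dw \<in> Lp p U" "has_weak_gradient w Dw U"
      "AE x in lborel. x \<in> U \<longrightarrow> trace (Dw x) = trace (Db x)"
      "(LINT x:U|lborel. norm (Dw x) powr p) \<le> C * (LINT x|lborel. \<bar>trace (Db x)\<bar> powr p)"
      by (elim exE conjE) (rule that)
    \<comment> \<open>Membership of \<open>u - w\<close> in \<open>W1p\<close> uses the gradient
      \<open>D'\<close> in \<open>Lp\<close> that comes with \<open>u\<close>; the estimate concerns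
      the given \<open>Du\<close>.\<close>
    from u obtain D' where uLp: "u \<in> Lp p U" and D': "D' \<in> Lp p U" "has_weak_gradient u D' U" unfolding W1p_def by blast
    have "(\<lambda>x. u x - w x) \<in> W1p p U"
      unfolding W1p_def using Lp_diff[OF p0(1) uLp w(3)] Lp_diff[OF p0(1) D'(1) w(4)] has_weak_gradient_diff[OF U(1) D'(2) w(5)] by blast
    moreover have "has_weak_gradient (\<lambda>x. u x - w x) (\<lambda>x. Du x - Dw x) U" by (rule has_weak_gradient_diff[OF U(1) D w(5)])
    moreover have "div_free U (\<lambda>x. Du x - Dw x)"
    proof (rule div_freeI[OF U(1)])
      show "AE x in lborel. x \<in> U \<longrightarrow> trace (Du x - Dw x) = 0"
        using b(8) w(6) by eventually_elim (auto simp: trace_sub)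
    qed
    moreover have "(\<integral>x\<in>U. norm (Du x - (Du x - Dw x)) powr p \<partial>lebesgue) \<le> C * CARD('n) powr p * (\<integral>x\<in>U. infdist (Du x) sl powr p \<partial>lebesgue)"
    proof -
      have nm: "(\<lambda>x. norm (Dw x) powr p) \<in> borel_measurable borel" using w(2) by measurable
      have "(\<integral>x\<in>U. norm (Du x - (Du x - Dw x)) powr p \<partial>lebesgue) = (LINT x:U|lborel. norm (Dw x) powr p)"
        using lebesgue_on_integral_transfer(3)[OF Ub nm _ borel_measurable_lebesgue_onI[OF nm]] by simp
      also have "\<dots> \<le> C * (LINT x|lborel. \<bar>trace (Db x)\<bar> powr p)" by (rule w(7))
      also have "\<dots> \<le> C * (CARD('n) powr p * (\<integral>x\<in>U. infdist (Du x) sl powr p \<partial>lebesgue))"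
        using C(1) tr(2) by (intro mult_left_mono) auto
      finally show ?thesis by (simp add: mult.assoc)
    qed
    ultimately show "\<exists>v Dv. v \<in> W1p p U \<and> has_weak_gradient v Dv U \<and> div_free U Dv \<and>
           (\<integral>x\<in>U. norm (Du x - Dv x) powr p \<partial>lebesgue)
             \<le> C * CARD('n) powr p * (\<integral>x\<in>U. infdist (Du x) sl powr p \<partial>lebesgue)"
      by (intro exI[of _ "\<lambda>x. u x - w x"] exI[of _ "\<lambda>x. Du x - Dw x"] conjI)
  qed
qed

lemma nearby_div_free_L1:
  fixes u :: "real^'n::finite \<Rightarrow> real^'n"
  assumes U: "open U" "bounded U" "lipschitz_boundary U" and u: "u \<in> W1p 1 U" and D: "has_weak_gradient u Du U"
  shows "\<exists>v Dv. v \<in> W1p 1 U \<and> has_weak_gradient v Dv U \<and> div_free U Dv \<and>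
           (\<integral>x\<in>U. norm (u x - v x) \<partial>lebesgue)
             \<le> ((diameter U + 4) * CARD('n)) * (\<integral>x\<in>U. infdist (Du x) sl \<partial>lebesgue)"
proof -
  have Ub: "U \<in> sets borel" using U by simp
  obtain ub Db where b: "ub \<in> borel_measurable borel" "Db \<in> borel_measurable borel" "ub \<in> Lp 1 U" "Db \<in> Lp 1 U"
    "\<forall>x. x \<notin> U \<longrightarrow> ub x = 0" "\<forall>x. x \<notin> U \<longrightarrow> Db x = 0"
    "AE x in lborel. x \<in> U \<longrightarrow> u x = ub x" "AE x in lborel. x \<in> U \<longrightarrow> Du x = Db x"
    "u \<in> borel_measurable (lebesgue_on U)" "Du \<in> borel_measurable (lebesgue_on U)"
    using W1p_borel_representative[OF U(1) u D] by (elim exE conjE) (rule that)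
  note tr = infdist_sl_integrals[OF zero_less_one Ub b(2,4,6,8,10)]
  have ex: "integrable lborel f" if "f \<in> borel_measurable borel" "f \<in> Lp 1 U" "\<forall>x. x \<notin> U \<longrightarrow> f x = 0" for f :: "real^'n \<Rightarrow> 'b::euclidean_space"
  proof -
    have "integrable (lebesgue_on U) f" by (rule Lp_imp_integrable[OF _ Ub U(2) that(2)]) simp
    then have "set_integrable lborel U f"
      using lebesgue_on_integral_transfer(1)[OF Ub that(1) _ borel_measurable_lebesgue_onI[OF that(1)]] by simp
    moreover have "(\<lambda>x. indicator U x *\<^sub>R f x) = f" using that(3) by (auto simp: fun_eq_iff indicator_def)
    ultimately show ?thesis by (simp add: set_integrable_def)
  qed
  have red: "(\<integral>x\<in>U. F x * q x \<partial>lebesgue) = (LINT x|lborel. G x * q x)"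
    if "F \<in> borel_measurable (lebesgue_on U)" "G \<in> borel_measurable borel" "AE x in lborel. x \<in> U \<longrightarrow> F x = G x" "\<And>x. x \<notin> U \<Longrightarrow> G x = 0"
      and q: "q \<in> borel_measurable borel" for F G q :: "real^'n \<Rightarrow> real"
  proof -
    have "(\<integral>x\<in>U. F x * q x \<partial>lebesgue) = (LINT x:U|lborel. G x * q x)"
    proof (rule lebesgue_on_integral_transfer(3)[OF Ub])
      show "(\<lambda>x. G x * q x) \<in> borel_measurable borel" using that(2) q by measurable
      show "AE x in lborel. x \<in> U \<longrightarrow> F x * q x = G x * q x" using that(3) by eventually_elim auto
      show "(\<lambda>x. F x * q x) \<in> borel_measurable (lebesgue_on U)"
        using that(1) borel_measurable_lebesgue_onI[OF q] by (rule borel_measurable_times)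
    qed
    also have "\<dots> = (LINT x|lborel. G x * q x)"
      unfolding set_lebesgue_integral_def using that(4) by (intro Bochner_Integration.integral_cong) (auto simp: indicator_def)
    finally show ?thesis .
  qed
  have wd: "weak_deriv U l (\<lambda>x. ub x $ i) (\<lambda>x. Db x $ i $ l)" for i l
    unfolding weak_deriv_def
  proof (intro allI impI)
    fix \<phi> assume \<phi>: "test_function U \<phi>"
    note m = test_function_continuous[OF \<phi>, THEN borel_measurable_continuous_onI]
    have "(\<integral>x\<in>U. u x $ i * partial_deriv l \<phi> x \<partial>lebesgue) = - (\<integral>x\<in>U. Du x $ i $ l * \<phi> x \<partial>lebesgue)"
      using D \<phi> unfolding has_weak_gradient_def by blast
    moreover have "(\<integral>x\<in>U. u x $ i * partial_deriv l \<phi> x \<partial>lebesgue) = (LINT x|lborel. ub x $ i * partial_deriv l \<phi> x)"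
      by (rule red) (use b m in \<open>auto elim: eventually_mono\<close>)
    moreover have "(\<integral>x\<in>U. Du x $ i $ l * \<phi> x \<partial>lebesgue) = (LINT x|lborel. Db x $ i $ l * \<phi> x)"
      by (rule red) (use b m in \<open>auto elim: eventually_mono\<close>)
    ultimately show "(LINT x|lborel. ub x $ i * partial_deriv l \<phi> x) = - (LINT x|lborel. Db x $ i $ l * \<phi> x)" by simp
  qed
  obtain v Dv where v: "integrable lborel v" "integrable lborel Dv" "\<forall>i l. weak_deriv U l (\<lambda>x. v x $ i) (\<lambda>x. Dv x $ i $ l)"
     "AE x in lborel. trace (Dv x) = 0"
     "(LINT x|lborel. norm (ub x - v x)) \<le> (diameter U + 4) * (LINT x|lborel. \<bar>trace (Db x)\<bar>)"
    using divergence_correction_L1[OF U ex[OF b(1,3,5)] ex[OF b(2,4,6)] b(5,6) wd] by (elim exE conjE) (rule that; assumption)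
  have vm: "v \<in> borel_measurable borel" "Dv \<in> borel_measurable borel" using v(1,2) by auto
  have si: "set_integrable lborel U f" if "integrable lborel f" for f :: "real^'n \<Rightarrow> 'b::euclidean_space"
    unfolding set_integrable_def using that Ub by (intro integrable_mult_indicator) auto
  have g: "has_weak_gradient v Dv U"
    by (rule has_weak_gradientI_borel[OF Ub vm si[OF v(1)] si[OF v(2)]]) (use v(3) in \<open>simp add: weak_deriv_def\<close>)
  have "v \<in> Lp 1 U" "Dv \<in> Lp 1 U" unfolding Lp_iff_borel[OF Ub vm(1)] Lp_iff_borel[OF Ub vm(2)]
    using si[OF integrable_norm[OF v(1)]] si[OF integrable_norm[OF v(2)]] by simp_all
  then have "v \<in> W1p 1 U" using g unfolding W1p_def by blast
  moreover have "div_free U Dv" by (rule div_freeI[OF U(1)]) (use v(4) in \<open>auto elim: eventually_mono\<close>)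
  moreover have "(\<integral>x\<in>U. norm (u x - v x) \<partial>lebesgue) \<le> ((diameter U + 4) * CARD('n)) * (\<integral>x\<in>U. infdist (Du x) sl \<partial>lebesgue)"
  proof -
    have di: "integrable lborel (\<lambda>x. norm (ub x - v x))" using ex[OF b(1,3,5)] v(1) by simp
    have "(\<integral>x\<in>U. norm (u x - v x) \<partial>lebesgue) = (LINT x:U|lborel. norm (ub x - v x))"
    proof (rule lebesgue_on_integral_transfer(3)[OF Ub])
      show "(\<lambda>x. norm (ub x - v x)) \<in> borel_measurable borel" using di by auto
      show "AE x in lborel. x \<in> U \<longrightarrow> norm (u x - v x) = norm (ub x - v x)" using b(7) by eventually_elim auto
      show "(\<lambda>x. norm (u x - v x)) \<in> borel_measurable (lebesgue_on U)"
        by (rule measurable_compose[OF borel_measurable_diff[OF b(9) borel_measurable_lebesgue_onI[OF vm(1)]] borel_measurable_norm])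
    qed
    also have "\<dots> \<le> (LINT x|lborel. norm (ub x - v x))"
      unfolding set_lebesgue_integral_def using si[OF di] di
      by (intro integral_mono) (auto simp: set_integrable_def indicator_def)
    also have "\<dots> \<le> (diameter U + 4) * (LINT x|lborel. \<bar>trace (Db x)\<bar>)" by (rule v(5))
    also have "\<dots> \<le> (diameter U + 4) * (CARD('n) * (\<integral>x\<in>U. infdist (Du x) sl \<partial>lebesgue))"
      using tr(2) diameter_ge_0[OF U(2)] by (intro mult_left_mono) (simp_all add: infdist_nonneg)
    finally show ?thesis by (simp add: mult.assoc)
  qed
  ultimately show ?thesis using g by blast
qed

theorem proposition4p3:
  shows
    "(\<forall>p::real. 1 < p \<longrightarrow> (\<exists>C::real. \<forall>(U::(real^'n) set) (u::real^'n \<Rightarrow> real^'n) Du.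
        open U \<and> bounded U \<and> connected U \<and> lipschitz_boundary U \<and>
        u \<in> W1p p U \<and> has_weak_gradient u Du U \<longrightarrow>
        (\<exists>v Dv. v \<in> W1p p U \<and> has_weak_gradient v Dv U \<and> div_free U Dv \<and>
           (\<integral>x\<in>U. norm (Du x - Dv x) powr p \<partial>lebesgue)
             \<le> C * (\<integral>x\<in>U. infdist (Du x) sl powr p \<partial>lebesgue))))
     \<and>
     (\<exists>C::real \<Rightarrow> real. \<forall>(U::(real^'n) set) (u::real^'n \<Rightarrow> real^'n) Du.
        open U \<and> bounded U \<and> connected U \<and> lipschitz_boundary U \<and>
        u \<in> W1p 1 U \<and> has_weak_gradient u Du U \<longrightarrow>
        (\<exists>v Dv. v \<in> W1p 1 U \<and> has_weak_gradient v Dv U \<and> div_free U Dv \<and>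
           (\<integral>x\<in>U. norm (u x - v x) \<partial>lebesgue)
             \<le> C (diameter U) * (\<integral>x\<in>U. infdist (Du x) sl \<partial>lebesgue)))"
proof (intro conjI allI impI)
  fix p :: real assume "1 < p"
  from nearby_div_free_Lp[OF this]
  obtain C where C: "\<forall>(U::(real^'n) set) (u::real^'n \<Rightarrow> real^'n) Du.
        open U \<and> bounded U \<and> u \<in> W1p p U \<and> has_weak_gradient u Du U \<longrightarrow>
        (\<exists>v Dv. v \<in> W1p p U \<and> has_weak_gradient v Dv U \<and> div_free U Dv \<and>
           (\<integral>x\<in>U. norm (Du x - Dv x) powr p \<partial>lebesgue)
             \<le> C * (\<integral>x\<in>U. infdist (Du x) sl powr p \<partial>lebesgue))" ..
  show "\<exists>C::real. \<forall>(U::(real^'n) set) (u::real^'n \<Rightarrow> real^'n) Du.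
        open U \<and> bounded U \<and> connected U \<and> lipschitz_boundary U \<and>
        u \<in> W1p p U \<and> has_weak_gradient u Du U \<longrightarrow>
        (\<exists>v Dv. v \<in> W1p p U \<and> has_weak_gradient v Dv U \<and> div_free U Dv \<and>
           (\<integral>x\<in>U. norm (Du x - Dv x) powr p \<partial>lebesgue)
             \<le> C * (\<integral>x\<in>U. infdist (Du x) sl powr p \<partial>lebesgue))"
    by (rule exI[of _ C], intro allI impI, rule C[rule_format], elim conjE, intro conjI)
next
  show "\<exists>C::real \<Rightarrow> real. \<forall>(U::(real^'n) set) (u::real^'n \<Rightarrow> real^'n) Du.
        open U \<and> bounded U \<and> connected U \<and> lipschitz_boundary U \<and>
        u \<in> W1p 1 U \<and> has_weak_gradient u Du U \<longrightarrow>
        (\<exists>v Dv. v \<in> W1p 1 U \<and> has_weak_gradient v Dv U \<and> div_free U Dv \<and>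
           (\<integral>x\<in>U. norm (u x - v x) \<partial>lebesgue)
             \<le> C (diameter U) * (\<integral>x\<in>U. infdist (Du x) sl \<partial>lebesgue))"
    by (rule exI[of _ "\<lambda>d. (d + 4) * real CARD('n)"], intro allI impI, elim conjE) (rule nearby_div_free_L1)
qed

end
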